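(* Suppose that there exist a function $w:S\to[1,\infty)$ and constants $\rho_1,\rho_2,\rho_3>0$, $b_1,b_2,b_3\ge0$, $L>0$, $M>0$ such that: (1) $\sum_{j\in S}w(j)q(j|i,a)\le\rho_1w(i)+b_1$ for all $(i,a)\in K$, and $q^*(i)\le Lw(i)$ for all $i\in S$; (2) $\sum_{i\in S}w(i)\gamma(i)<\infty$, and $|c_n(i,a)|\le Mw(i)$ for all $(i,a)\in K$ and $n=0,1,\ldots,N$; (3) $\sum_{j\in S}w^2(j)q(j|i,a)\le\rho_2w^2(i)+b_2$ and $\sum_{j\in S}w^3(j)q(j|i,a)\le\rho_3w^3(i)+b_3$ for all $(i,a)\in K$; (4) for each $i\in S$ the set $A(i)$ is compact; (5) for each fixed $i,j\in S$ and $n=0,1,\ldots,N$, the functions $c_n(i,a)$, $q(j|i,a)$ and $\sum_{k\in S}w(k)q(k|i,a)$ are continuous in $a\in A(i)$; (6) for each integer $m\ge1$ the set $S_m:=\{i\in S:w(i)\le m\}$ is nonempty and finite; (7) $\sum_{i\in S}w^2(i)\gamma(i)<\infty$ and $\sum_{i\in S}w^3(i)\gamma(i)<\infty$. Then there exists a constrained-optimal policy $\pi^*\in\Pi^M$ for the constrained optimization problem of minimizing $V_0(\pi)$ over $\pi\in U:=\{\pi\in\Pi: V_n(\pi)\le d_n,\ 1\le n\le N\}$.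
   Context: Model. $S$ is a denumerable set (discrete topology), $A$ is a Polish space with Borel $\sigma$-algebra $\mathcal{B}(A)$, and for each $i\in S$, $A(i)\in\mathcal{B}(A)$ is the set of admissible actions in state $i$; $K:=\{(i,a): i\in S, a\in A(i)\}$. The transition rates $q(j|i,a)$ are real numbers, measurable in $a\in A(i)$ for fixed $i,j\in S$, with $q(j|i,a)\ge 0$ for $j\ne i$, $\sum_{j\in S}q(j|i,a)=0$ for all $(i,a)\in K$, and $q^*(i):=\sup_{a\in A(i)}|q(i|i,a)|<\infty$ for all $i\in S$. The cost functions $c_n:K\to\mathbb{R}$ $(0\le n\le N)$ are measurable in $a\in A(i)$ for each $i$; $d_1,\ldots,d_N$ are real constants. $T>0$ is a fixed terminal time and $\gamma$ a fixed (initial) probability distribution on $S$. Path space. $S_\infty:=S\cup\{i_\infty\}$ and $A_\infty:=A\cup\{a_\infty\}$ with isolated points $i_\infty\notin S$, $a_\infty\notin A$; $A(i_\infty):=\{a_\infty\}$ and $q(i_\infty|i_\infty,a_\infty):=0$. $\mathbb{R}_+:=(0,\infty)$, $\mathbb{R}_+^0:=[0,\infty)$. $\Omega$ is the union of $(S\times\mathbb{R}_+)^\infty$ (sequences $(i_0,\theta_1,i_1,\theta_2,i_2,\ldots)$) and the set of all sequences $(i_0,\theta_1,i_1,\ldots,\theta_{m-1},i_{m-1},\infty,i_\infty,\infty,i_\infty,\ldots)$ with $m\ge1$, $i_l\in S$, $\theta_l\in\mathbb{R}_+$; $\mathcal{F}$ is its Borel $\sigma$-algebra. For $\omega=(i_0,\theta_1,i_1,\ldots)$: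 $T_0:=0$, $X_m(\omega):=i_m$ $(m\ge 0)$, $T_m:=\theta_1+\cdots+\theta_m$ $(m\ge1)$, $T_\infty:=\lim_mT_m$, and $\xi_t:=X_m$ for $T_m\le t<T_{m+1}$, $\xi_t:=i_\infty$ for $t\ge T_\infty$. $\xi_{t-}:=X_m$ for $T_m<t\le T_{m+1}$ with $t<T_\infty$, $\xi_{0-}:=\xi_0$, $\xi_{t-}:=i_\infty$ for $t\ge T_\infty$. $\mathcal{F}_t:=\sigma(\{T_m\le s,X_m=j\}:j\in S,s\le t,m\ge0)$, $\mathcal{F}_{s-}:=\bigvee_{0\le t<s}\mathcal{F}_t$, and $\mathcal{P}:=\sigma(B\times\{0\}\,(B\in\mathcal{F}_0),\ B\times(s,\infty)\,(B\in\mathcal{F}_{s-},s>0))$ is the predictable $\sigma$-algebra on $\Omega\times\mathbb{R}_+^0$. Policies. $\Pi$ is the set of randomized history-dependent policies: $\mathcal{P}$-measurable transition probabilities $\pi(\cdot|\omega,t)$ on $(A_\infty,\mathcal{B}(A_\infty))$ concentrated on $A(\xi_{t-}(\omega))$. $\Pi^M\subseteq\Pi$ is the set of randomized Markov policies: those of the form $\pi(\cdot|\omega,t)=\varphi(\cdot|\xi_{t-}(\omega),t)$ for a kernel $\varphi$ on $A_\infty$ given $S_\infty\times\mathbb{R}_+^0$. Probability. For $\pi\in\Pi$, $P_\gamma^\pi$ is the unique probability measure on $(\Omega,\mathcal{F})$ with $P_\gamma^\pi(\xi_0=i)=\gamma(i)$ for all $i\in S$ and such that, under it, $\nu^\pi(\omega,dt,j):=\left[\int_A\pi(da|\omega,t)q(j|\xi_{t-}(\omega),a)I_{\{j\ne\xi_{t-}(\omega)\}}\right]dt$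 is the dual predictable projection (compensator) of the random measure $\mu(\omega,dt,j):=\sum_{m\ge1}I_{\{T_m<\infty\}}I_{\{X_m=j\}}\delta_{T_m}(dt)$ on $\mathbb{R}_+\times S$, where $\delta_x$ is the Dirac measure at $x$; the stochastic basis is assumed complete. $E_\gamma^\pi$ is the corresponding expectation. Costs. $V_n(\pi):=E_\gamma^\pi\left[\int_0^T\int_Ac_n(\xi_{t-},a)\pi(da|\omega,t)dt\right]$, $n=0,1,\ldots,N$ (integrands at $i_\infty$ are taken to be $0$; immaterial, since under the stated hypotheses $i_\infty$ is reached with probability zero). A policy $\pi^*\in U$ is called constrained-optimal if $V_0(\pi^* )=\inf_{\pi\in U}V_0(\pi)$.
   Formalization: The formal theorem additionally assumes that U is nonempty; a constrained-optimal policy must belong to U, so the claim fails when no policy satisfies the constraints V_n(π) ≤ d_n. *)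

theory Defs
  imports "HOL-Probability.Probability"
begin

(* A path omega = (i_0, theta_1, i_1, theta_2, ...) is stored as the sequence of pairs
   omega m = (i_m, theta_{m+1}).  The cemetery state and the cemetery action are None. *)
type_synonym 's path = "nat \<Rightarrow> 's option \<times> ennreal"

definition paths :: "'s path set" where
  "paths =
     {\<omega>. \<forall>l. fst (\<omega> l) \<noteq> None \<and> 0 < snd (\<omega> l) \<and> snd (\<omega> l) < \<infinity>} \<union>
     {\<omega>. \<exists>m\<ge>1. (\<forall>l<m. fst (\<omega> l) \<noteq> None) \<and>
                (\<forall>l<m - 1. 0 < snd (\<omega> l) \<and> snd (\<omega> l) < \<infinity>) \<and>
                snd (\<omega> (m - 1)) = \<infinity> \<and> (\<forall>l\<ge>m. \<omega> l = (None, \<infinity>))}"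

(* For countable 's this is the Borel sigma-algebra of the subspace topology inherited from the
   countable product of the second countable spaces S_infinity x [0,infinity]. *)
definition path_algebra :: "'s::countable path measure" where
  "path_algebra = restrict_space (PiM UNIV (\<lambda>_. count_space UNIV \<Otimes>\<^sub>M borel)) paths"

definition jump_state :: "nat \<Rightarrow> 's path \<Rightarrow> 's option" where
  "jump_state m \<omega> = fst (\<omega> m)"

definition jump_time :: "nat \<Rightarrow> 's path \<Rightarrow> ennreal" where
  "jump_time m \<omega> = (\<Sum>l<m. snd (\<omega> l))"

definition explosion_time :: "'s path \<Rightarrow> ennreal" where
  "explosion_time \<omega> = lim (\<lambda>m. jump_time m \<omega>)"

definition state_at :: "real \<Rightarrow> 's path \<Rightarrow> 's option" where
  "state_at t \<omega> =
     (if ennreal t < explosion_time \<omega>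
      then jump_state (THE m. jump_time m \<omega> \<le> ennreal t \<and> ennreal t < jump_time (Suc m) \<omega>) \<omega>
      else None)"

definition state_before :: "real \<Rightarrow> 's path \<Rightarrow> 's option" where
  "state_before t \<omega> =
     (if t = 0 then state_at 0 \<omega>
      else if ennreal t < explosion_time \<omega>
      then jump_state (THE m. jump_time m \<omega> < ennreal t \<and> ennreal t \<le> jump_time (Suc m) \<omega>) \<omega>
      else None)"

definition natural_filtration :: "real \<Rightarrow> 's path set set" where
  "natural_filtration t =
     sigma_sets paths
       {{\<omega> \<in> paths. jump_time m \<omega> \<le> ennreal s \<and> jump_state m \<omega> = Some j} | m s j. 0 \<le> s \<and> s \<le> t}"

definition left_filtration :: "(real \<Rightarrow> 's path set set) \<Rightarrow> real \<Rightarrow> 's path set set" where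
  "left_filtration G s = sigma_sets paths (\<Union>t\<in>{0..<s}. G t)"

definition predictable_algebra ::
    "(real \<Rightarrow> 's path set set) \<Rightarrow> ('s path \<times> real) measure" where
  "predictable_algebra G =
     sigma (paths \<times> {0..})
       ({B \<times> {0} | B. B \<in> G 0} \<union> {B \<times> {s<..} | B s. 0 < s \<and> B \<in> left_filtration G s})"

(* The sigma-algebra of A with the isolated point None added. *)
definition action_algebra :: "'a::polish_space option measure" where
  "action_algebra = sigma UNIV {B. Some -` B \<in> sets borel}"

fun admissible :: "('s \<Rightarrow> 'a set) \<Rightarrow> 's option \<Rightarrow> 'a option set" where
  "admissible A (Some i) = Some ` A i"
| "admissible A None = {None}"

type_synonym ('s, 'a) policy = "'s path \<Rightarrow> real \<Rightarrow> 'a option measure"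

definition policies :: "('s::countable \<Rightarrow> 'a::polish_space set) \<Rightarrow> ('s, 'a) policy set" where
  "policies A =
     {\<pi>. (\<lambda>(\<omega>, t). \<pi> \<omega> t) \<in> predictable_algebra natural_filtration \<rightarrow>\<^sub>M prob_algebra action_algebra \<and>
         (\<forall>\<omega>\<in>paths. \<forall>t\<ge>0. emeasure (\<pi> \<omega> t) (admissible A (state_before t \<omega>)) = 1)}"

definition markov_policies :: "('s::countable \<Rightarrow> 'a::polish_space set) \<Rightarrow> ('s, 'a) policy set" where
  "markov_policies A =
     {\<pi> \<in> policies A. \<exists>\<phi>.
        (\<lambda>(x, t). \<phi> x t) \<in> count_space UNIV \<Otimes>\<^sub>M restrict_space borel {0..} \<rightarrow>\<^sub>M prob_algebra action_algebra \<and>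
        (\<forall>\<omega>\<in>paths. \<forall>t\<ge>0. \<pi> \<omega> t = \<phi> (state_before t \<omega>) t)}"

definition mark_measure :: "(real \<times> 's::countable) measure" where
  "mark_measure = restrict_space lborel {0<..} \<Otimes>\<^sub>M count_space UNIV"

(* The image of counting measure is the sum over m of the Dirac measures at (T_m, X_m). *)
definition jump_measure :: "'s::countable path \<Rightarrow> (real \<times> 's) measure" where
  "jump_measure \<omega> =
     distr (count_space {m. 1 \<le> m \<and> jump_time m \<omega> < \<infinity>}) mark_measure
       (\<lambda>m. (enn2real (jump_time m \<omega>), the (jump_state m \<omega>)))"

(* q j i a stands for q(j|i,a) and is meaningful for a in A i only, hence the indicator; it costs
   nothing, since the policy is concentrated there. *)
definition jump_rate ::
    "('s::countable \<Rightarrow> 'a::polish_space set) \<Rightarrow> ('s \<Rightarrow> 's \<Rightarrow> 'a \<Rightarrow> real) \<Rightarrow> ('s, 'a) policy \<Rightarrow>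
     's path \<Rightarrow> real \<Rightarrow> 's \<Rightarrow> ennreal" where
  "jump_rate A q \<pi> \<omega> t j =
     (case state_before t \<omega> of
        None \<Rightarrow> 0
      | Some i \<Rightarrow> if j = i then 0
                  else \<integral>\<^sup>+x. indicator (Some ` A i) x * ennreal (q j i (the x)) \<partial>\<pi> \<omega> t)"

definition policy_compensator ::
    "('s::countable \<Rightarrow> 'a::polish_space set) \<Rightarrow> ('s \<Rightarrow> 's \<Rightarrow> 'a \<Rightarrow> real) \<Rightarrow> ('s, 'a) policy \<Rightarrow>
     's path \<Rightarrow> (real \<times> 's) measure" where
  "policy_compensator A q \<pi> \<omega> = density mark_measure (\<lambda>(t, j). jump_rate A q \<pi> \<omega> t j)"

definition completed_filtration :: "'s path measure \<Rightarrow> real \<Rightarrow> 's path set set" where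
  "completed_filtration P t =
     sigma_sets paths (natural_filtration t \<union> null_sets (completion P))"

(* nu is a predictable random measure, and integrals of nonnegative predictable functions against
   mu and nu have the same expectation; everything refers to the basis completed under P. *)
definition dual_predictable_projection ::
    "'s::countable path measure \<Rightarrow> ('s path \<Rightarrow> (real \<times> 's) measure) \<Rightarrow>
     ('s path \<Rightarrow> (real \<times> 's) measure) \<Rightarrow> bool" where
  "dual_predictable_projection P \<mu> \<nu> \<longleftrightarrow>
     (let Pred = predictable_algebra (completed_filtration P) in
      \<forall>W \<in> borel_measurable (Pred \<Otimes>\<^sub>M count_space UNIV) :: (('s path \<times> real) \<times> 's \<Rightarrow> ennreal) set.
        (\<lambda>(\<omega>, t). \<integral>\<^sup>+(s, j). indicator {0<..t} s * W ((\<omega>, s), j) \<partial>\<nu> \<omega>) \<in> borel_measurable Pred \<and>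
        (\<integral>\<^sup>+\<omega>. (\<integral>\<^sup>+(s, j). W ((\<omega>, s), j) \<partial>\<mu> \<omega>) \<partial>completion P) =
        (\<integral>\<^sup>+\<omega>. (\<integral>\<^sup>+(s, j). W ((\<omega>, s), j) \<partial>\<nu> \<omega>) \<partial>completion P))"

definition is_policy_measure ::
    "('s::countable \<Rightarrow> 'a::polish_space set) \<Rightarrow> ('s \<Rightarrow> 's \<Rightarrow> 'a \<Rightarrow> real) \<Rightarrow> 's pmf \<Rightarrow>
     ('s, 'a) policy \<Rightarrow> 's path measure \<Rightarrow> bool" where
  "is_policy_measure A q \<gamma> \<pi> P \<longleftrightarrow>
     prob_space P \<and> sets P = sets path_algebra \<and>
     (\<forall>i. measure P {\<omega> \<in> paths. state_at 0 \<omega> = Some i} = pmf \<gamma> i) \<and>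
     dual_predictable_projection P jump_measure (policy_compensator A q \<pi>)"

definition policy_measure ::
    "('s::countable \<Rightarrow> 'a::polish_space set) \<Rightarrow> ('s \<Rightarrow> 's \<Rightarrow> 'a \<Rightarrow> real) \<Rightarrow> 's pmf \<Rightarrow>
     ('s, 'a) policy \<Rightarrow> 's path measure" where
  "policy_measure A q \<gamma> \<pi> = (THE P. is_policy_measure A q \<gamma> \<pi> P)"

definition running_cost ::
    "('s::countable \<Rightarrow> 'a::polish_space set) \<Rightarrow> ('s \<Rightarrow> 'a \<Rightarrow> real) \<Rightarrow> ('s, 'a) policy \<Rightarrow>
     's path \<Rightarrow> real \<Rightarrow> real" where
  "running_cost A f \<pi> \<omega> t =
     (case state_before t \<omega> of
        None \<Rightarrow> 0
      | Some i \<Rightarrow> \<integral>x. indicator (Some ` A i) x * f i (the x) \<partial>\<pi> \<omega> t)"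

definition expected_cost ::
    "('s::countable \<Rightarrow> 'a::polish_space set) \<Rightarrow> ('s \<Rightarrow> 's \<Rightarrow> 'a \<Rightarrow> real) \<Rightarrow> 's pmf \<Rightarrow> real \<Rightarrow>
     ('s \<Rightarrow> 'a \<Rightarrow> real) \<Rightarrow> ('s, 'a) policy \<Rightarrow> real" where
  "expected_cost A q \<gamma> T f \<pi> =
     (\<integral>\<omega>. (LINT t:{0..T}|lborel. running_cost A f \<pi> \<omega> t) \<partial>policy_measure A q \<gamma> \<pi>)"

definition feasible_policies ::
    "('s::countable \<Rightarrow> 'a::polish_space set) \<Rightarrow> ('s \<Rightarrow> 's \<Rightarrow> 'a \<Rightarrow> real) \<Rightarrow> 's pmf \<Rightarrow> real \<Rightarrow>
     nat \<Rightarrow> (nat \<Rightarrow> 's \<Rightarrow> 'a \<Rightarrow> real) \<Rightarrow> (nat \<Rightarrow> real) \<Rightarrow> ('s, 'a) policy set" where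
  "feasible_policies A q \<gamma> T N c d =
     {\<pi> \<in> policies A. \<forall>n\<in>{1..N}. expected_cost A q \<gamma> T (c n) \<pi> \<le> d n}"

(* The infimum is taken in the extended reals, where it exists unconditionally. *)
definition constrained_optimal ::
    "('s::countable \<Rightarrow> 'a::polish_space set) \<Rightarrow> ('s \<Rightarrow> 's \<Rightarrow> 'a \<Rightarrow> real) \<Rightarrow> 's pmf \<Rightarrow> real \<Rightarrow>
     nat \<Rightarrow> (nat \<Rightarrow> 's \<Rightarrow> 'a \<Rightarrow> real) \<Rightarrow> (nat \<Rightarrow> real) \<Rightarrow> ('s, 'a) policy \<Rightarrow> bool" where
  "constrained_optimal A q \<gamma> T N c d \<pi> \<longleftrightarrow>
     \<pi> \<in> feasible_policies A q \<gamma> T N c d \<and>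
     ereal (expected_cost A q \<gamma> T (c 0) \<pi>) =
       (INF \<pi>'\<in>feasible_policies A q \<gamma> T N c d. ereal (expected_cost A q \<gamma> T (c 0) \<pi>'))"

definition max_rate :: "('s \<Rightarrow> 'a set) \<Rightarrow> ('s \<Rightarrow> 's \<Rightarrow> 'a \<Rightarrow> real) \<Rightarrow> 's \<Rightarrow> real" where
  "max_rate A q i = (SUP a\<in>A i. \<bar>q i i a\<bar>)"

end

(* A policy is seen through its flow Lambda i f t = E[f(a_t); state i just before t].  Testing the compensator
   identity with functions that depend on the history up to the m-th jump shows that it holds iff, given the history,
   the next jump has the prescribed rates; this yields existence and uniqueness of the process and, for every policy,
   the forward equation of its flow together with a bound for the second moment of w.

   Given a minimizing sequence of policies, code the actions of each compact A(i) by nested finite partitions.  The flows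
   of the cells have Lipschitz time integrals, so along a subsequence they converge weakly to densities; at almost every
   time the limits of the cells of state i form a consistent family and so define a law on A(i), which is the kernel of a
   Markov policy.  Continuity of rates and costs in the action and the second moment (uniform integrability over the
   infinitely many states) allow passing to the limit in the forward equation and in the costs.  The forward equation
   of the Markov policy has only one solution of mass at most one, so the limit is the flow of that policy, and the
   costs of the sequence converge to its costs. *)
theory Submission imports Defs begin

text \<open>Rates are bounded in each state but not uniformly, so explosion cannot be excluded
  beforehand: the forward equation is derived level by level in the number of jumps and holds
  whether or not the process explodes. Gains and losses are kept on opposite sides, in the extended
  nonnegative reals, until finiteness is known. Weak convergence of the cell flows determines
  densities only up to null sets of times, while uniqueness needs a solution defined at every time.
  The forward equation itself supplies it: its integral terms converge, hence so does the remaining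
  term, the mass of a state at time t. The second moment of w acts twice. Costs and rates grow at
  most like w, so their part on w > R is at most a multiple of 1/R. And it makes the total loss of
  the limit policy finite, so that its flow has mass one; this is what turns minimality of the level
  sums into uniqueness.\<close>

section \<open>Paths, jump times and the state just before a time\<close>

text \<open>Every condition relates neighbouring entries only. Membership can thus be checked entry
  by entry for frozen, prolonged and glued paths, and it is visibly a measurable condition.\<close>

lemma paths_iff:
 "w \<in> paths \<longleftrightarrow> fst (w 0) \<noteq> None \<and>
   (\<forall>l. 0 < snd (w l) \<and> (snd (w l) = \<infinity> \<longleftrightarrow> fst (w (Suc l)) = None) \<and>
     (fst (w l) = None \<longrightarrow> snd (w l) = \<infinity>))" (is "_ \<longleftrightarrow> ?R")
proof
 assume "w \<in> paths"
 then consider "\<forall>l. fst (w l) \<noteq> None \<and> 0 < snd (w l) \<and> snd (w l) < \<infinity>"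
  | m where "m \<ge> 1" "\<forall>l<m. fst (w l) \<noteq> None" "\<forall>l<m - 1. 0 < snd (w l) \<and> snd (w l) < \<infinity>"
   "snd (w (m - 1)) = \<infinity>" "\<forall>l\<ge>m. w l = (None, \<infinity>)"
  unfolding paths_def by blast
 then show ?R
 proof cases
  case 2
  have c: "l < m - 1 \<or> l = m - 1 \<or> l \<ge> m" for l by linarith
  have "0 < snd (w l) \<and> (snd (w l) = \<infinity> \<longleftrightarrow> fst (w (Suc l)) = None) \<and>
     (fst (w l) = None \<longrightarrow> snd (w l) = \<infinity>)" for l
   using c[of l]
  proof (elim disjE)
   assume "l < m - 1"
   then have "Suc l < m" "l < m" by auto
   then show ?thesis using 2 \<open>l < m - 1\<close> by (metis less_irrefl)
  next
   assume "l = m - 1"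
   then have "Suc l = m" using 2(1) by auto
   then show ?thesis using 2 \<open>l = m - 1\<close> by simp
  next
   assume "l \<ge> m"
   then show ?thesis using 2 by simp
  qed
  then show ?thesis using 2 by auto
 next
  case 1
  then show ?thesis by (metis infinity_ennreal_def less_irrefl)
 qed
next
 assume R: ?R
 show "w \<in> paths"
 proof (cases "\<exists>l. snd (w l) = \<infinity>")
  case False
  then have "\<forall>l. snd (w l) < \<infinity>" by (auto simp: less_top)
  moreover have "fst (w l) \<noteq> None" for l
   using R False by metis
  ultimately show ?thesis using R unfolding paths_def by auto
 next
  case True
  \<comment> \<open>\<open>k\<close> is the index of the first infinite sojourn; the
    \<open>m\<close> of \<open>paths_def\<close> counts states and is therefore
    \<open>Suc k\<close>.\<close>
  define k where "k = (LEAST l. snd (w l) = \<infinity>)"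
  have k: "snd (w k) = \<infinity>" using LeastI_ex[OF True] k_def by simp
  have lt: "snd (w l) < \<infinity>" if "l < k" for l
   using not_less_Least[of l "\<lambda>l. snd (w l) = \<infinity>"] that by (auto simp: k_def less_top)
  have some: "fst (w l) \<noteq> None" if "l < Suc k" for l
  proof (cases l)
   case 0
   then show ?thesis using R by simp
  next
   case (Suc i)
   then show ?thesis using that R lt[of i] by (metis Suc_less_eq less_irrefl)
  qed
  have "fst (w (Suc k + d)) = None \<and> snd (w (Suc k + d)) = \<infinity>" for d
   using R k by (induction d) auto
  then have "w l = (None, \<infinity>)" if "l \<ge> Suc k" for l
   using that by (metis le_Suc_ex prod.collapse)
  then show ?thesis
   unfolding paths_def using R k lt some
   by (intro UnI2 CollectI exI[of _ "Suc k"]) auto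
 qed
qed

text \<open>The path in which the process is absorbed at its state number \<open>m\<close>: exactly what is known at the \<open>m\<close>-th jump.\<close>
definition freeze :: "nat \<Rightarrow> 's path \<Rightarrow> 's path" where
 "freeze m w l = (if l < m then w l else if l = m then (fst (w m), \<infinity>) else (None, \<infinity>))"

text \<open>Open on the left and closed on the right, as for \<open>state_before\<close>: the time
  of jump m + 1 belongs to the sojourn that it ends, where the history still consists of the first m
  jumps.\<close>

definition sojourn :: "nat \<Rightarrow> 's path \<Rightarrow> real \<Rightarrow> bool" where
 "sojourn m w t \<longleftrightarrow> jump_time m w < ennreal t \<and> ennreal t \<le> jump_time (Suc m) w"

lemma jump_time_0 [simp]: "jump_time 0 w = 0"
 by (simp add: jump_time_def)

lemma jump_time_Suc: "jump_time (Suc m) w = jump_time m w + snd (w m)"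
 by (simp add: jump_time_def)

lemma jump_time_mono: "m \<le> n \<Longrightarrow> jump_time m w \<le> jump_time n w"
 unfolding jump_time_def by (intro sum_mono2) auto

lemma jump_time_less_Suc:
 "w \<in> paths \<Longrightarrow> jump_time m w < \<infinity> \<Longrightarrow> jump_time m w < jump_time (Suc m) w"
 unfolding jump_time_Suc
 by (metis add.right_neutral ennreal_add_left_cancel_less infinity_ennreal_def less_irrefl paths_iff)

lemma jump_time_Suc_pos: "w \<in> paths \<Longrightarrow> 0 < jump_time (Suc m) w"
proof (induction m)
 case 0
 then show ?case using jump_time_less_Suc[of w 0] by simp
next
 case (Suc m)
 then show ?case using jump_time_mono[of "Suc m" "Suc (Suc m)" w] by simp
qed

lemma jump_state_None_iff:
 assumes "w \<in> paths" shows "jump_state m w = None \<longleftrightarrow> jump_time m w = \<infinity>"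
proof (induction m)
 case 0
 then show ?case using assms by (simp add: jump_state_def paths_iff)
next
 case (Suc m)
 have "jump_time m w = \<infinity> \<Longrightarrow> snd (w m) = \<infinity>"
  using Suc assms by (auto simp: jump_state_def paths_iff)
 then have "jump_time (Suc m) w = \<infinity> \<longleftrightarrow> snd (w m) = \<infinity>"
  by (auto simp: jump_time_Suc)
 then show ?case using assms by (auto simp: jump_state_def paths_iff)
qed

lemma jump_state_Some: "w \<in> paths \<Longrightarrow> jump_time m w < \<infinity> \<Longrightarrow> \<exists>i. jump_state m w = Some i"
 using jump_state_None_iff[of w m] by (cases "jump_state m w") auto

lemma jump_time_freeze: "k \<le> m \<Longrightarrow> jump_time k (freeze m w) = jump_time k w"
 unfolding jump_time_def by (intro sum.cong) (auto simp: freeze_def)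

lemma jump_time_freeze_gt: "m < k \<Longrightarrow> jump_time k (freeze m w) = \<infinity>"
 using jump_time_mono[of "Suc m" k "freeze m w"]
 by (auto simp: jump_time_Suc[of m] freeze_def[of m w m] top_unique)

lemma jump_state_freeze: "k \<le> m \<Longrightarrow> jump_state k (freeze m w) = jump_state k w"
 by (auto simp: jump_state_def freeze_def)

lemma jump_state_freeze_gt: "m < k \<Longrightarrow> jump_state k (freeze m w) = None"
 by (auto simp: jump_state_def freeze_def)

lemma freeze_freeze: "m \<le> n \<Longrightarrow> freeze m (freeze n w) = freeze m w"
 by (auto simp: freeze_def fun_eq_iff)

text \<open>Once no further jump occurs, all later entries are the ones that freezing writes. This
  settles the no-jump case in inductions over frozen histories.\<close>

lemma freeze_eq_self:
 assumes "w \<in> paths" "jump_time (Suc m) w = \<infinity>" shows "freeze m w = w"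
proof
 fix l
 have None: "fst (w k) = None" if "k > m" for k
  using that assms(2) jump_time_mono[of "Suc m" k w] jump_state_None_iff[OF assms(1), of k]
  by (auto simp: jump_state_def top_unique)
 moreover have "snd (w m) = \<infinity>" using None[of "Suc m"] assms(1) by (auto simp: paths_iff)
 moreover have "snd (w k) = \<infinity>" if "k > m" for k
  using None[OF that] assms(1) by (auto simp: paths_iff)
 ultimately show "freeze m w l = w l"
  unfolding freeze_def by (cases "l < m"; cases "l = m") (simp_all add: prod_eq_iff)
qed

lemma freeze_in_paths: "w \<in> paths \<Longrightarrow> freeze m w \<in> paths"
proof (cases "jump_time m w = \<infinity>")
 case True
 assume "w \<in> paths"
 then show ?thesis
  using freeze_eq_self[of w m] True jump_time_mono[of m "Suc m" w] by (auto simp: top_unique)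
next
 case False
 assume p: "w \<in> paths"
 then have X: "fst (w k) \<noteq> None" if "k \<le> m" for k
  using False jump_state_None_iff[OF p, of k] jump_time_mono[OF that, of w]
  by (auto simp: jump_state_def top_unique)
 have c: "l < m \<or> l = m \<or> l > m" for l by linarith
 have "0 < snd (freeze m w l) \<and> (snd (freeze m w l) = \<infinity> \<longleftrightarrow> fst (freeze m w (Suc l)) = None) \<and>
     (fst (freeze m w l) = None \<longrightarrow> snd (freeze m w l) = \<infinity>)" for l
  using c[of l]
 proof (elim disjE)
  assume l: "l < m"
  then have "fst (freeze m w (Suc l)) = fst (w (Suc l))" "freeze m w l = w l"
   by (auto simp: freeze_def) (metis Suc_lessI fst_conv)
  then show ?thesis using p by (simp add: paths_iff)
 qed (auto simp: freeze_def)
 moreover have "fst (freeze m w 0) = fst (w 0)" by (simp add: freeze_def)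
 ultimately show ?thesis
  using p by (simp add: paths_iff)
qed

lemma explosion_time_eq: "explosion_time w = (SUP m. jump_time m w)"
 unfolding explosion_time_def
 by (intro limI LIMSEQ_SUP incseq_SucI jump_time_mono) auto

lemma sojourn_pos: "sojourn m w t \<Longrightarrow> 0 < t"
 by (metis ennreal_neg leI not_less_zero sojourn_def)

lemma sojourn_unique: "sojourn m w t \<Longrightarrow> sojourn n w t \<Longrightarrow> m = n"
proof (induction m n rule: linorder_wlog)
 case (le m n)
 show ?case
 proof (rule ccontr)
  assume "m \<noteq> n"
  then have "jump_time (Suc m) w \<le> jump_time n w" using le(1) by (intro jump_time_mono) simp
  then show False using le(2,3) unfolding sojourn_def by (metis leD le_less_trans)
 qed
qed metis

lemma sojourn_finite: "sojourn m w t \<Longrightarrow> jump_time m w < \<infinity>"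
 unfolding sojourn_def using less_le_trans[of "jump_time m w" "ennreal t" top] by auto

lemma sojourn_explosion: "w \<in> paths \<Longrightarrow> sojourn m w t \<Longrightarrow> ennreal t < explosion_time w"
proof -
 assume p: "w \<in> paths" "sojourn m w t"
 \<comment> \<open>A sojourn contains its right end, so T_{m+1} alone gives no strict bound; one
   more jump, after a positive waiting time, does.\<close>
 have "ennreal t < jump_time (Suc (Suc m)) w"
 proof (cases "jump_time (Suc m) w = \<infinity>")
  case True
  then show ?thesis using jump_time_mono[of "Suc m" "Suc (Suc m)" w] by (auto simp: top_unique)
 next
  case False
  then show ?thesis using p jump_time_less_Suc[of w "Suc m"] by (auto simp: sojourn_def less_top)
 qed
 then show ?thesis unfolding explosion_time_eq by (auto simp: less_SUP_iff)
qed

lemma ex_sojourn: "0 < t \<Longrightarrow> ennreal t < explosion_time w \<Longrightarrow> \<exists>m. sojourn m w t"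
proof -
 assume t: "0 < t" "ennreal t < explosion_time w"
 then have ex: "\<exists>m. ennreal t \<le> jump_time m w"
  by (auto simp: explosion_time_eq less_SUP_iff intro: less_imp_le)
 define k where "k = (LEAST m. ennreal t \<le> jump_time m w)"
 have k: "ennreal t \<le> jump_time k w" using LeastI_ex[OF ex] k_def by simp
 with t(1) have "k \<noteq> 0" by (cases k) auto
 then obtain m where m: "k = Suc m" by (cases k) auto
 have "jump_time m w < ennreal t"
  using not_less_Least[of m "\<lambda>m. ennreal t \<le> jump_time m w"] m k_def by auto
 with k m show ?thesis by (auto simp: sojourn_def)
qed

lemma state_before_sojourn:
 assumes "w \<in> paths" "sojourn m w t" shows "state_before t w = jump_state m w"
proof -
 have "(THE m. jump_time m w < ennreal t \<and> ennreal t \<le> jump_time (Suc m) w) = m"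
  using assms sojourn_unique by (intro the_equality) (auto simp: sojourn_def[symmetric])
 then show ?thesis
  using sojourn_explosion[OF assms] sojourn_pos[OF assms(2)] by (simp add: state_before_def)
qed

lemma state_before_Some_iff:
 assumes "w \<in> paths" "0 < t"
 shows "state_before t w = Some i \<longleftrightarrow> (\<exists>m. sojourn m w t \<and> jump_state m w = Some i)"
proof
 assume s: "state_before t w = Some i"
 then have "ennreal t < explosion_time w"
  using assms(2) by (auto simp: state_before_def split: if_splits)
 with ex_sojourn assms show "\<exists>m. sojourn m w t \<and> jump_state m w = Some i"
  using s state_before_sojourn by metis
qed (use assms state_before_sojourn in metis)

lemma state_at_0: "w \<in> paths \<Longrightarrow> state_at 0 w = jump_state 0 w"
proof -
 assume p: "w \<in> paths"
 have pos: "0 < jump_time (Suc m) w" for m using jump_time_Suc_pos[OF p] .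
 have "(THE m. jump_time m w \<le> ennreal 0 \<and> ennreal 0 < jump_time (Suc m) w) = 0"
 proof (rule the_equality)
  show "jump_time 0 w \<le> ennreal 0 \<and> ennreal 0 < jump_time (Suc 0) w" using pos by simp
  fix m assume "jump_time m w \<le> ennreal 0 \<and> ennreal 0 < jump_time (Suc m) w"
  then show "m = 0" using pos by (cases m) (auto simp: not_le[symmetric])
 qed
 moreover have "0 < explosion_time w"
  using pos[of 0] by (auto simp: explosion_time_eq less_SUP_iff)
 ultimately show ?thesis by (simp add: state_at_def)
qed

lemma state_before_0: "w \<in> paths \<Longrightarrow> state_before 0 w = jump_state 0 w"
 by (simp add: state_before_def state_at_0)

lemma space_path_algebra [simp]: "space path_algebra = paths"
 by (simp add: path_algebra_def space_restrict_space space_PiM space_pair_measure)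

lemma measurable_path_coordinate [measurable]:
 "(\<lambda>w. w l) \<in> path_algebra \<rightarrow>\<^sub>M (count_space UNIV \<Otimes>\<^sub>M borel)"
 unfolding path_algebra_def by (intro measurable_restrict_space1) measurable

lemma measurable_into_path_algebra:
 assumes "\<And>l. (\<lambda>x. f x l) \<in> M \<rightarrow>\<^sub>M (count_space UNIV \<Otimes>\<^sub>M borel)" "\<And>x. x \<in> space M \<Longrightarrow> f x \<in> paths"
 shows "f \<in> M \<rightarrow>\<^sub>M path_algebra"
 unfolding path_algebra_def
 using assms by (intro measurable_restrict_space2 measurable_PiM_single') (auto simp: space_pair_measure)

lemma measurable_jump_state [measurable]: "jump_state m \<in> path_algebra \<rightarrow>\<^sub>M count_space UNIV"
 unfolding jump_state_def[abs_def] by measurable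

lemma measurable_jump_time [measurable]: "jump_time m \<in> borel_measurable path_algebra"
 unfolding jump_time_def[abs_def] by measurable

lemma measurable_freeze [measurable]: "freeze m \<in> path_algebra \<rightarrow>\<^sub>M path_algebra"
proof (intro measurable_into_path_algebra)
 show "(\<lambda>x. freeze m x l) \<in> path_algebra \<rightarrow>\<^sub>M count_space UNIV \<Otimes>\<^sub>M borel" for l
  unfolding freeze_def by (cases "l < m"; cases "l = m") simp_all
qed (simp add: freeze_in_paths)

lemma measurable_sojourn [measurable]:
 "Measurable.pred (path_algebra \<Otimes>\<^sub>M borel) (\<lambda>(w, t). sojourn m w t)"
 unfolding sojourn_def by measurable

abbreviation csum :: "('b \<Rightarrow> ennreal) \<Rightarrow> ennreal" where
 "csum f \<equiv> \<integral>\<^sup>+i. f i \<partial>count_space UNIV"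

abbreviation before :: "real \<Rightarrow> (real \<Rightarrow> ennreal) \<Rightarrow> ennreal" where
 "before t h \<equiv> \<integral>\<^sup>+s. (if s < t then h s else 0) \<partial>lborel"

abbreviation predictable :: "('s path \<times> real) measure" where
 "predictable \<equiv> predictable_algebra natural_filtration"

abbreviation path_time :: "('s::countable path \<times> real) measure" where
 "path_time \<equiv> path_algebra \<Otimes>\<^sub>M borel"

text \<open>No predictability is asked: inserting \<open>freeze m w\<close> for the path makes any
  jointly measurable function predictable on sojourn m, see
  \<open>predictable_sojourn_function\<close>.\<close>

abbreviation marked :: "('s::countable path \<Rightarrow> real \<Rightarrow> 'j \<Rightarrow> ennreal) \<Rightarrow> bool" where
 "marked W \<equiv> (\<lambda>((w, t), j). W w t j) \<in> borel_measurable (path_time \<Otimes>\<^sub>M count_space UNIV)"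

abbreviation next_jump :: "('s::countable path \<Rightarrow> real \<Rightarrow> 's \<Rightarrow> ennreal) \<Rightarrow> nat \<Rightarrow> 's path \<Rightarrow> ennreal" where
 "next_jump W m w \<equiv> if jump_time (Suc m) w < \<infinity>
  then W (freeze m w) (enn2real (jump_time (Suc m) w)) (the (jump_state (Suc m) w)) else 0"

section \<open>Path space and predictability\<close>

definition history_events :: "'s path set set" where
 "history_events = {{w \<in> paths. jump_time k w \<le> ennreal s \<and> jump_state k w = Some j} | k s j. 0 \<le> s}"

lemma ennreal_le_iff_ex: "(\<exists>n::nat. x \<le> ennreal (real n)) \<longleftrightarrow> x < \<infinity>"
proof
 assume "x < \<infinity>"
 then obtain r where "x = ennreal r" "0 \<le> r" by (cases x) auto
 then show "\<exists>n::nat. x \<le> ennreal (real n)"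
  using real_arch_simple[of r] by (auto intro: ennreal_leI)
qed (metis ennreal_less_top infinity_ennreal_def le_less_trans)

lemma jump_time_finite: "w \<in> paths \<Longrightarrow> jump_state m w = Some j \<Longrightarrow> jump_time m w < \<infinity>"
 using jump_state_None_iff[of w m] by (auto simp: less_top)

text \<open>The entries of a path are recovered from its jump times and states by taking
  differences. Proofs about measurable sets of paths can therefore go by induction over the events
  that generate the natural filtration.\<close>

lemma sets_path_algebra_eq: "sets path_algebra = sigma_sets paths (history_events :: 's::countable path set set)"
proof
 define S :: "'s path measure" where "S = sigma paths history_events"
 have sub: "history_events \<subseteq> Pow (paths :: 's path set)" by (auto simp: history_events_def)
 have sp: "space S = paths" by (simp add: S_def space_measure_of_conv)
 have sS: "sets S = sigma_sets paths history_events" using sub by (simp add: S_def)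
 have basic: "{w \<in> space S. jump_time k w \<le> ennreal s \<and> jump_state k w = Some j} \<in> sets S" if "0 \<le> s" for k s j
  using that unfolding sS sp by (auto simp: history_events_def)
 have [measurable]: "jump_state k \<in> S \<rightarrow>\<^sub>M count_space UNIV" for k
 proof -
  have so: "{w \<in> space S. jump_state k w = Some j} \<in> sets S" for j
  proof -
   \<comment> \<open>A state other than the cemetery is entered at a finite time, hence before some
     integer time.\<close>
   have "{w \<in> space S. jump_state k w = Some j} =
    (\<Union>n. {w \<in> space S. jump_time k w \<le> ennreal (real n) \<and> jump_state k w = Some j})"
    unfolding sp using ennreal_le_iff_ex[THEN iffD2] jump_time_finite[of _ k j] by blast
   also have "\<dots> \<in> sets S" by (intro sets.countable_UN) (auto intro: basic)
   finally show ?thesis .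
  qed
  have no: "{w \<in> space S. jump_state k w = None} = space S - (\<Union>j. {w \<in> space S. jump_state k w = Some j})"
   by auto
  have "{w \<in> space S. jump_state k w = None} \<in> sets S"
   unfolding no using so by (intro sets.Diff sets.top sets.countable_UN) auto
  with so have "{w \<in> space S. jump_state k w = x} \<in> sets S" for x by (cases x) auto
  then show ?thesis
   by (subst measurable_count_space_eq2_countable) (auto simp: vimage_def Int_def conj_commute)
 qed
 have [measurable]: "jump_time k \<in> borel_measurable S" for k
 proof (rule borel_measurableI_le)
  fix a :: ennreal
  show "{w \<in> space S. jump_time k w \<le> a} \<in> sets S"
  proof (cases a)
   case (real s)
   have "{w \<in> space S. jump_time k w \<le> a} =
    (\<Union>j. {w \<in> space S. jump_time k w \<le> ennreal s \<and> jump_state k w = Some j})"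
    using jump_state_Some[of _ k] le_less_trans[of "jump_time k _" "ennreal s" top]
    unfolding real(2) sp by fastforce
   also have "\<dots> \<in> sets S" using real by (intro sets.countable_UN) (auto intro: basic)
   finally show ?thesis .
  qed simp
 qed
 have "(\<lambda>x. x) \<in> S \<rightarrow>\<^sub>M path_algebra"
 proof (rule measurable_into_path_algebra)
  fix l
  \<comment> \<open>After an infinite jump time the difference is meaningless, but there the waiting
    time of a path is infinite.\<close>
  have "(\<lambda>x. (jump_state l x, if jump_time l x < \<infinity> then jump_time (Suc l) x - jump_time l x else \<infinity>))
    \<in> S \<rightarrow>\<^sub>M count_space UNIV \<Otimes>\<^sub>M borel"
   by measurable
  moreover have "x l = (jump_state l x, if jump_time l x < \<infinity> then jump_time (Suc l) x - jump_time l x else \<infinity>)"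
   if "x \<in> space S" for x
  proof (cases "jump_time l x = \<infinity>")
   case True
   then have "jump_state l x = None" using that jump_state_None_iff[of x l] by (simp add: sp)
   then have "snd (x l) = \<infinity>" using that paths_iff[of x] by (simp add: sp jump_state_def)
   then show ?thesis using True by (simp add: jump_state_def prod_eq_iff)
  next
   case False
   then show ?thesis
    by (simp add: jump_state_def prod_eq_iff jump_time_Suc less_top)
  qed
  ultimately show "(\<lambda>x. x l) \<in> S \<rightarrow>\<^sub>M count_space UNIV \<Otimes>\<^sub>M borel"
   by (rule measurable_cong[THEN iffD2, rotated])
 qed (simp add: sp)
 from measurable_sets[OF this] show "sets path_algebra \<subseteq> sigma_sets paths (history_events :: 's path set set)"
  unfolding sS[symmetric] sp using sets.sets_into_space[of _ path_algebra] by (fastforce simp: vimage_def Int_absorb2 sp)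
 show "sigma_sets paths history_events \<subseteq> sets (path_algebra :: 's path measure)"
 proof -
  have "history_events \<subseteq> sets (path_algebra :: 's path measure)"
  proof
   fix E :: "'s path set" assume "E \<in> history_events"
   then obtain k s j where E: "E = {w \<in> space path_algebra. jump_time k w \<le> ennreal s \<and> jump_state k w = Some j}"
    by (auto simp: history_events_def)
   show "E \<in> sets path_algebra" unfolding E by measurable
  qed
  from sets.sigma_sets_subset[OF this] show ?thesis by simp
 qed
qed

lemma natural_filtration_subset: "natural_filtration t \<subseteq> Pow (paths :: 's path set)"
proof -
 have "{{w \<in> paths. jump_time m w \<le> ennreal s \<and> jump_state m w = Some j} |m s j. 0 \<le> s \<and> s \<le> t}
  \<subseteq> Pow (paths :: 's path set)"
  by auto
 from sigma_sets_into_sp[OF this] show ?thesis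
  unfolding natural_filtration_def by blast
qed

lemma sigma_sets_natural_filtration: "sigma_sets paths (natural_filtration t) = natural_filtration t"
 unfolding natural_filtration_def by (rule sigma_sets_sigma_sets_eq) auto

lemma natural_filtration_subset_path_algebra:
 "natural_filtration t \<subseteq> sets (path_algebra :: 's::countable path measure)"
 unfolding natural_filtration_def sets_path_algebra_eq
 by (intro sigma_sets_mono') (auto simp: history_events_def)

lemma left_filtration_subset:
 "(\<And>t. G t \<subseteq> Pow paths) \<Longrightarrow> left_filtration G s \<subseteq> Pow paths"
 unfolding left_filtration_def using sigma_sets_into_sp[of "\<Union>t\<in>{0..<s}. G t" paths] by blast

lemma left_filtration_mono: "s \<le> t \<Longrightarrow> left_filtration G s \<subseteq> left_filtration G t"
 unfolding left_filtration_def by (intro sigma_sets_mono' UN_mono) auto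

lemma left_filtration_subset_path_algebra:
 "left_filtration natural_filtration t \<subseteq> sets (path_algebra :: 's::countable path measure)"
proof -
 have "(\<Union>s\<in>{0..<t}. natural_filtration s) \<subseteq> sets (path_algebra :: 's path measure)"
  using natural_filtration_subset_path_algebra by blast
 from sets.sigma_sets_subset[OF this] show ?thesis by (simp add: left_filtration_def)
qed

lemma space_predictable [simp]: "space (predictable_algebra G) = paths \<times> {0..}"
 by (simp add: predictable_algebra_def space_measure_of_conv)

definition predictable_rectangles :: "(real \<Rightarrow> 's path set set) \<Rightarrow> ('s path \<times> real) set set" where
 "predictable_rectangles G =
   {B \<times> {0} | B. B \<in> G 0} \<union> {B \<times> {s<..} | B s. 0 < s \<and> B \<in> left_filtration G s}"

lemma predictable_rectangles_subset:
 assumes "\<And>t. G t \<subseteq> Pow paths" shows "predictable_rectangles G \<subseteq> Pow (paths \<times> {0..})"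
 using assms left_filtration_subset[OF assms] unfolding predictable_rectangles_def by fastforce

lemma sets_predictable:
 "(\<And>t. G t \<subseteq> Pow paths) \<Longrightarrow>
   sets (predictable_algebra G) = sigma_sets (paths \<times> {0..}) (predictable_rectangles G)"
 unfolding predictable_algebra_def using predictable_rectangles_subset[of G]
 by (simp add: predictable_rectangles_def)

lemma predictable_rectangle:
 assumes "\<And>t. G t \<subseteq> Pow paths"
 shows "0 < s \<Longrightarrow> B \<in> left_filtration G s \<Longrightarrow> B \<times> {s<..} \<in> sets (predictable_algebra G)"
  and "B \<in> G 0 \<Longrightarrow> B \<times> {0} \<in> sets (predictable_algebra G)"
 unfolding sets_predictable[OF assms] by (auto simp: predictable_rectangles_def)

lemmas natural_rectangle = predictable_rectangle[of natural_filtration, OF natural_filtration_subset]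

lemma measurable_into_predictable:
 assumes G: "\<And>t. G t \<subseteq> Pow paths"
  and sp: "\<And>x. x \<in> space M \<Longrightarrow> f x \<in> paths \<times> {0..}"
  and zero: "\<And>B. B \<in> G 0 \<Longrightarrow> {x \<in> space M. f x \<in> B \<times> {0}} \<in> sets M"
  and later: "\<And>B s. 0 < s \<Longrightarrow> B \<in> left_filtration G s \<Longrightarrow> {x \<in> space M. f x \<in> B \<times> {s<..}} \<in> sets M"
 shows "f \<in> M \<rightarrow>\<^sub>M predictable_algebra G"
 unfolding predictable_algebra_def
proof (rule measurable_measure_of)
 show "{B \<times> {0} |B. B \<in> G 0} \<union> {B \<times> {s<..} |B s. 0 < s \<and> B \<in> left_filtration G s} \<subseteq> Pow (paths \<times> {0..})"
  using predictable_rectangles_subset[of G, OF G] unfolding predictable_rectangles_def .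
 fix y assume "y \<in> {B \<times> {0} |B. B \<in> G 0} \<union> {B \<times> {s<..} |B s. 0 < s \<and> B \<in> left_filtration G s}"
 then show "f -` y \<inter> space M \<in> sets M"
  using zero later by (auto simp: vimage_def Int_def conj_commute)
qed (use sp in auto)

text \<open>Predictable sets live on nonnegative times, \<open>path_time\<close> on all reals;
  \<open>max 0 t\<close> mediates between them.\<close>

lemma measurable_predictable_joint:
 "(\<lambda>(w, t). (w, max 0 t)) \<in> path_time \<rightarrow>\<^sub>M
   (predictable :: ('s::countable path \<times> real) measure)"
proof (rule measurable_into_predictable[OF natural_filtration_subset])
 fix B :: "'s path set" assume "B \<in> natural_filtration 0"
 then have [measurable]: "B \<in> sets path_algebra" using natural_filtration_subset_path_algebra by blast
 have eq: "{x \<in> space (path_algebra \<Otimes>\<^sub>M (borel :: real measure)). (case x of (w, t) \<Rightarrow> (w, max 0 t)) \<in> B \<times> {0}}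
  = B \<times> {..(0::real)}" using sets.sets_into_space[of B path_algebra]
  by (auto simp: space_pair_measure max_def split: if_splits)
 show "{x \<in> space (path_algebra \<Otimes>\<^sub>M (borel :: real measure)). (case x of (w, t) \<Rightarrow> (w, max 0 t)) \<in> B \<times> {0}}
   \<in> sets path_time" unfolding eq by measurable
next
 fix B :: "'s path set" and s :: real assume s: "0 < s" "B \<in> left_filtration natural_filtration s"
 then have [measurable]: "B \<in> sets path_algebra" using left_filtration_subset_path_algebra by blast
 have eq: "{x \<in> space (path_algebra \<Otimes>\<^sub>M (borel :: real measure)). (case x of (w, t) \<Rightarrow> (w, max 0 t)) \<in> B \<times> {s<..}}
  = B \<times> {s<..}" using s(1) sets.sets_into_space[of B path_algebra]
  by (auto simp: space_pair_measure max_def split: if_splits)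
 show "{x \<in> space (path_algebra \<Otimes>\<^sub>M (borel :: real measure)). (case x of (w, t) \<Rightarrow> (w, max 0 t)) \<in> B \<times> {s<..}}
   \<in> sets path_time" unfolding eq by measurable
qed (auto simp: space_pair_measure)

text \<open>Stated for any filtration of sets of paths, since events of a completed filtration may
  lie outside \<open>path_algebra\<close>. Sections suffice to integrate over time along a fixed
  path.\<close>

lemma measurable_predictable_section:
 assumes G: "\<And>t. G t \<subseteq> Pow paths" and w: "w \<in> paths"
 shows "(\<lambda>t. (w, max 0 t)) \<in> borel \<rightarrow>\<^sub>M predictable_algebra G"
proof (rule measurable_into_predictable[OF G])
 fix B
 have eq: "{t \<in> space borel. (w, max 0 t) \<in> B \<times> {0}} = (if w \<in> B then {..0::real} else {})"
  by (auto simp: max_def split: if_splits)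
 show "{t \<in> space borel. (w, max 0 t) \<in> B \<times> {0::real}} \<in> sets borel" unfolding eq by simp
 fix s :: real assume "0 < s"
 then have eq: "{t \<in> space borel. (w, max 0 t) \<in> B \<times> {s<..}} = (if w \<in> B then {s<..} else {})"
  by (auto simp: max_def split: if_splits)
 show "{t \<in> space borel. (w, max 0 t) \<in> B \<times> {s<..}} \<in> sets borel" unfolding eq by simp
qed (use w in auto)

lemma natural_filtration_freeze:
 assumes "E \<in> natural_filtration s" "w \<in> paths" "ennreal s < jump_time (Suc m) w"
 shows "w \<in> E \<longleftrightarrow> freeze m w \<in> E"
 using assms(1) unfolding natural_filtration_def
proof induction
 case (Basic a)
 then obtain k u j where a: "a = {w \<in> paths. jump_time k w \<le> ennreal u \<and> jump_state k w = Some j}" "0 \<le> u" "u \<le> s"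
  by blast
 show ?case
 proof (cases "k \<le> m")
  case True
  then show ?thesis using assms(2) freeze_in_paths[OF assms(2), of m]
   by (simp add: a jump_time_freeze jump_state_freeze)
 next
  case False
  have "ennreal u < jump_time (Suc m) w" using a(3) assms(3) ennreal_leI le_less_trans by blast
  also have "\<dots> \<le> jump_time k w" using False by (intro jump_time_mono) simp
  finally have "\<not> jump_time k w \<le> ennreal u" by simp
  moreover have "\<not> jump_time k (freeze m w) \<le> ennreal u"
   using False by (simp add: jump_time_freeze_gt top_unique)
  ultimately show ?thesis by (simp add: a)
 qed
next
 case (Compl a)
 then show ?case using assms(2) freeze_in_paths[OF assms(2), of m] by simp
qed auto

text \<open>Events entering a rectangle over (s, infinity) are known at some u < s < t <= T_{m+1},
  so the strict hypothesis of \<open>natural_filtration_freeze\<close> holds even at t = T_{m+1}.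
  Predictable functions evaluated at a jump time thus see only the history before that jump.\<close>

lemma predictable_freeze_set:
 assumes "C \<in> sets predictable" "w \<in> paths" "sojourn m w t"
 shows "(w, t) \<in> C \<longleftrightarrow> (freeze m w, t) \<in> C"
 using assms(1) unfolding sets_predictable[OF natural_filtration_subset]
proof induction
 case (Basic a)
 have t: "0 < t" using assms(3) by (rule sojourn_pos)
 consider B where "a = B \<times> {0}" | B s where "a = B \<times> {s<..}" "0 < s" "B \<in> left_filtration natural_filtration s"
  using Basic by (auto simp: predictable_rectangles_def)
 then show ?case
 proof cases
  case 1 then show ?thesis using t by simp
 next
  case (2 B s)
  have "w \<in> B \<longleftrightarrow> freeze m w \<in> B" if "s < t"
   using 2(3) unfolding left_filtration_def
  proof induction
   case (Basic b)
   then obtain u where u: "u < s" "0 \<le> u" "b \<in> natural_filtration u" by auto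
   have "ennreal u < ennreal t" using u that t by (intro ennreal_lessI) auto
   also have "\<dots> \<le> jump_time (Suc m) w" using assms(3) by (simp add: sojourn_def)
   finally show ?case using natural_filtration_freeze[OF u(3) assms(2)] by simp
  next
   case (Compl a)
   then show ?case using assms(2) freeze_in_paths[OF assms(2), of m] by simp
  qed auto
  then show ?thesis using 2 by auto
 qed
next
 case (Compl a)
 then show ?case using assms(2) sojourn_pos[OF assms(3)] freeze_in_paths[OF assms(2), of m] by simp
qed auto

lemma predictable_freeze:
 fixes H :: "'s path \<times> real \<Rightarrow> 'b::t1_space"
 assumes H: "H \<in> borel_measurable predictable"
  and w: "w \<in> paths" "sojourn m w t"
 shows "H (w, t) = H (freeze m w, t)"
proof -
 let ?C = "H -` {H (w, t)} \<inter> space predictable"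
 have "?C \<in> sets predictable"
  using H by (intro measurable_sets) auto
 from predictable_freeze_set[OF this w] show ?thesis
  using w(1) sojourn_pos[OF w(2)] by auto
qed

lemma history_left_filtration:
 assumes "0 \<le> u" "u < s"
 shows "{w \<in> paths. jump_time k w \<le> ennreal u \<and> jump_state k w = Some j} \<in> left_filtration natural_filtration s"
 unfolding left_filtration_def
 using assms by (intro sigma_sets.Basic UN_I[of u]) (auto simp: natural_filtration_def intro!: sigma_sets.Basic)

text \<open>The left filtration as a measure, so that closure rules for \<open>sets\<close> apply to
  it.\<close>

definition left_algebra :: "real \<Rightarrow> 's path measure" where
 "left_algebra s = sigma paths (\<Union>t\<in>{0..<s}. natural_filtration t)"

lemma space_left_algebra [simp]: "space (left_algebra s) = paths"
 by (simp add: left_algebra_def space_measure_of_conv)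

lemma sets_left_algebra: "sets (left_algebra s) = left_filtration natural_filtration s"
 unfolding left_algebra_def left_filtration_def
 using natural_filtration_subset by (intro sets_measure_of) blast

lemma freeze_left_filtration:
 fixes E :: "'s::countable path set"
 assumes "E \<in> sets path_algebra"
 shows "{w \<in> paths. jump_time m w < ennreal s \<and> freeze m w \<in> E} \<in> left_filtration natural_filtration s"
proof -
 have before: "{w \<in> paths. jump_time m w \<le> ennreal u} \<in> sets (left_algebra s :: 's path measure)"
  if "0 \<le> u" "u < s" for u
 proof -
  have "{w \<in> paths. jump_time m w \<le> ennreal u} =
    (\<Union>j. {w \<in> paths. jump_time m w \<le> ennreal u \<and> jump_state m w = Some j})"
   using jump_state_Some[of _ m] le_less_trans[of "jump_time m _" "ennreal u" top] by fastforce
  also have "\<dots> \<in> sets (left_algebra s :: 's path measure)"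
   using history_left_filtration[OF that] by (intro sets.countable_UN) (auto simp: sets_left_algebra)
  finally show ?thesis .
 qed
 \<comment> \<open>Rational times below s turn the strict inequality T_m < s into a countable union
   of events T_m <= u, the form of the generators.\<close>
 define U where "U = {u::real. u \<in> \<rat> \<and> 0 \<le> u \<and> u < s}"
 have cU: "countable U" unfolding U_def by (rule countable_subset[OF _ countable_rat]) auto
 have less_iff: "x < ennreal s \<longleftrightarrow> (\<exists>u\<in>U. x \<le> ennreal u)" for x
 proof
  assume "x < ennreal s"
  then obtain r where r: "x = ennreal r" "0 \<le> r" "r < s"
   by (cases x) (auto simp: ennreal_less_iff dest: less_le_trans)
  then obtain u where "u \<in> \<rat>" "r < u" "u < s" using Rats_dense_in_real by blast
  then show "\<exists>u\<in>U. x \<le> ennreal u" using r by (auto simp: U_def intro!: bexI[of _ u] ennreal_leI)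
 next
  assume "\<exists>u\<in>U. x \<le> ennreal u"
  then obtain u where "0 \<le> u" "u < s" "x \<le> ennreal u" by (auto simp: U_def)
  then show "x < ennreal s" using ennreal_lessI[of s u] by (auto intro: le_less_trans)
 qed
 have lt: "{w \<in> paths. jump_time m w < ennreal s} \<in> sets (left_algebra s :: 's path measure)"
 proof -
  have "{w \<in> paths. jump_time m w < ennreal s} = (\<Union>u\<in>U. {w \<in> paths. jump_time m w \<le> ennreal u})"
   unfolding less_iff by blast
  also have "\<dots> \<in> sets (left_algebra s :: 's path measure)"
   using cU before by (intro sets.countable_UN'') (auto simp: U_def)
  finally show ?thesis .
 qed
 have "{w \<in> paths. jump_time m w < ennreal s \<and> freeze m w \<in> E} \<in> sets (left_algebra s)"
  using assms unfolding sets_path_algebra_eq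
 proof induction
  case (Basic a)
  then obtain k v j where a: "a = {w \<in> paths. jump_time k w \<le> ennreal v \<and> jump_state k w = Some j}" "0 \<le> v"
   by (auto simp: history_events_def)
  show ?case
  proof (cases "k \<le> m")
   case True
   \<comment> \<open>If T_m <= u then also T_k <= u, so T_k <= v may be replaced by T_k <= min u v;
     the event is then decided before s.\<close>
   have "{w \<in> paths. jump_time m w < ennreal s \<and> freeze m w \<in> a} =
    (\<Union>u\<in>U. {w \<in> paths. jump_time m w \<le> ennreal u} \<inter>
     {w \<in> paths. jump_time k w \<le> ennreal (min u v) \<and> jump_state k w = Some j})"
    (is "?L = ?R")
   proof (intro set_eqI iffI)
    fix w assume w: "w \<in> ?L"
    then obtain u where u: "u \<in> U" "jump_time m w \<le> ennreal u" using less_iff by auto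
    have "jump_time k w \<le> ennreal u" using u(2) jump_time_mono[OF True, of w] by simp
    then show "w \<in> ?R"
     using w u True by (auto simp: a jump_time_freeze jump_state_freeze min_def)
   next
    fix w assume w: "w \<in> ?R"
    then obtain u where u: "u \<in> U" "jump_time m w \<le> ennreal u" "jump_time k w \<le> ennreal (min u v)"
      "w \<in> paths" "jump_state k w = Some j" by auto
    have "jump_time k w \<le> ennreal v" using u(3) by (rule order_trans) (simp add: ennreal_leI)
    then show "w \<in> ?L"
     using u True less_iff freeze_in_paths[OF u(4), of m] by (auto simp: a jump_time_freeze jump_state_freeze)
   qed
   also have "\<dots> \<in> sets (left_algebra s :: 's path measure)"
   proof (intro sets.countable_UN'' cU sets.Int before)
    fix u assume "u \<in> U"
    then show "{w \<in> paths. jump_time k w \<le> ennreal (min u v) \<and> jump_state k w = Some j} \<in> sets (left_algebra s)"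
     unfolding sets_left_algebra using a(2) by (intro history_left_filtration) (auto simp: U_def)
   qed (auto simp: U_def)
   finally show ?thesis .
  next
   case False
   then have eq: "{w \<in> paths. jump_time m w < ennreal s \<and> freeze m w \<in> a} = {}"
    by (auto simp: a jump_state_freeze_gt)
   show ?thesis unfolding eq by simp
  qed
 next
  case (Compl a)
  have "{w \<in> paths. jump_time m w < ennreal s \<and> freeze m w \<in> paths - a} =
   {w \<in> paths. jump_time m w < ennreal s} - {w \<in> paths. jump_time m w < ennreal s \<and> freeze m w \<in> a}"
   using freeze_in_paths by auto
  then show ?case using Compl lt by auto
 next
  case (Union a)
  have "{w \<in> paths. jump_time m w < ennreal s \<and> freeze m w \<in> \<Union> (range a)} =
   (\<Union>i. {w \<in> paths. jump_time m w < ennreal s \<and> freeze m w \<in> a i})" by auto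
  then show ?case using Union by auto
 qed simp
 then show ?thesis by (simp add: sets_left_algebra)
qed

text \<open>A rational s between T_m and t turns the set into a countable union of rectangles whose
  bases lie in the left filtration at s.\<close>

lemma after_jump_predictable:
 fixes E :: "'s::countable path set"
 assumes "E \<in> sets path_algebra"
 shows "{(w, t). w \<in> paths \<and> jump_time m w < ennreal t \<and> freeze m w \<in> E}
   \<in> sets predictable"
proof -
 have "{(w, t). w \<in> paths \<and> jump_time m w < ennreal t \<and> freeze m w \<in> E} =
  (\<Union>s\<in>\<rat> \<inter> {0<..}. {w \<in> paths. jump_time m w < ennreal s \<and> freeze m w \<in> E} \<times> {s<..})" (is "?L = ?R")
 proof (intro set_eqI iffI)
  fix x assume "x \<in> ?L"
  then obtain w t where x: "x = (w, t)" "w \<in> paths" "jump_time m w < ennreal t" "freeze m w \<in> E" by auto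
  then obtain r where r: "jump_time m w = ennreal r" "0 \<le> r" by (cases "jump_time m w") auto
  then have "r < t" using x(3) by (simp add: ennreal_less_iff)
  then obtain s where "s \<in> \<rat>" "r < s" "s < t" using Rats_dense_in_real by blast
  then show "x \<in> ?R" using r x by (auto simp: ennreal_less_iff intro!: bexI[of _ s])
 next
  fix x assume "x \<in> ?R"
  then obtain w t s where x: "x = (w, t)" "0 < s" "s < t" "w \<in> paths" "jump_time m w < ennreal s" "freeze m w \<in> E"
   by auto
  then have "jump_time m w < ennreal t" using ennreal_lessI[of t s] by (auto intro: less_trans)
  then show "x \<in> ?L" using x by auto
 qed
 also have "\<dots> \<in> sets predictable"
  using freeze_left_filtration[OF assms] 
  by (intro sets.countable_UN'' countable_Int1 countable_rat natural_rectangle) auto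
 finally show ?thesis .
qed

lemma sojourn_predictable:
 fixes E :: "'s::countable path set"
 assumes "E \<in> sets path_algebra"
 shows "{(w, t). w \<in> paths \<and> sojourn m w t \<and> freeze m w \<in> E}
   \<in> sets predictable"
proof -
 have "{(w, t). w \<in> paths \<and> sojourn m w t \<and> freeze m w \<in> E} =
  {(w, t). w \<in> paths \<and> jump_time m w < ennreal t \<and> freeze m w \<in> E} -
  {(w, t). w \<in> paths \<and> jump_time (Suc m) w < ennreal t \<and> freeze (Suc m) w \<in> paths}"
  using freeze_in_paths by (auto simp: sojourn_def)
 also have "\<dots> \<in> sets predictable"
  using sets.top[of "path_algebra :: 's path measure"]
  by (intro sets.Diff after_jump_predictable assms) auto
 finally show ?thesis .
qed

lemma measurable_predictable_time:
 "snd \<in> borel_measurable ((predictable :: ('s::countable path \<times> real) measure))"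
proof (rule borel_measurableI_greater)
 let ?P = "(predictable :: ('s path \<times> real) measure)"
 have top: "paths \<in> left_filtration (natural_filtration :: real \<Rightarrow> 's path set set) s" for s
  unfolding left_filtration_def by (rule sigma_sets_top)
 have pos: "paths \<times> {s<..} \<in> sets ?P" if "0 < s" for s
  using natural_rectangle(1)[OF that top] .
 fix y :: real
 consider "y < 0" | "0 \<le> y" by linarith
 then show "{w \<in> space ?P. y < snd w} \<in> sets ?P"
 proof cases
  case 1
  then have "{w \<in> space ?P. y < snd w} = space ?P" by auto
  then show ?thesis by (metis sets.top)
 next
  case 2
  \<comment> \<open>The generating rectangles start at positive times, so y = 0 is approached from
    above.\<close>
  have "{w \<in> space ?P. y < snd w} = (\<Union>n. paths \<times> {y + 1 / real (Suc n)<..})" (is "?L = ?R")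
  proof (intro set_eqI iffI)
   fix x assume "x \<in> ?L"
   then have x: "fst x \<in> paths" "y < snd x" by auto
   then obtain n where "inverse (real (Suc n)) < snd x - y" using reals_Archimedean[of "snd x - y"] by auto
   then show "x \<in> ?R" using x by (cases x) (auto simp: field_simps inverse_eq_divide intro!: exI[of _ n])
  next
   fix x assume "x \<in> ?R"
   then obtain n where "fst x \<in> paths" "y + 1 / real (Suc n) < snd x" by (cases x) auto
   moreover from this have "y < snd x" using divide_pos_pos[of 1 "real (Suc n)"] by linarith
   ultimately show "x \<in> ?L" using 2 by (cases x) auto
  qed
  also have "\<dots> \<in> sets ?P" using 2
   by (intro sets.countable_UN) (auto intro!: pos add_nonneg_pos)
  finally show ?thesis .
 qed
qed

lemma predictable_sojourn_function:
 fixes f :: "'s::countable path \<times> real \<Rightarrow> ennreal"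
 assumes f: "f \<in> borel_measurable path_time"
 shows "(\<lambda>(w, t). if sojourn m w t then f (freeze m w, t) else 0)
   \<in> borel_measurable predictable"
proof -
 let ?P = "(predictable :: ('s path \<times> real) measure)"
 define S where "S = {(w, t). w \<in> (paths :: 's path set) \<and> sojourn m w t}"
 let ?R = "restrict_space ?P S"
 have S: "S \<in> sets ?P"
 proof -
  have eq: "S = {(w, t). w \<in> paths \<and> sojourn m w t \<and> freeze m w \<in> paths}" using freeze_in_paths by (auto simp: S_def)
  show ?thesis unfolding eq
   using sets.top[of "path_algebra :: 's path measure"] by (intro sojourn_predictable) simp
 qed
 have sub: "S \<subseteq> space ?P" using sets.sets_into_space[OF S] .
 have "(\<lambda>x. freeze m (fst x)) \<in> ?R \<rightarrow>\<^sub>M path_algebra"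
 proof (rule measurableI)
  fix x assume "x \<in> space ?R"
  then show "freeze m (fst x) \<in> space path_algebra"
   using freeze_in_paths by (auto simp: space_restrict_space S_def)
 next
  fix E :: "'s path set" assume "E \<in> sets path_algebra"
  have "(\<lambda>x. freeze m (fst x)) -` E \<inter> space ?R = {(w, t). w \<in> paths \<and> sojourn m w t \<and> freeze m w \<in> E}"
   using sub by (auto simp: space_restrict_space S_def)
  then show "(\<lambda>x. freeze m (fst x)) -` E \<inter> space ?R \<in> sets ?R"
   using S sojourn_predictable[OF \<open>E \<in> sets path_algebra\<close>, of m] Int_absorb2[OF sub] by (auto simp: sets_restrict_space_iff S_def)
 qed
 moreover have "snd \<in> borel_measurable ?R"
  using measurable_predictable_time by (rule measurable_restrict_space1)
 ultimately have "(\<lambda>x. (freeze m (fst x), snd x)) \<in> ?R \<rightarrow>\<^sub>M path_time" by simp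
 from measurable_compose[OF this f] have "(\<lambda>x. f (freeze m (fst x), snd x)) \<in> borel_measurable ?R" .
 then have "(\<lambda>x. if x \<in> S then f (freeze m (fst x), snd x) else 0) \<in> borel_measurable ?P"
  using S by (subst measurable_If_restrict_space_iff) (simp_all add: Collect_conj_eq Int_absorb1[OF sub[unfolded space_predictable]])
 then show ?thesis
  by (rule measurable_cong[THEN iffD1, rotated]) (auto simp: S_def split: if_splits)
qed

lemma measurable_state_before:
 "(\<lambda>(w, t). state_before t w) \<in>
   (predictable :: ('s::countable path \<times> real) measure) \<rightarrow>\<^sub>M count_space UNIV"
proof -
 let ?P = "(predictable :: ('s path \<times> real) measure)"
 let ?f = "\<lambda>(w, t). state_before t w :: 's option"
 have so: "{x \<in> space ?P. ?f x = Some i} \<in> sets ?P" for i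
 proof -
  have "{w \<in> paths. jump_time 0 w \<le> ennreal 0 \<and> jump_state 0 w = Some i} \<in> natural_filtration 0"
   unfolding natural_filtration_def by (rule sigma_sets.Basic) force
  then have 0: "{w \<in> paths. jump_state 0 w = Some i} \<times> {0} \<in> sets ?P"
   by (intro natural_rectangle) simp
  have E: "{w \<in> paths. jump_state m w = Some i} \<in> sets (path_algebra :: 's path measure)" for m
  proof -
   have "{w \<in> space path_algebra. jump_state m w = Some i} \<in> sets (path_algebra :: 's path measure)"
    by measurable
   then show ?thesis by simp
  qed
  \<comment> \<open>No sojourn contains time 0, so the initial state needs a rectangle of its
    own.\<close>
  have "{x \<in> space ?P. ?f x = Some i} = {w \<in> paths. jump_state 0 w = Some i} \<times> {0} \<union>
   (\<Union>m. {(w, t). w \<in> paths \<and> sojourn m w t \<and> freeze m w \<in> {w \<in> paths. jump_state m w = Some i}})"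
   (is "?L = ?R")
  proof (intro set_eqI)
   fix x :: "'s path \<times> real"
   obtain w t where x: "x = (w, t)" by fastforce
   show "x \<in> ?L \<longleftrightarrow> x \<in> ?R"
   proof (cases "w \<in> paths \<and> 0 < t")
    case True
    then show ?thesis using freeze_in_paths[of w]
     by (auto simp: x state_before_Some_iff jump_state_freeze)
   next
    case False
    then show ?thesis by (auto simp: x state_before_0 not_less dest!: sojourn_pos)
   qed
  qed
  also have "\<dots> \<in> sets ?P" by (intro sets.Un 0 sets.countable_UN image_subsetI sojourn_predictable E)
  finally show ?thesis .
 qed
 have no: "{x \<in> space ?P. ?f x = None} = space ?P - (\<Union>j. {x \<in> space ?P. ?f x = Some j})"
  by auto
 have "{x \<in> space ?P. ?f x = None} \<in> sets ?P"
  unfolding no using so by (intro sets.Diff sets.top sets.countable_UN) auto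
 with so have "{x \<in> space ?P. ?f x = y} \<in> sets ?P" for y by (cases y) auto
 then show ?thesis
  by (subst measurable_count_space_eq2_countable) (auto simp: vimage_def Int_def conj_commute)
qed

text \<open>A time integral is left-continuous in its upper end, hence a supremum of integrals up to
  rational r < t, and each of these is known just before r. This gives the predictability of the
  compensator, also for the completed filtration.\<close>

lemma measurable_predictable_integral:
 assumes G: "\<And>t. G t \<subseteq> Pow paths"
  and H: "H \<in> borel_measurable (predictable_algebra G)"
 shows "(\<lambda>(w, t). \<integral>\<^sup>+s. indicator {0<..t} s * H (w, s) \<partial>lborel) \<in> borel_measurable (predictable_algebra G)"
proof -
 let ?P = "predictable_algebra G"
 define I where "I r w = (\<integral>\<^sup>+s. indicator {0<..r} s * H (w, s) \<partial>lborel)" for r w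
 define L where "L r = sigma paths (\<Union>t\<in>{0..<r}. G t)" for r
 have spL: "space (L r) = paths" for r by (simp add: L_def space_measure_of_conv)
 have sL: "sets (L r) = left_filtration G r" for r
  unfolding L_def left_filtration_def using G by (intro sets_measure_of) blast
 have IL: "I r \<in> borel_measurable (L r)" if r: "0 < r" for r
 proof -
  \<comment> \<open>Sending times outside [0, r] to 0 makes the map measurable from the left
    filtration at r into the predictable sigma-algebra.\<close>
  let ?c = "\<lambda>(w, s). (w, if 0 \<le> s \<and> s \<le> r then s else 0)"
  have "?c \<in> L r \<Otimes>\<^sub>M borel \<rightarrow>\<^sub>M ?P"
  proof (rule measurable_into_predictable[OF G])
   fix B assume "B \<in> G 0"
   then have B: "B \<in> sets (L r)" unfolding sL left_filtration_def using r by (intro sigma_sets.Basic) auto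
   have "{x \<in> space (L r \<Otimes>\<^sub>M borel). ?c x \<in> B \<times> {0}} = B \<times> ({..0} \<union> {r<..})"
    using sets.sets_into_space[OF B] r by (auto simp: space_pair_measure split: if_splits)
   then show "{x \<in> space (L r \<Otimes>\<^sub>M borel). ?c x \<in> B \<times> {0}} \<in> sets (L r \<Otimes>\<^sub>M borel)"
    using B by simp
  next
   fix B s assume s: "0 < s" "B \<in> left_filtration G s"
   show "{x \<in> space (L r \<Otimes>\<^sub>M borel). ?c x \<in> B \<times> {s<..}} \<in> sets (L r \<Otimes>\<^sub>M borel)"
   proof (cases "s < r")
    case True
    then have B: "B \<in> sets (L r)" unfolding sL using left_filtration_mono[of s r G] s by auto
    have "{x \<in> space (L r \<Otimes>\<^sub>M borel). ?c x \<in> B \<times> {s<..}} = B \<times> {s<..r}"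
     using sets.sets_into_space[OF B] r s by (auto simp: space_pair_measure split: if_splits)
    then show ?thesis using B by simp
   next
    case False
    then have "{x \<in> space (L r \<Otimes>\<^sub>M borel). ?c x \<in> B \<times> {s<..}} = {}" using s by auto
    then show ?thesis by (simp only: sets.empty_sets)
   qed
  qed (auto simp: space_pair_measure spL)
  from measurable_compose[OF this H]
  have [measurable]: "(\<lambda>x. H (?c x)) \<in> borel_measurable (L r \<Otimes>\<^sub>M borel)" .
  have "(\<lambda>w. \<integral>\<^sup>+s. indicator {0<..r} s * H (?c (w, s)) \<partial>lborel) \<in> borel_measurable (L r)"
   by measurable
  moreover have "(\<integral>\<^sup>+s. indicator {0<..r} s * H (?c (w, s)) \<partial>lborel) = I r w" for w
   unfolding I_def by (intro nn_integral_cong) (auto split: split_indicator)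
  ultimately show ?thesis by (simp add: I_def[abs_def])
 qed
 \<comment> \<open>Zero up to time r and afterwards a function known just before r, hence
   predictable.\<close>
 define g where "g r x = (if r < snd x then I r (fst x) else 0)" for r :: real and x
 have gm: "g r \<in> borel_measurable ?P" if r: "0 < r" for r
 proof (rule measurableI)
  fix A :: "ennreal set" assume A: "A \<in> sets borel"
  have "I r -` A \<inter> paths \<in> left_filtration G r"
   using measurable_sets[OF IL[OF r] A] by (simp add: spL sL)
  from predictable_rectangle(1)[OF G r this] have 1: "(I r -` A \<inter> paths) \<times> {r<..} \<in> sets ?P" .
  have "paths \<in> left_filtration G r"
   unfolding left_filtration_def by (rule sigma_sets_top)
  from predictable_rectangle(1)[OF G r this] have 2: "space ?P - paths \<times> {r<..} \<in> sets ?P" by blast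
  have "g r -` A \<inter> space ?P = (I r -` A \<inter> paths) \<times> {r<..} \<union> (if 0 \<in> A then space ?P - paths \<times> {r<..} else {})"
   using r by (auto simp: g_def split: if_splits)
  then show "g r -` A \<inter> space ?P \<in> sets ?P" using 1 2 by auto
 qed simp
 have Imono: "I r w \<le> I t w" if "r \<le> t" for r t w
  unfolding I_def using that by (intro nn_integral_mono) (auto split: split_indicator)
 have "(\<lambda>x. SUP r\<in>\<rat> \<inter> {0<..}. g r x) \<in> borel_measurable ?P"
  using gm by (intro borel_measurable_SUP) (auto intro: countable_rat)
 moreover have "(SUP r\<in>\<rat> \<inter> {0<..}. g r x) = (\<integral>\<^sup>+s. indicator {0<..snd x} s * H (fst x, s) \<partial>lborel)"
  if x: "x \<in> space ?P" for x
 proof -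
  obtain w t where xt: "x = (w, t)" "w \<in> paths" "0 \<le> t" using x by auto
  have "(SUP r\<in>\<rat> \<inter> {0<..}. g r x) = I t w"
  proof (rule antisym)
   show "(SUP r\<in>\<rat> \<inter> {0<..}. g r x) \<le> I t w"
    using Imono by (intro SUP_least) (auto simp: g_def xt)
   have [measurable]: "(\<lambda>s. H (w, max 0 s)) \<in> borel_measurable borel"
    using measurable_compose[OF measurable_predictable_section[OF G xt(2)] H] .
   \<comment> \<open>Integrating only up to t - 1 / (n + 1) loses nothing but the null set {t} in
     the limit, and leaves room for a rational below t.\<close>
   have "I t w = (\<integral>\<^sup>+s. (SUP n. indicator {0<..t - 1 / Suc n} s * H (w, max 0 s)) \<partial>lborel)"
    unfolding I_def
   proof (rule nn_integral_cong_AE)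
    have "AE s in lborel. s \<noteq> t" by (rule AE_lborel_singleton)
    then show "AE s in lborel. indicator {0<..t} s * H (w, s) =
     (SUP n. indicator {0<..t - 1 / Suc n} s * H (w, max 0 s))"
    proof eventually_elim
     case (elim s)
     show ?case
     proof (cases "0 < s \<and> s < t")
      case True
      then obtain n where "inverse (real (Suc n)) < t - s" using reals_Archimedean[of "t - s"] by auto
      then have "s \<in> {0<..t - 1 / Suc n}" using True by (auto simp: inverse_eq_divide)
      then have "H (w, s) \<le> (SUP n. indicator {0<..t - 1 / Suc n} s * H (w, max 0 s))"
       using True by (intro SUP_upper2[of n]) auto
      moreover have "(SUP n. indicator {0<..t - 1 / Suc n} s * H (w, max 0 s)) \<le> H (w, s)"
       using True by (intro SUP_least) (auto split: split_indicator)
      ultimately show ?thesis using True by (auto intro: antisym)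
     next
      case False
      then have "indicator {0<..t - 1 / Suc n} s = (0::ennreal)" for n
       using elim by (auto split: split_indicator simp: not_less) (smt (verit) divide_nonneg_nonneg of_nat_0_le_iff)
      then show ?thesis using False elim by (auto split: split_indicator)
     qed
    qed
   qed
   also have "\<dots> = (SUP n. \<integral>\<^sup>+s. indicator {0<..t - 1 / Suc n} s * H (w, max 0 s) \<partial>lborel)"
   proof (intro nn_integral_monotone_convergence_SUP incseq_SucI le_funI)
    fix n s
    have "1 / real (Suc (Suc n)) \<le> 1 / real (Suc n)" by (simp add: frac_le)
    then show "indicator {0<..t - 1 / Suc n} s * H (w, max 0 s) \<le> indicator {0<..t - 1 / Suc (Suc n)} s * H (w, max 0 s)"
     by (auto split: split_indicator)
   qed measurable
   also have "\<dots> = (SUP n. I (t - 1 / Suc n) w)"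
    unfolding I_def by (intro SUP_cong refl nn_integral_cong) (auto split: split_indicator)
   also have "\<dots> \<le> (SUP r\<in>\<rat> \<inter> {0<..}. g r x)"
   proof (rule SUP_least)
    fix n
    show "I (t - 1 / Suc n) w \<le> (SUP r\<in>\<rat> \<inter> {0<..}. g r x)"
    proof (cases "t > 0")
     case True
     then have "max 0 (t - 1 / Suc n) < t" by simp
     then obtain r where r: "r \<in> \<rat>" "max 0 (t - 1 / Suc n) < r" "r < t" using Rats_dense_in_real by blast
     have "I (t - 1 / Suc n) w \<le> g r x" using r by (auto simp: g_def xt intro: Imono)
     with r show ?thesis by (intro SUP_upper2[of r]) auto
    next
     case False
     then have "indicator {0<..t - 1 / Suc n} s = (0::ennreal)" for s
      by (auto split: split_indicator simp: not_less) (smt (verit) divide_nonneg_nonneg of_nat_0_le_iff)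
     then have "I (t - 1 / Suc n) w = 0"
      unfolding I_def by simp
     then show ?thesis by simp
    qed
   qed
   finally show "I t w \<le> (SUP r\<in>\<rat> \<inter> {0<..}. g r x)" .
  qed
  then show ?thesis by (simp add: xt I_def)
 qed
 ultimately show ?thesis
  by (subst measurable_cong[where g="\<lambda>x. SUP r\<in>\<rat> \<inter> {0<..}. g r x"]) auto
qed

section \<open>Completion of the filtration\<close>

text \<open>Agreement off a set of the family \<N> survives complements, and countable unions
  because \<N> is closed under them. It is applied in turn to the filtration, to the left filtration
  and to the predictable sets.\<close>

lemma sigma_sets_modulo:
 assumes N: "\<And>N :: nat \<Rightarrow> 'a set. range N \<subseteq> \<N> \<Longrightarrow> (\<Union>i. N i) \<in> \<N>" "{} \<in> \<N>"
  and gen: "\<And>a. a \<in> A \<Longrightarrow> \<exists>b\<in>sigma_sets \<Omega> A'. \<exists>N\<in>\<N>. a - N = b - N"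
  and a: "a \<in> sigma_sets \<Omega> A"
 shows "\<exists>b\<in>sigma_sets \<Omega> A'. \<exists>N\<in>\<N>. a - N = b - N"
 using a
proof induction
 case (Basic a)
 then show ?case by (rule gen)
next
 case Empty
 then show ?case using N(2) sigma_sets.Empty by blast
next
 case (Compl a)
 then obtain b N where "b \<in> sigma_sets \<Omega> A'" "N \<in> \<N>" "a - N = b - N" by blast
 moreover from this have "(\<Omega> - a) - N = (\<Omega> - b) - N" by blast
 ultimately show ?case using sigma_sets.Compl by metis
next
 case (Union a)
 then obtain b N' where b: "\<And>i. b i \<in> sigma_sets \<Omega> A'" "\<And>i. N' i \<in> \<N>" "\<And>i. a i - N' i = b i - N' i" by metis
 have "x \<in> a i \<longleftrightarrow> x \<in> b i" if "x \<notin> N' i" for x i using b(3)[of i] that by blast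
 then have "(\<Union>i. a i) - (\<Union>i. N' i) = (\<Union>i. b i) - (\<Union>i. N' i)" by auto
 moreover have "(\<Union>i. N' i) \<in> \<N>" using b(2) by (intro N(1)) auto
 moreover have "(\<Union>i. b i) \<in> sigma_sets \<Omega> A'" using b(1) by (rule sigma_sets.Union)
 ultimately show ?case by blast
qed

lemma completed_filtration_subset:
 assumes "sets P = sets path_algebra" shows "completed_filtration P t \<subseteq> Pow paths"
proof -
 have "natural_filtration t \<union> null_sets (completion P) \<subseteq> Pow paths"
  using natural_filtration_subset[of t] sets.sets_into_space[of _ "completion P"] sets_eq_imp_space_eq[OF assms]
  by (fastforce simp: null_sets_def)
 from sigma_sets_into_sp[OF this] show ?thesis unfolding completed_filtration_def by blast
qed

lemma predictable_natural_subset_completed: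
 assumes P: "sets P = sets path_algebra"
 shows "sets predictable \<subseteq> sets (predictable_algebra (completed_filtration P))"
proof -
 have sub: "natural_filtration t \<subseteq> completed_filtration P t" for t
  unfolding completed_filtration_def by auto
 have "left_filtration natural_filtration s \<subseteq> left_filtration (completed_filtration P) s" for s
  unfolding left_filtration_def using sub by (intro sigma_sets_mono') blast
 then show ?thesis
  unfolding sets_predictable[OF natural_filtration_subset] sets_predictable[OF completed_filtration_subset[OF P]]
  using sub unfolding predictable_rectangles_def by (intro sigma_sets_mono') blast
qed

lemma measurable_predictable_completed:
 assumes P: "sets P = sets path_algebra"
  and H: "H \<in> predictable \<rightarrow>\<^sub>M N"
 shows "H \<in> predictable_algebra (completed_filtration P) \<rightarrow>\<^sub>M N"
 using H predictable_natural_subset_completed[OF P] unfolding measurable_def by auto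

text \<open>Reduces test functions on the completed basis to the natural one, where freezing is
  available. The exceptional set consists of whole paths: off it the two functions agree at all
  times simultaneously.\<close>

lemma predictable_completed_modulo_null:
 fixes P :: "'s::countable path measure"
 assumes P: "sets P = sets path_algebra"
  and H: "H \<in> borel_measurable (predictable_algebra (completed_filtration P))"
 shows "\<exists>H'\<in>borel_measurable predictable. \<exists>N\<in>null_sets (completion P).
  \<forall>w\<in>paths - N. \<forall>t\<ge>0. H (w, t) = (H' (w, t) :: ennreal)"
proof -
 let ?N = "null_sets (completion P)"
 have N: "range M \<subseteq> ?N \<Longrightarrow> (\<Union>i. M i) \<in> ?N" for M :: "nat \<Rightarrow> _" by (intro null_sets_UN) auto
 have comp: "\<exists>b\<in>natural_filtration t. \<exists>N\<in>?N. a - N = b - N" if "a \<in> completed_filtration P t" for a t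
 proof -
  have "\<exists>b\<in>sigma_sets paths (natural_filtration t). \<exists>N\<in>?N. a - N = b - N"
   using that unfolding completed_filtration_def
  proof (rule sigma_sets_modulo[rotated 3])
   fix a assume "a \<in> natural_filtration t \<union> ?N"
   then show "\<exists>b\<in>sigma_sets paths (natural_filtration t). \<exists>N\<in>?N. a - N = b - N"
   proof
    assume "a \<in> ?N"
    then show ?thesis by (intro bexI[of _ "{}"] bexI[of _ a] sigma_sets.Empty) auto
   next
    assume "a \<in> natural_filtration t"
    then show ?thesis by (intro bexI[of _ a] bexI[of _ "{}"] sigma_sets.Basic) auto
   qed
  qed (use N in auto)
  then show ?thesis unfolding sigma_sets_natural_filtration .
 qed
 have left: "\<exists>b\<in>left_filtration natural_filtration t. \<exists>N\<in>?N. a - N = b - N" if "a \<in> left_filtration (completed_filtration P) t" for a t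
  using that unfolding left_filtration_def
 proof (rule sigma_sets_modulo[rotated 3])
  fix a assume "a \<in> (\<Union>s\<in>{0..<t}. completed_filtration P s)"
  then obtain s where "s \<in> {0..<t}" "a \<in> completed_filtration P s" by auto
  then show "\<exists>b\<in>sigma_sets paths (\<Union> (natural_filtration ` {0..<t})). \<exists>N\<in>?N. a - N = b - N"
   using comp[of a s] by (meson UN_I sigma_sets.Basic)
 qed (use N in auto)
 \<comment> \<open>Exceptional sets of the form N x UNIV, so that the null set of paths does not
   depend on time.\<close>
 let ?M = "(\<lambda>N. N \<times> UNIV) ` ?N"
 have pred: "\<exists>b\<in>sets predictable. \<exists>N\<in>?M. a - N = b - N"
  if "a \<in> sets (predictable_algebra (completed_filtration P))" for a
  using that unfolding sets_predictable[OF natural_filtration_subset] sets_predictable[OF completed_filtration_subset[OF P]]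
 proof (rule sigma_sets_modulo[rotated 3])
  fix K :: "nat \<Rightarrow> ('s path \<times> real) set" assume "range K \<subseteq> ?M"
  then have "\<forall>i. \<exists>M\<in>?N. K i = M \<times> UNIV" by blast
  then obtain M where "\<And>i. M i \<in> ?N" "\<And>i. K i = M i \<times> UNIV" by metis
  then show "(\<Union>i. K i) \<in> ?M" using N[of M] by (intro image_eqI[of _ _ "\<Union>i. M i"]) auto
 next
  fix a assume "a \<in> predictable_rectangles (completed_filtration P)"
  then consider B where "a = B \<times> {0}" "B \<in> completed_filtration P 0"
   | B s where "a = B \<times> {s<..}" "0 < s" "B \<in> left_filtration (completed_filtration P) s"
   by (auto simp: predictable_rectangles_def)
  then show "\<exists>b\<in>sigma_sets (paths \<times> {0..}) (predictable_rectangles natural_filtration). \<exists>N\<in>?M. a - N = b - N"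
  proof cases
   case (1 B)
   with comp obtain B' N' where "B' \<in> natural_filtration 0" "N' \<in> ?N" "B - N' = B' - N'" by blast
   then have eq: "B \<times> {0} - N' \<times> UNIV = B' \<times> {0} - N' \<times> UNIV" and N': "N' \<times> UNIV \<in> ?M"
    and g: "B' \<times> {0} \<in> predictable_rectangles natural_filtration"
    unfolding predictable_rectangles_def by blast+
   show ?thesis unfolding 1(1) by (rule bexI[rotated, OF sigma_sets.Basic[OF g]]) (rule bexI[rotated, OF N'], rule eq)
  next
   case (2 B s)
   with left obtain B' N' where "B' \<in> left_filtration natural_filtration s" "N' \<in> ?N" "B - N' = B' - N'" by blast
   then have eq: "B \<times> {s<..} - N' \<times> UNIV = B' \<times> {s<..} - N' \<times> UNIV" and N': "N' \<times> UNIV \<in> ?M"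
    and g: "B' \<times> {s<..} \<in> predictable_rectangles natural_filtration"
    using 2(2) unfolding predictable_rectangles_def by blast+
   show ?thesis unfolding 2(1) by (rule bexI[rotated, OF sigma_sets.Basic[OF g]]) (rule bexI[rotated, OF N'], rule eq)
  qed
 qed (auto intro!: image_eqI[of _ _ "{}"])
 show ?thesis using H
 proof (induction rule: borel_measurable_induct)
  case (cong f g)
  then show ?case by (metis Diff_iff SigmaI atLeast_iff space_predictable)
 next
  case (set A)
  then obtain b N' where "b \<in> sets predictable" "N' \<in> ?N" "A - N' \<times> UNIV = b - N' \<times> UNIV"
   using pred by blast
  then show ?case
   by (intro bexI[of _ "indicator b"] bexI[of _ N'] ballI allI impI) (simp_all add: indicator_def, blast)
 next
  case (mult u c)
  then obtain u' M where "u' \<in> borel_measurable predictable" "M \<in> ?N"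
   "\<forall>w\<in>paths - M. \<forall>t\<ge>0. u (w, t) = u' (w, t)" by blast
  then show ?case by (intro bexI[of _ "\<lambda>x. c * u' x"] bexI[of _ M]) auto
 next
  case (add u v)
  then obtain u' M v' M' where "u' \<in> borel_measurable predictable" "M \<in> ?N"
   "\<forall>w\<in>paths - M. \<forall>t\<ge>0. u (w, t) = u' (w, t)"
   "v' \<in> borel_measurable predictable" "M' \<in> ?N"
   "\<forall>w\<in>paths - M'. \<forall>t\<ge>0. v (w, t) = v' (w, t)" by blast
  then show ?case
   by (intro bexI[of _ "\<lambda>x. v' x + u' x"] bexI[of _ "M \<union> M'"]) auto
 next
  case (seq U)
  then obtain U' M where U: "\<And>i. U' i \<in> borel_measurable predictable" "\<And>i. M i \<in> ?N"
   "\<And>i. \<forall>w\<in>paths - M i. \<forall>t\<ge>0. U i (w, t) = U' i (w, t)" by metis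
  have "(\<lambda>x. SUP i. U' i x) \<in> borel_measurable predictable"
   using U(1) by (intro borel_measurable_SUP) auto
  moreover have "(\<Union>i. M i) \<in> ?N" using U(2) N[of M] by auto
  ultimately show ?case
   using U(3) by (intro bexI[of _ "\<lambda>x. SUP i. U' i x"] bexI[of _ "\<Union>i. M i"]) (auto simp: image_comp)
 qed
qed

section \<open>Actions with an added point, and integrals over countably many marks\<close>

lemma sets_action_algebra: "sets action_algebra = {B. Some -` B \<in> sets (borel :: 'a::polish_space measure)}"
proof -
 have "sigma_algebra UNIV {B. Some -` B \<in> sets (borel :: 'a measure)}"
  unfolding sigma_algebra_iff2
  by (auto simp: vimage_UN vimage_Diff intro!: sets.countable_UN sets.Diff)
 then show ?thesis
  unfolding action_algebra_def using sigma_algebra.sets_measure_of_eq by blast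
qed

lemma space_action_algebra [simp]: "space action_algebra = UNIV"
 by (simp add: action_algebra_def space_measure_of_conv)

lemma measurable_from_action_algebra:
 "f \<in> action_algebra \<rightarrow>\<^sub>M N \<longleftrightarrow> (\<lambda>a. f (Some a)) \<in> (borel :: 'a::polish_space measure) \<rightarrow>\<^sub>M N \<and> f None \<in> space N"
proof -
 have "(\<forall>x. f x \<in> space N) \<longleftrightarrow> (\<forall>a. f (Some a) \<in> space N) \<and> f None \<in> space N"
  by (metis not_None_eq)
 then show ?thesis
  by (auto simp: measurable_def sets_action_algebra vimage_def Pi_iff)
qed

lemma measurable_Some_action [measurable]: "Some \<in> (borel :: 'a::polish_space measure) \<rightarrow>\<^sub>M action_algebra"
 by (auto simp: measurable_def sets_action_algebra)

lemma measurable_the_action [measurable]: "the \<in> action_algebra \<rightarrow>\<^sub>M (borel :: 'a::polish_space measure)"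
 by (simp add: measurable_from_action_algebra)

lemma Some_image_action: "B \<in> sets (borel :: 'a::polish_space measure) \<Longrightarrow> Some ` B \<in> sets action_algebra"
 by (simp add: sets_action_algebra inj_vimage_image_eq)

lemma measurable_from_pair_count:
 assumes "\<And>j::'j::countable. (\<lambda>x. f (x, j)) \<in> M \<rightarrow>\<^sub>M N"
 shows "f \<in> M \<Otimes>\<^sub>M count_space UNIV \<rightarrow>\<^sub>M N"
proof -
 have "(\<lambda>p. (\<lambda>j p. f (fst p, j)) (snd p) p) \<in> M \<Otimes>\<^sub>M count_space (UNIV :: 'j set) \<rightarrow>\<^sub>M N"
  by (rule measurable_compose_countable[OF measurable_compose[OF measurable_fst assms] measurable_snd])
 then show ?thesis by simp
qed

lemma measurable_to_pair_count:
 "f \<in> M \<Otimes>\<^sub>M count_space UNIV \<rightarrow>\<^sub>M N \<Longrightarrow> (\<lambda>x. f (x, j)) \<in> M \<rightarrow>\<^sub>M N"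
 by (rule measurable_compose[of "\<lambda>x. (x, j)"]) auto

interpretation C: sigma_finite_measure "count_space (UNIV :: 'c::countable set)"
 by (rule sigma_finite_measure_count_space)

lemma measurable_csum [measurable]:
 "(\<And>j::'c::countable. F j \<in> borel_measurable M) \<Longrightarrow> (\<lambda>x. csum (\<lambda>j. F j x)) \<in> borel_measurable M"
 by (intro C.borel_measurable_nn_integral measurable_from_pair_count) simp

lemma space_mark_measure: "space mark_measure = {0<..} \<times> UNIV"
 by (simp add: mark_measure_def space_pair_measure space_restrict_space)

lemma suminf_single_ennreal: "(\<Sum>k. if k = m then f k else (0::ennreal)) = f m"
 using suminf_finite[of "{m}" "\<lambda>k. if k = m then f k else 0"] by simp

lemma nn_integral_count_jumps:
 fixes f :: "real \<times> 's::countable \<Rightarrow> ennreal"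
 assumes w: "w \<in> paths" and f: "f \<in> borel_measurable mark_measure"
 shows "(\<integral>\<^sup>+x. f x \<partial>jump_measure w) =
  (\<Sum>m. if jump_time (Suc m) w < \<infinity> then f (enn2real (jump_time (Suc m) w), the (jump_state (Suc m) w)) else 0)"
proof -
 let ?g = "\<lambda>m. (enn2real (jump_time m w), the (jump_state m w))"
 let ?A = "{m. 1 \<le> m \<and> jump_time m w < \<infinity>}" and ?B = "{m. jump_time (Suc m) w < \<infinity>}"
 have "0 < enn2real (jump_time m w)" if "m \<in> ?A" for m
  using that jump_time_Suc_pos[OF w, of "m - 1"] by (simp add: enn2real_positive_iff)
 then have "?g \<in> count_space ?A \<rightarrow>\<^sub>M mark_measure"
  by (auto simp: measurable_count_space_eq1 space_mark_measure)
 then have "(\<integral>\<^sup>+x. f x \<partial>jump_measure w) = (\<integral>\<^sup>+m. f (?g m) \<partial>count_space ?A)"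
  unfolding jump_measure_def by (subst nn_integral_distr) (simp_all add: f)
 also have "\<dots> = (\<integral>\<^sup>+m. f (?g (Suc m)) \<partial>count_space ?B)"
 proof (rule nn_integral_bij_count_space[symmetric])
  show "bij_betw Suc ?B ?A"
   unfolding bij_betw_def by (auto simp: image_iff) (metis Suc_le_D)
 qed
 also have "\<dots> = csum (\<lambda>m. f (?g (Suc m)) * indicator ?B m)"
  by (subst nn_integral_restrict_space[symmetric]) (simp_all add: restrict_count_space)
 also have "\<dots> = (\<Sum>m. f (?g (Suc m)) * indicator ?B m)"
  by (rule nn_integral_count_space_nat)
 also have "\<dots> = (\<Sum>m. if jump_time (Suc m) w < \<infinity> then f (?g (Suc m)) else 0)"
  by (intro suminf_cong) (auto split: split_indicator)
 finally show ?thesis .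
qed

lemma nn_integral_density_mark:
 fixes f g :: "real \<times> 's::countable \<Rightarrow> ennreal"
 assumes [measurable]: "f \<in> borel_measurable mark_measure" "g \<in> borel_measurable mark_measure"
 shows "(\<integral>\<^sup>+x. f x \<partial>density mark_measure g) =
  (\<integral>\<^sup>+t. (if 0 < t then csum (\<lambda>j. g (t, j) * f (t, j)) else 0) \<partial>lborel)"
proof -
 have "(\<integral>\<^sup>+x. f x \<partial>density mark_measure g) = (\<integral>\<^sup>+x. g x * f x \<partial>mark_measure)"
  by (intro nn_integral_density) auto
 also have "\<dots> = (\<integral>\<^sup>+t. csum (\<lambda>j. g (t, j) * f (t, j)) \<partial>restrict_space lborel {0<..})"
  unfolding mark_measure_def using assms[unfolded mark_measure_def] by (subst C.nn_integral_fst) auto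
 also have "\<dots> = (\<integral>\<^sup>+t. csum (\<lambda>j. g (t, j) * f (t, j)) * indicator {0<..} t \<partial>lborel)"
  by (subst nn_integral_restrict_space) auto
 also have "\<dots> = (\<integral>\<^sup>+t. (if 0 < t then csum (\<lambda>j. g (t, j) * f (t, j)) else 0) \<partial>lborel)"
  by (intro nn_integral_cong) (auto split: split_indicator)
 finally show ?thesis .
qed

lemma measurable_the_jump_state [measurable]: "(\<lambda>w. the (jump_state m w)) \<in> path_algebra \<rightarrow>\<^sub>M count_space UNIV"
 by (rule measurable_compose[OF measurable_jump_state]) simp

lemma measurable_sojourn_time [measurable]: "Measurable.pred borel (sojourn m w)"
 unfolding sojourn_def[abs_def] by measurable

text \<open>The sojourns partition the times from 0 to the explosion; after it the state is the
  cemetery and the integrand vanishes.\<close>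

lemma nn_integral_split_sojourn:
 assumes w: "w \<in> paths" and [measurable]: "h \<in> borel_measurable borel"
  and dead: "\<And>t. 0 < t \<Longrightarrow> state_before t w = None \<Longrightarrow> h t = 0" and neg: "\<And>t. t \<le> 0 \<Longrightarrow> h t = 0"
 shows "(\<integral>\<^sup>+t. h t \<partial>lborel) = (\<Sum>m. \<integral>\<^sup>+t. (if sojourn m w t then h t else 0) \<partial>lborel)"
proof -
 have "h t = (\<Sum>m. if sojourn m w t then h t else 0)" for t
 proof (cases "\<exists>m. sojourn m w t")
  case True
  then obtain m where m: "sojourn m w t" by blast
  have "sojourn k w t \<longleftrightarrow> k = m" for k using m sojourn_unique by blast
  then show ?thesis using suminf_single_ennreal[of m "\<lambda>_. h t"] by simp
 next
  case False
  then have "h t = 0"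
   using neg[of t] dead[of t] state_before_Some_iff[OF w, of t] by (cases "0 < t"; cases "state_before t w") auto
  then show ?thesis by (simp cong: if_cong)
 qed
 then have "(\<integral>\<^sup>+t. h t \<partial>lborel) = (\<integral>\<^sup>+t. (\<Sum>m. if sojourn m w t then h t else 0) \<partial>lborel)"
  by (intro nn_integral_cong) blast
 also have "\<dots> = (\<Sum>m. \<integral>\<^sup>+t. (if sojourn m w t then h t else 0) \<partial>lborel)"
  by (intro nn_integral_suminf) measurable
 finally show ?thesis .
qed

lemma measurable_mark_section:
 fixes H :: "'s path \<times> real \<Rightarrow> ennreal"
 assumes G: "\<And>t. G t \<subseteq> Pow paths" and w: "w \<in> paths"
  and H: "H \<in> borel_measurable (predictable_algebra G)"
 shows "(\<lambda>t. if 0 < t then H (w, t) else 0) \<in> borel_measurable borel"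
  and "(\<lambda>t. H (w, t)) \<in> borel_measurable (restrict_space lborel {0<..})"
proof -
 have [measurable]: "(\<lambda>t. H (w, max 0 t)) \<in> borel_measurable borel"
  using measurable_compose[OF measurable_predictable_section[OF G w] H] .
 have "(\<lambda>t. if 0 < t then H (w, max 0 t) else 0) \<in> borel_measurable borel" by measurable
 also have "(\<lambda>t. if 0 < t then H (w, max 0 t) else 0) = (\<lambda>t. if 0 < t then H (w, t) else 0)"
  by (auto simp: fun_eq_iff)
 finally show "(\<lambda>t. if 0 < t then H (w, t) else 0) \<in> borel_measurable borel" .
 have "(\<lambda>t. H (w, max 0 t)) \<in> borel_measurable (restrict_space lborel {0<..})"
  by (rule measurable_restrict_space1) simp
 then show "(\<lambda>t. H (w, t)) \<in> borel_measurable (restrict_space lborel {0<..})"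
  by (rule measurable_cong[THEN iffD1, rotated]) (simp add: space_restrict_space)
qed

text \<open>The compensator identity tested with predictable functions living on the sojourn number \<open>m\<close>; such a function
 depends on the path only through \<open>freeze m w\<close>.\<close>
definition jump_identity :: "'s::countable path measure \<Rightarrow> ('s path \<Rightarrow> real \<Rightarrow> 's \<Rightarrow> ennreal) \<Rightarrow> bool" where
 "jump_identity P r \<longleftrightarrow> (\<forall>m W. marked W \<longrightarrow>
   (\<integral>\<^sup>+w. next_jump W m w \<partial>P) =
   (\<integral>\<^sup>+w. \<integral>\<^sup>+t. (if sojourn m w t then csum (\<lambda>j. r (freeze m w) t j * W (freeze m w) t j) else 0) \<partial>lborel \<partial>P))"

text \<open>A test function living on sojourn m sees exactly one jump, the one that ends this
  sojourn.\<close>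

lemma sojourn_at_jump:
 assumes w: "w \<in> paths" and fin: "jump_time (Suc m) w < \<infinity>"
 shows "sojourn k w (enn2real (jump_time (Suc m) w)) \<longleftrightarrow> k = m"
proof -
 have "jump_time m w < jump_time (Suc m) w"
  using fin jump_time_mono[of m "Suc m" w] by (intro jump_time_less_Suc w) (auto intro: le_less_trans)
 then have "sojourn m w (enn2real (jump_time (Suc m) w))"
  using fin by (simp add: sojourn_def less_top)
 then show ?thesis using sojourn_unique by blast
qed

lemma jump_identity_measurable1:
 fixes W :: "'s::countable path \<Rightarrow> real \<Rightarrow> 's \<Rightarrow> ennreal"
 assumes W: "marked W"
 shows "(\<lambda>w. next_jump W m w) \<in> borel_measurable path_algebra"
proof -
 have "(\<lambda>w. ((freeze m w, enn2real (jump_time (Suc m) w)), the (jump_state (Suc m) w)))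
   \<in> path_algebra \<rightarrow>\<^sub>M (path_time \<Otimes>\<^sub>M count_space UNIV)"
  by measurable
 from measurable_compose[OF this W]
 have [measurable]: "(\<lambda>w. W (freeze m w) (enn2real (jump_time (Suc m) w)) (the (jump_state (Suc m) w))) \<in> borel_measurable path_algebra"
  by simp
 show ?thesis by measurable
qed

lemma jump_identity_measurable2:
 fixes W r :: "'s::countable path \<Rightarrow> real \<Rightarrow> 's \<Rightarrow> ennreal"
 assumes W: "marked W"
  and r: "marked r"
 shows "(\<lambda>(w, t). if sojourn m w t then csum (\<lambda>j. r (freeze m w) t j * W (freeze m w) t j) else 0)
   \<in> borel_measurable path_time" (is "?f \<in> _")
  and "(\<lambda>w. \<integral>\<^sup>+t. (if sojourn m w t then csum (\<lambda>j. r (freeze m w) t j * W (freeze m w) t j) else 0) \<partial>lborel)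
   \<in> borel_measurable path_algebra"
proof -
 have "(\<lambda>p. ((freeze m (fst (fst p)), snd (fst p)), snd p)) \<in> path_time \<Otimes>\<^sub>M count_space (UNIV :: 's set) \<rightarrow>\<^sub>M ((path_algebra \<Otimes>\<^sub>M (borel :: real measure)) \<Otimes>\<^sub>M count_space UNIV)"
  by measurable
 from measurable_compose[OF this W] measurable_compose[OF this r]
 have [measurable]: "(\<lambda>p. W (freeze m (fst (fst p))) (snd (fst p)) (snd p)) \<in> borel_measurable (path_time \<Otimes>\<^sub>M count_space UNIV)"
  "(\<lambda>p. r (freeze m (fst (fst p))) (snd (fst p)) (snd p)) \<in> borel_measurable (path_time \<Otimes>\<^sub>M count_space UNIV)"
  by (simp_all add: case_prod_beta')
 have [measurable]: "(\<lambda>p. csum (\<lambda>j. r (freeze m (fst p)) (snd p) j * W (freeze m (fst p)) (snd p) j))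
   \<in> borel_measurable path_time"
  by (intro C.borel_measurable_nn_integral) (simp add: case_prod_beta')
 have "?f = (\<lambda>p. if (case p of (w, t) \<Rightarrow> sojourn m w t) then csum (\<lambda>j. r (freeze m (fst p)) (snd p) j * W (freeze m (fst p)) (snd p) j) else 0)"
  by (auto simp: fun_eq_iff)
 also have "\<dots> \<in> borel_measurable path_time" by measurable
 finally show f: "?f \<in> borel_measurable path_time" .
 then have "?f \<in> borel_measurable (path_algebra \<Otimes>\<^sub>M lborel)" by simp
 then show "(\<lambda>w. \<integral>\<^sup>+t. (if sojourn m w t then csum (\<lambda>j. r (freeze m w) t j * W (freeze m w) t j) else 0) \<partial>lborel)
   \<in> borel_measurable path_algebra"
  by (rule lborel.borel_measurable_nn_integral)
qed

section \<open>The compensator identity, sojourn by sojourn\<close>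

context
 fixes \<rho> :: "'s::countable path \<Rightarrow> real \<Rightarrow> 's \<Rightarrow> ennreal"
 assumes \<rho>_measurable: "\<And>j. (\<lambda>(w, t). \<rho> w t j) \<in> borel_measurable predictable"
  and \<rho>_dead: "\<And>w t j. state_before t w = None \<Longrightarrow> \<rho> w t j = 0"
begin

abbreviation compensator :: "'s path \<Rightarrow> (real \<times> 's) measure" where
 "compensator w \<equiv> density mark_measure (\<lambda>(t, j). \<rho> w t j)"

lemma \<rho>_section:
 assumes "w \<in> paths"
 shows "(\<lambda>t. \<rho> w t j) \<in> borel_measurable (restrict_space lborel {0<..})"
  and "(\<lambda>t. if 0 < t then \<rho> w t j else 0) \<in> borel_measurable borel"
 using measurable_mark_section[OF natural_filtration_subset assms \<rho>_measurable[of j]] by auto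

lemma \<rho>_freeze:
 assumes "w \<in> paths" "sojourn m w t" shows "\<rho> (freeze m w) t j = \<rho> w t j"
 using predictable_freeze[OF \<rho>_measurable[of j] assms] by simp

lemma compensator_integral:
 fixes W :: "real \<Rightarrow> 's \<Rightarrow> ennreal"
 assumes w: "w \<in> paths" and W: "\<And>j. (\<lambda>t. W t j) \<in> borel_measurable (restrict_space lborel {0<..})"
 shows "(\<integral>\<^sup>+(t, j). W t j \<partial>compensator w) =
   (\<integral>\<^sup>+t. (if 0 < t then csum (\<lambda>j. \<rho> w t j * W t j) else 0) \<partial>lborel)"
  and "(\<integral>\<^sup>+(t, j). W t j \<partial>compensator w) =
   (\<Sum>m. \<integral>\<^sup>+t. (if sojourn m w t then csum (\<lambda>j. \<rho> w t j * W t j) else 0) \<partial>lborel)"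
proof -
 let ?h = "\<lambda>t. if 0 < t then csum (\<lambda>j. \<rho> w t j * W t j) else 0"
 have 1: "(\<lambda>(t, j). W t j) \<in> borel_measurable mark_measure"
  unfolding mark_measure_def using W by (intro measurable_from_pair_count) simp
 have 2: "(\<lambda>(t, j). \<rho> w t j) \<in> borel_measurable mark_measure"
  unfolding mark_measure_def using \<rho>_section[OF w] by (intro measurable_from_pair_count) simp
 show eq: "(\<integral>\<^sup>+(t, j). W t j \<partial>compensator w) = (\<integral>\<^sup>+t. ?h t \<partial>lborel)"
  using nn_integral_density_mark[OF 1 2] unfolding prod.case .
 have "(\<lambda>t. csum (\<lambda>j. \<rho> w t j * W t j)) \<in> borel_measurable (restrict_space lborel {0<..})"
  using W \<rho>_section(1)[OF w]
  by (intro C.borel_measurable_nn_integral measurable_from_pair_count) auto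
 then have "(\<lambda>t. if t \<in> {0<..} then csum (\<lambda>j. \<rho> w t j * W t j) else 0) \<in> borel_measurable lborel"
  by (subst measurable_If_restrict_space_iff) (auto simp: greaterThan_def)
 then have [measurable]: "?h \<in> borel_measurable borel" by simp
 have "(\<integral>\<^sup>+t. ?h t \<partial>lborel) = (\<Sum>m. \<integral>\<^sup>+t. (if sojourn m w t then ?h t else 0) \<partial>lborel)"
  by (rule nn_integral_split_sojourn[OF w]) (auto simp: \<rho>_dead)
 also have "\<dots> = (\<Sum>m. \<integral>\<^sup>+t. (if sojourn m w t then csum (\<lambda>j. \<rho> w t j * W t j) else 0) \<partial>lborel)"
  by (intro suminf_cong nn_integral_cong) (auto dest: sojourn_pos)
 finally show "(\<integral>\<^sup>+(t, j). W t j \<partial>compensator w) =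
   (\<Sum>m. \<integral>\<^sup>+t. (if sojourn m w t then csum (\<lambda>j. \<rho> w t j * W t j) else 0) \<partial>lborel)"
  using eq by simp
qed

lemma jump_integral:
 fixes W :: "real \<Rightarrow> 's \<Rightarrow> ennreal"
 assumes w: "w \<in> paths" and W: "\<And>j. (\<lambda>t. W t j) \<in> borel_measurable (restrict_space lborel {0<..})"
 shows "(\<integral>\<^sup>+(t, j). W t j \<partial>jump_measure w) =
   (\<Sum>m. if jump_time (Suc m) w < \<infinity> then W (enn2real (jump_time (Suc m) w)) (the (jump_state (Suc m) w)) else 0)"
proof -
 have "(\<lambda>(t, j). W t j) \<in> borel_measurable mark_measure"
  unfolding mark_measure_def using W by (intro measurable_from_pair_count) simp
 from nn_integral_count_jumps[OF w this] show ?thesis unfolding prod.case .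
qed

text \<open>Only positive times enter the identities; the value 0 elsewhere makes the rate jointly
  measurable in real time.\<close>

definition \<rho>_pos :: "'s path \<Rightarrow> real \<Rightarrow> 's \<Rightarrow> ennreal" where
 "\<rho>_pos w t j = (if 0 < t then \<rho> w t j else 0)"

lemma \<rho>_pos_measurable:
 "marked \<rho>_pos"
proof (rule measurable_from_pair_count)
 fix j
 have "(\<lambda>x. (\<lambda>(w, t). \<rho> w t j) ((\<lambda>(w, t). (w, max 0 t)) x)) \<in> borel_measurable path_time"
  by (rule measurable_compose[OF measurable_predictable_joint \<rho>_measurable])
 then have [measurable]: "(\<lambda>(w, t). \<rho> w (max 0 t) j) \<in> borel_measurable path_time"
  by (simp add: case_prod_beta')
 have "(\<lambda>(w, t). if 0 < t then \<rho> w (max 0 t) j else 0) \<in> borel_measurable path_time"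
  by measurable
 then show "(\<lambda>x. case (x, j) of (x, xa) \<Rightarrow> (case x of (w, t) \<Rightarrow> \<lambda>j. \<rho>_pos w t j) xa) \<in> borel_measurable path_time"
  by (rule measurable_cong[THEN iffD1, rotated]) (auto simp: \<rho>_pos_def)
qed

text \<open>For a test function that vanishes off sojourn m, the sum over jumps and the sum over
  stretches of the compensator both collapse to the term k = m.\<close>

theorem jump_identity_of_projection:
 assumes P: "sets P = sets path_algebra"
  and dpp: "dual_predictable_projection P jump_measure compensator"
 shows "jump_identity P \<rho>_pos"
 unfolding jump_identity_def
proof (intro allI impI)
 fix m and W :: "'s path \<Rightarrow> real \<Rightarrow> 's \<Rightarrow> ennreal"
 assume W: "marked W"
 have spP: "space P = paths" using sets_eq_imp_space_eq[OF P] by simp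
 define V where "V = (\<lambda>((w, t), j). if sojourn m w t then W (freeze m w) t j else 0)"
 have Vj: "(\<lambda>x. V (x, j)) \<in> borel_measurable predictable" for j
 proof -
  have "(\<lambda>(w, t). W w t j) \<in> borel_measurable path_time"
   using measurable_to_pair_count[OF W, of j] by (simp add: case_prod_beta')
  from predictable_sojourn_function[OF this, of m] show ?thesis
   by (simp add: V_def case_prod_beta' cong: if_cong)
 qed
 then have "V \<in> borel_measurable (predictable_algebra (completed_filtration P) \<Otimes>\<^sub>M count_space UNIV)"
  by (intro measurable_from_pair_count measurable_predictable_completed[OF P])
 with dpp have "(\<integral>\<^sup>+w. (\<integral>\<^sup>+(s, j). V ((w, s), j) \<partial>jump_measure w) \<partial>P) =
   (\<integral>\<^sup>+w. (\<integral>\<^sup>+(s, j). V ((w, s), j) \<partial>compensator w) \<partial>P)"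
  unfolding dual_predictable_projection_def Let_def nn_integral_completion by blast
 moreover have "(\<integral>\<^sup>+(s, j). V ((w, s), j) \<partial>jump_measure w) = next_jump W m w"
  (is "?L = ?R") if w: "w \<in> paths" for w
 proof -
  have "?L = (\<Sum>k. if jump_time (Suc k) w < \<infinity> then V ((w, enn2real (jump_time (Suc k) w)), the (jump_state (Suc k) w)) else 0)"
   by (rule jump_integral[OF w]) (rule measurable_mark_section(2)[OF natural_filtration_subset w Vj])
  also have "\<dots> = (\<Sum>k. if k = m then ?R else 0)"
   using sojourn_at_jump[OF w, of _ m] by (intro suminf_cong) (auto simp: V_def)
  also have "\<dots> = ?R" by (rule suminf_single_ennreal)
  finally show ?thesis .
 qed
 moreover have "(\<integral>\<^sup>+(s, j). V ((w, s), j) \<partial>compensator w) =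
   (\<integral>\<^sup>+t. (if sojourn m w t then csum (\<lambda>j. \<rho>_pos (freeze m w) t j * W (freeze m w) t j) else 0) \<partial>lborel)"
  (is "?L = ?R") if w: "w \<in> paths" for w
 proof -
  have "?L = (\<Sum>k. \<integral>\<^sup>+t. (if sojourn k w t then csum (\<lambda>j. \<rho> w t j * V ((w, t), j)) else 0) \<partial>lborel)"
   by (rule compensator_integral[OF w]) (rule measurable_mark_section(2)[OF natural_filtration_subset w Vj])
  also have "\<dots> = (\<Sum>k. if k = m then ?R else 0)"
  proof (intro suminf_cong)
   fix k
   show "(\<integral>\<^sup>+t. (if sojourn k w t then csum (\<lambda>j. \<rho> w t j * V ((w, t), j)) else 0) \<partial>lborel) = (if k = m then ?R else 0)"
   proof (cases "k = m")
    case True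
    then show ?thesis
     by (auto simp: V_def \<rho>_pos_def \<rho>_freeze[OF w] sojourn_pos intro!: nn_integral_cong)
   next
    case False
    then have "\<not> sojourn m w t" if "sojourn k w t" for t
     using sojourn_unique that by blast
    then have "(if sojourn k w t then csum (\<lambda>j. \<rho> w t j * V ((w, t), j)) else 0) = 0" for t
     by (auto simp: V_def)
    with False show ?thesis by simp
   qed
  qed
  also have "\<dots> = ?R" by (rule suminf_single_ennreal)
  finally show ?thesis .
 qed
 ultimately show "(\<integral>\<^sup>+w. next_jump W m w \<partial>P) =
   (\<integral>\<^sup>+w. \<integral>\<^sup>+t. (if sojourn m w t then csum (\<lambda>j. \<rho>_pos (freeze m w) t j * W (freeze m w) t j) else 0) \<partial>lborel \<partial>P)"
  by (simp add: spP cong: nn_integral_cong_simp)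
qed

theorem projection_of_jump_identity:
 assumes P: "sets P = sets path_algebra" and id: "jump_identity P \<rho>_pos"
 shows "dual_predictable_projection P jump_measure compensator"
 unfolding dual_predictable_projection_def Let_def nn_integral_completion
proof (intro ballI conjI)
 let ?C = "predictable_algebra (completed_filtration P)"
 fix W :: "('s path \<times> real) \<times> 's \<Rightarrow> ennreal"
 assume W: "W \<in> borel_measurable (?C \<Otimes>\<^sub>M count_space UNIV)"
 have spP: "space P = paths" using sets_eq_imp_space_eq[OF P] by simp
 note Csub = completed_filtration_subset[OF P]
 have Wj: "(\<lambda>x. W (x, j)) \<in> borel_measurable ?C" for j
  using measurable_to_pair_count[OF W] .
 have Wsec: "(\<lambda>t. W ((w, t), j)) \<in> borel_measurable (restrict_space lborel {0<..})" if "w \<in> paths" for w j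
  using measurable_mark_section(2)[OF Csub that Wj] .
 have "(\<lambda>p. csum (\<lambda>j. (case p of (w, t) \<Rightarrow> \<rho> w t j) * W (p, j))) \<in> borel_measurable ?C"
  by (intro C.borel_measurable_nn_integral measurable_from_pair_count)
   (use Wj measurable_predictable_completed[OF P \<rho>_measurable] in \<open>auto intro!: borel_measurable_times_ennreal\<close>)
 from measurable_predictable_integral[OF Csub this]
 have "(\<lambda>(w, t). \<integral>\<^sup>+s. indicator {0<..t} s * csum (\<lambda>j. \<rho> w s j * W ((w, s), j)) \<partial>lborel) \<in> borel_measurable ?C"
  by simp
 then show "(\<lambda>(w, t). \<integral>\<^sup>+(s, j). indicator {0<..t} s * W ((w, s), j) \<partial>compensator w) \<in> borel_measurable ?C"
 proof (rule measurable_cong[THEN iffD1, rotated])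
  fix p assume "p \<in> space ?C"
  then obtain w t where p: "p = (w, t)" "w \<in> paths" by auto
  have "(\<integral>\<^sup>+(s, j). indicator {0<..t} s * W ((w, s), j) \<partial>compensator w) =
   (\<integral>\<^sup>+s. (if 0 < s then csum (\<lambda>j. \<rho> w s j * (indicator {0<..t} s * W ((w, s), j))) else 0) \<partial>lborel)"
  proof (intro compensator_integral(1)[OF p(2)] borel_measurable_times_ennreal Wsec[OF p(2)])
   show "indicator {0<..t} \<in> borel_measurable (restrict_space lborel {0<..})"
    by (rule measurable_restrict_space1) simp
  qed
  also have "\<dots> = (\<integral>\<^sup>+s. indicator {0<..t} s * csum (\<lambda>j. \<rho> w s j * W ((w, s), j)) \<partial>lborel)"
   by (intro nn_integral_cong) (auto split: split_indicator)
  finally show "(case p of (w, t) \<Rightarrow> \<integral>\<^sup>+s. indicator {0<..t} s * csum (\<lambda>j. \<rho> w s j * W ((w, s), j)) \<partial>lborel)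
   = (case p of (w, t) \<Rightarrow> \<integral>\<^sup>+(s, j). indicator {0<..t} s * W ((w, s), j) \<partial>compensator w)"
   using p by simp
 qed
 have "\<forall>j. \<exists>H'\<in>borel_measurable predictable. \<exists>N\<in>null_sets (completion P).
  \<forall>w\<in>paths - N. \<forall>t\<ge>0. W ((w, t), j) = (H' (w, t) :: ennreal)"
  using predictable_completed_modulo_null[OF P Wj] by simp
 then obtain V N where V: "\<And>j. V j \<in> borel_measurable predictable"
  and N: "\<And>j. N j \<in> null_sets (completion P)"
  and WV: "\<And>j w t. w \<in> paths - N j \<Longrightarrow> 0 \<le> t \<Longrightarrow> W ((w, t), j) = V j (w, t)"
  by metis
 have Vsec: "(\<lambda>t. V j (w, t)) \<in> borel_measurable (restrict_space lborel {0<..})" if "w \<in> paths" for w j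
  using measurable_mark_section(2)[OF natural_filtration_subset that V] .
 have Vfreeze: "V j (freeze m w, t) = V j (w, t)" if "w \<in> paths" "sojourn m w t" for j w m t
  using predictable_freeze[OF V that] by simp
 \<comment> \<open>As there are countably many marks, one null set serves them all.\<close>
 have "(\<Union>j. N j) \<in> null_sets (completion P)" using N by (rule null_sets_UN)
 then have "AE w in completion P. w \<notin> (\<Union>j. N j)" by (rule AE_not_in)
 then have good: "AE w in P. w \<in> paths \<and> (\<forall>j. w \<notin> N j)"
  unfolding AE_completion_iff using AE_space[of P] by eventually_elim (auto simp: spP)
 define V' where "V' w t j = V j (w, max 0 t)" for w t j
 have V'm: "marked V'"
 proof (rule measurable_from_pair_count)
  fix j
  have "(\<lambda>x. V j ((\<lambda>(w, t). (w, max 0 t)) x)) \<in> borel_measurable path_time"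
   by (rule measurable_compose[OF measurable_predictable_joint V])
  then show "(\<lambda>x. case (x, j) of (x, xa) \<Rightarrow> (case x of (w, t) \<Rightarrow> \<lambda>j. V' w t j) xa) \<in> borel_measurable path_time"
   by (simp add: V'_def case_prod_beta')
 qed
 let ?A = "\<lambda>m w. next_jump V' m w"
 let ?B = "\<lambda>m w. \<integral>\<^sup>+t. (if sojourn m w t then csum (\<lambda>j. \<rho>_pos (freeze m w) t j * V' (freeze m w) t j) else 0) \<partial>lborel"
 have "(\<integral>\<^sup>+w. (\<integral>\<^sup>+(s, j). W ((w, s), j) \<partial>jump_measure w) \<partial>P) = (\<integral>\<^sup>+w. (\<Sum>m. ?A m w) \<partial>P)"
 proof (rule nn_integral_cong_AE)
  show "AE w in P. (\<integral>\<^sup>+(s, j). W ((w, s), j) \<partial>jump_measure w) = (\<Sum>m. ?A m w)"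
   using good
  proof eventually_elim
   case (elim w)
   then have w: "w \<in> paths" by simp
   have "(\<integral>\<^sup>+(s, j). W ((w, s), j) \<partial>jump_measure w) =
    (\<Sum>m. if jump_time (Suc m) w < \<infinity> then W ((w, enn2real (jump_time (Suc m) w)), the (jump_state (Suc m) w)) else 0)"
    by (rule jump_integral[OF w Wsec[OF w]])
   also have "\<dots> = (\<Sum>m. ?A m w)"
    using elim by (intro suminf_cong) (auto simp: V'_def WV Vfreeze[OF w] sojourn_at_jump[OF w])
   finally show ?case .
  qed
 qed
 also have "\<dots> = (\<Sum>m. \<integral>\<^sup>+w. ?A m w \<partial>P)"
  using jump_identity_measurable1[OF V'm]
  by (intro nn_integral_suminf) (simp add: measurable_cong_sets[OF P refl])
 also have "\<dots> = (\<Sum>m. \<integral>\<^sup>+w. ?B m w \<partial>P)"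
  using id V'm unfolding jump_identity_def by (intro suminf_cong) blast
 also have "\<dots> = (\<integral>\<^sup>+w. (\<Sum>m. ?B m w) \<partial>P)"
  using jump_identity_measurable2(2)[OF V'm \<rho>_pos_measurable]
  by (intro nn_integral_suminf[symmetric]) (simp add: measurable_cong_sets[OF P refl])
 also have "\<dots> = (\<integral>\<^sup>+w. (\<integral>\<^sup>+(s, j). W ((w, s), j) \<partial>compensator w) \<partial>P)"
 proof (rule nn_integral_cong_AE)
  show "AE w in P. (\<Sum>m. ?B m w) = (\<integral>\<^sup>+(s, j). W ((w, s), j) \<partial>compensator w)"
   using good
  proof eventually_elim
   case (elim w)
   then have w: "w \<in> paths" by simp
   have "(\<integral>\<^sup>+(s, j). W ((w, s), j) \<partial>compensator w) =
    (\<Sum>m. \<integral>\<^sup>+t. (if sojourn m w t then csum (\<lambda>j. \<rho> w t j * W ((w, t), j)) else 0) \<partial>lborel)"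
    by (rule compensator_integral(2)[OF w Wsec[OF w]])
   also have "\<dots> = (\<Sum>m. ?B m w)"
   proof (intro suminf_cong nn_integral_cong)
    fix m t
    show "(if sojourn m w t then csum (\<lambda>j. \<rho> w t j * W ((w, t), j)) else 0) =
     (if sojourn m w t then csum (\<lambda>j. \<rho>_pos (freeze m w) t j * V' (freeze m w) t j) else 0)"
     using elim sojourn_pos[of m w t] by (auto simp: V'_def WV Vfreeze[OF w] \<rho>_pos_def \<rho>_freeze[OF w])
   qed
   finally show ?case by simp
  qed
 qed
 finally show "(\<integral>\<^sup>+w. (\<integral>\<^sup>+(s, j). W ((w, s), j) \<partial>jump_measure w) \<partial>P) =
   (\<integral>\<^sup>+w. (\<integral>\<^sup>+(s, j). W ((w, s), j) \<partial>compensator w) \<partial>P)" .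
qed

end

section \<open>Existence and uniqueness of the jump process\<close>

text \<open>Ionescu-Tulcea for kernels that read only the last coordinate. It is used for the chain
  of frozen histories and for the chain of nested action cells; both need no more than the initial
  law and the law of consecutive pairs.\<close>

lemma markov_chain_exists:
 fixes M :: "'b measure" and K :: "nat \<Rightarrow> 'b \<Rightarrow> 'b measure"
 assumes K: "\<And>m. K m \<in> M \<rightarrow>\<^sub>M prob_algebra M" and \<mu>: "\<mu> \<in> space (prob_algebra M)"
 obtains Q where "prob_space Q" "sets Q = sets (PiM UNIV (\<lambda>_::nat. M))"
  "distr Q M (\<lambda>x. x 0) = \<mu>"
  "\<forall>m. \<forall>F\<in>borel_measurable (M \<Otimes>\<^sub>M M).
    (\<integral>\<^sup>+x. F (x m, x (Suc m)) \<partial>Q) = (\<integral>\<^sup>+x. \<integral>\<^sup>+y. F (x m, y) \<partial>K m (x m) \<partial>Q)"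
proof -
 have sub: "prob_algebra M = restrict_space (subprob_algebra M) {M. prob_space M}"
  by (simp add: prob_algebra_def)
 have Ks: "K m \<in> M \<rightarrow>\<^sub>M subprob_algebra M" for m
  using K[of m] by (rule measurable_prob_algebraD)
 have \<mu>s: "\<mu> \<in> space (subprob_algebra M)" "prob_space \<mu>" "sets \<mu> = sets M"
  using \<mu> by (auto simp: space_prob_algebra space_subprob_algebra prob_space_imp_subprob_space)
 define P where "P i x = (case i of 0 \<Rightarrow> \<mu> | Suc m \<Rightarrow> K m (x m))" for i and x :: "nat \<Rightarrow> 'b"
 interpret IT: Ionescu_Tulcea P "\<lambda>_. M"
 proof (rule Ionescu_Tulcea.intro)
  fix i
  show "P i \<in> Pi\<^sub>M {0..<i} (\<lambda>_. M) \<rightarrow>\<^sub>M subprob_algebra M"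
  proof (cases i)
   case 0
   then show ?thesis unfolding P_def using \<mu>s by simp
  next
   case (Suc m)
   then show ?thesis unfolding P_def
    by (auto intro!: measurable_compose[OF _ Ks] measurable_component_singleton)
  qed
 next
  fix i :: nat and x assume x: "x \<in> space (Pi\<^sub>M {0..<i} (\<lambda>_. M))"
  show "prob_space (P i x)"
  proof (cases i)
   case 0
   then show ?thesis unfolding P_def using \<mu>s by simp
  next
   case (Suc m)
   have "x m \<in> space M" using Suc x by (auto simp: space_PiM)
   from measurable_space[OF K this, of m] show ?thesis
    unfolding P_def Suc by (simp add: space_prob_algebra)
  qed
 qed
 define Q where "Q = IT.PF.lim"
 have sQ: "sets Q = sets (PiM UNIV (\<lambda>_. M))" by (simp add: Q_def)
 have CI: "IT.CI {0..<n} = IT.C 0 n (\<lambda>_. undefined)" for n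
 proof (rule measure_eqI)
  show "sets (IT.CI {0..<n}) = sets (IT.C 0 n (\<lambda>_. undefined))"
   by (simp add: IT.CI_def IT.sets_C space_PiM)
  fix X assume "X \<in> sets (IT.CI {0..<n})"
  then have X: "X \<in> sets (PiM {0..<n} (\<lambda>_. M))" by (simp add: IT.CI_def)
  from IT.emeasure_CI[of "{0..<n}" n, OF subset_refl X]
  show "emeasure (IT.CI {0..<n}) X = emeasure (IT.C 0 n (\<lambda>_. undefined)) X"
   using sets.sets_into_space[OF X] by (simp add: prod_emb_id space_PiM)
 qed
 have int: "(\<integral>\<^sup>+x. f (restrict x {0..<n}) \<partial>Q) = (\<integral>\<^sup>+x. f x \<partial>IT.C 0 n (\<lambda>_. undefined))"
  if f: "f \<in> borel_measurable (PiM {0..<n} (\<lambda>_. M))" for f n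
 proof -
  have "(\<integral>\<^sup>+x. f x \<partial>IT.C 0 n (\<lambda>_. undefined)) = (\<integral>\<^sup>+x. f x \<partial>distr Q (PiM {0..<n} (\<lambda>_. M)) (\<lambda>x. restrict x {0..<n}))"
   unfolding CI[symmetric] Q_def by (subst IT.distr_lim) auto
  also have "\<dots> = (\<integral>\<^sup>+x. f (restrict x {0..<n}) \<partial>Q)"
   using f by (intro nn_integral_distr) (auto simp: measurable_cong_sets[OF sQ refl] intro!: measurable_restrict_subset)
  finally show ?thesis by simp
 qed
 have pQ: "prob_space Q"
 proof -
  have "(\<integral>\<^sup>+x. 1 \<partial>Q) = (\<integral>\<^sup>+x. 1 \<partial>IT.C 0 0 (\<lambda>_. undefined))"
   using int[of "\<lambda>_. 1" 0] by simp
  also have "\<dots> = 1" using prob_space.emeasure_space_1[OF IT.prob_space_C[of "\<lambda>_. undefined" 0 0]]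
   by (simp add: space_PiM)
  finally show ?thesis by (intro prob_spaceI) simp
 qed
 have comp: "(\<lambda>x. x k) \<in> Q \<rightarrow>\<^sub>M M" for k
  unfolding measurable_cong_sets[OF sQ refl] by (rule measurable_component_singleton) simp
 have step: "(\<integral>\<^sup>+x. F (x m, x (Suc m)) \<partial>Q) = (\<integral>\<^sup>+x. \<integral>\<^sup>+y. F (x m, y) \<partial>K m (x m) \<partial>Q)"
  if F: "F \<in> borel_measurable (M \<Otimes>\<^sub>M M)" for F m
 proof -
  have Fm: "(\<lambda>x. F (x m, x (Suc m))) \<in> borel_measurable (PiM {0..<Suc (Suc m)} (\<lambda>_. M))"
   by (rule measurable_compose[OF _ F]) (intro measurable_Pair measurable_component_singleton, auto)
  have Gm: "(\<lambda>z. \<integral>\<^sup>+y. F (z, y) \<partial>K m z) \<in> borel_measurable M"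
   by (rule nn_integral_measurable_subprob_algebra2[OF _ Ks]) (use F in simp)
  have Gm': "(\<lambda>x. \<integral>\<^sup>+y. F (x m, y) \<partial>K m (x m)) \<in> borel_measurable (PiM {0..<Suc m} (\<lambda>_. M))"
   by (rule measurable_compose[OF _ Gm]) (intro measurable_component_singleton, simp)
  have "(\<integral>\<^sup>+x. F (x m, x (Suc m)) \<partial>Q) = (\<integral>\<^sup>+x. F (x m, x (Suc m)) \<partial>IT.C 0 (Suc (Suc m)) (\<lambda>_. undefined))"
   using int[OF Fm] by simp
  also have "\<dots> = (\<integral>\<^sup>+x. \<integral>\<^sup>+x'. F (x' m, x' (Suc m)) \<partial>IT.eP (Suc m) x \<partial>IT.C 0 (Suc m) (\<lambda>_. undefined))"
  proof -
   have "IT.eP (0 + Suc m) \<in> IT.C 0 (Suc m) (\<lambda>_. undefined) \<rightarrow>\<^sub>M subprob_algebra (PiM {0..<Suc (Suc m)} (\<lambda>_. M))"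
    using IT.measurable_eP[of "Suc m"] IT.sets_C[of "\<lambda>_. undefined" 0 "Suc m"]
    by (simp add: space_PiM cong: measurable_cong_sets)
   from nn_integral_bind[OF Fm this] show ?thesis
    by (subst IT.C.simps(2)) simp
  qed
  also have "\<dots> = (\<integral>\<^sup>+x. \<integral>\<^sup>+y. F (x m, y) \<partial>K m (x m) \<partial>IT.C 0 (Suc m) (\<lambda>_. undefined))"
  proof (rule nn_integral_cong)
   fix x assume "x \<in> space (IT.C 0 (Suc m) (\<lambda>_. undefined))"
   then have "x \<in> space (PiM {0..<Suc m} (\<lambda>_. M))" using IT.space_C[of "\<lambda>_. undefined" 0 "Suc m"] by (simp add: space_PiM)
   from IT.nn_integral_eP[OF this Fm]
   show "(\<integral>\<^sup>+x'. F (x' m, x' (Suc m)) \<partial>IT.eP (Suc m) x) = (\<integral>\<^sup>+y. F (x m, y) \<partial>K m (x m))"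
    by (simp add: P_def)
  qed
  also have "\<dots> = (\<integral>\<^sup>+x. \<integral>\<^sup>+y. F (x m, y) \<partial>K m (x m) \<partial>Q)"
   using int[OF Gm'] by simp
  finally show ?thesis .
 qed
 have init: "distr Q M (\<lambda>x. x 0) = \<mu>"
 proof (rule measure_eqI)
  show "sets (distr Q M (\<lambda>x. x 0)) = sets \<mu>" using \<mu>s by simp
  fix X assume "X \<in> sets (distr Q M (\<lambda>x. x 0))"
  then have X: "X \<in> sets M" by simp
  have fm: "(\<lambda>x. indicator X (x 0) :: ennreal) \<in> borel_measurable (PiM {0..<Suc 0} (\<lambda>_. M))"
   by (rule measurable_compose[where N=M]) (use X in \<open>auto intro!: measurable_component_singleton\<close>)
  have "emeasure (distr Q M (\<lambda>x. x 0)) X = (\<integral>\<^sup>+x. indicator X (x 0) \<partial>Q)"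
   using X comp[of 0] by (subst nn_integral_distr[symmetric, of _ _ M]) simp_all
  also have "\<dots> = (\<integral>\<^sup>+x. indicator X (x 0) \<partial>IT.C 0 (Suc 0) (\<lambda>_. undefined))"
   using int[OF fm] by simp
  also have "\<dots> = (\<integral>\<^sup>+x. indicator X (x 0) \<partial>IT.eP 0 (\<lambda>_. undefined))"
  proof -
   have "IT.C 0 (Suc 0) (\<lambda>_. undefined) = IT.eP 0 (\<lambda>_. undefined)"
    using IT.measurable_eP[of 0] by (simp add: bind_return space_PiM)
   then show ?thesis by simp
  qed
  also have "\<dots> = (\<integral>\<^sup>+y. indicator X y \<partial>\<mu>)"
   using IT.nn_integral_eP[OF _ fm, of "\<lambda>_. undefined"] by (simp add: P_def space_PiM)
  also have "\<dots> = emeasure \<mu> X" using X \<mu>s by simp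
  finally show "emeasure (distr Q M (\<lambda>x. x 0)) X = emeasure \<mu> X" .
 qed
 show thesis by (rule that[OF pQ sQ init]) (intro allI ballI step)
qed

text \<open>Substitution u = G s for a density \<open>h\<close> that is merely measurable, so G need
  not be differentiable everywhere. Instead, the image of the measure with density \<open>h\<close>
  under G is compared with Lebesgue measure on [0, G b] on the half-lines (x, infinity).\<close>

lemma nn_integral_time_change:
 fixes h :: "real \<Rightarrow> ennreal"
 assumes [measurable]: "h \<in> borel_measurable borel" "f \<in> borel_measurable borel"
  and h: "\<And>s. h s \<le> ennreal k" "\<And>s. s \<le> a \<Longrightarrow> h s = 0" and k: "0 \<le> k" and ab: "a \<le> b"
 defines "H \<equiv> \<lambda>t. \<integral>\<^sup>+s. (if s \<le> t then h s else 0) \<partial>lborel"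
 defines "G \<equiv> \<lambda>t. enn2real (H t)"
 shows "(\<integral>\<^sup>+s. (if s \<le> b then h s * f (G s) else 0) \<partial>lborel) = (\<integral>\<^sup>+u. f u * indicator {0..G b} u \<partial>lborel)"
proof -
 have split: "H y = H x + (\<integral>\<^sup>+s. (if x < s \<and> s \<le> y then h s else 0) \<partial>lborel)" if "x \<le> y" for x y
  unfolding H_def using that by (subst nn_integral_add[symmetric]) (auto intro!: nn_integral_cong)
 have inc: "(\<integral>\<^sup>+s. (if x < s \<and> s \<le> y then h s else 0) \<partial>lborel) \<le> ennreal (k * (y - x))" if "x \<le> y" for x y
 proof -
  have "(\<integral>\<^sup>+s. (if x < s \<and> s \<le> y then h s else 0) \<partial>lborel) \<le> (\<integral>\<^sup>+s. ennreal k * indicator {x<..y} s \<partial>lborel)"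
   using h by (intro nn_integral_mono) auto
  also have "\<dots> = ennreal (k * (y - x))" using that k by (simp add: nn_integral_cmult_indicator ennreal_mult)
  finally show ?thesis .
 qed
 have Ha: "H t = 0" if "t \<le> a" for t
 proof -
  have "(if s \<le> t then h s else 0) = 0" for s using h(2)[of s] that by auto
  then show ?thesis unfolding H_def by simp
 qed
 have "H t < \<infinity>" for t
  using split[of a t] inc[of a t] Ha[of a] Ha[of t] by (cases "a \<le> t") (auto simp: less_top[symmetric] top_unique)
 then have HG: "H t = ennreal (G t)" for t by (simp add: G_def less_top)
 have G0: "0 \<le> G t" for t by (simp add: G_def)
 have lip: "G x \<le> G y \<and> G y \<le> G x + k * (y - x)" if "x \<le> y" for x y
 proof -
  have "ennreal (G x) \<le> ennreal (G y)" unfolding HG[symmetric] split[OF that] by simp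
  moreover have "ennreal (G y) \<le> ennreal (G x) + ennreal (k * (y - x))"
   unfolding HG[symmetric] split[OF that] by (intro add_left_mono inc that)
  ultimately show ?thesis using G0 k that by (simp add: ennreal_plus[symmetric] ennreal_le_iff del: ennreal_plus)
 qed
 have mono: "mono G" using lip by (auto simp: mono_def)
 then have [measurable]: "G \<in> borel_measurable borel" by (rule borel_measurable_mono)
 have "\<bar>G x - G y\<bar> \<le> k * \<bar>x - y\<bar>" for x y using lip[of x y] lip[of y x] by (cases "x \<le> y") auto
 then have "k-lipschitz_on UNIV G" using k by (auto simp: lipschitz_on_def dist_real_def)
 then have cont: "continuous_on S G" for S
  using continuous_on_subset[OF lipschitz_on_continuous_on] by blast
 let ?M = "distr (density lborel (\<lambda>s. if s \<le> b then h s else 0)) borel G" and ?N = "density lborel (indicator {0..G b})"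
 have M: "emeasure ?M {x<..} = (\<integral>\<^sup>+s. (if x < G s \<and> s \<le> b then h s else 0) \<partial>lborel)" for x
  using measurable_sets[of G borel borel "{x<..}"]
  by (subst emeasure_distr, simp, simp, subst emeasure_density) (auto intro!: nn_integral_cong split: split_indicator)
 have N: "emeasure ?N {x<..} = ennreal (G b - max x 0)" for x
 proof -
  have "emeasure ?N {x<..} = (\<integral>\<^sup>+u. indicator {0..G b} u * indicator {x<..} u \<partial>lborel)"
   by (rule emeasure_density) auto
  also have "\<dots> = (\<integral>\<^sup>+u. indicator (if x < 0 then {0..G b} else {x<..G b}) u \<partial>lborel)"
   by (intro nn_integral_cong) (auto split: split_indicator)
  also have "\<dots> = emeasure lborel (if x < 0 then {0..G b} else {x<..G b})" by simp
  finally show ?thesis using G0[of b] by (cases "x \<le> G b") (auto simp: ennreal_neg max_def)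
 qed
 have MN: "emeasure ?M {x<..} = ennreal (G b - max x 0)" for x
 proof -
  have *: "(\<integral>\<^sup>+s. (if s0 < s \<and> s \<le> b then h s else 0) \<partial>lborel) = ennreal (G b - G s0)" if "s0 \<le> b" for s0
  proof -
   have "ennreal (G b) = ennreal (G s0) + ennreal (G b - G s0)"
    using lip[OF that] G0 by (subst ennreal_plus[symmetric]) auto
   then show ?thesis using split[OF that] unfolding HG by (simp add: ennreal_add_left_cancel)
  qed
  consider "x < 0" | "G b \<le> x" | "0 \<le> x" "x < G b" by linarith
  then show ?thesis
  proof cases
   case 1
   then have "x < G s" for s using G0[of s] by simp
   moreover have "(\<integral>\<^sup>+s. (if s \<le> b then h s else 0) \<partial>lborel) = ennreal (G b)"
    using HG[of b] by (simp only: H_def)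
   ultimately show ?thesis using 1 unfolding M by simp
  next
   case 2
   then have z: "(if x < G s \<and> s \<le> b then h s else 0) = 0" for s using lip[of s b] by auto
   show ?thesis unfolding M z using 2 by (simp add: ennreal_neg)
  next
   case 3
   have Ga: "G a = 0" using Ha[of a] by (simp add: G_def)
   \<comment> \<open>The last time s0 in [a, b] with G s0 <= x exists by compactness, and there G
     equals x by the intermediate value theorem. So G exceeds x exactly after s0, even if G has flat
     pieces.\<close>
   let ?S = "{s \<in> {a..b}. G s \<le> x}"
   have "compact ({a..b} \<inter> {s. G s \<le> x})"
    by (intro compact_Int_closed compact_Icc closed_Collect_le cont continuous_on_const)
   then have "compact ?S" by (simp only: Int_def mem_Collect_eq)
   moreover have "a \<in> ?S" using ab Ga 3 by simp
   ultimately obtain s0 where s0: "s0 \<in> ?S" "\<And>s. s \<in> ?S \<Longrightarrow> s \<le> s0"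
    using compact_attains_sup[of ?S] by blast
   obtain s1 where s1: "s0 \<le> s1" "s1 \<le> b" "G s1 = x"
    using IVT'[of G s0 x b] s0(1) 3 cont by auto
   then have "G s0 = x" using s0(2)[of s1] s0(1) s1 by auto
   moreover have "(x < G s \<and> s \<le> b) = (s0 < s \<and> s \<le> b)" for s
    using s0 lip[of s s0] lip[of s0 s] by (smt (verit) atLeastAtMost_iff mem_Collect_eq)
   ultimately show ?thesis using *[of s0] s0(1) 3 unfolding M by simp
  qed
 qed
 have "?M = ?N" by (rule measure_eqI_lessThan) (simp_all add: MN N)
 have "(\<integral>\<^sup>+s. (if s \<le> b then h s * f (G s) else 0) \<partial>lborel) = (\<integral>\<^sup>+u. f u \<partial>?M)"
  by (subst nn_integral_distr, simp, simp, subst nn_integral_density) (auto intro!: nn_integral_cong)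
 also have "\<dots> = (\<integral>\<^sup>+u. f u * indicator {0..G b} u \<partial>lborel)"
  unfolding \<open>?M = ?N\<close> by (subst nn_integral_density) (auto simp: mult.commute)
 finally show ?thesis .
qed

section \<open>The conditional law of the next jump\<close>

lemma measurable_marked:
 fixes W :: "'s::countable path \<Rightarrow> real \<Rightarrow> 's \<Rightarrow> 'b"
 assumes "\<And>j. (\<lambda>p. W (fst p) (snd p) j) \<in> path_time \<rightarrow>\<^sub>M N"
 shows "(\<lambda>((w, t), j). W w t j) \<in> path_time \<Otimes>\<^sub>M count_space UNIV \<rightarrow>\<^sub>M N"
 by (rule measurable_from_pair_count) (use assms in \<open>simp add: case_prod_beta'\<close>)

text \<open>The bound depends on the current state and is asked on sojourns only. It keeps the
  cumulative hazard finite at finite times, which the time change requires, but does not exclude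
  explosion.\<close>

locale bounded_jump_rates =
 fixes r :: "'s::countable path \<Rightarrow> real \<Rightarrow> 's \<Rightarrow> ennreal" and kb :: "'s \<Rightarrow> real"
 assumes r_measurable: "marked r"
  and r_bound: "\<And>w m t i. w \<in> paths \<Longrightarrow> sojourn m w t \<Longrightarrow> jump_state m w = Some i \<Longrightarrow>
   (csum (\<lambda>j. r w t j)) \<le> ennreal (kb i)"
begin

definition exit_rate :: "'s path \<Rightarrow> real \<Rightarrow> ennreal" where
 "exit_rate w t = csum (\<lambda>j. r w t j)"

definition hazard :: "nat \<Rightarrow> 's path \<Rightarrow> real \<Rightarrow> ennreal" where
 "hazard m w t = (\<integral>\<^sup>+s. (if jump_time m w < ennreal s \<and> s \<le> t then exit_rate (freeze m w) s else 0) \<partial>lborel)"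

definition survival :: "nat \<Rightarrow> 's path \<Rightarrow> real \<Rightarrow> real" where
 "survival m w t = exp (- enn2real (hazard m w t))"

lemma measurable_exit_rate [measurable]: "(\<lambda>p. exit_rate (fst p) (snd p)) \<in> borel_measurable path_time"
proof -
 show ?thesis unfolding exit_rate_def
  by (intro C.borel_measurable_nn_integral) (use r_measurable in \<open>simp add: case_prod_beta'\<close>)
qed

lemma measurable_exit_rate_freeze [measurable]:
 assumes [measurable]: "f \<in> M \<rightarrow>\<^sub>M path_algebra" "g \<in> borel_measurable M"
 shows "(\<lambda>x. exit_rate (freeze m (f x)) (g x)) \<in> borel_measurable M"
proof -
 have "(\<lambda>x. (freeze m (f x), g x)) \<in> M \<rightarrow>\<^sub>M path_time" by measurable
 from measurable_compose[OF this measurable_exit_rate] show ?thesis by simp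
qed

lemma measurable_hazard [measurable]:
 assumes [measurable]: "f \<in> M \<rightarrow>\<^sub>M path_algebra" "g \<in> borel_measurable M"
 shows "(\<lambda>x. hazard m (f x) (g x)) \<in> borel_measurable M"
 unfolding hazard_def
proof (rule lborel.borel_measurable_nn_integral)
 show "(\<lambda>(x, s). if jump_time m (f x) < ennreal s \<and> s \<le> g x then exit_rate (freeze m (f x)) s else 0) \<in> borel_measurable (M \<Otimes>\<^sub>M lborel)"
  by measurable
qed

lemma measurable_survival [measurable]:
 assumes [measurable]: "f \<in> M \<rightarrow>\<^sub>M path_algebra" "g \<in> borel_measurable M"
 shows "(\<lambda>x. survival m (f x) (g x)) \<in> borel_measurable M"
 unfolding survival_def by measurable

lemma freeze_idem [simp]: "freeze m (freeze m w) = freeze m w"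
 by (rule freeze_freeze) simp

lemma survival_freeze [simp]: "survival m (freeze m w) t = survival m w t"
 by (simp add: survival_def hazard_def jump_time_freeze cong: if_cong)

lemma survival_pos: "0 < survival m w t" and survival_le_1: "survival m w t \<le> 1"
 by (simp_all add: survival_def)

lemma exit_rate_bound:
 assumes "w \<in> paths" "jump_time m w < ennreal t"
 shows "exit_rate (freeze m w) t \<le> ennreal (kb (the (jump_state m w)))"
proof -
 have "jump_time m w < \<infinity>" using assms(2) less_trans[of _ "ennreal t" top] by auto
 with assms(1) obtain i where i: "jump_state m w = Some i" using jump_state_Some by blast
 have "sojourn m (freeze m w) t"
  using assms by (simp add: sojourn_def jump_time_freeze jump_time_freeze_gt)
 from r_bound[OF freeze_in_paths[OF assms(1)] this, of i] show ?thesis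
  using i by (simp add: exit_rate_def jump_state_freeze)
qed

text \<open>Time change by the cumulative hazard turns the integrands into exp (-u) and exp u. The
  first integral is the probability of a jump by time b; the second, with the reciprocal of the
  survival function, serves as an integrating factor in
  \<open>survival_law_of_identity\<close>.\<close>

lemma survival_integrals:
 assumes w: "w \<in> paths" and a: "jump_time m w = ennreal a" "0 \<le> a" and ab: "a \<le> b"
 shows "(\<integral>\<^sup>+s. (if a < s \<and> s \<le> b then exit_rate (freeze m w) s * ennreal (survival m w s) else 0) \<partial>lborel) = ennreal (1 - survival m w b)"
  and "(\<integral>\<^sup>+s. (if a < s \<and> s \<le> b then exit_rate (freeze m w) s * ennreal (1 / survival m w s) else 0) \<partial>lborel) = ennreal (1 / survival m w b - 1)"
  and "\<And>s. a \<le> s \<Longrightarrow> s \<le> b \<Longrightarrow> survival m w b \<le> survival m w s"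
proof -
 define k where "k = max 0 (kb (the (jump_state m w)))"
 define h where "h s = (if a < s then exit_rate (freeze m w) s else 0)" for s
 have after: "jump_time m w < ennreal s \<longleftrightarrow> a < s" for s using a by (simp add: ennreal_less_iff)
 have bound: "h s \<le> ennreal k" for s
  using exit_rate_bound[OF w, of m s] after[of s] order_trans[OF _ ennreal_leI[of _ k]] by (auto simp: h_def k_def)
 have hazard: "hazard m w t = (\<integral>\<^sup>+s. (if s \<le> t then h s else 0) \<partial>lborel)" for t
  unfolding hazard_def after by (intro nn_integral_cong) (auto simp: h_def)
 have [measurable]: "(\<lambda>s. exit_rate (freeze m w) s) \<in> borel_measurable borel"
  using measurable_exit_rate_freeze[of "\<lambda>_. w" borel "\<lambda>s. s" m] w by auto
 have m: "h \<in> borel_measurable borel" unfolding h_def[abs_def] by measurable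
 let ?G = "\<lambda>t. enn2real (hazard m w t)"
 have change: "(\<integral>\<^sup>+s. (if a < s \<and> s \<le> b then exit_rate (freeze m w) s * f (?G s) else 0) \<partial>lborel) =
  (\<integral>\<^sup>+u. f u * indicator {0..?G b} u \<partial>lborel)" if "f \<in> borel_measurable borel" for f
  unfolding hazard
  by (subst nn_integral_time_change[OF m that bound _ _ ab, symmetric])
   (auto simp: h_def k_def intro!: nn_integral_cong)
 have "(\<integral>\<^sup>+u. ennreal (exp (- u)) * indicator {0..?G b} u \<partial>lborel) = - exp (- ?G b) - - exp (- 0)"
  by (rule nn_integral_FTC_Icc) (auto intro!: derivative_eq_intros)
 then show "(\<integral>\<^sup>+s. (if a < s \<and> s \<le> b then exit_rate (freeze m w) s * ennreal (survival m w s) else 0) \<partial>lborel) = ennreal (1 - survival m w b)"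
  using change[of "\<lambda>u. ennreal (exp (- u))"] by (simp add: survival_def cong: if_cong)
 have "(\<integral>\<^sup>+u. ennreal (exp u) * indicator {0..?G b} u \<partial>lborel) = exp (?G b) - exp 0"
  by (rule nn_integral_FTC_Icc) (auto intro!: derivative_eq_intros)
 then show "(\<integral>\<^sup>+s. (if a < s \<and> s \<le> b then exit_rate (freeze m w) s * ennreal (1 / survival m w s) else 0) \<partial>lborel) = ennreal (1 / survival m w b - 1)"
  using change[of "\<lambda>u. ennreal (exp u)"] by (simp add: survival_def exp_minus divide_inverse cong: if_cong)
 fix s assume s: "a \<le> s" "s \<le> b"
 have "hazard m w b \<le> (\<integral>\<^sup>+s. ennreal k * indicator {a..b} s \<partial>lborel)"
  unfolding hazard
 proof (rule nn_integral_mono)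
  show "(if s \<le> b then h s else 0) \<le> ennreal k * indicator {a..b} s" for s
   using bound[of s] by (auto simp: h_def split: split_indicator)
 qed
 also have "\<dots> < \<infinity>" using ab by (simp add: nn_integral_cmult_indicator ennreal_mult_less_top)
 finally have "?G s \<le> ?G b"
  unfolding hazard using s by (intro enn2real_mono nn_integral_mono) (auto simp: less_top)
 then show "survival m w b \<le> survival m w s" by (simp add: survival_def)
qed

definition jump_law :: "'s path measure \<Rightarrow> bool" where
 "jump_law P \<longleftrightarrow> (\<forall>m W. marked W \<longrightarrow>
   (\<integral>\<^sup>+w. next_jump W m w \<partial>P) =
   (\<integral>\<^sup>+w. \<integral>\<^sup>+t. (if jump_time m w < ennreal t
    then csum (\<lambda>j. r (freeze m w) t j * W (freeze m w) t j) * ennreal (survival m w t) else 0) \<partial>lborel \<partial>P))"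

text \<open>The bridge between \<open>jump_identity\<close> and \<open>jump_law\<close>: given the
  history, sojourn m lasts until t with probability \<open>survival m w t\<close>. Each of the two
  implies it.\<close>

definition survival_law :: "'s path measure \<Rightarrow> bool" where
 "survival_law P \<longleftrightarrow> (\<forall>m t. \<forall>f\<in>borel_measurable path_algebra.
   (\<integral>\<^sup>+w. (if sojourn m w t then f (freeze m w) else 0) \<partial>P) =
   (\<integral>\<^sup>+w. (if jump_time m w < ennreal t then f (freeze m w) * ennreal (survival m w t) else 0) \<partial>P))"

text \<open>Truncation at n makes the integrals finite, so that they may be cancelled; monotone
  convergence removes it.\<close>

lemma survival_lawI:
 assumes P: "sets P = sets path_algebra"
  and bounded: "\<And>m t f n. f \<in> borel_measurable path_algebra \<Longrightarrow> (\<And>w. f w \<le> of_nat n) \<Longrightarrow> 0 < t \<Longrightarrow>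
   (\<integral>\<^sup>+w. (if sojourn m w t then f (freeze m w) else 0) \<partial>P) =
   (\<integral>\<^sup>+w. (if jump_time m w < ennreal t then f (freeze m w) * ennreal (survival m w t) else 0) \<partial>P)"
 shows "survival_law P"
 unfolding survival_law_def
proof (intro allI ballI)
 fix m t and f :: "'s path \<Rightarrow> ennreal" assume [measurable]: "f \<in> borel_measurable path_algebra"
 note [measurable_cong] = P
 let ?f = "\<lambda>n w. min (f w) (of_nat n)"
 let ?X = "\<lambda>f w. if sojourn m w t then f (freeze m w) else 0"
 let ?Y = "\<lambda>f w. if jump_time m w < ennreal t then f (freeze m w) * ennreal (survival m w t) else 0"
 have mono: "incseq (\<lambda>n. ?f n w)" for w by (intro incseq_SucI min.mono) auto
 have sup: "f w = (SUP n. ?f n w)" for w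
  using inf_SUP[of "f w" of_nat UNIV] by (simp add: inf_min ennreal_SUP_of_nat_eq_top)
 show "integral\<^sup>N P (?X f) = integral\<^sup>N P (?Y f)"
 proof (cases "0 < t")
  case False
  then have "\<not> sojourn m w t" "\<not> jump_time m w < ennreal t" for w :: "'s path"
   using sojourn_pos[of m w t] by (auto simp: ennreal_neg)
  then show ?thesis by simp
 next
  case True
  have "integral\<^sup>N P (?X f) = (\<integral>\<^sup>+w. (SUP n. ?X (?f n) w) \<partial>P)"
   using sup by (intro nn_integral_cong) simp
  also have "\<dots> = (SUP n. integral\<^sup>N P (?X (?f n)))"
   using mono by (intro nn_integral_monotone_convergence_SUP) (auto simp: incseq_def le_fun_def)
  also have "\<dots> = (SUP n. integral\<^sup>N P (?Y (?f n)))"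
   using bounded[OF _ _ True, of "?f n" n m for n] by (intro SUP_cong refl) auto
  also have "\<dots> = (\<integral>\<^sup>+w. (SUP n. ?Y (?f n) w) \<partial>P)"
   using mono by (intro nn_integral_monotone_convergence_SUP[symmetric]) (auto simp: incseq_def le_fun_def intro!: mult_right_mono)
  also have "\<dots> = integral\<^sup>N P (?Y f)"
  proof (intro nn_integral_cong)
   have "(SUP n. ?f n (freeze m w) * ennreal (survival m w t)) = f (freeze m w) * ennreal (survival m w t)" for w
    by (subst SUP_mult_right_ennreal[symmetric]) (simp add: sup[symmetric])
   then show "(SUP n. ?Y (?f n) w) = ?Y f w" for w by simp
  qed
  finally show ?thesis .
 qed
qed

lemma real_time_cases:
 assumes "w \<in> paths" "jump_time m w < ennreal t"
 obtains a where "jump_time m w = ennreal a" "0 \<le> a" "a < t" "jump_time (Suc m) w < ennreal t" "sojourn m w t = False"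
   "jump_time (Suc m) w = ennreal (enn2real (jump_time (Suc m) w))" "a \<le> enn2real (jump_time (Suc m) w)" "enn2real (jump_time (Suc m) w) < t"
  | a where "jump_time m w = ennreal a" "0 \<le> a" "a < t" "\<not> jump_time (Suc m) w < ennreal t" "sojourn m w t = True"
proof -
 obtain a where a: "jump_time m w = ennreal a" "0 \<le> a" using assms(2) by (cases "jump_time m w") auto
 then have at: "a < t" using assms(2) by (simp add: ennreal_less_iff)
 show thesis
 proof (cases "jump_time (Suc m) w < ennreal t")
  case True
  then obtain c where c: "jump_time (Suc m) w = ennreal c" "0 \<le> c" by (cases "jump_time (Suc m) w") auto
  have "a \<le> c" using jump_time_mono[of m "Suc m" w] a c by (simp add: ennreal_le_iff)
  moreover have "c < t" using True c by (simp add: ennreal_less_iff)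
  ultimately show thesis using a at True c by (intro that(1)[of a]) (auto simp: sojourn_def)
 next
  case False
  then show thesis using a at assms(2) by (intro that(2)[of a]) (auto simp: sojourn_def)
 qed
qed

lemma enn2real_less_iff: "x < \<infinity> \<Longrightarrow> 0 < t \<Longrightarrow> enn2real x < t \<longleftrightarrow> x < ennreal t"
 by (cases x) (auto simp: ennreal_less_iff)

text \<open>Subtraction of equal finite integrals, arranged so that only sums of extended
  nonnegative functions occur.\<close>

lemma nn_integral_cancel:
 fixes A B C D :: "'b \<Rightarrow> ennreal"
 assumes [measurable]: "A \<in> borel_measurable M" "B \<in> borel_measurable M" "C \<in> borel_measurable M" "D \<in> borel_measurable M"
  and pw: "\<And>x. x \<in> space M \<Longrightarrow> B x + C x = A x + D x"
  and eq: "(\<integral>\<^sup>+x. A x \<partial>M) = (\<integral>\<^sup>+x. B x \<partial>M)" and fin: "(\<integral>\<^sup>+x. A x \<partial>M) < \<infinity>"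
 shows "(\<integral>\<^sup>+x. D x \<partial>M) = (\<integral>\<^sup>+x. C x \<partial>M)"
proof -
 have "(\<integral>\<^sup>+x. A x \<partial>M) + (\<integral>\<^sup>+x. D x \<partial>M) = (\<integral>\<^sup>+x. A x + D x \<partial>M)"
  by (rule nn_integral_add[symmetric]) auto
 also have "\<dots> = (\<integral>\<^sup>+x. B x + C x \<partial>M)" using pw by (intro nn_integral_cong) simp
 also have "\<dots> = (\<integral>\<^sup>+x. B x \<partial>M) + (\<integral>\<^sup>+x. C x \<partial>M)" by (rule nn_integral_add) auto
 finally show ?thesis using eq fin by (auto simp: ennreal_add_left_cancel)
qed

text \<open>Write S for the survival function. The test function is f S(t) / S(s) for s < t,
  whatever the mark. Its compensator integral over the sojourn up to t is f S(t) (1 / S(x) - 1),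
  where x is the smaller of t and T_{m+1}. If the jump comes before t, the jump term exceeds this by
  f S(t); otherwise there is no jump term and the integral is f (1 - S(t)). Both cases give the
  pointwise balance needed for \<open>nn_integral_cancel\<close>.\<close>

lemma survival_law_of_identity:
 assumes "prob_space P" and P: "sets P = sets path_algebra" and id: "jump_identity P r"
 shows "survival_law P"
proof (rule survival_lawI[OF P])
 interpret prob_space P by fact
 note [measurable_cong] = P
 have spP: "space P = paths" using sets_eq_imp_space_eq[OF P] by simp
 fix m n and t :: real and f :: "'s path \<Rightarrow> ennreal" assume [measurable]: "f \<in> borel_measurable path_algebra" and f: "\<And>w. f w \<le> of_nat n" and t: "0 < t"
 define W where "W h s (j :: 's) = (if s < t then f h * ennreal (survival m h t) * ennreal (1 / survival m h s) else 0)" for h s j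
 let ?A = "\<lambda>w. next_jump W m w"
 let ?B = "\<lambda>w. \<integral>\<^sup>+t. (if sojourn m w t then csum (\<lambda>j. r (freeze m w) t j * W (freeze m w) t j) else 0) \<partial>lborel"
 have W: "marked W"
  by (rule measurable_marked) (simp only: W_def, measurable)
 have A: "?A \<in> borel_measurable path_algebra" by (rule jump_identity_measurable1[OF W])
 have B: "?B \<in> borel_measurable path_algebra" by (rule jump_identity_measurable2[OF W r_measurable])
 show "(\<integral>\<^sup>+w. (if sojourn m w t then f (freeze m w) else 0) \<partial>P) =
   (\<integral>\<^sup>+w. (if jump_time m w < ennreal t then f (freeze m w) * ennreal (survival m w t) else 0) \<partial>P)"
 proof (rule nn_integral_cancel[of ?A _ ?B])
  show "?A \<in> borel_measurable P" "?B \<in> borel_measurable P" using A B P by simp_all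
  show "(\<integral>\<^sup>+w. ?A w \<partial>P) = (\<integral>\<^sup>+w. ?B w \<partial>P)"
   using id W unfolding jump_identity_def by blast
  show "?B w + (if jump_time m w < ennreal t then f (freeze m w) * ennreal (survival m w t) else 0) =
   ?A w + (if sojourn m w t then f (freeze m w) else 0)" if "w \<in> space P" for w
  proof -
   have w: "w \<in> paths" using that spP by simp
   have inner: "csum (\<lambda>j. r (freeze m w) s j * W (freeze m w) s j) =
     f (freeze m w) * ennreal (survival m w t) * (if s < t then exit_rate (freeze m w) s * ennreal (1 / survival m w s) else 0)" for s
    by (simp add: W_def exit_rate_def nn_integral_multc mult_ac)
   have B_eq: "?B w = f (freeze m w) * ennreal (survival m w t) *
     (\<integral>\<^sup>+s. (if sojourn m w s \<and> s < t then exit_rate (freeze m w) s * ennreal (1 / survival m w s) else 0) \<partial>lborel)"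
   proof -
    have [measurable]: "(\<lambda>s. exit_rate (freeze m w) s) \<in> borel_measurable borel" "(\<lambda>s. survival m w s) \<in> borel_measurable borel"
     using measurable_exit_rate_freeze[of "\<lambda>_. w" borel "\<lambda>s. s" m] measurable_survival[of "\<lambda>_. w" borel "\<lambda>s. s" m] w by auto
    show ?thesis
     by (subst nn_integral_cmult[symmetric]) (auto intro!: nn_integral_cong simp: inner)
   qed
   show ?thesis
   proof (cases "jump_time m w < ennreal t")
    case False
    have "\<not> (sojourn m w s \<and> s < t)" for s
     using False ennreal_leI[of s t] by (auto simp: sojourn_def not_less)
    then have z: "(\<lambda>s. if sojourn m w s \<and> s < t then exit_rate (freeze m w) s * ennreal (1 / survival m w s) else 0) = (\<lambda>s. 0)"
     by (intro ext) (simp only: if_False)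
    have "?B w = 0" unfolding B_eq z by simp
    moreover have "?A w = 0"
     using False t jump_time_mono[of m "Suc m" w] by (auto simp: W_def enn2real_less_iff not_less)
    moreover have "\<not> sojourn m w t" using False by (simp add: sojourn_def)
    ultimately show ?thesis using False by simp
   next
    case True
    from w True show ?thesis
    proof (cases rule: real_time_cases)
     case (1 a)
     let ?c = "enn2real (jump_time (Suc m) w)"
     have "(sojourn m w s \<and> s < t) \<longleftrightarrow> (a < s \<and> s \<le> ?c)" for s
     proof -
      have "ennreal s \<le> jump_time (Suc m) w \<longleftrightarrow> s \<le> ?c"
       by (subst 1(6)) (simp add: ennreal_le_iff)
      then show ?thesis using 1(1,2,8) by (auto simp: sojourn_def ennreal_less_iff)
     qed
     then have "?B w = f (freeze m w) * ennreal (survival m w t) * ennreal (1 / survival m w ?c - 1)"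
      unfolding B_eq using survival_integrals(2)[OF w 1(1,2,7)] by simp
     moreover have "?A w = f (freeze m w) * ennreal (survival m w t) * ennreal (1 / survival m w ?c)"
      using 1 less_trans[of "jump_time (Suc m) w" "ennreal t" top] by (simp add: W_def)
     moreover have "ennreal (1 / survival m w ?c - 1) + 1 = ennreal (1 / survival m w ?c)"
      using survival_pos[of m w ?c] survival_le_1[of m w ?c]
      by (subst ennreal_1[symmetric], subst ennreal_plus[symmetric]) auto
     moreover have "x * u + x = x * v" if "u + 1 = v" for x u v :: ennreal
      using that by (auto simp: distrib_left)
     ultimately show ?thesis using 1(5) True by (simp only: if_True if_False add_0_right)
    next
     case (2 a)
     have AEeq: "AE s in lborel. (if sojourn m w s \<and> s < t then exit_rate (freeze m w) s * ennreal (1 / survival m w s) else 0) =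
       (if a < s \<and> s \<le> t then exit_rate (freeze m w) s * ennreal (1 / survival m w s) else 0)"
      using AE_lborel_singleton[of t]
     proof eventually_elim
      case (elim s)
      have "ennreal s \<le> jump_time (Suc m) w" if "s \<le> t"
       using that 2(4) ennreal_leI[of s t] by (auto simp: not_less intro: order_trans)
      then show ?case using elim 2 by (auto simp: sojourn_def ennreal_less_iff)
     qed
     have "?B w = f (freeze m w) * ennreal (survival m w t) * ennreal (1 / survival m w t - 1)"
      unfolding B_eq nn_integral_cong_AE[OF AEeq] using survival_integrals(2)[OF w 2(1,2), of t] 2(3) by simp
     moreover have "?A w = 0"
      using 2(4) t by (auto simp: W_def enn2real_less_iff)
     moreover have "ennreal (survival m w t) * ennreal (1 / survival m w t - 1) + ennreal (survival m w t) = 1"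
      using survival_pos[of m w t] survival_le_1[of m w t]
      by (simp add: ennreal_mult'[symmetric] ennreal_plus[symmetric] right_diff_distrib del: ennreal_plus)
     moreover have "x * y * z + x * y = x" if "y * z + y = 1" for x y z :: ennreal
      using that by (metis distrib_left mult.assoc mult.right_neutral)
     ultimately show ?thesis using 2(5) True by (simp only: if_True if_False add_0)
    qed
   qed
  qed
  \<comment> \<open>Survival decreases after the last jump, so the quotient in the test function is
    at most 1 and the jump term inherits the bound of \<open>f\<close>.\<close>
  have "?A w \<le> of_nat n" if "w \<in> space P" for w
  proof (cases "jump_time (Suc m) w < \<infinity> \<and> enn2real (jump_time (Suc m) w) < t")
   case True
   have w: "w \<in> paths" using that spP by simp
   let ?c = "enn2real (jump_time (Suc m) w)"
   have "jump_time m w \<le> jump_time (Suc m) w" by (rule jump_time_mono) simp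
   then obtain a where a: "jump_time m w = ennreal a" "0 \<le> a" "a \<le> ?c"
    using True by (cases "jump_time m w"; cases "jump_time (Suc m) w") (auto simp: top_unique)
   have "survival m w t \<le> survival m w ?c"
    using a True by (intro survival_integrals(3)[OF w a(1,2)]) auto
   then have "ennreal (survival m w t) * ennreal (1 / survival m w ?c) \<le> 1"
    using survival_pos[of m w t] survival_pos[of m w ?c]
    by (simp add: ennreal_mult'[symmetric] divide_le_eq ennreal_le_1)
   then have "f (freeze m w) * (ennreal (survival m w t) * ennreal (1 / survival m w ?c)) \<le> of_nat n * 1"
    using f by (intro mult_mono) auto
   then show ?thesis using True by (simp add: W_def mult.assoc)
  qed (auto simp: W_def)
  then have "(\<integral>\<^sup>+w. ?A w \<partial>P) \<le> (\<integral>\<^sup>+w. of_nat n \<partial>P)" by (intro nn_integral_mono) simp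
  also have "\<dots> < \<infinity>" by (simp add: emeasure_space_1 ennreal_of_nat_eq_real_of_nat less_top)
  finally show "(\<integral>\<^sup>+w. ?A w \<partial>P) < \<infinity>" .
 qed measurable
qed

text \<open>The test function \<open>f\<close> before t gives the probability 1 - S(t) of a jump
  before t; the event of no such jump is the complement.\<close>

lemma survival_law_of_law:
 assumes "prob_space P" and P: "sets P = sets path_algebra" and law: "jump_law P"
 shows "survival_law P"
proof (rule survival_lawI[OF P])
 interpret prob_space P by fact
 note [measurable_cong] = P
 have spP: "space P = paths" using sets_eq_imp_space_eq[OF P] by simp
 fix m n and t :: real and f :: "'s path \<Rightarrow> ennreal" assume [measurable]: "f \<in> borel_measurable path_algebra" and f: "\<And>w. f w \<le> of_nat n" and t: "0 < t"
 define W where "W h s (j :: 's) = (if s < t then f h else 0)" for h s j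
 have W: "marked W"
  by (rule measurable_marked) (simp only: W_def, measurable)
 let ?A = "\<lambda>w. if jump_time (Suc m) w < ennreal t then f (freeze m w) else 0"
 let ?B = "\<lambda>w. if jump_time m w < ennreal t then f (freeze m w) * ennreal (1 - survival m w t) else 0"
 show "(\<integral>\<^sup>+w. (if sojourn m w t then f (freeze m w) else 0) \<partial>P) =
   (\<integral>\<^sup>+w. (if jump_time m w < ennreal t then f (freeze m w) * ennreal (survival m w t) else 0) \<partial>P)"
 proof (rule nn_integral_cancel[of ?A _ ?B])
  have "(\<integral>\<^sup>+w. ?A w \<partial>P) = (\<integral>\<^sup>+w. next_jump W m w \<partial>P)"
   using t less_trans[of _ "ennreal t" top] by (intro nn_integral_cong) (auto simp: W_def enn2real_less_iff)
  also have "\<dots> = (\<integral>\<^sup>+w. \<integral>\<^sup>+t. (if jump_time m w < ennreal t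
   then csum (\<lambda>j. r (freeze m w) t j * W (freeze m w) t j) * ennreal (survival m w t) else 0) \<partial>lborel \<partial>P)"
   using law W unfolding jump_law_def by blast
  also have "\<dots> = (\<integral>\<^sup>+w. ?B w \<partial>P)"
  proof (intro nn_integral_cong)
   fix w assume "w \<in> space P"
   then have w: "w \<in> paths" using spP by simp
   have inner: "csum (\<lambda>j. r (freeze m w) s j * W (freeze m w) s j) =
     (if s < t then f (freeze m w) * exit_rate (freeze m w) s else 0)" for s
    by (simp add: W_def exit_rate_def nn_integral_multc mult_ac)
   have [measurable]: "(\<lambda>s. exit_rate (freeze m w) s) \<in> borel_measurable borel" "(\<lambda>s. survival m w s) \<in> borel_measurable borel"
    using measurable_exit_rate_freeze[of "\<lambda>_. w" borel "\<lambda>s. s" m] measurable_survival[of "\<lambda>_. w" borel "\<lambda>s. s" m] w by auto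
   have "(\<integral>\<^sup>+s. (if jump_time m w < ennreal s
     then csum (\<lambda>j. r (freeze m w) s j * W (freeze m w) s j) * ennreal (survival m w s) else 0) \<partial>lborel) =
    (\<integral>\<^sup>+s. f (freeze m w) * (if jump_time m w < ennreal s \<and> s < t then exit_rate (freeze m w) s * ennreal (survival m w s) else 0) \<partial>lborel)"
    unfolding inner by (intro nn_integral_cong) (auto simp: mult_ac)
   also have "\<dots> = f (freeze m w) * (\<integral>\<^sup>+s. (if jump_time m w < ennreal s \<and> s < t then exit_rate (freeze m w) s * ennreal (survival m w s) else 0) \<partial>lborel)"
    by (rule nn_integral_cmult) measurable
   also have "\<dots> = ?B w"
   proof (cases "jump_time m w < ennreal t")
    case True
    then obtain a where a: "jump_time m w = ennreal a" "0 \<le> a" "a < t"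
     by (cases "jump_time m w") (auto simp: ennreal_less_iff)
    have AEeq: "AE s in lborel. (if jump_time m w < ennreal s \<and> s < t then exit_rate (freeze m w) s * ennreal (survival m w s) else 0) =
      (if a < s \<and> s \<le> t then exit_rate (freeze m w) s * ennreal (survival m w s) else 0)"
     using AE_lborel_singleton[of t] by eventually_elim (use a in \<open>auto simp: ennreal_less_iff\<close>)
    show ?thesis unfolding nn_integral_cong_AE[OF AEeq]
     using survival_integrals(1)[OF w a(1,2), of t] a(3) True by simp
   next
    case False
    then have "\<not> (jump_time m w < ennreal s \<and> s < t)" for s
     using ennreal_leI[of s t] by (auto simp: not_less intro: order_trans dest: less_le_trans)
    then have z: "(\<lambda>s. if jump_time m w < ennreal s \<and> s < t then exit_rate (freeze m w) s * ennreal (survival m w s) else 0) = (\<lambda>s. 0)"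
     by (intro ext) (simp only: if_False)
    show ?thesis unfolding z using False by simp
   qed
   finally show "(\<integral>\<^sup>+s. (if jump_time m w < ennreal s
     then csum (\<lambda>j. r (freeze m w) s j * W (freeze m w) s j) * ennreal (survival m w s) else 0) \<partial>lborel) = ?B w" .
  qed
  finally show "(\<integral>\<^sup>+w. ?A w \<partial>P) = (\<integral>\<^sup>+w. ?B w \<partial>P)" .
  have "(\<integral>\<^sup>+w. ?A w \<partial>P) \<le> (\<integral>\<^sup>+w. of_nat n \<partial>P)" using f by (intro nn_integral_mono) simp
  also have "\<dots> < \<infinity>" by (simp add: emeasure_space_1 ennreal_of_nat_eq_real_of_nat less_top)
  finally show "(\<integral>\<^sup>+w. ?A w \<partial>P) < \<infinity>" .
  show "?B w + (if jump_time m w < ennreal t then f (freeze m w) * ennreal (survival m w t) else 0) =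
   ?A w + (if sojourn m w t then f (freeze m w) else 0)" for w
  proof -
   have "ennreal (1 - survival m w t) + ennreal (survival m w t) = 1"
    using survival_pos[of m w t] survival_le_1[of m w t] by (subst ennreal_plus[symmetric]) auto
   then have "f (freeze m w) * ennreal (1 - survival m w t) + f (freeze m w) * ennreal (survival m w t) = f (freeze m w)"
    by (metis distrib_left mult.right_neutral)
   then show ?thesis
    using jump_time_mono[of m "Suc m" w] by (auto simp: sojourn_def not_less dest: le_less_trans)
  qed
 qed measurable
qed

text \<open>With the time integral outside, \<open>survival_law\<close> replaces at each fixed t the
  indicator of the sojourn by its conditional probability; this turns the right side of one
  statement into that of the other.\<close>

lemma identity_iff_law:
 assumes "prob_space P" and P: "sets P = sets path_algebra"
 shows "jump_identity P r \<longleftrightarrow> jump_law P"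
proof -
 interpret prob_space P by fact
 note [measurable_cong] = P
 have eq: "(\<integral>\<^sup>+w. \<integral>\<^sup>+t. (if sojourn m w t then csum (\<lambda>j. r (freeze m w) t j * W (freeze m w) t j) else 0) \<partial>lborel \<partial>P)
  = (\<integral>\<^sup>+w. \<integral>\<^sup>+t. (if jump_time m w < ennreal t
    then csum (\<lambda>j. r (freeze m w) t j * W (freeze m w) t j) * ennreal (survival m w t) else 0) \<partial>lborel \<partial>P)"
  if survival: "survival_law P" and W: "marked W" for W m
 proof -
  interpret PL: pair_sigma_finite P lborel ..
  define F where "F w t = csum (\<lambda>j. r w t j * W w t j)" for w t
  have F: "(\<lambda>p. F (fst p) (snd p)) \<in> borel_measurable path_time"
   unfolding F_def using W r_measurable by (intro C.borel_measurable_nn_integral) (simp add: case_prod_beta')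
  have Ff [measurable]: "(\<lambda>x. F (f x) (g x)) \<in> borel_measurable N"
   if [measurable]: "f \<in> N \<rightarrow>\<^sub>M path_algebra" "g \<in> borel_measurable N" for f g and N :: "'n measure"
  proof -
   have "(\<lambda>x. (f x, g x)) \<in> N \<rightarrow>\<^sub>M path_time" by measurable
   from measurable_compose[OF this F] show ?thesis by simp
  qed
  have "(\<integral>\<^sup>+w. \<integral>\<^sup>+t. (if sojourn m w t then F (freeze m w) t else 0) \<partial>lborel \<partial>P) =
    (\<integral>\<^sup>+t. \<integral>\<^sup>+w. (if sojourn m w t then F (freeze m w) t else 0) \<partial>P \<partial>lborel)"
   by (rule PL.Fubini'[symmetric]) measurable
  also have "\<dots> = (\<integral>\<^sup>+t. \<integral>\<^sup>+w. (if jump_time m w < ennreal t then F (freeze m w) t * ennreal (survival m w t) else 0) \<partial>P \<partial>lborel)"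
  proof (rule nn_integral_cong)
   fix t :: real
   have "(\<lambda>w. F w t) \<in> borel_measurable path_algebra" by measurable
   from bspec[OF spec[OF spec[OF survival[unfolded survival_law_def], of m], of t] this]
   show "(\<integral>\<^sup>+w. (if sojourn m w t then F (freeze m w) t else 0) \<partial>P) =
    (\<integral>\<^sup>+w. (if jump_time m w < ennreal t then F (freeze m w) t * ennreal (survival m w t) else 0) \<partial>P)"
    .
  qed
  also have "\<dots> = (\<integral>\<^sup>+w. \<integral>\<^sup>+t. (if jump_time m w < ennreal t then F (freeze m w) t * ennreal (survival m w t) else 0) \<partial>lborel \<partial>P)"
   by (rule PL.Fubini') measurable
  finally show ?thesis unfolding F_def .
 qed
 show ?thesis
 proof
  assume id: "jump_identity P r"
  note eq' = eq[OF survival_law_of_identity[OF assms id]]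
  show "jump_law P" unfolding jump_law_def
  proof (intro allI impI)
   fix m and W :: "'s path \<Rightarrow> real \<Rightarrow> 's \<Rightarrow> ennreal" assume W: "marked W"
   from mp[OF spec[OF spec[OF id[unfolded jump_identity_def], of m], of W] W]
   show "(\<integral>\<^sup>+w. next_jump W m w \<partial>P) =
    (\<integral>\<^sup>+w. \<integral>\<^sup>+t. (if jump_time m w < ennreal t
    then csum (\<lambda>j. r (freeze m w) t j * W (freeze m w) t j) * ennreal (survival m w t) else 0) \<partial>lborel \<partial>P)"
    unfolding eq'[OF W] .
  qed
 next
  assume law: "jump_law P"
  note eq' = eq[OF survival_law_of_law[OF assms law]]
  show "jump_identity P r" unfolding jump_identity_def
  proof (intro allI impI)
   fix m and W :: "'s path \<Rightarrow> real \<Rightarrow> 's \<Rightarrow> ennreal" assume W: "marked W"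
   from mp[OF spec[OF spec[OF law[unfolded jump_law_def], of m], of W] W]
   show "(\<integral>\<^sup>+w. next_jump W m w \<partial>P) =
    (\<integral>\<^sup>+w. \<integral>\<^sup>+t. (if sojourn m w t then csum (\<lambda>j. r (freeze m w) t j * W (freeze m w) t j) else 0) \<partial>lborel \<partial>P)"
    unfolding eq'[OF W] .
  qed
 qed
qed

end

section \<open>Prolonging a frozen path by one jump; uniqueness\<close>

definition next_path :: "nat \<Rightarrow> 's path \<Rightarrow> real \<Rightarrow> 's \<Rightarrow> 's path" where
 "next_path m h t j l =
   (if l < m then h l else if l = m then (fst (h m), ennreal t - jump_time m h)
   else if l = Suc m then (Some j, \<infinity>) else (None, \<infinity>))"

text \<open>The guard keeps the value in \<open>paths\<close> for every t, so that a map into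
  \<open>path_algebra\<close> results.\<close>

definition extend_path :: "nat \<Rightarrow> 's path \<Rightarrow> real \<Rightarrow> 's \<Rightarrow> 's path" where
 "extend_path m h t j = (if jump_time m h < ennreal t then next_path m h t j else h)"

definition start_path :: "'s \<Rightarrow> 's path" where
 "start_path i l = (if l = 0 then (Some i, \<infinity>) else (None, \<infinity>))"

lemma freeze_Suc_eq_next_path:
 assumes "w \<in> paths" "jump_time (Suc m) w < \<infinity>"
 shows "freeze (Suc m) w = next_path m (freeze m w) (enn2real (jump_time (Suc m) w)) (the (jump_state (Suc m) w))"
proof
 fix l
 have "jump_time m w < \<infinity>" using assms(2) jump_time_mono[of m "Suc m" w] by (auto intro: le_less_trans)
 then have snd: "jump_time (Suc m) w - jump_time m w = snd (w m)"
  by (simp add: jump_time_Suc less_top)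
 obtain j where j: "jump_state (Suc m) w = Some j" using jump_state_Some[OF assms] by blast
 have T: "ennreal (enn2real (jump_time (Suc m) w)) = jump_time (Suc m) w" using assms(2) by (simp add: less_top)
 consider "l < m" | "l = m" | "l = Suc m" | "l > Suc m" by linarith
 then show "freeze (Suc m) w l = next_path m (freeze m w) (enn2real (jump_time (Suc m) w)) (the (jump_state (Suc m) w)) l"
 proof cases
  case 2
  then have "freeze (Suc m) w l = w m" "fst (freeze m w m) = fst (w m)" by (simp_all add: freeze_def)
  then show ?thesis using 2 T snd by (simp add: next_path_def jump_time_freeze prod_eq_iff)
 next
  case 3
  then show ?thesis using j by (simp add: freeze_def next_path_def jump_state_def)
 qed (simp_all add: freeze_def next_path_def)
qed

lemma jump_time_next_path:
 assumes "jump_time m h < ennreal t"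
 shows "k \<le> m \<Longrightarrow> jump_time k (next_path m h t j) = jump_time k h"
  and "jump_time (Suc m) (next_path m h t j) = ennreal t"
proof -
 have *: "jump_time k (next_path m h t j) = jump_time k h" if "k \<le> m" for k
  unfolding jump_time_def by (intro sum.cong) (use that in \<open>auto simp: next_path_def\<close>)
 then show "k \<le> m \<Longrightarrow> jump_time k (next_path m h t j) = jump_time k h" .
 have "jump_time m h + (ennreal t - jump_time m h) = ennreal t"
  using assms by (intro add_diff_inverse_ennreal) simp
 then show "jump_time (Suc m) (next_path m h t j) = ennreal t"
  unfolding jump_time_Suc *[OF order_refl] by (simp add: next_path_def)
qed

lemma next_path_in_paths:
 assumes h: "h \<in> paths" and t: "jump_time m h < ennreal t"
 shows "next_path m h t j \<in> paths"
proof -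
 have fin: "jump_time m h < \<infinity>" using t less_trans[of _ "ennreal t" top] by auto
 obtain i where i: "jump_state m h = Some i" using jump_state_Some[OF h fin] by blast
 have pos: "0 < ennreal t - jump_time m h" using t by (simp add: diff_gr0_ennreal)
 have nt: "ennreal t - jump_time m h \<noteq> \<infinity>" by (simp add: ennreal_minus_eq_top)
 have c: "l < m \<or> l = m \<or> l > m" for l by linarith
 have "0 < snd (next_path m h t j l) \<and> (snd (next_path m h t j l) = \<infinity> \<longleftrightarrow> fst (next_path m h t j (Suc l)) = None) \<and>
     (fst (next_path m h t j l) = None \<longrightarrow> snd (next_path m h t j l) = \<infinity>)" for l
  using c[of l]
 proof (elim disjE)
  assume l: "l < m"
  then have "fst (next_path m h t j (Suc l)) = fst (h (Suc l))" "next_path m h t j l = h l"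
   by (auto simp: next_path_def) (metis Suc_lessI fst_conv)
  then show ?thesis using h by (simp add: paths_iff)
 next
  assume "l = m"
  then show ?thesis using pos nt i by (auto simp: next_path_def jump_state_def)
 qed (auto simp: next_path_def)
 moreover have "fst (next_path m h t j 0) = fst (h 0)"
  by (cases m) (auto simp: next_path_def)
 ultimately show ?thesis using h by (simp add: paths_iff)
qed

lemma extend_path_in_paths: "h \<in> paths \<Longrightarrow> extend_path m h t j \<in> paths"
 by (simp add: extend_path_def next_path_in_paths)

lemma freeze_next_path: "freeze m (next_path m h t j) = freeze m h"
 by (auto simp: freeze_def next_path_def fun_eq_iff)

lemma freeze_Suc_next_path: "freeze (Suc m) (next_path m h t j) = next_path m h t j"
 by (auto simp: freeze_def next_path_def fun_eq_iff)

lemma freeze_freeze_ge: "m \<le> n \<Longrightarrow> freeze n (freeze m w) = freeze m w"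
 by (auto simp: freeze_def fun_eq_iff)

lemma jump_state_next_path: "jump_state (Suc m) (next_path m h t j) = Some j"
 by (simp add: jump_state_def next_path_def)

lemma start_path_in_paths: "start_path i \<in> paths"
 by (simp add: paths_iff start_path_def)

lemma freeze_0_eq_start_path: "jump_state 0 w = Some i \<Longrightarrow> freeze 0 w = start_path i"
 by (auto simp: freeze_def start_path_def jump_state_def fun_eq_iff)

lemma freeze_start_path: "freeze m (start_path i) = start_path i"
 by (auto simp: freeze_def start_path_def fun_eq_iff)

lemma jump_state_start_path: "jump_state 0 (start_path i) = Some i"
 by (simp add: jump_state_def start_path_def)

lemma measurable_extend_path [measurable]:
 assumes [measurable]: "f \<in> M \<rightarrow>\<^sub>M path_algebra" "g \<in> borel_measurable M"
 shows "(\<lambda>x. extend_path m (f x) (g x) j) \<in> M \<rightarrow>\<^sub>M path_algebra"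
proof (rule measurable_into_path_algebra)
 fix x assume "x \<in> space M"
 then show "extend_path m (f x) (g x) j \<in> paths"
  using measurable_space[OF assms(1)] by (simp add: extend_path_in_paths)
next
 fix l
 have [measurable]: "(\<lambda>x. f x k) \<in> M \<rightarrow>\<^sub>M count_space UNIV \<Otimes>\<^sub>M borel" for k
  by (rule measurable_compose[OF assms(1)]) measurable
 have [measurable]: "(\<lambda>x. next_path m (f x) (g x) j l) \<in> M \<rightarrow>\<^sub>M count_space UNIV \<Otimes>\<^sub>M borel"
  unfolding next_path_def by (cases "l < m"; cases "l = m"; cases "l = Suc m") simp_all
 have "(\<lambda>x. extend_path m (f x) (g x) j l) = (\<lambda>x. if jump_time m (f x) < ennreal (g x) then next_path m (f x) (g x) j l else f x l)"
  by (simp add: extend_path_def fun_eq_iff)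
 also have "\<dots> \<in> M \<rightarrow>\<^sub>M count_space UNIV \<Otimes>\<^sub>M borel" by measurable
 finally show "(\<lambda>x. extend_path m (f x) (g x) j l) \<in> M \<rightarrow>\<^sub>M count_space UNIV \<Otimes>\<^sub>M borel" .
qed

lemma initial_law:
 fixes P :: "'s::countable path measure"
 assumes "prob_space P" and P: "sets P = sets path_algebra"
  and init: "\<And>i. measure P {w \<in> paths. state_at 0 w = Some i} = pmf \<gamma> i"
 shows "distr P path_algebra (freeze 0) = distr (measure_pmf \<gamma>) path_algebra start_path"
proof -
 interpret prob_space P by fact
 note [measurable_cong] = P
 have spP: "space P = paths" using sets_eq_imp_space_eq[OF P] by simp
 have some: "jump_state 0 w = Some (the (jump_state 0 w))" if "w \<in> paths" for w :: "'s path"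
  using jump_state_Some[OF that, of 0] by auto
 have "distr P (count_space UNIV) (\<lambda>w. the (jump_state 0 w)) = measure_pmf \<gamma>"
 proof (rule measure_eqI_countable[of _ UNIV])
  fix i
  have "emeasure (distr P (count_space UNIV) (\<lambda>w. the (jump_state 0 w))) {i}
    = emeasure P {w \<in> paths. state_at 0 w = Some i}"
   using some by (subst emeasure_distr) (auto intro!: arg_cong[where f="emeasure P"] simp: spP state_at_0)
  also have "\<dots> = emeasure (measure_pmf \<gamma>) {i}"
   by (simp add: emeasure_eq_measure init emeasure_pmf_single)
  finally show "emeasure (distr P (count_space UNIV) (\<lambda>w. the (jump_state 0 w))) {i} = emeasure (measure_pmf \<gamma>) {i}" .
 qed auto
 then have "distr (measure_pmf \<gamma>) path_algebra start_path =
  distr (distr P (count_space UNIV) (\<lambda>w. the (jump_state 0 w))) path_algebra start_path" by simp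
 also have "\<dots> = distr P path_algebra (start_path \<circ> (\<lambda>w. the (jump_state 0 w)))"
  using start_path_in_paths by (intro distr_distr) auto
 also have "\<dots> = distr P path_algebra (freeze 0)"
  using freeze_0_eq_start_path[OF some] by (intro distr_cong) (auto simp: spP)
 finally show ?thesis ..
qed

context bounded_jump_rates
begin

definition jump_part :: "nat \<Rightarrow> ('s path \<Rightarrow> real \<Rightarrow> 's \<Rightarrow> ennreal) \<Rightarrow> 's path \<Rightarrow> ennreal" where
 "jump_part m W w = (\<integral>\<^sup>+t. (if jump_time m w < ennreal t
    then csum (\<lambda>j. r (freeze m w) t j * W (freeze m w) t j) * ennreal (survival m w t) else 0) \<partial>lborel)"

lemma jump_part_freeze: "jump_part m W (freeze m w) = jump_part m W w"
 by (simp add: jump_part_def jump_time_freeze cong: if_cong)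

lemma measurable_jump_part:
 assumes W: "marked W"
 shows "jump_part m W \<in> borel_measurable path_algebra"
proof -
 define F where "F w t = csum (\<lambda>j. r w t j * W w t j)" for w t
 have F: "(\<lambda>p. F (fst p) (snd p)) \<in> borel_measurable path_time"
  unfolding F_def using W r_measurable by (intro C.borel_measurable_nn_integral) (simp add: case_prod_beta')
 have "(\<lambda>p. (freeze m (fst p), snd p)) \<in> path_time \<rightarrow>\<^sub>M path_time" by measurable
 from measurable_compose[OF this F]
 have [measurable]: "(\<lambda>p. F (freeze m (fst p)) (snd p)) \<in> borel_measurable path_time" by simp
 have "(\<lambda>p. if jump_time m (fst p) < ennreal (snd p) then F (freeze m (fst p)) (snd p) * ennreal (survival m (fst p) (snd p)) else 0)
   \<in> borel_measurable (path_algebra \<Otimes>\<^sub>M lborel)" by measurable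
 then show ?thesis
  unfolding jump_part_def[abs_def] F_def[symmetric]
  by (intro lborel.borel_measurable_nn_integral) (simp add: case_prod_beta')
qed

lemma jump_law_integral:
 assumes "jump_law P" "marked W"
 shows "(\<integral>\<^sup>+w. next_jump W m w \<partial>P) =
   (\<integral>\<^sup>+w. jump_part m W w \<partial>P)"
 unfolding jump_part_def by (rule mp[OF spec[OF spec[OF assms(1)[unfolded jump_law_def], of m], of W] assms(2)])

text \<open>The next frozen history is either a prolongation of the present one, whose law
  \<open>jump_law\<close> gives, or the present one itself if no further jump comes. The latter part
  is accessible only as a difference: everything minus the part with a jump.\<close>

lemma jump_law_freeze_unique:
 assumes P: "prob_space P" "sets P = sets path_algebra" "jump_law P"
  and Q: "prob_space Q" "sets Q = sets path_algebra" "jump_law Q"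
  and 0: "distr P path_algebra (freeze 0) = distr Q path_algebra (freeze 0)"
 shows "distr P path_algebra (freeze m) = distr Q path_algebra (freeze m)"
proof (induction m)
 case (Suc m)
 have IH: "(\<integral>\<^sup>+w. f (freeze m w) \<partial>P) = (\<integral>\<^sup>+w. f (freeze m w) \<partial>Q)" if f: "f \<in> borel_measurable path_algebra" for f :: "'s path \<Rightarrow> ennreal"
 proof -
  have "(\<integral>\<^sup>+w. f (freeze m w) \<partial>R) = (\<integral>\<^sup>+w. f w \<partial>distr R path_algebra (freeze m))" if "sets R = sets path_algebra" for R
   using f by (intro nn_integral_distr[symmetric]) (auto simp: measurable_cong_sets[OF that refl])
  then show ?thesis using P Q Suc by simp
 qed
 show ?case
 proof (rule measure_eqI)
  fix E assume "E \<in> sets (distr P path_algebra (freeze (Suc m)))"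
  then have E [measurable]: "E \<in> sets path_algebra" by simp
  let ?W1 = "\<lambda>h t (j :: 's). indicator E (extend_path m h t j) :: ennreal"
  let ?W2 = "\<lambda>h (t :: real) (j :: 's). indicator E h :: ennreal"
  have W1: "marked ?W1"
   by (rule measurable_marked) measurable
  have W2: "marked ?W2"
   by (rule measurable_marked) measurable
  let ?A = "\<lambda>w. next_jump ?W1 m w"
  let ?B = "\<lambda>w. next_jump ?W2 m w"
  let ?C = "\<lambda>w. if jump_time (Suc m) w < \<infinity> then 0 else indicator E (freeze m w) :: ennreal"
  have eq1: "(\<integral>\<^sup>+w. ?A w \<partial>P) = (\<integral>\<^sup>+w. ?A w \<partial>Q)"
   using IH[OF measurable_jump_part[OF W1, of m]]
   unfolding jump_law_integral[OF P(3) W1] jump_law_integral[OF Q(3) W1] jump_part_freeze .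
  have eq2: "(\<integral>\<^sup>+w. ?B w \<partial>P) = (\<integral>\<^sup>+w. ?B w \<partial>Q)"
   using IH[OF measurable_jump_part[OF W2, of m]]
   unfolding jump_law_integral[OF P(3) W2] jump_law_integral[OF Q(3) W2] jump_part_freeze .
  have mA: "?A \<in> borel_measurable path_algebra" and mB: "?B \<in> borel_measurable path_algebra" and mC: "?C \<in> borel_measurable path_algebra"
   using jump_identity_measurable1[OF W1] jump_identity_measurable1[OF W2] by simp_all
  have fin: "(\<integral>\<^sup>+w. ?B w \<partial>R) \<noteq> \<infinity>" if "prob_space R" for R
  proof -
   interpret prob_space R by fact
   have "(\<integral>\<^sup>+w. ?B w \<partial>R) \<le> (\<integral>\<^sup>+w. 1 \<partial>R)" by (intro nn_integral_mono) (auto split: split_indicator)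
   then show ?thesis by (auto simp: emeasure_space_1 top_unique)
  qed
  have sumBC: "(\<integral>\<^sup>+w. ?B w \<partial>R) + (\<integral>\<^sup>+w. ?C w \<partial>R) = (\<integral>\<^sup>+w. indicator E (freeze m w) \<partial>R)"
   if "sets R = sets path_algebra" for R
   using mB mC by (subst nn_integral_add[symmetric]) (auto simp: measurable_cong_sets[OF that refl] intro!: nn_integral_cong)
  have "(\<integral>\<^sup>+w. ?B w \<partial>Q) + (\<integral>\<^sup>+w. ?C w \<partial>P) = (\<integral>\<^sup>+w. ?B w \<partial>Q) + (\<integral>\<^sup>+w. ?C w \<partial>Q)"
  proof -
   have "(\<integral>\<^sup>+w. indicator E (freeze m w) \<partial>P) = (\<integral>\<^sup>+w. indicator E (freeze m w) \<partial>Q)"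
    by (rule IH) simp
   then show ?thesis unfolding sumBC[OF P(2), symmetric] sumBC[OF Q(2), symmetric] unfolding eq2 .
  qed
  then have eqC: "(\<integral>\<^sup>+w. ?C w \<partial>P) = (\<integral>\<^sup>+w. ?C w \<partial>Q)"
   using fin[OF Q(1)] unfolding ennreal_add_left_cancel by blast
  have em: "emeasure (distr R path_algebra (freeze (Suc m))) E = (\<integral>\<^sup>+w. ?A w \<partial>R) + (\<integral>\<^sup>+w. ?C w \<partial>R)"
   if R: "sets R = sets path_algebra" for R
  proof -
   have mf: "freeze (Suc m) \<in> R \<rightarrow>\<^sub>M path_algebra" by (simp add: measurable_cong_sets[OF R refl])
   have "emeasure (distr R path_algebra (freeze (Suc m))) E = (\<integral>\<^sup>+w. indicator E w \<partial>distr R path_algebra (freeze (Suc m)))"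
    by simp
   also have "\<dots> = (\<integral>\<^sup>+w. indicator E (freeze (Suc m) w) \<partial>R)"
    by (rule nn_integral_distr[OF mf]) simp
   also have "\<dots> = (\<integral>\<^sup>+w. ?A w + ?C w \<partial>R)"
   proof (rule nn_integral_cong)
    fix w assume "w \<in> space R"
    then have w: "w \<in> paths" using sets_eq_imp_space_eq[OF R] by simp
    show "indicator E (freeze (Suc m) w) = ?A w + ?C w"
    proof (cases "jump_time (Suc m) w < \<infinity>")
     case True
     have "jump_time m w < jump_time (Suc m) w"
      using True jump_time_mono[of m "Suc m" w] by (intro jump_time_less_Suc w) (auto intro: le_less_trans)
     then have "extend_path m (freeze m w) (enn2real (jump_time (Suc m) w)) (the (jump_state (Suc m) w)) = freeze (Suc m) w"
      using True by (simp add: extend_path_def freeze_Suc_eq_next_path[OF w] jump_time_freeze less_top)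
     then show ?thesis using True by simp
    next
     case False
     then have top: "jump_time (Suc m) w = \<infinity>" by (simp add: less_top[symmetric])
     have "freeze (Suc m) w = freeze (Suc m) (freeze m w)" using freeze_eq_self[OF w top] by simp
     then show ?thesis using False by (simp add: freeze_freeze_ge)
    qed
   qed
   also have "\<dots> = (\<integral>\<^sup>+w. ?A w \<partial>R) + (\<integral>\<^sup>+w. ?C w \<partial>R)"
    using mA mC by (intro nn_integral_add) (simp_all only: measurable_cong_sets[OF R refl])
   finally show ?thesis .
  qed
  show "emeasure (distr P path_algebra (freeze (Suc m))) E = emeasure (distr Q path_algebra (freeze (Suc m))) E"
   unfolding em[OF P(2)] em[OF Q(2)] eq1 eqC by (rule refl)
 qed simp
qed (rule 0)

text \<open>Events depending on some frozen path generate the sigma-algebra. They are stable under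
  intersection, because events at m and at n are both events at max m n.\<close>

lemma jump_law_unique:
 assumes P: "prob_space P" "sets P = sets path_algebra" "jump_law P"
  and Q: "prob_space Q" "sets Q = sets path_algebra" "jump_law Q"
  and 0: "distr P path_algebra (freeze 0) = distr Q path_algebra (freeze 0)"
 shows "P = Q"
proof -
 interpret P: prob_space P by fact
 interpret Q: prob_space Q by fact
 let ?E = "{freeze m -` B \<inter> paths | m B. B \<in> sets (path_algebra :: 's path measure)}"
 have spP: "space P = paths" and spQ: "space Q = paths" using sets_eq_imp_space_eq[OF P(2)] sets_eq_imp_space_eq[OF Q(2)] by simp_all
 have sub: "?E \<subseteq> sets path_algebra"
 proof
  fix X assume "X \<in> ?E"
  then obtain m B where X: "X = freeze m -` B \<inter> paths" "B \<in> sets (path_algebra :: 's path measure)" by blast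
  show "X \<in> sets path_algebra" unfolding X(1) using measurable_sets[OF measurable_freeze X(2), of m] by simp
 qed
 have "sigma_sets paths ?E = sets (path_algebra :: 's path measure)"
 proof
  show "sigma_sets paths ?E \<subseteq> sets path_algebra"
   using sets.sigma_sets_subset[OF sub] by simp
  have "(history_events :: 's path set set) \<subseteq> ?E"
  proof
   fix X :: "'s path set" assume X: "X \<in> history_events"
   then obtain k s j where "X = {w \<in> paths. jump_time k w \<le> ennreal s \<and> jump_state k w = Some j}"
    by (auto simp: history_events_def)
   then have "X = freeze k -` X \<inter> paths"
    by (auto simp: jump_time_freeze jump_state_freeze freeze_in_paths)
   moreover have "X \<in> sets path_algebra" using X unfolding sets_path_algebra_eq by (rule sigma_sets.Basic)
   ultimately show "X \<in> ?E" by blast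
  qed
  then show "sets (path_algebra :: 's path measure) \<subseteq> sigma_sets paths ?E"
   unfolding sets_path_algebra_eq by (rule sigma_sets_mono')
 qed
 note gen = this
 show ?thesis
 proof (rule measure_eqI_generator_eq[where \<Omega>=paths and E="?E" and A="\<lambda>_. paths"])
  show "Int_stable ?E"
  proof (rule Int_stableI)
   fix X Y assume "X \<in> ?E" "Y \<in> ?E"
   then obtain m B n C where X: "X = freeze m -` B \<inter> paths" "B \<in> sets (path_algebra :: 's path measure)"
    and Y: "Y = freeze n -` C \<inter> paths" "C \<in> sets (path_algebra :: 's path measure)" by blast
   let ?k = "max m n"
   let ?D = "(freeze m -` B \<inter> paths) \<inter> (freeze n -` C \<inter> paths)"
   have "?D \<in> sets path_algebra"
    using measurable_sets[OF measurable_freeze X(2), of m] measurable_sets[OF measurable_freeze Y(2), of n] by simp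
   moreover have "X \<inter> Y = freeze ?k -` ?D \<inter> paths"
    unfolding X(1) Y(1) by (auto simp: freeze_freeze freeze_in_paths)
   ultimately show "X \<inter> Y \<in> ?E" by blast
  qed
  show "?E \<subseteq> Pow paths" by auto
  fix X assume "X \<in> ?E"
  then obtain m B where X: "X = freeze m -` B \<inter> paths" "B \<in> sets (path_algebra :: 's path measure)" by blast
  have "emeasure R X = emeasure (distr R path_algebra (freeze m)) B" if "sets R = sets path_algebra" for R
   using X sets_eq_imp_space_eq[OF that]
   by (subst emeasure_distr) (auto simp: measurable_cong_sets[OF that refl])
  then show "emeasure P X = emeasure Q X"
   using P(2) Q(2) jump_law_freeze_unique[OF P Q 0, of m] by simp
 next
  show "sets P = sigma_sets paths ?E" "sets Q = sigma_sets paths ?E" using gen P(2) Q(2) by simp_all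
  have "paths = freeze 0 -` paths \<inter> (paths :: 's path set)" using freeze_in_paths by auto
  moreover have "paths \<in> sets (path_algebra :: 's path measure)"
   using sets.top[of "path_algebra :: 's path measure"] by simp
  ultimately have "paths \<in> ?E" by blast
  then show "range (\<lambda>_. paths) \<subseteq> ?E" by (rule image_subsetI)
  show "emeasure P paths \<noteq> \<infinity>" using P.emeasure_space_1 spP by simp
 qed auto
qed

end

section \<open>Construction of the process\<close>

lemma nn_integral_count_option:
 fixes f :: "'s option \<Rightarrow> ennreal"
 shows "csum (\<lambda>x. f x) = f None + csum (\<lambda>j. f (Some j))"
proof -
 have "csum (\<lambda>x. f x) =
   csum (\<lambda>x. f x * indicator {None} x + f x * indicator (range Some) x)"
 proof (rule nn_integral_cong)
  fix x :: "'s option"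
  show "f x = f x * indicator {None} x + f x * indicator (range Some) x" by (cases x) simp_all
 qed
 also have "\<dots> = csum (\<lambda>x. f x * indicator {None} x) + csum (\<lambda>x. f x * indicator (range Some) x)"
  by (intro nn_integral_add) auto
 also have "csum (\<lambda>x. f x * indicator {None} x) = f None"
  by (subst nn_integral_count_space'[of "{None}"]) auto
 also have "csum (\<lambda>x. f x * indicator (range Some) x) = (\<integral>\<^sup>+x. f x \<partial>count_space (range Some))"
  by (subst nn_integral_restrict_space[symmetric]) (auto simp: restrict_count_space)
 also have "\<dots> = csum (\<lambda>j. f (Some j))"
  by (rule nn_integral_bij_count_space[symmetric]) (auto simp: bij_betw_def)
 finally show ?thesis .
qed

lemma pred_path_eq:
 assumes [measurable]: "f \<in> M \<rightarrow>\<^sub>M path_algebra" "g \<in> M \<rightarrow>\<^sub>M (path_algebra :: 's::countable path measure)"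
 shows "Measurable.pred M (\<lambda>x. f x = g x)"
proof -
 have [measurable]: "(\<lambda>x. h x k) \<in> M \<rightarrow>\<^sub>M count_space UNIV \<Otimes>\<^sub>M borel" if h: "h \<in> M \<rightarrow>\<^sub>M (path_algebra :: 's path measure)" for h k
  by (rule measurable_compose[OF h]) measurable
 have eq: "(f x = g x) \<longleftrightarrow> (\<forall>l. (\<exists>c. fst (f x l) = c \<and> fst (g x l) = c) \<and> snd (f x l) \<le> snd (g x l) \<and> snd (g x l) \<le> snd (f x l))" for x
  by (auto simp: fun_eq_iff prod_eq_iff intro: antisym)
 have "Measurable.pred M (\<lambda>x. \<forall>l. (\<exists>c. fst (f x l) = c \<and> fst (g x l) = c) \<and> snd (f x l) \<le> snd (g x l) \<and> snd (g x l) \<le> snd (f x l))"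
  using assms by measurable
 then show ?thesis unfolding eq .
qed

context bounded_jump_rates
begin

text \<open>Conditional probability, given the history, that a further jump occurs; it may be less
  than 1, and \<open>step_density\<close> gives the defect to \<open>None\<close>.\<close>

definition total :: "nat \<Rightarrow> 's path \<Rightarrow> ennreal" where
 "total m = jump_part m (\<lambda>_ _ _. 1)"

lemma measurable_total [measurable]: "total m \<in> borel_measurable path_algebra"
 unfolding total_def by (rule measurable_jump_part, rule measurable_marked) simp

lemma total_le_1:
 assumes w: "w \<in> paths" shows "total m w \<le> 1"
proof (cases "jump_time m w < \<infinity>")
 case False
 then have "\<not> jump_time m w < ennreal t" for t using less_trans[of "jump_time m w" "ennreal t" top] by auto
 then show ?thesis unfolding total_def jump_part_def by simp
next
 case True
 then obtain a where a: "jump_time m w = ennreal a" "0 \<le> a" by (cases "jump_time m w") auto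
 have [measurable]: "(\<lambda>s. exit_rate (freeze m w) s) \<in> borel_measurable borel" "(\<lambda>s. survival m w s) \<in> borel_measurable borel"
  using measurable_exit_rate_freeze[of "\<lambda>_. w" borel "\<lambda>s. s" m] measurable_survival[of "\<lambda>_. w" borel "\<lambda>s. s" m] w by auto
 let ?f = "\<lambda>n s. if a < s \<and> s \<le> a + real n then exit_rate (freeze m w) s * ennreal (survival m w s) else 0"
 have "total m w = (\<integral>\<^sup>+s. (SUP n. ?f n s) \<partial>lborel)"
  unfolding total_def jump_part_def
 proof (rule nn_integral_cong)
  fix s
  show "(if jump_time m w < ennreal s then csum (\<lambda>j. r (freeze m w) s j * 1) * ennreal (survival m w s) else 0) = (SUP n. ?f n s)"
  proof (cases "a < s")
   case True
   obtain n where n: "s - a \<le> real n" using real_arch_simple by blast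
   have "exit_rate (freeze m w) s * ennreal (survival m w s) \<le> (SUP n. ?f n s)"
    using n True by (intro SUP_upper2[of n]) auto
   moreover have "(SUP n. ?f n s) \<le> exit_rate (freeze m w) s * ennreal (survival m w s)"
    by (intro SUP_least) auto
   ultimately show ?thesis using True a by (simp add: exit_rate_def ennreal_less_iff antisym)
  next
   case False
   then show ?thesis using a by (simp add: ennreal_less_iff)
  qed
 qed
 also have "\<dots> = (SUP n. \<integral>\<^sup>+s. ?f n s \<partial>lborel)"
  by (intro nn_integral_monotone_convergence_SUP incseq_SucI le_funI) auto
 also have "\<dots> \<le> 1"
 proof (rule SUP_least)
  fix n
  have "(\<integral>\<^sup>+s. ?f n s \<partial>lborel) = ennreal (1 - survival m w (a + real n))"
   by (rule survival_integrals(1)[OF w a]) simp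
  also have "\<dots> \<le> ennreal 1" using survival_pos[of m w "a + real n"] by (intro ennreal_leI) simp
  finally show "(\<integral>\<^sup>+s. ?f n s \<partial>lborel) \<le> 1" by simp
 qed
 finally show ?thesis .
qed

text \<open>The mark \<open>None\<close> says that no further jump occurs; its mass is spread over an arbitrary unit interval.\<close>
definition step_density :: "nat \<Rightarrow> 's path \<Rightarrow> real \<times> 's option \<Rightarrow> ennreal" where
 "step_density m h p = (case snd p of
   Some j \<Rightarrow> if jump_time m h < ennreal (fst p) then r (freeze m h) (fst p) j * ennreal (survival m h (fst p)) else 0
  | None \<Rightarrow> if 0 < fst p \<and> fst p \<le> 1 then 1 - total m h else 0)"

definition step_map :: "nat \<Rightarrow> 's path \<Rightarrow> real \<times> 's option \<Rightarrow> 's path" where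
 "step_map m h p = (case snd p of Some j \<Rightarrow> extend_path m (freeze m h) (fst p) j | None \<Rightarrow> h)"

definition step_kernel :: "nat \<Rightarrow> 's path \<Rightarrow> 's path measure" where
 "step_kernel m h = distr (density (lborel \<Otimes>\<^sub>M count_space UNIV) (step_density m h)) path_algebra (step_map m h)"

lemma measurable_r_section:
 assumes "h \<in> paths" shows "(\<lambda>t. r h t j) \<in> borel_measurable borel"
proof -
 have "(\<lambda>t. ((h, t), j)) \<in> borel \<rightarrow>\<^sub>M path_time \<Otimes>\<^sub>M count_space UNIV"
  using assms by (intro measurable_Pair) auto
 from measurable_compose[OF this r_measurable] show ?thesis by simp
qed

lemma nn_integral_step_kernel:
 assumes h: "h \<in> paths" and F [measurable]: "F \<in> borel_measurable path_algebra"
 shows "(\<integral>\<^sup>+w. F w \<partial>step_kernel m h) =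
  jump_part m (\<lambda>g t j. F (extend_path m g t j)) h + (1 - total m h) * F h"
proof -
 let ?K = "\<lambda>t. csum (\<lambda>j. r (freeze m h) t j * F (extend_path m (freeze m h) t j))"
 have fh: "freeze m h \<in> paths" by (rule freeze_in_paths[OF h])
 have [measurable]: "(\<lambda>t. r (freeze m h) t j) \<in> borel_measurable borel" for j by (rule measurable_r_section[OF fh])
 have [measurable]: "(\<lambda>s. survival m h s) \<in> borel_measurable borel"
  using measurable_survival[of "\<lambda>_. h" borel "\<lambda>s. s" m] h by auto
 have [measurable]: "(\<lambda>t. extend_path m (freeze m h) t j) \<in> borel \<rightarrow>\<^sub>M path_algebra" for j
  using measurable_extend_path[of "\<lambda>_. freeze m h" borel "\<lambda>t. t" m j] fh by simp
 have d: "step_density m h \<in> borel_measurable (lborel \<Otimes>\<^sub>M count_space UNIV)"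
 proof (rule measurable_from_pair_count)
  fix x show "(\<lambda>t. step_density m h (t, x)) \<in> borel_measurable lborel"
   unfolding step_density_def by (cases x) (simp_all cong: if_cong)
 qed
 have k: "step_map m h \<in> lborel \<Otimes>\<^sub>M count_space UNIV \<rightarrow>\<^sub>M path_algebra"
 proof (rule measurable_from_pair_count)
  fix x show "(\<lambda>t. step_map m h (t, x)) \<in> lborel \<rightarrow>\<^sub>M path_algebra"
   unfolding step_map_def using h by (cases x) (simp_all cong: if_cong)
 qed
 have Fk: "(\<lambda>p. F (step_map m h p)) \<in> borel_measurable (lborel \<Otimes>\<^sub>M count_space UNIV)"
  by (rule measurable_compose[OF k F])
 have "(\<integral>\<^sup>+w. F w \<partial>step_kernel m h) = (\<integral>\<^sup>+p. F (step_map m h p) \<partial>density (lborel \<Otimes>\<^sub>M count_space UNIV) (step_density m h))"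
  unfolding step_kernel_def using k by (intro nn_integral_distr) (auto simp: F)
 also have "\<dots> = (\<integral>\<^sup>+p. step_density m h p * F (step_map m h p) \<partial>(lborel \<Otimes>\<^sub>M count_space UNIV))"
  by (rule nn_integral_density[OF d Fk])
 also have "\<dots> = (\<integral>\<^sup>+t. csum (\<lambda>x. step_density m h (t, x) * F (step_map m h (t, x))) \<partial>lborel)"
  by (rule C.nn_integral_fst[symmetric]) (use d Fk in measurable)
 also have "\<dots> = (\<integral>\<^sup>+t. (1 - total m h) * F h * indicator {0<..1} t +
   (if jump_time m h < ennreal t then ?K t * ennreal (survival m h t) else 0) \<partial>lborel)"
 proof (rule nn_integral_cong)
  fix t :: real
  have 1: "step_density m h (t, None) * F (step_map m h (t, None)) = (1 - total m h) * F h * indicator {0<..1} t"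
   by (auto simp: step_density_def step_map_def split: split_indicator)
  have 2: "csum (\<lambda>j. step_density m h (t, Some j) * F (step_map m h (t, Some j))) =
   (if jump_time m h < ennreal t then ?K t * ennreal (survival m h t) else 0)"
  proof (cases "jump_time m h < ennreal t")
   case True
   have "csum (\<lambda>j. step_density m h (t, Some j) * F (step_map m h (t, Some j))) =
    csum (\<lambda>j. (r (freeze m h) t j * F (extend_path m (freeze m h) t j)) * ennreal (survival m h t))"
    using True by (intro nn_integral_cong) (simp add: step_density_def step_map_def mult_ac)
   also have "\<dots> = ?K t * ennreal (survival m h t)"
    by (rule nn_integral_multc) simp
   finally show ?thesis using True by simp
  qed (simp add: step_density_def)
  show "csum (\<lambda>x. step_density m h (t, x) * F (step_map m h (t, x))) =
   (1 - total m h) * F h * indicator {0<..1} t +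
   (if jump_time m h < ennreal t then ?K t * ennreal (survival m h t) else 0)"
   unfolding nn_integral_count_option 1 2 ..
 qed
 also have "\<dots> = (\<integral>\<^sup>+t. (1 - total m h) * F h * indicator {0<..1::real} t \<partial>lborel) +
   jump_part m (\<lambda>g t j. F (extend_path m g t j)) h"
  unfolding jump_part_def
 proof (rule nn_integral_add)
  have [measurable]: "(\<lambda>t. ?K t) \<in> borel_measurable borel"
   by (intro C.borel_measurable_nn_integral measurable_from_pair_count) simp
  show "(\<lambda>t. if jump_time m h < ennreal t then ?K t * ennreal (survival m h t) else 0) \<in> borel_measurable lborel"
   by measurable
 qed measurable
 also have "(\<integral>\<^sup>+t. (1 - total m h) * F h * indicator {0<..1::real} t \<partial>lborel) = (1 - total m h) * F h"
  by (subst nn_integral_cmult) auto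
 finally show ?thesis by (simp add: add.commute)
qed

lemma step_kernel_measurable: "step_kernel m \<in> path_algebra \<rightarrow>\<^sub>M prob_algebra path_algebra"
proof (rule measurable_prob_algebraI)
 show prob: "prob_space (step_kernel m h)" if "h \<in> space path_algebra" for h
 proof
  have h: "h \<in> paths" using that by simp
  have "emeasure (step_kernel m h) (space (step_kernel m h)) = (\<integral>\<^sup>+w. 1 \<partial>step_kernel m h)" by simp
  also have "\<dots> = total m h + (1 - total m h)"
   using nn_integral_step_kernel[OF h, of "\<lambda>_. 1" m] by (simp add: total_def)
  also have "\<dots> = 1" using total_le_1[OF h, of m] by (rule add_diff_inverse_ennreal)
  finally show "emeasure (step_kernel m h) (space (step_kernel m h)) = 1" .
 qed
 show "step_kernel m \<in> path_algebra \<rightarrow>\<^sub>M subprob_algebra path_algebra"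
 proof (rule measurable_subprob_algebra)
  show "subprob_space (step_kernel m h)" if "h \<in> space path_algebra" for h
   using prob[OF that] by (rule prob_space_imp_subprob_space)
  show "sets (step_kernel m h) = sets path_algebra" for h by (simp add: step_kernel_def)
  fix E :: "'s path set" assume E [measurable]: "E \<in> sets path_algebra"
  have W: "(\<lambda>((g, t), j). indicator E (extend_path m g t j) :: ennreal) \<in> borel_measurable (path_time \<Otimes>\<^sub>M count_space UNIV)"
   by (rule measurable_marked) measurable
  note [measurable] = measurable_jump_part[OF W]
  have "(\<lambda>h. jump_part m (\<lambda>g t j. indicator E (extend_path m g t j)) h + (1 - total m h) * indicator E h) \<in> borel_measurable path_algebra"
   by measurable
  then show "(\<lambda>h. emeasure (step_kernel m h) E) \<in> borel_measurable path_algebra"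
  proof (rule measurable_cong[THEN iffD1, rotated])
   fix h :: "'s path" assume "h \<in> space path_algebra"
   then have h: "h \<in> paths" by simp
   have "emeasure (step_kernel m h) E = (\<integral>\<^sup>+w. indicator E w \<partial>step_kernel m h)"
    using E by (simp add: step_kernel_def)
   also have "\<dots> = jump_part m (\<lambda>g t j. indicator E (extend_path m g t j)) h + (1 - total m h) * indicator E h"
    by (rule nn_integral_step_kernel[OF h]) simp
   finally show "jump_part m (\<lambda>g t j. indicator E (extend_path m g t j)) h + (1 - total m h) * indicator E h = emeasure (step_kernel m h) E" ..
  qed
 qed
qed

text \<open>The kernels produce a chain of frozen histories, each almost surely prolonging its
  predecessor. Such a chain has a common limit path, whose frozen histories are the members of the
  chain; the step property of the chain is then \<open>jump_law\<close>.\<close>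

lemma jump_law_exists:
 obtains P where "prob_space P" "sets P = sets path_algebra" "jump_law P"
  "distr P path_algebra (freeze 0) = distr (measure_pmf \<gamma>) path_algebra start_path"
proof -
 define \<mu> where "\<mu> = distr (measure_pmf \<gamma>) path_algebra start_path"
 have start: "start_path \<in> measure_pmf \<gamma> \<rightarrow>\<^sub>M path_algebra"
  by (rule measurableI) (auto simp: start_path_in_paths)
 have \<mu>: "\<mu> \<in> space (prob_algebra path_algebra)"
  unfolding \<mu>_def space_prob_algebra using start by (auto intro!: measure_pmf.prob_space_distr)
 obtain Q
  where pQ: "prob_space Q" and sQ: "sets Q = sets (PiM UNIV (\<lambda>_::nat. path_algebra))"
   and init: "distr Q path_algebra (\<lambda>x. x 0) = \<mu>"
   and step': "\<forall>m. \<forall>F\<in>borel_measurable (path_algebra \<Otimes>\<^sub>M path_algebra).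
    (\<integral>\<^sup>+x. F (x m, x (Suc m)) \<partial>Q) = (\<integral>\<^sup>+x. \<integral>\<^sup>+y. F (x m, y) \<partial>step_kernel m (x m) \<partial>Q)"
  by (rule markov_chain_exists[of step_kernel, OF step_kernel_measurable \<mu>])
 note step = bspec[OF spec[OF step']]
 interpret prob_space Q by (rule pQ)
 have comp [measurable]: "(\<lambda>x. x k) \<in> Q \<rightarrow>\<^sub>M path_algebra" for k
  unfolding measurable_cong_sets[OF sQ refl] by (rule measurable_component_singleton) simp
 have paths: "x k \<in> paths" if "x \<in> space Q" for x k
  using measurable_space[OF comp that] by simp
 have link: "AE x in Q. freeze m (x (Suc m)) = x m \<and> freeze (Suc m) (x (Suc m)) = x (Suc m)"
  if frozen: "AE x in Q. freeze m (x m) = x m" for m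
 proof -
  \<comment> \<open>Indicator of inconsistent pairs. The kernel charges only prolongations of
    \<open>h\<close> and \<open>h\<close> itself, hence gives them no mass.\<close>
  define G :: "'s path \<times> 's path \<Rightarrow> ennreal" where
   "G p = (if freeze m (snd p) = fst p \<and> freeze (Suc m) (snd p) = snd p then 0 else 1)" for p
  have [measurable]: "Measurable.pred (path_algebra \<Otimes>\<^sub>M path_algebra) (\<lambda>p. freeze m (snd p) = fst (p :: 's path \<times> 's path))"
   "Measurable.pred (path_algebra \<Otimes>\<^sub>M path_algebra) (\<lambda>p. freeze (Suc m) (snd p) = snd (p :: 's path \<times> 's path))"
   by (rule pred_path_eq; measurable)+
  have G: "G \<in> borel_measurable (path_algebra \<Otimes>\<^sub>M path_algebra)"
   unfolding G_def[abs_def] by measurable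
  have zero: "(\<integral>\<^sup>+y. G (h, y) \<partial>step_kernel m h) = 0" if h: "h \<in> paths" and fr: "freeze m h = h" for h
  proof -
   have Gh: "(\<lambda>y. G (h, y)) \<in> borel_measurable path_algebra"
    using h by (intro measurable_compose[OF _ G]) simp
   have "G (h, h) = 0" using fr freeze_freeze_ge[of m "Suc m" h] by (simp add: G_def)
   moreover have "G (h, extend_path m h t j) = 0" if "jump_time m h < ennreal t" for t j
    using that fr by (simp add: G_def extend_path_def freeze_next_path freeze_Suc_next_path)
   then have "jump_part m (\<lambda>g t j. G (h, extend_path m g t j)) h = 0"
    unfolding jump_part_def fr by (simp cong: if_cong)
   ultimately show ?thesis
    unfolding nn_integral_step_kernel[OF h Gh] by simp
  qed
  have "AE x in Q. (\<integral>\<^sup>+y. G (x m, y) \<partial>step_kernel m (x m)) = 0"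
   using frozen AE_space by eventually_elim (simp add: paths zero)
  then have "(\<integral>\<^sup>+x. \<integral>\<^sup>+y. G (x m, y) \<partial>step_kernel m (x m) \<partial>Q) = (\<integral>\<^sup>+x. 0 \<partial>Q)"
   by (rule nn_integral_cong_AE)
  then have "(\<integral>\<^sup>+x. G (x m, x (Suc m)) \<partial>Q) = 0" unfolding step[OF G] by simp
  moreover have "(\<lambda>x. G (x m, x (Suc m))) \<in> borel_measurable Q"
   by (rule measurable_compose[OF _ G]) measurable
  ultimately have "AE x in Q. G (x m, x (Suc m)) = 0"
   by (simp add: nn_integral_0_iff_AE)
  then show ?thesis by eventually_elim (auto simp: G_def split: if_splits)
 qed
 have fr0: "AE x in Q. freeze 0 (x 0) = x 0"
 proof -
  have "Measurable.pred path_algebra (\<lambda>h :: 's path. freeze 0 h = h)"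
   by (rule pred_path_eq) measurable
  then have E: "{h \<in> space path_algebra. freeze 0 h = (h :: 's path)} \<in> sets path_algebra"
   unfolding pred_def .
  have "AE h in \<mu>. freeze 0 h = h"
   unfolding \<mu>_def AE_distr_iff[OF start E] by (simp add: freeze_start_path)
  then show ?thesis
   unfolding init[symmetric] AE_distr_iff[OF comp E] .
 qed
 have frm: "AE x in Q. freeze m (x m) = x m" for m
 proof (induction m)
  case 0 show ?case by (rule fr0)
 next
  case (Suc m)
  from link[OF this] show ?case by eventually_elim simp
 qed
 have good: "AE x in Q. \<forall>m. freeze m (x m) = x m \<and> freeze m (x (Suc m)) = x m"
  unfolding AE_all_countable
 proof
  fix m show "AE x in Q. freeze m (x m) = x m \<and> freeze m (x (Suc m)) = x m"
   using frm[of m] link[OF frm[of m]] by eventually_elim simp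
 qed
 \<comment> \<open>Entry l does not change any more from history l + 1 on. The arbitrary start path
   only keeps the value in \<open>paths\<close> on the exceptional null set.\<close>
 define \<Psi> where "\<Psi> x = (let w = (\<lambda>l. x (Suc l) l) in if w \<in> paths then w else start_path undefined)"
  for x :: "nat \<Rightarrow> 's path"
 have \<Psi>: "\<Psi> x \<in> paths \<and> (\<forall>m. freeze m (\<Psi> x) = x m)"
  if x: "\<forall>m. freeze m (x m) = x m \<and> freeze m (x (Suc m)) = x m" and p: "\<And>m. x m \<in> paths" for x
 proof -
  define w where "w = (\<lambda>l. x (Suc l) l)"
  have later: "freeze m (x (m + d)) = x m" for m d
  proof (induction d)
   case 0 then show ?case using x by simp
  next
   case (Suc d)
   have "freeze m (x (m + Suc d)) = freeze m (freeze (m + d) (x (Suc (m + d))))"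
    by (simp add: freeze_freeze)
   also have "\<dots> = freeze m (x (m + d))" using x by simp
   finally show ?case using Suc by simp
  qed
  have lt: "x m l = w l" if "l < m" for l m
  proof -
   have "x (Suc l) = freeze (Suc l) (x m)" using later[of "Suc l" "m - Suc l"] that by simp
   then have "x (Suc l) l = x m l" by (simp add: freeze_def)
   then show ?thesis by (simp add: w_def)
  qed
  have fr: "freeze m w = x m" for m
  proof
   fix l
   have xm: "x m = freeze m (x (Suc m))" using x by simp
   have "freeze m w l = freeze m (x (Suc m)) l"
    using lt[of l "Suc m"] lt[of m "Suc m"] by (auto simp: freeze_def)
   then show "freeze m w l = x m l" using xm by simp
  qed
  have "w \<in> paths" unfolding paths_iff
  proof (intro conjI allI)
   show "fst (w 0) \<noteq> None" using p[of 1] lt[of 0 1] by (simp add: paths_iff)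
   fix l
   have "w l = x (Suc (Suc l)) l" "w (Suc l) = x (Suc (Suc l)) (Suc l)" using lt by simp_all
   then show "0 < snd (w l)" "(snd (w l) = \<infinity>) = (fst (w (Suc l)) = None)" "fst (w l) = None \<longrightarrow> snd (w l) = \<infinity>"
    using p[of "Suc (Suc l)"] by (auto simp: paths_iff)
  qed
  then show ?thesis using fr by (simp add: \<Psi>_def w_def[symmetric] Let_def)
 qed
 have [measurable]: "(\<lambda>x. x k l) \<in> Q \<rightarrow>\<^sub>M count_space UNIV \<Otimes>\<^sub>M borel" for k l
  by (rule measurable_compose[OF comp]) measurable
 have in_paths: "Measurable.pred Q (\<lambda>x. (\<lambda>l. x (Suc l) l) \<in> paths)"
  unfolding paths_iff by measurable
 have \<Psi>m [measurable]: "\<Psi> \<in> Q \<rightarrow>\<^sub>M path_algebra"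
 proof (rule measurable_into_path_algebra)
  fix l
  have "(\<lambda>x. \<Psi> x l) = (\<lambda>x. if (\<lambda>l. x (Suc l) l) \<in> paths then x (Suc l) l else start_path undefined l)"
   by (simp add: \<Psi>_def Let_def fun_eq_iff)
  also have "\<dots> \<in> Q \<rightarrow>\<^sub>M count_space UNIV \<Otimes>\<^sub>M borel"
  proof (rule measurable_If)
   show "{x \<in> space Q. (\<lambda>l. x (Suc l) l) \<in> paths} \<in> sets Q" using in_paths by (simp add: pred_def)
   show "(\<lambda>x. start_path undefined l) \<in> Q \<rightarrow>\<^sub>M count_space UNIV \<Otimes>\<^sub>M borel"
    by (rule measurable_const) (simp add: space_pair_measure)
  qed measurable
  finally show "(\<lambda>x. \<Psi> x l) \<in> Q \<rightarrow>\<^sub>M count_space UNIV \<Otimes>\<^sub>M borel" .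
 qed (auto simp: \<Psi>_def Let_def start_path_in_paths)
 have goodP: "AE x in Q. \<Psi> x \<in> paths \<and> (\<forall>m. freeze m (\<Psi> x) = x m)"
  using good AE_space by eventually_elim (rule \<Psi>; simp add: paths)
 define P where "P = distr Q path_algebra \<Psi>"
 have pP: "prob_space P" unfolding P_def by (rule prob_space_distr[OF \<Psi>m])
 have sP: "sets P = sets path_algebra" by (simp add: P_def)
 have intP: "(\<integral>\<^sup>+w. f (freeze m w) \<partial>P) = (\<integral>\<^sup>+x. f (x m) \<partial>Q)" if [measurable]: "f \<in> borel_measurable path_algebra" for f m
 proof -
  have "(\<integral>\<^sup>+w. f (freeze m w) \<partial>P) = (\<integral>\<^sup>+x. f (freeze m (\<Psi> x)) \<partial>Q)"
   unfolding P_def by (rule nn_integral_distr[OF \<Psi>m]) (simp add: measurable_compose[OF measurable_freeze that])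
  also have "\<dots> = (\<integral>\<^sup>+x. f (x m) \<partial>Q)"
  proof (rule nn_integral_cong_AE)
   show "AE x in Q. f (freeze m (\<Psi> x)) = f (x m)" using goodP by eventually_elim simp
  qed
  finally show ?thesis .
 qed
 have "jump_law P" unfolding jump_law_def
 proof (intro allI impI)
  fix m and W :: "'s path \<Rightarrow> real \<Rightarrow> 's \<Rightarrow> ennreal"
  assume W: "marked W"
  \<comment> \<open>This term involves jump m + 1 and nothing later, so its value at the limit path
    is its value at member m + 1 of the chain.\<close>
  define \<Phi> where "\<Phi> w = next_jump W m w" for w
  have \<Phi>: "\<Phi> \<in> borel_measurable path_algebra"
   unfolding \<Phi>_def[abs_def] by (rule jump_identity_measurable1[OF W])
  have kernel: "(\<integral>\<^sup>+y. \<Phi> y \<partial>step_kernel m h) = jump_part m W h" if h: "h \<in> paths" and fr: "freeze m h = h" for h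
  proof -
   have "\<not> jump_time (Suc m) h < \<infinity>" using jump_time_freeze_gt[of m "Suc m" h] fr by simp
   then have "\<Phi> h = 0" by (simp add: \<Phi>_def)
   moreover have "\<Phi> (extend_path m h t j) = W h t j" if t: "jump_time m h < ennreal t" for t j
   proof -
    have "0 \<le> t" using t by (metis ennreal_neg leI less_imp_le not_less_zero)
    then show ?thesis
     using t fr by (simp add: \<Phi>_def extend_path_def jump_time_next_path freeze_next_path jump_state_next_path)
   qed
   then have "jump_part m (\<lambda>g t j. \<Phi> (extend_path m g t j)) h = jump_part m W h"
    unfolding jump_part_def fr by (intro nn_integral_cong) simp
   ultimately show ?thesis unfolding nn_integral_step_kernel[OF h \<Phi>] by simp
  qed
  have "(\<integral>\<^sup>+w. \<Phi> w \<partial>P) = (\<integral>\<^sup>+w. \<Phi> (freeze (Suc m) w) \<partial>P)"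
   by (simp add: \<Phi>_def jump_time_freeze jump_state_freeze freeze_freeze cong: if_cong)
  also have "\<dots> = (\<integral>\<^sup>+x. \<Phi> (x (Suc m)) \<partial>Q)" by (rule intP[OF \<Phi>])
  also have "\<dots> = (\<integral>\<^sup>+x. \<integral>\<^sup>+y. \<Phi> y \<partial>step_kernel m (x m) \<partial>Q)"
   using step[of "\<lambda>p. \<Phi> (snd p)" m] \<Phi> by simp
  also have "\<dots> = (\<integral>\<^sup>+x. jump_part m W (x m) \<partial>Q)"
  proof (rule nn_integral_cong_AE)
   show "AE x in Q. (\<integral>\<^sup>+y. \<Phi> y \<partial>step_kernel m (x m)) = jump_part m W (x m)"
    using frm[of m] AE_space by eventually_elim (simp add: kernel paths)
  qed
  also have "\<dots> = (\<integral>\<^sup>+w. jump_part m W (freeze m w) \<partial>P)"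
   by (rule intP[OF measurable_jump_part[OF W], symmetric])
  also have "\<dots> = (\<integral>\<^sup>+w. jump_part m W w \<partial>P)" unfolding jump_part_freeze ..
  finally show "(\<integral>\<^sup>+w. next_jump W m w \<partial>P) =
   (\<integral>\<^sup>+w. \<integral>\<^sup>+t. (if jump_time m w < ennreal t
    then csum (\<lambda>j. r (freeze m w) t j * W (freeze m w) t j) * ennreal (survival m w t) else 0) \<partial>lborel \<partial>P)"
   unfolding \<Phi>_def jump_part_def .
 qed
 moreover have "distr P path_algebra (freeze 0) = \<mu>"
 proof -
  have "distr P path_algebra (freeze 0) = distr Q path_algebra (freeze 0 \<circ> \<Psi>)"
   unfolding P_def by (rule distr_distr[OF measurable_freeze \<Psi>m])
  also have "\<dots> = distr Q path_algebra (\<lambda>x. x 0)"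
  proof (rule distr_cong_AE)
   show "AE x in Q. (freeze 0 \<circ> \<Psi>) x = x 0" using goodP by eventually_elim simp
  qed (auto intro!: measurable_comp[OF \<Psi>m] comp)
  finally show ?thesis using init by simp
 qed
 ultimately show thesis using that pP sP \<mu>_def by blast
qed

theorem jump_identity_exists_unique:
 "\<exists>!P. prob_space P \<and> sets P = sets path_algebra \<and>
   (\<forall>i. measure P {w \<in> paths. state_at 0 w = Some i} = pmf \<gamma> i) \<and> jump_identity P r"
proof -
 obtain P where P: "prob_space P" "sets P = sets path_algebra" "jump_law P"
  and 0: "distr P path_algebra (freeze 0) = distr (measure_pmf \<gamma>) path_algebra start_path"
  by (rule jump_law_exists)
 have start: "start_path \<in> measure_pmf \<gamma> \<rightarrow>\<^sub>M path_algebra"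
  by (rule measurableI) (auto simp: start_path_in_paths)
 have "measure P {w \<in> paths. state_at 0 w = Some i} = pmf \<gamma> i" for i
 proof -
  have E: "{w \<in> space path_algebra. jump_state 0 w = Some i} \<in> sets path_algebra" by measurable
  have spP: "space P = paths" using sets_eq_imp_space_eq[OF P(2)] by simp
  have "{w \<in> paths. state_at 0 w = Some i} = freeze 0 -` {w \<in> paths. jump_state 0 w = Some i} \<inter> space P"
   using freeze_in_paths by (auto simp: spP state_at_0 jump_state_freeze)
  then have "measure P {w \<in> paths. state_at 0 w = Some i} = measure (distr P path_algebra (freeze 0)) {w \<in> paths. jump_state 0 w = Some i}"
   using E by (subst measure_distr) (simp_all add: measurable_cong_sets[OF P(2) refl])
  also have "\<dots> = measure (measure_pmf \<gamma>) (start_path -` {w \<in> paths. jump_state 0 w = Some i} \<inter> space (measure_pmf \<gamma>))"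
   unfolding 0 using E start by (subst measure_distr) simp_all
  also have "start_path -` {w \<in> paths. jump_state 0 w = Some i} \<inter> space (measure_pmf \<gamma>) = {i}"
   by (auto simp: start_path_in_paths jump_state_start_path)
  finally show ?thesis by (simp add: measure_pmf_single)
 qed
 moreover have "Q = P" if Q: "prob_space Q \<and> sets Q = sets path_algebra \<and>
   (\<forall>i. measure Q {w \<in> paths. state_at 0 w = Some i} = pmf \<gamma> i) \<and> jump_identity Q r" for Q
 proof -
  have "jump_law Q" using identity_iff_law[of Q] Q by blast
  moreover have "distr Q path_algebra (freeze 0) = distr P path_algebra (freeze 0)"
   unfolding 0 using Q initial_law[of Q \<gamma>] by blast
  ultimately show ?thesis using jump_law_unique[of Q P] Q P(1-3) by blast
 qed
 moreover have "jump_identity P r" using P(3) identity_iff_law[OF P(1,2)] by (rule iffD2[rotated])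
 ultimately show ?thesis using P(1,2) by (intro ex1I[of _ P]) blast+
qed

end

section \<open>From signed sums to integrals over states\<close>

lemma nn_integral_count_has_sum:
 fixes f :: "'b \<Rightarrow> real"
 assumes "(f has_sum s) UNIV" "\<And>x. 0 \<le> f x"
 shows "csum (\<lambda>x. ennreal (f x)) = ennreal s"
proof -
 have "f summable_on UNIV" using assms(1) unfolding summable_on_def by blast
 then have norm: "(\<lambda>x. norm (f x)) summable_on UNIV" using assms(2) by simp
 have abs: "Infinite_Set_Sum.abs_summable_on f UNIV"
  by (rule abs_summable_equivalent[THEN iffD1, OF norm])
 then have int: "integrable (count_space UNIV) f" by (simp add: abs_summable_on_def)
 have "csum (\<lambda>x. ennreal (f x)) = ennreal (\<integral>x. f x \<partial>count_space UNIV)"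
  using int assms(2) by (intro nn_integral_eq_integral) auto
 also have "(\<integral>x. f x \<partial>count_space UNIV) = infsum f UNIV"
  using infsetsum_infsum[OF abs] by (simp add: infsetsum_def)
 also have "infsum f UNIV = s" using assms(1) by (rule infsumI)
 finally show ?thesis .
qed

lemma has_sum_except:
 fixes f :: "'b \<Rightarrow> real"
 assumes "(f has_sum s) UNIV"
 shows "((\<lambda>j. if j = i then 0 else f j) has_sum (s - f i)) UNIV"
proof -
 have "((\<lambda>j. if j = i then f i else 0) has_sum f i) {i}"
  using has_sum_finite[of "{i}" "\<lambda>j. if j = i then f i else 0"] by simp
 then have "((\<lambda>j. if j = i then f i else 0) has_sum f i) UNIV"
  by (rule has_sum_cong_neutral[THEN iffD1, rotated -1]) auto
 then have "((\<lambda>j. - (if j = i then f i else 0)) has_sum - f i) UNIV"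
  by (rule has_sum_uminusI)
 from has_sum_add[OF assms this]
 have "((\<lambda>j. f j + - (if j = i then f i else 0)) has_sum (s - f i)) UNIV" by simp
 then show ?thesis by (rule has_sum_cong[THEN iffD1, rotated]) auto
qed

section \<open>Controlled rates and the process of a policy\<close>

locale control_model =
 fixes A :: "'s::countable \<Rightarrow> 'a::polish_space set"
  and q :: "'s \<Rightarrow> 's \<Rightarrow> 'a \<Rightarrow> real"
 assumes A_borel: "\<And>i. A i \<in> sets borel"
  and q_measurable: "\<And>i j. (\<lambda>a. q j i a) \<in> borel_measurable (restrict_space borel (A i))"
  and q_nonneg: "\<And>i j a. a \<in> A i \<Longrightarrow> j \<noteq> i \<Longrightarrow> 0 \<le> q j i a"
  and q_conservative: "\<And>i a. a \<in> A i \<Longrightarrow> ((\<lambda>j. q j i a) has_sum 0) UNIV"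
  and q_stable: "\<And>i. bdd_above ((\<lambda>a. \<bar>q i i a\<bar>) ` A i)"
begin

text \<open>For j = i the value is 0, since \<open>ennreal\<close> clips the nonpositive diagonal
  entry (\<open>rate_diag\<close>); sums over j need no side condition.\<close>

definition rate :: "'s \<Rightarrow> 's \<Rightarrow> 'a \<Rightarrow> ennreal" where
 "rate j i a = indicator (A i) a * ennreal (q j i a)"

definition out_rate :: "'s \<Rightarrow> 'a \<Rightarrow> ennreal" where
 "out_rate i a = indicator (A i) a * ennreal (- q i i a)"

lemma q_diag: "a \<in> A i \<Longrightarrow> q i i a \<le> 0"
proof -
 assume a: "a \<in> A i"
 have "0 \<le> 0 - q i i a"
  by (rule has_sum_nonneg[OF has_sum_except[OF q_conservative[OF a], of i]]) (use q_nonneg[OF a] in auto)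
 then show ?thesis by simp
qed

lemma rate_diag [simp]: "rate i i a = 0"
 using q_diag[of a i] by (auto simp: rate_def ennreal_neg split: split_indicator)

lemma borel_measurable_on_actions:
 fixes f :: "'a \<Rightarrow> real"
 assumes "f \<in> borel_measurable (restrict_space borel (A i))"
 shows "(\<lambda>a. indicator (A i) a * ennreal (f a)) \<in> borel_measurable borel"
proof -
 have "(\<lambda>a. if a \<in> A i then ennreal (f a) else 0) \<in> borel_measurable borel"
  using assms A_borel[of i] by (subst measurable_If_restrict_space_iff) auto
 also have "(\<lambda>a. if a \<in> A i then ennreal (f a) else 0) = (\<lambda>a. indicator (A i) a * ennreal (f a))"
  by (auto simp: fun_eq_iff)
 finally show ?thesis .
qed

lemma measurable_rate [measurable]: "rate j i \<in> borel_measurable borel"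
 unfolding rate_def[abs_def] by (rule borel_measurable_on_actions[OF q_measurable])

lemma measurable_out_rate [measurable]: "out_rate i \<in> borel_measurable borel"
 unfolding out_rate_def[abs_def] by (rule borel_measurable_on_actions) (use q_measurable in measurable)

lemma nn_integral_rate: "csum (\<lambda>j. rate j i a) = out_rate i a"
proof (cases "a \<in> A i")
 case True
 have "csum (\<lambda>j. rate j i a) = csum (\<lambda>j. ennreal (if j = i then 0 else q j i a))"
  using True by (intro nn_integral_cong) (auto simp: rate_def intro!: ennreal_neg q_diag)
 also have "\<dots> = ennreal (0 - q i i a)"
  by (rule nn_integral_count_has_sum[OF has_sum_except[OF q_conservative[OF True]]]) (use q_nonneg True in auto)
 finally show ?thesis using True by (simp add: out_rate_def)
qed (simp add: rate_def out_rate_def)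

lemma out_rate_le: "out_rate i a \<le> ennreal (max_rate A q i)"
proof (cases "a \<in> A i")
 case True
 then have "- q i i a \<le> max_rate A q i"
  unfolding max_rate_def using q_diag[OF True] by (intro cSUP_upper2[OF q_stable True]) auto
 then show ?thesis using True by (simp add: out_rate_def ennreal_leI)
qed (simp add: out_rate_def)

text \<open>The only negative term of the drift is the diagonal one. Moved to the other side it
  becomes the loss term, and the inequality makes sense in the extended nonnegative reals.\<close>

lemma drift_nn_integral:
 assumes a: "a \<in> A i" and u: "\<And>j. 0 \<le> u j"
  and drift: "(\<lambda>j. u j * q j i a) summable_on UNIV" "(\<Sum>\<^sub>\<infinity>j. u j * q j i a) \<le> c" and c: "0 \<le> c"
 shows "csum (\<lambda>j. ennreal (u j) * rate j i a) \<le> ennreal c + ennreal (u i) * out_rate i a"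
proof -
 have s: "((\<lambda>j. u j * q j i a) has_sum (\<Sum>\<^sub>\<infinity>j. u j * q j i a)) UNIV" using drift(1) by (rule has_sum_infsum)
 have "csum (\<lambda>j. ennreal (u j) * rate j i a) = csum (\<lambda>j. ennreal (if j = i then 0 else u j * q j i a))"
 proof (rule nn_integral_cong)
  fix j show "ennreal (u j) * rate j i a = ennreal (if j = i then 0 else u j * q j i a)"
   using a u[of j] q_nonneg[OF a, of j] rate_diag[of i a] by (cases "j = i") (auto simp: rate_def ennreal_mult)
 qed
 also have "\<dots> = ennreal ((\<Sum>\<^sub>\<infinity>j. u j * q j i a) - u i * q i i a)"
  by (rule nn_integral_count_has_sum[OF has_sum_except[OF s]]) (use u q_nonneg a in auto)
 also have "\<dots> \<le> ennreal (c + u i * (- q i i a))" using drift(2) by (intro ennreal_leI) simp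
 also have "\<dots> = ennreal c + ennreal (u i) * out_rate i a"
  using a u[of i] q_diag[OF a] c by (simp add: out_rate_def ennreal_mult[symmetric] ennreal_plus[symmetric] mult_nonneg_nonpos del: ennreal_plus)
 finally show ?thesis .
qed

end

text \<open>Negative times are sent to 0 to have a function of real time. \<open>the None\<close> is
  unspecified, but a policy gives \<open>None\<close> probability 0 whenever the process is in a
  genuine state.\<close>

definition action_integral :: "('s, 'a) policy \<Rightarrow> ('a \<Rightarrow> ennreal) \<Rightarrow> 's path \<Rightarrow> real \<Rightarrow> ennreal" where
 "action_integral \<pi> f w t = (\<integral>\<^sup>+x. f (the x) \<partial>\<pi> w (max 0 t))"

locale controlled_policy = control_model A q for A :: "'s::countable \<Rightarrow> 'a::polish_space set" and q +
 fixes \<pi> :: "('s, 'a) policy"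
 assumes policy: "\<pi> \<in> policies A"
begin

abbreviation act :: "('a \<Rightarrow> ennreal) \<Rightarrow> 's path \<Rightarrow> real \<Rightarrow> ennreal" where
 "act \<equiv> action_integral \<pi>"

lemma policy_measurable: "(\<lambda>(w, t). \<pi> w t) \<in> predictable \<rightarrow>\<^sub>M subprob_algebra action_algebra"
 using policy unfolding policies_def by (auto intro: measurable_prob_algebraD)

lemma policy_kernel:
 assumes "w \<in> paths" "0 \<le> t"
 shows "prob_space (\<pi> w t)" "sets (\<pi> w t) = sets action_algebra"
proof -
 have "(\<lambda>(w, t). \<pi> w t) \<in> predictable \<rightarrow>\<^sub>M prob_algebra action_algebra"
  using policy unfolding policies_def by simp
 from measurable_space[OF this, of "(w, t)"] assms
 show "prob_space (\<pi> w t)" "sets (\<pi> w t) = sets action_algebra" by (auto simp: space_prob_algebra)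
qed

lemma policy_admissible:
 assumes "w \<in> paths" "0 \<le> t" "state_before t w = Some i"
 shows "AE x in \<pi> w t. x \<in> Some ` A i"
proof -
 interpret prob_space "\<pi> w t" using assms by (intro policy_kernel)
 have "emeasure (\<pi> w t) (Some ` A i) = 1"
  using policy assms unfolding policies_def by (metis (mono_tags, lifting) admissible.simps(1) mem_Collect_eq)
 moreover have "Some ` A i \<in> sets (\<pi> w t)"
  using policy_kernel[OF assms(1,2)] Some_image_action[OF A_borel] by simp
 ultimately show ?thesis by (intro AE_prob_1) (simp_all add: measure_def)
qed

lemma action_integral_predictable:
 assumes "f \<in> borel_measurable borel"
 shows "(\<lambda>(w, t). \<integral>\<^sup>+x. f (the x) \<partial>\<pi> w t) \<in> borel_measurable predictable"
proof -
 have "(\<lambda>x. f (the x)) \<in> borel_measurable action_algebra"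
  using assms by (rule measurable_compose[OF measurable_the_action])
 from measurable_compose[OF policy_measurable nn_integral_measurable_subprob_algebra[OF this]]
 show ?thesis by (simp add: case_prod_beta')
qed

lemma measurable_act:
 assumes "f \<in> borel_measurable borel" "g \<in> M \<rightarrow>\<^sub>M path_algebra" "h \<in> borel_measurable M"
 shows "(\<lambda>x. act f (g x) (h x)) \<in> borel_measurable M"
proof -
 have "(\<lambda>x. (g x, h x)) \<in> M \<rightarrow>\<^sub>M path_time" using assms by simp
 from measurable_compose[OF measurable_compose[OF this measurable_predictable_joint] action_integral_predictable[OF assms(1)]]
 show ?thesis by (simp add: action_integral_def case_prod_beta')
qed

lemma act_mono:
 assumes "w \<in> paths" "0 < t" "state_before t w = Some i" "\<And>a. a \<in> A i \<Longrightarrow> f a \<le> g a"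
 shows "act f w t \<le> act g w t"
 unfolding action_integral_def
proof (rule nn_integral_mono_AE)
 have "AE x in \<pi> w (max 0 t). x \<in> Some ` A i"
  unfolding max_absorb2[OF less_imp_le[OF assms(2)]] using assms by (intro policy_admissible) auto
 then show "AE x in \<pi> w (max 0 t). f (the x) \<le> g (the x)"
  by eventually_elim (use assms(4) in auto)
qed

lemma act_const:
 assumes "w \<in> paths" shows "act (\<lambda>_. c) w t = c"
proof -
 interpret prob_space "\<pi> w (max 0 t)" using assms by (intro policy_kernel) auto
 show ?thesis by (simp add: action_integral_def emeasure_space_1)
qed

lemma act_add:
 assumes "w \<in> paths" "f \<in> borel_measurable borel" "g \<in> borel_measurable borel"
 shows "act (\<lambda>a. f a + g a) w t = act f w t + act g w t"
 unfolding action_integral_def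
 using policy_kernel(2)[OF assms(1), of "max 0 t"] measurable_compose[OF measurable_the_action assms(2)]
  measurable_compose[OF measurable_the_action assms(3)]
 by (intro nn_integral_add) (simp_all cong: measurable_cong_sets)

lemma act_cmult:
 assumes "w \<in> paths" "f \<in> borel_measurable borel"
 shows "act (\<lambda>a. c * f a) w t = c * act f w t"
 unfolding action_integral_def
 using policy_kernel(2)[OF assms(1), of "max 0 t"] measurable_compose[OF measurable_the_action assms(2)]
 by (intro nn_integral_cmult) (simp_all cong: measurable_cong_sets)

lemma act_count:
 assumes "w \<in> paths" "\<And>j :: 's. f j \<in> borel_measurable borel"
 shows "act (\<lambda>a. csum (\<lambda>j. f j a)) w t = csum (\<lambda>j. act (f j) w t)"
 unfolding action_integral_def
 using policy_kernel(2)[OF assms(1), of "max 0 t"] measurable_compose[OF measurable_the_action assms(2)]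
 by (intro nn_integral_count_space_nn_integral) (simp_all cong: measurable_cong_sets)

lemma jump_rate_eq:
 assumes "w \<in> paths" "0 \<le> t" "state_before t w = Some i"
 shows "jump_rate A q \<pi> w t j = act (rate j i) w t"
proof -
 have "(\<integral>\<^sup>+x. indicator (Some ` A i) x * ennreal (q j i (the x)) \<partial>\<pi> w t) = act (rate j i) w t"
  unfolding action_integral_def max_absorb2[OF assms(2)]
 proof (rule nn_integral_cong_AE)
  show "AE x in \<pi> w t. indicator (Some ` A i) x * ennreal (q j i (the x)) = rate j i (the x)"
   using policy_admissible[OF assms] by eventually_elim (auto simp: rate_def)
 qed
 moreover have "act (rate i i) w t = 0" by (simp add: action_integral_def)
 ultimately show ?thesis using assms(3) by (auto simp: jump_rate_def)
qed

lemma jump_rate_None: "state_before t w = None \<Longrightarrow> jump_rate A q \<pi> w t j = 0"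
 by (simp add: jump_rate_def)

lemma jump_rate_predictable:
 "(\<lambda>(w, t). jump_rate A q \<pi> w t j) \<in> borel_measurable predictable"
proof -
 let ?P = "(predictable :: ('s path \<times> real) measure)"
 define F where "F x p = (case x of None \<Rightarrow> 0 | Some i \<Rightarrow> case p of (w, t) \<Rightarrow> \<integral>\<^sup>+y. rate j i (the y) \<partial>\<pi> w t)"
  for x :: "'s option" and p :: "'s path \<times> real"
 have "F x \<in> borel_measurable ?P" for x
  unfolding F_def using action_integral_predictable[OF measurable_rate] by (cases x) simp_all
 from measurable_compose_countable[OF this measurable_state_before]
 have "(\<lambda>p. F (case p of (w, t) \<Rightarrow> state_before t w) p) \<in> borel_measurable ?P" .
 then show ?thesis
 proof (rule measurable_cong[THEN iffD1, rotated])
  fix p assume "p \<in> space ?P"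
  then obtain w t where p: "p = (w, t)" "w \<in> paths" "0 \<le> t" by auto
  show "F (case p of (w, t) \<Rightarrow> state_before t w) p = (case p of (w, t) \<Rightarrow> jump_rate A q \<pi> w t j)"
   using p jump_rate_eq[of w t _ j] jump_rate_None[of t w j]
   by (cases "state_before t w") (auto simp: F_def action_integral_def)
 qed
qed

definition policy_rate :: "'s path \<Rightarrow> real \<Rightarrow> 's \<Rightarrow> ennreal" where
 "policy_rate w t j = (if 0 < t then jump_rate A q \<pi> w t j else 0)"

lemma policy_rate_sum:
 assumes "w \<in> paths" "sojourn m w t" "jump_state m w = Some i"
 shows "csum (\<lambda>j. policy_rate w t j) = act (out_rate i) w t"
proof -
 have t: "0 < t" by (rule sojourn_pos[OF assms(2)])
 have "csum (\<lambda>j. policy_rate w t j) = csum (\<lambda>j. act (rate j i) w t)"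
  using t assms jump_rate_eq[of w t i] state_before_sojourn[of w m t]
  by (intro nn_integral_cong) (simp add: policy_rate_def)
 also have "\<dots> = act (\<lambda>a. csum (\<lambda>j. rate j i a)) w t"
  by (rule act_count[symmetric, OF assms(1)]) simp
 finally show ?thesis unfolding nn_integral_rate by simp
qed

sublocale bounded_jump_rates policy_rate "max_rate A q"
proof
 have "policy_rate = \<rho>_pos (jump_rate A q \<pi>)"
  by (simp add: fun_eq_iff policy_rate_def \<rho>_pos_def[OF jump_rate_predictable jump_rate_None])
 then show "marked policy_rate"
  using \<rho>_pos_measurable[OF jump_rate_predictable jump_rate_None] by simp
 fix w m t i assume w: "w \<in> paths" "sojourn m w t" "jump_state m w = Some (i :: 's)"
 have "act (out_rate i) w t \<le> act (\<lambda>_. ennreal (max_rate A q i)) w t"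
  unfolding action_integral_def by (intro nn_integral_mono out_rate_le)
 then show "csum (\<lambda>j. policy_rate w t j) \<le> ennreal (max_rate A q i)"
  unfolding policy_rate_sum[OF w] act_const[OF w(1)] .
qed

lemma is_policy_measure_iff:
 "is_policy_measure A q \<gamma> \<pi> P \<longleftrightarrow> prob_space P \<and> sets P = sets path_algebra \<and>
   (\<forall>i. measure P {w \<in> paths. state_at 0 w = Some i} = pmf \<gamma> i) \<and> jump_identity P policy_rate"
proof -
 have eq: "policy_rate = \<rho>_pos (jump_rate A q \<pi>)"
  by (simp add: fun_eq_iff policy_rate_def \<rho>_pos_def[OF jump_rate_predictable jump_rate_None])
 have pc: "policy_compensator A q \<pi> = (\<lambda>w. density mark_measure (\<lambda>(t, j). jump_rate A q \<pi> w t j))"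
  by (simp add: policy_compensator_def fun_eq_iff)
 show ?thesis
  unfolding is_policy_measure_def pc eq
  using jump_identity_of_projection[where \<rho>="jump_rate A q \<pi>" and P=P, OF jump_rate_predictable jump_rate_None]
   projection_of_jump_identity[where \<rho>="jump_rate A q \<pi>" and P=P, OF jump_rate_predictable jump_rate_None] by blast
qed

text \<open>Existence and uniqueness make the description in the definition of
  \<open>policy_measure\<close> denote.\<close>

lemma policy_measure:
 "prob_space (policy_measure A q \<gamma> \<pi>)" "sets (policy_measure A q \<gamma> \<pi>) = sets path_algebra"
 "measure (policy_measure A q \<gamma> \<pi>) {w \<in> paths. state_at 0 w = Some i} = pmf \<gamma> i"
 "jump_identity (policy_measure A q \<gamma> \<pi>) policy_rate"
proof -
 have "\<exists>!P. is_policy_measure A q \<gamma> \<pi> P"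
  unfolding is_policy_measure_iff by (rule jump_identity_exists_unique)
 then have "is_policy_measure A q \<gamma> \<pi> (policy_measure A q \<gamma> \<pi>)"
  unfolding policy_measure_def by (rule theI')
 then show "prob_space (policy_measure A q \<gamma> \<pi>)" "sets (policy_measure A q \<gamma> \<pi>) = sets path_algebra"
  "measure (policy_measure A q \<gamma> \<pi>) {w \<in> paths. state_at 0 w = Some i} = pmf \<gamma> i"
  "jump_identity (policy_measure A q \<gamma> \<pi>) policy_rate"
  unfolding is_policy_measure_iff by blast+
qed

end

section \<open>A Gronwall inequality\<close>

lemma suminf_ennreal_head: "(\<Sum>n. f n) = f 0 + (\<Sum>n. f (Suc n))" for f :: "nat \<Rightarrow> ennreal"
proof -
 have "(\<lambda>n. \<Sum>k<n. f (Suc k)) \<longlonglongrightarrow> (\<Sum>n. f (Suc n))"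
  using summable_sums[OF summableI, of "\<lambda>n. f (Suc n)"] by (simp add: sums_def)
 then have "(\<lambda>n. f 0 + (\<Sum>k<n. f (Suc k))) \<longlonglongrightarrow> f 0 + (\<Sum>n. f (Suc n))"
  by (intro tendsto_add tendsto_const)
 then have "(\<lambda>n. \<Sum>k<Suc n. f k) \<longlonglongrightarrow> f 0 + (\<Sum>n. f (Suc n))"
  by (simp only: sum.lessThan_Suc_shift)
 then have "(\<lambda>n. \<Sum>k<n. f k) \<longlonglongrightarrow> f 0 + (\<Sum>n. f (Suc n))"
  by (rule filterlim_sequentially_Suc[THEN iffD1])
 then show ?thesis by (intro sums_unique[symmetric]) (simp add: sums_def)
qed

lemma nn_integral_exp_interval:
 assumes "0 < k" "0 < t"
 shows "(\<integral>\<^sup>+s. (if 0 < s \<and> s < t then ennreal (exp (k * s)) else 0) \<partial>lborel) = ennreal ((exp (k * t) - 1) / k)"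
proof -
 have "(\<integral>\<^sup>+s. (if 0 < s \<and> s < t then ennreal (exp (k * s)) else 0) \<partial>lborel)
   = (\<integral>\<^sup>+s. ennreal (exp (k * s)) * indicator {0..t} s \<partial>lborel)"
 proof (rule nn_integral_cong_AE)
  show "AE s in lborel. (if 0 < s \<and> s < t then ennreal (exp (k * s)) else 0) = ennreal (exp (k * s)) * indicator {0..t} s"
   using AE_lborel_singleton[of 0] AE_lborel_singleton[of t]
   by eventually_elim (auto split: split_indicator)
 qed
 also have "\<dots> = ennreal (exp (k * t) / k - exp (k * 0) / k)"
  using assms by (intro nn_integral_FTC_Icc[where F="\<lambda>s. exp (k * s) / k"]) (auto intro!: derivative_eq_intros)
 finally show ?thesis by (simp add: diff_divide_distrib)
qed

text \<open>Let M be the supremum of g weighted by exp (-2 \<rho> s). For this weight the integral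
  operator has norm at most 1/2, hence M <= c + M / 2 and M <= 2 c; the two factors 2 of the
  conclusion come from here. The a priori bound \<open>B\<close> only ensures that M is
  finite.\<close>

lemma gronwall_nn_integral:
 fixes g :: "real \<Rightarrow> ennreal"
 assumes \<rho>: "0 < \<rho>" and B: "\<And>t. 0 < t \<Longrightarrow> t \<le> T \<Longrightarrow> g t \<le> ennreal B"
  and c: "0 \<le> c"
  and step: "\<And>t. 0 < t \<Longrightarrow> t \<le> T \<Longrightarrow> g t \<le> ennreal c + ennreal \<rho> * (\<integral>\<^sup>+s. (if 0 < s \<and> s < t then g s else 0) \<partial>lborel)"
  and t: "0 < t" "t \<le> T"
 shows "g t \<le> ennreal (2 * c * exp (2 * \<rho> * T))"
proof -
 define M where "M = (SUP s\<in>{0<..T}. g s * ennreal (exp (- (2 * \<rho> * s))))"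
 have cancel: "ennreal (exp (- (2 * \<rho> * s))) * ennreal (exp (2 * \<rho> * s)) = 1" for s
  by (simp add: ennreal_mult'[symmetric] exp_minus_inverse exp_add[symmetric] del: exp_add)
 have gM: "g s \<le> M * ennreal (exp (2 * \<rho> * s))" if "0 < s" "s \<le> T" for s
 proof -
  have "g s * ennreal (exp (- (2 * \<rho> * s))) \<le> M" unfolding M_def using that by (intro SUP_upper) auto
  then have "g s * ennreal (exp (- (2 * \<rho> * s))) * ennreal (exp (2 * \<rho> * s)) \<le> M * ennreal (exp (2 * \<rho> * s))"
   by (rule mult_right_mono) simp
  then show ?thesis unfolding mult.assoc[of "g s"] cancel by simp
 qed
 have "M \<le> ennreal B" unfolding M_def
 proof (rule SUP_least)
  fix s assume s: "s \<in> {0<..T}"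
  have "g s * ennreal (exp (- (2 * \<rho> * s))) \<le> ennreal B * 1"
   using s B[of s] \<rho> by (intro mult_mono) (auto simp: ennreal_le_1)
  then show "g s * ennreal (exp (- (2 * \<rho> * s))) \<le> ennreal B" by simp
 qed
 then obtain M' where M': "M = ennreal M'" "0 \<le> M'"
  using le_less_trans[of M "ennreal B" top] by (cases M) auto
 have "M \<le> ennreal (c + M' / 2)" unfolding M_def
 proof (rule SUP_least)
  fix s assume "s \<in> {0<..T}"
  then have s: "0 < s" "s \<le> T" by auto
  have "(\<integral>\<^sup>+v. (if 0 < v \<and> v < s then g v else 0) \<partial>lborel) \<le>
    (\<integral>\<^sup>+v. M * (if 0 < v \<and> v < s then ennreal (exp (2 * \<rho> * v)) else 0) \<partial>lborel)"
   using gM s by (intro nn_integral_mono) auto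
  also have "\<dots> = M * (\<integral>\<^sup>+v. (if 0 < v \<and> v < s then ennreal (exp (2 * \<rho> * v)) else 0) \<partial>lborel)"
   by (rule nn_integral_cmult) measurable
  also have "\<dots> = ennreal (M' * ((exp (2 * \<rho> * s) - 1) / (2 * \<rho>)))"
   using nn_integral_exp_interval[of "2 * \<rho>" s] \<rho> s M' by (simp add: ennreal_mult'[symmetric])
  finally have "g s \<le> ennreal c + ennreal \<rho> * ennreal (M' * ((exp (2 * \<rho> * s) - 1) / (2 * \<rho>)))"
   using step[OF s] by (meson add_left_mono mult_left_mono order_trans zero_le)
  also have "\<dots> = ennreal (c + \<rho> * (M' * ((exp (2 * \<rho> * s) - 1) / (2 * \<rho>))))"
   using \<rho> c M' s by (simp add: ennreal_mult'[symmetric] ennreal_plus[symmetric] del: ennreal_plus)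
  also have "\<rho> * (M' * ((exp (2 * \<rho> * s) - 1) / (2 * \<rho>))) = M' * (exp (2 * \<rho> * s) - 1) / 2"
   using \<rho> by simp
  finally have "g s * ennreal (exp (- (2 * \<rho> * s))) \<le> ennreal (c + M' * (exp (2 * \<rho> * s) - 1) / 2) * ennreal (exp (- (2 * \<rho> * s)))"
   by (rule mult_right_mono) simp
  also have "\<dots> = ennreal ((c + M' * (exp (2 * \<rho> * s) - 1) / 2) * exp (- (2 * \<rho> * s)))"
   by (simp add: ennreal_mult'')
  also have "\<dots> \<le> ennreal (c + M' / 2)"
  proof (rule ennreal_leI)
   have alg: "(c + m * (x - 1) / 2) * y = c * y + m / 2 * (x * y - y)" for c m x y :: real
    by (simp add: field_simps)
   have e: "exp (2 * \<rho> * s) * exp (- (2 * \<rho> * s)) = 1" by (simp add: exp_minus_inverse)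
   have e1: "exp (- (2 * \<rho> * s)) \<le> 1" "0 < exp (- (2 * \<rho> * s))" using \<rho> s by auto
   have "(c + M' * (exp (2 * \<rho> * s) - 1) / 2) * exp (- (2 * \<rho> * s)) =
     c * exp (- (2 * \<rho> * s)) + M' / 2 * (exp (2 * \<rho> * s) * exp (- (2 * \<rho> * s)) - exp (- (2 * \<rho> * s)))"
    by (rule alg)
   also have "\<dots> \<le> c * 1 + M' / 2 * 1"
    unfolding e using c M' e1 by (intro add_mono mult_left_mono) auto
   finally show "(c + M' * (exp (2 * \<rho> * s) - 1) / 2) * exp (- (2 * \<rho> * s)) \<le> c + M' / 2" by simp
  qed
  finally show "g s * ennreal (exp (- (2 * \<rho> * s))) \<le> ennreal (c + M' / 2)" .
 qed
 then have "M' \<le> c + M' / 2" unfolding M' using M'(2) c by (subst (asm) ennreal_le_iff) auto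
 then have M2: "M' \<le> 2 * c" by simp
 have "g t \<le> ennreal (M' * exp (2 * \<rho> * t))" using gM[OF t] M' by (simp add: ennreal_mult')
 also have "\<dots> \<le> ennreal (2 * c * exp (2 * \<rho> * T))"
  using M2 M' c \<rho> t by (intro ennreal_leI mult_mono) auto
 finally show ?thesis .
qed

section \<open>The flow of a policy and its forward equation\<close>

locale controlled_process = controlled_policy A q \<pi>
 for A :: "'s::countable \<Rightarrow> 'a::polish_space set" and q and \<pi> :: "('s, 'a) policy" +
 fixes \<gamma> :: "'s pmf"
begin

abbreviation P :: "'s path measure" where "P \<equiv> policy_measure A q \<gamma> \<pi>"

lemma sets_P [measurable_cong]: "sets P = sets path_algebra" by (rule policy_measure)

lemma space_P: "space P = paths" using sets_eq_imp_space_eq[OF sets_P] by simp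

lemma prob_space_P: "prob_space P" by (rule policy_measure)

definition stay :: "nat \<Rightarrow> 's set \<Rightarrow> 's \<Rightarrow> 's path \<Rightarrow> real \<Rightarrow> bool" where
 "stay m D i w t \<longleftrightarrow> sojourn m w t \<and> jump_state m w = Some i \<and> (\<forall>k\<le>m. jump_state k w \<in> Some ` D)"

text \<open>The restriction to paths that have stayed in a finite set \<open>D\<close>, on which the rates are bounded, keeps all
 quantities of the moment estimate finite; \<open>D\<close> increases to \<open>UNIV\<close> afterwards.\<close>
definition level_flow :: "nat \<Rightarrow> 's set \<Rightarrow> 's \<Rightarrow> ('a \<Rightarrow> ennreal) \<Rightarrow> real \<Rightarrow> ennreal" where
 "level_flow m D i f t = (\<integral>\<^sup>+w. (if stay m D i w t then act f w t else 0) \<partial>P)"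

definition flow_in :: "'s set \<Rightarrow> 's \<Rightarrow> ('a \<Rightarrow> ennreal) \<Rightarrow> real \<Rightarrow> ennreal" where
 "flow_in D i f t = (\<integral>\<^sup>+w. (if \<exists>m. stay m D i w t then act f w t else 0) \<partial>P)"

lemma pred_jump_state [measurable]:
 "g \<in> M \<rightarrow>\<^sub>M path_algebra \<Longrightarrow> Measurable.pred M (\<lambda>x. jump_state k (g x) \<in> S)"
 by (rule measurable_compose[OF measurable_compose[OF _ measurable_jump_state]]) auto

lemma pred_sojourn [measurable]:
 assumes "g \<in> M \<rightarrow>\<^sub>M path_algebra" "h \<in> borel_measurable M"
 shows "Measurable.pred M (\<lambda>x. sojourn m (g x) (h x))"
proof -
 have "(\<lambda>x. (g x, h x)) \<in> M \<rightarrow>\<^sub>M path_time" using assms by simp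
 from measurable_compose[OF this measurable_sojourn] show ?thesis by simp
qed

lemma pred_stay [measurable]:
 assumes [measurable]: "g \<in> M \<rightarrow>\<^sub>M path_algebra" "h \<in> borel_measurable M"
 shows "Measurable.pred M (\<lambda>x. stay m D i (g x) (h x))"
proof -
 have [measurable]: "Measurable.pred M (\<lambda>x. jump_state m (g x) = Some i)"
  using pred_jump_state[OF assms(1), of m "{Some i}"] by simp
 show ?thesis unfolding stay_def by measurable
qed

lemma stay_state: "w \<in> paths \<Longrightarrow> stay m D i w t \<Longrightarrow> 0 < t \<and> state_before t w = Some i"
 by (auto simp: stay_def state_before_sojourn dest: sojourn_pos)

lemma stay_unique: "stay m D i w t \<Longrightarrow> stay n E j w t \<Longrightarrow> m = n \<and> i = j"
 using sojourn_unique[of m w t n] by (auto simp: stay_def)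

lemma stay_pos: "stay m D i w t \<Longrightarrow> 0 < t \<and> i \<in> D"
 using sojourn_pos[of m w t] by (auto simp: stay_def)

lemmas [measurable (raw)] = measurable_act

lemma measurable_level_flow [measurable]:
 assumes [measurable]: "f \<in> borel_measurable borel"
 shows "level_flow m D i f \<in> borel_measurable borel"
proof -
 interpret prob_space P by (rule prob_space_P)
 have "(\<lambda>p. if stay m D i (snd p) (fst p) then act f (snd p) (fst p) else 0) \<in> borel_measurable (borel \<Otimes>\<^sub>M P)"
  by measurable
 then show ?thesis unfolding level_flow_def[abs_def] by (intro borel_measurable_nn_integral) (simp add: case_prod_beta')
qed

lemma flow_in_eq_suminf:
 assumes [measurable]: "f \<in> borel_measurable borel"
 shows "flow_in D i f t = (\<Sum>m. level_flow m D i f t)"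
proof -
 have "flow_in D i f t = (\<integral>\<^sup>+w. (\<Sum>m. if stay m D i w t then act f w t else 0) \<partial>P)"
  unfolding flow_in_def
 proof (rule nn_integral_cong)
  fix w
  show "(if \<exists>m. stay m D i w t then act f w t else 0) = (\<Sum>m. if stay m D i w t then act f w t else 0)"
  proof (cases "\<exists>m. stay m D i w t")
   case True
   then obtain m where m: "stay m D i w t" by blast
   then have "stay k D i w t \<longleftrightarrow> k = m" for k using stay_unique by blast
   then show ?thesis using suminf_single_ennreal[of m "\<lambda>_. act f w t"] m by (simp cong: if_cong)
  qed simp
 qed
 also have "\<dots> = (\<Sum>m. level_flow m D i f t)"
  unfolding level_flow_def by (rule nn_integral_suminf) measurable
 finally show ?thesis .
qed

lemma measurable_flow_in [measurable]:
 assumes [measurable]: "f \<in> borel_measurable borel"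
 shows "flow_in D i f \<in> borel_measurable borel"
proof -
 have "flow_in D i f = (\<lambda>t. \<Sum>m. level_flow m D i f t)" using flow_in_eq_suminf[OF assms] by (rule ext)
 then show ?thesis by simp
qed

lemma policy_rate_freeze:
 assumes "w \<in> paths" "sojourn m w t" shows "policy_rate (freeze m w) t j = policy_rate w t j"
 using predictable_freeze[OF jump_rate_predictable assms, of j] by (simp add: policy_rate_def)

lemma measurable_policy_rate [measurable (raw)]:
 assumes "g \<in> M \<rightarrow>\<^sub>M path_algebra" "h \<in> borel_measurable M"
 shows "(\<lambda>x. policy_rate (g x) (h x) j) \<in> borel_measurable M"
proof -
 have "(\<lambda>x. ((g x, h x), j)) \<in> M \<rightarrow>\<^sub>M path_time \<Otimes>\<^sub>M count_space UNIV" using assms by simp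
 from measurable_compose[OF this r_measurable] show ?thesis by simp
qed

text \<open>The identity for the test function that is 1 when s < t and \<Phi> holds, with the time
  integral then moved outside. By \<open>frz\<close>, \<Phi> looks only at the history before the
  jump, which makes it admissible.\<close>

lemma jumps_before:
 assumes t: "0 < t" and \<Phi> [measurable]: "\<And>j. Measurable.pred path_algebra (\<lambda>w. \<Phi> w j)"
  and frz: "\<And>w j. \<Phi> (freeze m w) j = \<Phi> w j"
 shows "(\<integral>\<^sup>+w. (if jump_time (Suc m) w < ennreal t \<and> \<Phi> w (the (jump_state (Suc m) w)) then 1 else 0) \<partial>P) =
  before t (\<lambda>s. \<integral>\<^sup>+w. (if sojourn m w s then csum (\<lambda>j. (if \<Phi> w j then policy_rate w s j else 0)) else 0) \<partial>P)"
proof -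
 interpret prob_space P by (rule prob_space_P)
 interpret PL: pair_sigma_finite P lborel ..
 define W :: "'s path \<Rightarrow> real \<Rightarrow> 's \<Rightarrow> ennreal" where "W h s j = (if s < t \<and> \<Phi> h j then 1 else 0)" for h s j
 have W: "marked W"
 proof (rule measurable_marked)
  fix j
  have [measurable]: "Measurable.pred (path_algebra \<Otimes>\<^sub>M (borel :: real measure)) (\<lambda>p. \<Phi> (fst p) j)"
   by (rule measurable_compose[OF measurable_fst \<Phi>])
  show "(\<lambda>p. W (fst p) (snd p) j) \<in> borel_measurable path_time"
   unfolding W_def by measurable
 qed
 let ?R = "\<lambda>w s. csum (\<lambda>j. (if \<Phi> w j then policy_rate w s j else 0))"
 have "(\<integral>\<^sup>+w. (if jump_time (Suc m) w < ennreal t \<and> \<Phi> w (the (jump_state (Suc m) w)) then 1 else 0) \<partial>P) =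
  (\<integral>\<^sup>+w. next_jump W m w \<partial>P)"
  using t less_trans[of "jump_time (Suc m) _" "ennreal t" top]
  by (intro nn_integral_cong) (auto simp: W_def frz enn2real_less_iff)
 also have "\<dots> = (\<integral>\<^sup>+w. \<integral>\<^sup>+s. (if sojourn m w s then csum (\<lambda>j. policy_rate (freeze m w) s j * W (freeze m w) s j) else 0) \<partial>lborel \<partial>P)"
  using mp[OF spec[OF spec[OF policy_measure(4)[of \<gamma>, unfolded jump_identity_def], of m], of W] W] .
 also have "\<dots> = (\<integral>\<^sup>+w. before t (\<lambda>s. (if sojourn m w s then ?R w s else 0)) \<partial>P)"
 proof (intro nn_integral_cong)
  fix w s assume "w \<in> space P"
  then have w: "w \<in> paths" by (simp add: space_P)
  have "csum (\<lambda>j. policy_rate (freeze m w) s j * W (freeze m w) s j) = (if s < t then ?R w s else 0)"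
   if "sojourn m w s"
  proof (cases "s < t")
   case True
   then have "csum (\<lambda>j. policy_rate (freeze m w) s j * W (freeze m w) s j) = ?R w s"
    by (intro nn_integral_cong) (simp add: W_def frz policy_rate_freeze[OF w that])
   with True show ?thesis by simp
  qed (simp add: W_def)
  then show "(if sojourn m w s then csum (\<lambda>j. policy_rate (freeze m w) s j * W (freeze m w) s j) else 0) =
   (if s < t then (if sojourn m w s then ?R w s else 0) else 0)" by simp
 qed
 also have "\<dots> = (\<integral>\<^sup>+s. \<integral>\<^sup>+w. (if s < t then (if sojourn m w s then ?R w s else 0) else 0) \<partial>P \<partial>lborel)"
 proof (rule PL.Fubini'[symmetric])
  have [measurable]: "Measurable.pred (path_algebra \<Otimes>\<^sub>M (borel :: real measure)) (\<lambda>p. \<Phi> (fst p) j)" for j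
   by (rule measurable_compose[OF measurable_fst \<Phi>])
  have "(\<lambda>p. ?R (fst p) (snd p)) \<in> borel_measurable path_time"
   by (intro C.borel_measurable_nn_integral measurable_from_pair_count) simp
  then have [measurable]: "(\<lambda>p. ?R (fst p) (snd p)) \<in> borel_measurable (P \<Otimes>\<^sub>M lborel)"
   by (simp cong: measurable_cong_sets add: measurable_cong_sets[OF sets_pair_measure_cong[OF sets_P sets_lborel] refl])
  have "(\<lambda>p. if snd p < t then (if sojourn m (fst p) (snd p) then ?R (fst p) (snd p) else 0) else 0) \<in> borel_measurable (P \<Otimes>\<^sub>M lborel)"
   by measurable
  then show "(\<lambda>(w, s). if s < t then (if sojourn m w s then ?R w s else 0) else 0) \<in> borel_measurable (P \<Otimes>\<^sub>M lborel)"
   by (simp add: case_prod_beta')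
 qed
 also have "\<dots> = before t (\<lambda>s. \<integral>\<^sup>+w. (if sojourn m w s then ?R w s else 0) \<partial>P)"
 proof (rule nn_integral_cong)
  fix s
  show "(\<integral>\<^sup>+w. (if s < t then (if sojourn m w s then ?R w s else 0) else 0) \<partial>P) =
   (if s < t then \<integral>\<^sup>+w. (if sojourn m w s then ?R w s else 0) \<partial>P else 0)" by (cases "s < t") simp_all
 qed
 finally show ?thesis .
qed

text \<open>Strict inequalities fit the left-open sojourns: being there at \<open>t\<close> means
  having arrived before \<open>t\<close> without having departed before \<open>t\<close>.
  \<open>arrived_eq\<close> states this as a sum.\<close>

definition arrived :: "nat \<Rightarrow> 's set \<Rightarrow> 's \<Rightarrow> real \<Rightarrow> ennreal" where
 "arrived m D j t = (\<integral>\<^sup>+w. (if jump_time m w < ennreal t \<and> jump_state m w = Some j \<and> (\<forall>k\<le>m. jump_state k w \<in> Some ` D) then 1 else 0) \<partial>P)"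

definition departed :: "nat \<Rightarrow> 's set \<Rightarrow> 's \<Rightarrow> real \<Rightarrow> ennreal" where
 "departed m D j t = (\<integral>\<^sup>+w. (if jump_time (Suc m) w < ennreal t \<and> jump_state m w = Some j \<and> (\<forall>k\<le>m. jump_state k w \<in> Some ` D) then 1 else 0) \<partial>P)"

lemma arrived_eq: "arrived m D j t = level_flow m D j (\<lambda>_. 1) t + departed m D j t"
proof -
 have [measurable]: "Measurable.pred P (\<lambda>w. jump_state m w = Some j)"
  using pred_jump_state[of "\<lambda>w. w" P m "{Some j}"] by (simp add: measurable_cong_sets[OF sets_P refl])
 have [measurable]: "Measurable.pred P (\<lambda>w. jump_state k w \<in> Some ` D)" for k
  using pred_jump_state[of "\<lambda>w. w" P k "Some ` D"] by (simp add: measurable_cong_sets[OF sets_P refl])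
 have m1: "(\<lambda>w. if stay m D j w t then act (\<lambda>_. 1) w t else 0) \<in> borel_measurable P"
  by measurable
 have m2: "(\<lambda>w. if jump_time (Suc m) w < ennreal t \<and> jump_state m w = Some j \<and> (\<forall>k\<le>m. jump_state k w \<in> Some ` D) then 1 else 0 :: ennreal) \<in> borel_measurable P"
  by measurable
 show ?thesis
  unfolding arrived_def level_flow_def departed_def nn_integral_add[OF m1 m2, symmetric]
 proof (rule nn_integral_cong)
  fix w assume "w \<in> space P"
  then have "act (\<lambda>_. 1) w t = 1" using act_const by (simp add: space_P)
  then show "(if jump_time m w < ennreal t \<and> jump_state m w = Some j \<and> (\<forall>k\<le>m. jump_state k w \<in> Some ` D) then 1 else 0) =
   (if stay m D j w t then act (\<lambda>_. 1) w t else 0) +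
   (if jump_time (Suc m) w < ennreal t \<and> jump_state m w = Some j \<and> (\<forall>k\<le>m. jump_state k w \<in> Some ` D) then 1 else 0 :: ennreal)"
   using jump_time_mono[of m "Suc m" w] by (auto simp: stay_def sojourn_def not_less dest: le_less_trans)
 qed
qed

lemma arrived_0: "0 < t \<Longrightarrow> j \<in> D \<Longrightarrow> arrived 0 D j t = ennreal (pmf \<gamma> j)"
proof -
 assume t: "0 < t" and j: "j \<in> D"
 interpret prob_space P by (rule prob_space_P)
 have E: "{w \<in> paths. state_at 0 w = Some j} \<in> sets P"
 proof -
  have "{w \<in> space path_algebra. jump_state 0 w = Some j} \<in> sets path_algebra" by measurable
  moreover have "{w \<in> paths. state_at 0 w = Some j} = {w \<in> space path_algebra. jump_state 0 w = Some j}"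
   by (auto simp: state_at_0)
  ultimately show ?thesis by (simp add: sets_P)
 qed
 have "arrived 0 D j t = (\<integral>\<^sup>+w. indicator {w \<in> paths. state_at 0 w = Some j} w \<partial>P)"
  unfolding arrived_def using t j
  by (intro nn_integral_cong) (auto simp: space_P state_at_0 split: split_indicator)
 also have "\<dots> = emeasure P {w \<in> paths. state_at 0 w = Some j}" using E by simp
 also have "\<dots> = ennreal (pmf \<gamma> j)" unfolding emeasure_eq_measure policy_measure(3) ..
 finally show ?thesis .
qed

text \<open>On sojourn m exactly one state i is occupied, so the rate into j at the actual state can
  be written as a sum over all i.\<close>

lemma arrived_Suc:
 assumes t: "0 < t" and j: "j \<in> D"
 shows "arrived (Suc m) D j t = before t (\<lambda>s. csum (\<lambda>i. level_flow m D i (rate j i) s))"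
proof -
 let ?D = "\<lambda>w. \<forall>k\<le>m. jump_state k w \<in> Some ` D"
 have "arrived (Suc m) D j t =
  (\<integral>\<^sup>+w. (if jump_time (Suc m) w < ennreal t \<and> (the (jump_state (Suc m) w) = j \<and> ?D w) then 1 else 0) \<partial>P)"
  unfolding arrived_def
 proof (rule nn_integral_cong)
  fix w assume "w \<in> space P"
  then have w: "w \<in> paths" by (simp add: space_P)
  have "jump_state (Suc m) w = Some j \<longleftrightarrow> the (jump_state (Suc m) w) = j" if "jump_time (Suc m) w < ennreal t"
  proof -
   have "jump_time (Suc m) w < \<infinity>" using that less_trans[of _ "ennreal t" top] by auto
   from jump_state_Some[OF w this] show ?thesis by auto
  qed
  moreover have "(\<forall>k\<le>Suc m. jump_state k w \<in> Some ` D) \<longleftrightarrow> ?D w" if "jump_state (Suc m) w = Some j"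
   using that j by (auto simp: le_Suc_eq)
  ultimately have "(jump_time (Suc m) w < ennreal t \<and> jump_state (Suc m) w = Some j \<and> (\<forall>k\<le>Suc m. jump_state k w \<in> Some ` D)) \<longleftrightarrow>
   (jump_time (Suc m) w < ennreal t \<and> (the (jump_state (Suc m) w) = j \<and> ?D w))" by blast
  then show "(if jump_time (Suc m) w < ennreal t \<and> jump_state (Suc m) w = Some j \<and> (\<forall>k\<le>Suc m. jump_state k w \<in> Some ` D) then 1 else 0) =
   (if jump_time (Suc m) w < ennreal t \<and> (the (jump_state (Suc m) w) = j \<and> ?D w) then 1 else 0 :: ennreal)" by (simp only:)
 qed
 also have "\<dots> = before t (\<lambda>s. \<integral>\<^sup>+w. (if sojourn m w s then csum (\<lambda>j'. (if j' = j \<and> ?D w then policy_rate w s j' else 0)) else 0) \<partial>P)"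
 proof (rule jumps_before[OF t])
  show "Measurable.pred path_algebra (\<lambda>w. j' = j \<and> ?D w)" for j' by measurable
  show "(j' = j \<and> ?D (freeze m w)) = (j' = j \<and> ?D w)" for w j' by (auto simp: jump_state_freeze)
 qed
 also have "\<dots> = before t (\<lambda>s. csum (\<lambda>i. level_flow m D i (rate j i) s))"
 proof (rule nn_integral_cong)
  fix s :: real
  have "(\<integral>\<^sup>+w. (if sojourn m w s then csum (\<lambda>j'. (if j' = j \<and> ?D w then policy_rate w s j' else 0)) else 0) \<partial>P)
    = (\<integral>\<^sup>+w. csum (\<lambda>i. (if stay m D i w s then act (rate j i) w s else 0)) \<partial>P)"
  proof (rule nn_integral_cong)
   fix w assume "w \<in> space P"
   then have w: "w \<in> paths" by (simp add: space_P)
   have 1: "csum (\<lambda>j'. (if j' = j \<and> ?D w then policy_rate w s j' else 0)) = (if ?D w then policy_rate w s j else 0)"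
    by (subst nn_integral_count_space'[of "{j}"]) auto
   show "(if sojourn m w s then csum (\<lambda>j'. (if j' = j \<and> ?D w then policy_rate w s j' else 0)) else 0) =
    csum (\<lambda>i. (if stay m D i w s then act (rate j i) w s else 0))"
   proof (cases "sojourn m w s \<and> ?D w")
    case True
    then obtain i where i: "jump_state m w = Some i" by auto
    then have st: "stay m D i' w s \<longleftrightarrow> i' = i" for i' using True by (auto simp: stay_def)
    have "csum (\<lambda>i. (if stay m D i w s then act (rate j i) w s else 0)) = act (rate j i) w s"
     unfolding st by (subst nn_integral_count_space'[of "{i}"]) auto
    also have "\<dots> = policy_rate w s j"
     using True i w sojourn_pos[of m w s] jump_rate_eq[OF w, of s i j] state_before_sojourn[OF w, of m s]
     by (simp add: policy_rate_def)
    finally show ?thesis unfolding 1 using True by simp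
   next
    case False
    then have "\<not> stay m D i w s" for i by (auto simp: stay_def)
    then show ?thesis unfolding 1 using False by auto
   qed
  qed
  also have "\<dots> = csum (\<lambda>i. level_flow m D i (rate j i) s)"
   unfolding level_flow_def by (rule nn_integral_count_space_nn_integral) measurable
  finally show "(if s < t then \<integral>\<^sup>+w. (if sojourn m w s then csum (\<lambda>j'. (if j' = j \<and> ?D w then policy_rate w s j' else 0)) else 0) \<partial>P else 0) =
   (if s < t then csum (\<lambda>i. level_flow m D i (rate j i) s) else 0)" by (simp only:)
 qed
 finally show ?thesis .
qed

lemma departed_eq:
 assumes t: "0 < t"
 shows "departed m D j t = before t (\<lambda>s. level_flow m D j (out_rate j) s)"
proof -
 let ?D = "\<lambda>w. jump_state m w = Some j \<and> (\<forall>k\<le>m. jump_state k w \<in> Some ` D)"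
 have "departed m D j t = before t (\<lambda>s. \<integral>\<^sup>+w. (if sojourn m w s then csum (\<lambda>j'. (if ?D w then policy_rate w s j' else 0)) else 0) \<partial>P)"
  unfolding departed_def
 proof (rule jumps_before[OF t])
  have [measurable]: "Measurable.pred path_algebra (\<lambda>w. jump_state m w = Some j)"
   using pred_jump_state[of "\<lambda>w. w" path_algebra m "{Some j}"] by simp
  show "Measurable.pred path_algebra ?D" by measurable
  show "?D (freeze m w) = ?D w" for w by (auto simp: jump_state_freeze)
 qed
 also have "\<dots> = before t (\<lambda>s. level_flow m D j (out_rate j) s)"
 proof (rule nn_integral_cong)
  fix s :: real
  have "(\<integral>\<^sup>+w. (if sojourn m w s then csum (\<lambda>j'. (if ?D w then policy_rate w s j' else 0)) else 0) \<partial>P)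
    = level_flow m D j (out_rate j) s"
   unfolding level_flow_def
  proof (rule nn_integral_cong)
   fix w assume "w \<in> space P"
   then have w: "w \<in> paths" by (simp add: space_P)
   show "(if sojourn m w s then csum (\<lambda>j'. (if ?D w then policy_rate w s j' else 0)) else 0) =
    (if stay m D j w s then act (out_rate j) w s else 0)"
   proof (cases "stay m D j w s")
    case True
    then have D: "?D w" and so: "sojourn m w s" by (auto simp: stay_def)
    have "csum (\<lambda>j'. (if ?D w then policy_rate w s j' else 0)) = csum (\<lambda>j'. policy_rate w s j')"
     using D by (intro nn_integral_cong) auto
    also have "\<dots> = act (out_rate j) w s" using policy_rate_sum[OF w so, of j] D by blast
    finally show ?thesis using so True by (simp only: if_True)
   next
    case False
    show ?thesis
    proof (cases "sojourn m w s")
     case True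
     with False have "\<not> ?D w" by (auto simp: stay_def)
     then have "csum (\<lambda>j'. (if ?D w then policy_rate w s j' else 0)) = csum (\<lambda>(j' :: 's). 0)"
      by (intro nn_integral_cong) auto
     then show ?thesis using False by simp
    qed (use False in simp)
   qed
  qed
  then show "(if s < t then \<integral>\<^sup>+w. (if sojourn m w s then csum (\<lambda>j'. (if ?D w then policy_rate w s j' else 0)) else 0) \<partial>P else 0) =
   (if s < t then level_flow m D j (out_rate j) s else 0)" by (simp only:)
 qed
 finally show ?thesis .
qed

lemma level_0:
 assumes "0 < t" "j \<in> D"
 shows "level_flow 0 D j (\<lambda>_. 1) t + before t (\<lambda>s. level_flow 0 D j (out_rate j) s) = ennreal (pmf \<gamma> j)"
 using arrived_eq[of 0 D j t] arrived_0[OF assms] departed_eq[OF assms(1), of 0 D j] by simp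

lemma level_Suc:
 assumes "0 < t" "j \<in> D"
 shows "level_flow (Suc m) D j (\<lambda>_. 1) t + before t (\<lambda>s. level_flow (Suc m) D j (out_rate j) s) =
  before t (\<lambda>s. csum (\<lambda>i. level_flow m D i (rate j i) s))"
 using arrived_eq[of "Suc m" D j t] arrived_Suc[OF assms, of m] departed_eq[OF assms(1), of "Suc m" D j] by simp

text \<open>The level equations are added over m: the gain of level m + 1 comes out of level m, and
  level 0 contributes \<gamma>. Losses stay on the left, since a difference of possibly infinite
  terms would be meaningless.\<close>

lemma total_forward:
 assumes t: "0 < t" and j: "j \<in> D"
 shows "flow_in D j (\<lambda>_. 1) t + before t (\<lambda>s. flow_in D j (out_rate j) s) =
  ennreal (pmf \<gamma> j) + before t (\<lambda>s. csum (\<lambda>i. flow_in D i (rate j i) s))"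
proof -
 have mC: "(\<lambda>s. csum (\<lambda>i. level_flow m D i (rate j i) s)) \<in> borel_measurable borel" for m
  by (intro C.borel_measurable_nn_integral measurable_from_pair_count) (simp add: measurable_level_flow[OF measurable_rate])
 have 1: "before t (\<lambda>s. flow_in D j (out_rate j) s) =
  (\<Sum>m. before t (\<lambda>s. level_flow m D j (out_rate j) s))"
  by (subst nn_integral_suminf[symmetric]) (auto intro!: nn_integral_cong simp: flow_in_eq_suminf)
 have 2: "before t (\<lambda>s. csum (\<lambda>i. flow_in D i (rate j i) s)) =
  (\<Sum>m. before t (\<lambda>s. csum (\<lambda>i. level_flow m D i (rate j i) s)))"
 proof -
  have "csum (\<lambda>i. flow_in D i (rate j i) s) = (\<Sum>m. csum (\<lambda>i. level_flow m D i (rate j i) s))" for s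
   unfolding flow_in_eq_suminf[OF measurable_rate] by (rule nn_integral_suminf) simp
  then have "before t (\<lambda>s. csum (\<lambda>i. flow_in D i (rate j i) s)) =
   (\<integral>\<^sup>+s. (\<Sum>m. if s < t then csum (\<lambda>i. level_flow m D i (rate j i) s) else 0) \<partial>lborel)"
   by (intro nn_integral_cong) simp
  also have "\<dots> = (\<Sum>m. before t (\<lambda>s. csum (\<lambda>i. level_flow m D i (rate j i) s)))"
   using mC by (intro nn_integral_suminf) simp
  finally show ?thesis .
 qed
 have "flow_in D j (\<lambda>_. 1) t + before t (\<lambda>s. flow_in D j (out_rate j) s) =
  (\<Sum>m. level_flow m D j (\<lambda>_. 1) t + before t (\<lambda>s. level_flow m D j (out_rate j) s))"
  unfolding 1 by (subst flow_in_eq_suminf, simp, rule suminf_add[OF summableI summableI])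
 also have "\<dots> = ennreal (pmf \<gamma> j) + (\<Sum>m. before t (\<lambda>s. csum (\<lambda>i. level_flow m D i (rate j i) s)))"
  by (subst suminf_ennreal_head) (simp only: level_0[OF t j] level_Suc[OF t j])
 finally show ?thesis unfolding 2 .
qed

end

section \<open>Moments of the flow\<close>

context controlled_process
begin

lemma flow_in_mono:
 assumes "\<And>a. a \<in> A i \<Longrightarrow> f a \<le> g a" shows "flow_in D i f t \<le> flow_in D i g t"
 unfolding flow_in_def
proof (rule nn_integral_mono)
 fix w assume "w \<in> space P"
 then have w: "w \<in> paths" by (simp add: space_P)
 show "(if \<exists>m. stay m D i w t then act f w t else 0) \<le> (if \<exists>m. stay m D i w t then act g w t else 0)"
  using stay_state[OF w] act_mono[OF w] assms by auto
qed

lemma flow_in_outside: "\<not> (0 < t \<and> i \<in> D) \<Longrightarrow> flow_in D i f t = 0"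
proof -
 assume "\<not> (0 < t \<and> i \<in> D)"
 then have "\<not> (\<exists>m. stay m D i w t)" for w using stay_pos by blast
 then show ?thesis by (simp add: flow_in_def)
qed

lemma flow_in_add:
 assumes [measurable]: "f \<in> borel_measurable borel" "g \<in> borel_measurable borel"
 shows "flow_in D i (\<lambda>a. f a + g a) t = flow_in D i f t + flow_in D i g t"
proof -
 have "flow_in D i f t + flow_in D i g t =
  (\<integral>\<^sup>+w. (if \<exists>m. stay m D i w t then act f w t else 0) + (if \<exists>m. stay m D i w t then act g w t else 0) \<partial>P)"
  unfolding flow_in_def by (rule nn_integral_add[symmetric]) measurable
 also have "\<dots> = flow_in D i (\<lambda>a. f a + g a) t"
  unfolding flow_in_def by (rule nn_integral_cong) (simp add: act_add[OF _ assms] space_P)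
 finally show ?thesis ..
qed

lemma flow_in_cmult:
 assumes [measurable]: "f \<in> borel_measurable borel"
 shows "flow_in D i (\<lambda>a. c * f a) t = c * flow_in D i f t"
proof -
 have "c * flow_in D i f t = (\<integral>\<^sup>+w. c * (if \<exists>m. stay m D i w t then act f w t else 0) \<partial>P)"
  unfolding flow_in_def by (rule nn_integral_cmult[symmetric]) measurable
 also have "\<dots> = flow_in D i (\<lambda>a. c * f a) t"
  unfolding flow_in_def by (rule nn_integral_cong) (simp add: act_cmult[OF _ assms] space_P)
 finally show ?thesis ..
qed

lemma flow_in_count:
 assumes [measurable]: "\<And>j :: 's. f j \<in> borel_measurable borel"
 shows "flow_in D i (\<lambda>a. csum (\<lambda>j. f j a)) t = csum (\<lambda>j. flow_in D i (f j) t)"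
proof -
 have "csum (\<lambda>j. flow_in D i (f j) t) =
  (\<integral>\<^sup>+w. csum (\<lambda>j. (if \<exists>m. stay m D i w t then act (f j) w t else 0)) \<partial>P)"
  unfolding flow_in_def by (rule nn_integral_count_space_nn_integral[symmetric]) measurable
 also have "\<dots> = flow_in D i (\<lambda>a. csum (\<lambda>j. f j a)) t"
  unfolding flow_in_def by (rule nn_integral_cong) (simp add: act_count[OF _ assms] space_P)
 finally show ?thesis ..
qed

lemma flow_in_mass: "csum (\<lambda>i. flow_in D i (\<lambda>_. 1) t) \<le> 1"
proof -
 interpret prob_space P by (rule prob_space_P)
 have "csum (\<lambda>i. flow_in D i (\<lambda>_. 1) t) =
  (\<integral>\<^sup>+w. csum (\<lambda>i. (if \<exists>m. stay m D i w t then act (\<lambda>_. 1) w t else 0)) \<partial>P)"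
  unfolding flow_in_def by (rule nn_integral_count_space_nn_integral[symmetric]) measurable
 also have "\<dots> \<le> (\<integral>\<^sup>+w. 1 \<partial>P)"
 proof (rule nn_integral_mono)
  fix w assume "w \<in> space P"
  then have w: "w \<in> paths" by (simp add: space_P)
  show "csum (\<lambda>i. (if \<exists>m. stay m D i w t then act (\<lambda>_. 1) w t else 0)) \<le> 1"
  proof (cases "\<exists>i m. stay m D i w t")
   case True
   then obtain i m where "stay m D i w t" by blast
   then have "(\<exists>m. stay m D i' w t) \<longleftrightarrow> i' = i" for i' using stay_unique by blast
   then have "csum (\<lambda>i. (if \<exists>m. stay m D i w t then act (\<lambda>_. 1) w t else 0)) = act (\<lambda>_. 1) w t"
    by (subst nn_integral_count_space'[of "{i}"]) auto
   then show ?thesis by (simp add: act_const[OF w])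
  next
   case False
   then have "(\<exists>m. stay m D i w t) = False" for i by blast
   then show ?thesis by (simp only: if_False nn_integral_const) simp
  qed
 qed
 also have "\<dots> = 1" by (simp add: emeasure_space_1)
 finally show ?thesis .
qed

lemma flow_in_mass_single: "flow_in D i (\<lambda>_. 1) t \<le> 1"
proof -
 have "flow_in D i (\<lambda>_. 1) t = csum (\<lambda>j. (if j = i then flow_in D i (\<lambda>_. 1) t else 0))"
  by (subst nn_integral_count_space'[of "{i}"]) auto
 also have "\<dots> \<le> csum (\<lambda>i. flow_in D i (\<lambda>_. 1) t)" by (intro nn_integral_mono) auto
 also have "\<dots> \<le> 1" by (rule flow_in_mass)
 finally show ?thesis .
qed

lemma flow_in_const: "flow_in D i (\<lambda>_. c) t = c * flow_in D i (\<lambda>_. 1) t"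
 using flow_in_cmult[of "\<lambda>_. 1" D i c t] by simp

text \<open>The forward equations, weighted by u and summed, have as gain at most \<rho> times the
  moment plus b times the mass plus exactly the loss term. Finiteness of \<open>D\<close> bounds the
  loss, so it cancels, and Gronwall applies with c = \<Gamma> + b T.\<close>

lemma finite_moment_bound:
 fixes u :: "'s \<Rightarrow> real"
 assumes D: "finite D" and u: "\<And>j. 0 \<le> u j" and B: "\<And>j. j \<in> D \<Longrightarrow> u j \<le> B" "0 \<le> B"
  and drift: "\<And>i a. a \<in> A i \<Longrightarrow>
   (csum (\<lambda>j. ennreal (u j) * rate j i a)) \<le> ennreal (\<rho> * u i + b) + ennreal (u i) * out_rate i a"
  and \<rho>: "0 < \<rho>" and b: "0 \<le> b" and \<Gamma>: "csum (\<lambda>j. ennreal (u j) * ennreal (pmf \<gamma> j)) \<le> ennreal \<Gamma>" "0 \<le> \<Gamma>"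
  and t: "0 < t" "t \<le> T"
 shows "csum (\<lambda>j. ennreal (u j) * flow_in D j (\<lambda>_. 1) t) \<le> ennreal (2 * (\<Gamma> + b * T) * exp (2 * \<rho> * T))"
proof (rule gronwall_nn_integral[OF \<rho> _ _ _ t])
 let ?g = "\<lambda>t. csum (\<lambda>j. ennreal (u j) * flow_in D j (\<lambda>_. 1) t)"
 let ?r = "\<lambda>j v. csum (\<lambda>i. ennreal (u j) * flow_in D i (rate j i) v)" and ?G = "\<lambda>s. \<integral>\<^sup>+v. (if 0 < v \<and> v < s then ?g v else 0) \<partial>lborel"
 have T: "0 < T" using t by simp
 show "0 \<le> \<Gamma> + b * T" using \<Gamma> b T by simp
 show "?g s \<le> ennreal B" for s
 proof -
  have "?g s \<le> csum (\<lambda>j. ennreal B * flow_in D j (\<lambda>_. 1) s)"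
  proof (rule nn_integral_mono)
   fix j
   show "ennreal (u j) * flow_in D j (\<lambda>_. 1) s \<le> ennreal B * flow_in D j (\<lambda>_. 1) s"
    using B flow_in_outside[of s j D "\<lambda>_. 1"] by (cases "j \<in> D") (auto intro!: mult_right_mono ennreal_leI)
  qed
  also have "\<dots> = ennreal B * csum (\<lambda>j. flow_in D j (\<lambda>_. 1) s)" by (rule nn_integral_cmult) simp
  also have "\<dots> \<le> ennreal B * 1" by (intro mult_left_mono flow_in_mass) simp
  finally show ?thesis by simp
 qed
 fix s :: real assume s: "0 < s" "s \<le> T"
 let ?h = "\<lambda>v. csum (\<lambda>j. ennreal (u j) * flow_in D j (out_rate j) v)"
 let ?X = "before s (\<lambda>v. ?h v)"
 \<comment> \<open>Finitely many states of bounded exit rate; this is the point of the restriction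
   to \<open>D\<close>.\<close>
 have X: "?X < \<infinity>"
 proof -
  define K where "K = (\<Sum>j\<in>D. ennreal (u j) * ennreal (max_rate A q j))"
  have "?X \<le> (\<integral>\<^sup>+v. K * indicator {0<..<s} v \<partial>lborel)"
  proof (rule nn_integral_mono)
   fix v :: real
   have "?h v \<le> K" if "0 < v"
   proof -
    have "?h v = (\<Sum>j\<in>D. ennreal (u j) * flow_in D j (out_rate j) v)"
     using D by (intro nn_integral_count_space') (auto simp: flow_in_outside)
    also have "\<dots> \<le> K" unfolding K_def
    proof (intro sum_mono mult_left_mono)
     fix j
     have "flow_in D j (out_rate j) v \<le> flow_in D j (\<lambda>_. ennreal (max_rate A q j)) v"
      by (intro flow_in_mono out_rate_le)
     also have "\<dots> \<le> ennreal (max_rate A q j) * 1"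
      unfolding flow_in_const[of D j "ennreal (max_rate A q j)"] by (intro mult_left_mono flow_in_mass_single) simp
     finally show "flow_in D j (out_rate j) v \<le> ennreal (max_rate A q j)" by simp
    qed simp
    finally show ?thesis .
   qed
   moreover have "?h v = 0" if "\<not> 0 < v" using that by (simp add: flow_in_outside)
   ultimately show "(if v < s then ?h v else 0) \<le> K * indicator {0<..<s} v"
    by (cases "0 < v") (auto split: split_indicator)
  qed
  also have "\<dots> = K * ennreal s" using s by (subst nn_integral_cmult_indicator) auto
  also have "\<dots> < \<infinity>" 
  proof -
   have "K = ennreal (\<Sum>j\<in>D. u j * max 0 (max_rate A q j))"
    unfolding K_def using u by (subst sum_ennreal[symmetric]) (auto simp: ennreal_mult' max_def ennreal_neg intro!: sum.cong)
   then show ?thesis by (simp add: ennreal_mult_less_top)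
  qed
  finally show ?thesis .
 qed
 have "?g s + ?X = csum (\<lambda>j. ennreal (u j) * (flow_in D j (\<lambda>_. 1) s + before s (\<lambda>v. flow_in D j (out_rate j) v)))"
 proof -
  have "?X = (\<integral>\<^sup>+v. csum (\<lambda>j. (if v < s then ennreal (u j) * flow_in D j (out_rate j) v else 0)) \<partial>lborel)"
   by (intro nn_integral_cong) simp
  also have "\<dots> = csum (\<lambda>j. before s (\<lambda>v. ennreal (u j) * flow_in D j (out_rate j) v))"
   by (rule nn_integral_count_space_nn_integral) (simp_all add: measurable_flow_in)
  also have "\<dots> = csum (\<lambda>j. ennreal (u j) * before s (\<lambda>v. flow_in D j (out_rate j) v))"
   by (intro nn_integral_cong, subst nn_integral_cmult[symmetric]) (auto intro!: nn_integral_cong)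
  finally show ?thesis
   by (simp add: nn_integral_add[symmetric] distrib_left)
 qed
 also have "\<dots> \<le> csum (\<lambda>j. ennreal (u j) * ennreal (pmf \<gamma> j) +
    before s (?r j))"
 proof (rule nn_integral_mono)
  fix j
  have eq: "before s (?r j)
    = ennreal (u j) * before s (\<lambda>v. csum (\<lambda>i. flow_in D i (rate j i) v))"
  proof -
   have "before s (?r j)
    = (\<integral>\<^sup>+v. ennreal (u j) * (if v < s then csum (\<lambda>i. flow_in D i (rate j i) v) else 0) \<partial>lborel)"
    by (rule nn_integral_cong) (simp add: nn_integral_cmult)
   also have "\<dots> = ennreal (u j) * before s (\<lambda>v. csum (\<lambda>i. flow_in D i (rate j i) v))"
    by (rule nn_integral_cmult) (simp add: measurable_flow_in)
   finally show ?thesis .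
  qed
  show "ennreal (u j) * (flow_in D j (\<lambda>_. 1) s + before s (\<lambda>v. flow_in D j (out_rate j) v)) \<le>
   ennreal (u j) * ennreal (pmf \<gamma> j) +
    before s (?r j)"
  \<comment> \<open>Outside \<open>D\<close> the left side is 0: paths leaving \<open>D\<close> are
    discarded, which only helps an upper bound.\<close>
  proof (cases "j \<in> D")
   case True
   show ?thesis unfolding total_forward[OF s(1) True] eq distrib_left ..
  next
   case False
   then show ?thesis by (simp add: flow_in_outside cong: if_cong)
  qed
 qed
 also have "\<dots> = csum (\<lambda>j. ennreal (u j) * ennreal (pmf \<gamma> j)) +
   csum (\<lambda>j. before s (?r j))"
  by (rule nn_integral_add) auto
 also have "csum (\<lambda>j. before s (?r j))
  = (\<integral>\<^sup>+v. csum (\<lambda>j. (if v < s then ?r j v else 0)) \<partial>lborel)"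
  by (rule nn_integral_count_space_nn_integral[symmetric]) (simp_all add: measurable_flow_in)
 also have "\<dots> \<le> (\<integral>\<^sup>+v. ((if 0 < v \<and> v < s then ennreal \<rho> * ?g v else 0) + (ennreal b * indicator {0<..<s} v)) + (if v < s then ?h v else 0) \<partial>lborel)"
 proof (rule nn_integral_mono)
  fix v :: real
  show "csum (\<lambda>j. (if v < s then ?r j v else 0)) \<le>
   ((if 0 < v \<and> v < s then ennreal \<rho> * ?g v else 0) + (ennreal b * indicator {0<..<s} v)) + (if v < s then ?h v else 0)"
  proof (cases "0 < v \<and> v < s")
   case True
   have "csum (\<lambda>j. ?r j v) =
    csum (\<lambda>i. csum (\<lambda>j. ennreal (u j) * flow_in D i (rate j i) v))"
    by (rule nn_integral_count_space_nn_integral) auto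
   also have "\<dots> \<le> csum (\<lambda>i. (ennreal \<rho> * (ennreal (u i) * flow_in D i (\<lambda>_. 1) v) + ennreal b * flow_in D i (\<lambda>_. 1) v) + ennreal (u i) * flow_in D i (out_rate i) v)"
   proof (rule nn_integral_mono)
    fix i
    have "csum (\<lambda>j. ennreal (u j) * flow_in D i (rate j i) v) = csum (\<lambda>j. flow_in D i (\<lambda>a. ennreal (u j) * rate j i a) v)"
     by (intro nn_integral_cong flow_in_cmult[symmetric]) simp
    also have "\<dots> = flow_in D i (\<lambda>a. csum (\<lambda>j. ennreal (u j) * rate j i a)) v"
     by (rule flow_in_count[symmetric]) simp
    also have "\<dots> \<le> flow_in D i (\<lambda>a. ennreal (\<rho> * u i + b) + ennreal (u i) * out_rate i a) v"
     by (rule flow_in_mono) (rule drift)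
    also have "\<dots> = ennreal (\<rho> * u i + b) * flow_in D i (\<lambda>_. 1) v + ennreal (u i) * flow_in D i (out_rate i) v"
     by (subst flow_in_add) (auto simp: flow_in_cmult flow_in_const[of _ _ "ennreal (\<rho> * u i + b)"])
    also have "ennreal (\<rho> * u i + b) = ennreal \<rho> * ennreal (u i) + ennreal b"
     using \<rho> b u[of i] by (simp add: ennreal_mult[symmetric] ennreal_plus[symmetric] del: ennreal_plus)
    finally show "csum (\<lambda>j. ennreal (u j) * flow_in D i (rate j i) v) \<le>
     (ennreal \<rho> * (ennreal (u i) * flow_in D i (\<lambda>_. 1) v) + ennreal b * flow_in D i (\<lambda>_. 1) v) + ennreal (u i) * flow_in D i (out_rate i) v"
     by (simp add: distrib_right mult.assoc)
   qed
   also have "\<dots> = (ennreal \<rho> * ?g v + ennreal b * csum (\<lambda>i. flow_in D i (\<lambda>_. 1) v)) + ?h v"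
    by (simp add: nn_integral_add nn_integral_cmult)
   also have "\<dots> \<le> (ennreal \<rho> * ?g v + ennreal b * 1) + ?h v"
    by (intro add_mono mult_left_mono flow_in_mass) auto
   finally show ?thesis using True by simp
  next
   case False
   then show ?thesis by (cases "v < s") (auto simp: flow_in_outside)
  qed
 qed
 also have "\<dots> = ((\<integral>\<^sup>+v. (if 0 < v \<and> v < s then ennreal \<rho> * ?g v else 0) \<partial>lborel) + (\<integral>\<^sup>+v. ennreal b * indicator {0<..<s} v \<partial>lborel)) + ?X"
  by (simp add: nn_integral_add measurable_flow_in)
 also have "(\<integral>\<^sup>+v. ennreal b * indicator {0<..<s} v \<partial>lborel) = ennreal (b * s)"
  using s b by (subst nn_integral_cmult_indicator) (auto simp: ennreal_mult)
 also have "(\<integral>\<^sup>+v. (if 0 < v \<and> v < s then ennreal \<rho> * ?g v else 0) \<partial>lborel) = ennreal \<rho> * ?G s"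
  by (subst nn_integral_cmult[symmetric]) (auto intro!: nn_integral_cong simp: measurable_flow_in)
 finally have "?g s + ?X \<le> (csum (\<lambda>j. ennreal (u j) * ennreal (pmf \<gamma> j)) +
  (ennreal \<rho> * ?G s + ennreal (b * s))) + ?X"
  by (simp add: add.assoc add_left_mono)
 then have "?g s \<le> csum (\<lambda>j. ennreal (u j) * ennreal (pmf \<gamma> j)) +
  (ennreal \<rho> * ?G s + ennreal (b * s))"
  using X by (auto simp: ennreal_add_left_cancel_le add.commute[of _ ?X])
 also have "\<dots> \<le> ennreal \<Gamma> + (ennreal \<rho> * ?G s + ennreal (b * T))"
  using \<Gamma>(1) s b by (intro add_mono order_refl ennreal_leI mult_left_mono) auto
 also have "\<dots> = ennreal (\<Gamma> + b * T) + ennreal \<rho> * ?G s"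
  using \<Gamma>(2) b T by (simp add: ennreal_plus add_ac)
 finally show "?g s \<le> ennreal (\<Gamma> + b * T) + ennreal \<rho> * ?G s" .
qed

lemma flow_in_mono_set: "D \<subseteq> E \<Longrightarrow> flow_in D i f t \<le> flow_in E i f t"
 unfolding flow_in_def
proof (intro nn_integral_mono)
 fix w assume "D \<subseteq> E"
 then have "stay m D i w t \<Longrightarrow> stay m E i w t" for m unfolding stay_def by blast
 then show "(if \<exists>m. stay m D i w t then act f w t else 0) \<le> (if \<exists>m. stay m E i w t then act f w t else 0)" by auto
qed

lemma flow_in_SUP:
 assumes D: "incseq D" "(\<Union>n. D n) = UNIV" and [measurable]: "f \<in> borel_measurable borel"
 shows "flow_in UNIV i f t = (SUP n. flow_in (D n) i f t)"
proof -
 have "flow_in UNIV i f t = (\<integral>\<^sup>+w. (SUP n. if \<exists>m. stay m (D n) i w t then act f w t else 0) \<partial>P)"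
  unfolding flow_in_def
 proof (rule nn_integral_cong)
  fix w assume "w \<in> space P"
  then have w: "w \<in> paths" by (simp add: space_P)
  show "(if \<exists>m. stay m UNIV i w t then act f w t else 0) = (SUP n. if \<exists>m. stay m (D n) i w t then act f w t else 0)"
  proof (cases "\<exists>m. stay m UNIV i w t")
   case True
   then obtain m where m: "stay m UNIV i w t" by blast
   have "\<forall>k\<in>{..m}. \<exists>n. jump_state k w \<in> Some ` D n"
   proof
    fix k assume "k \<in> {..m}"
    then have "jump_state k w \<in> range Some" using m by (auto simp: stay_def)
    then show "\<exists>n. jump_state k w \<in> Some ` D n" using D(2) by blast
   qed
   then obtain N where N: "\<And>k. k \<le> m \<Longrightarrow> jump_state k w \<in> Some ` D (N k)" by (metis atMost_iff)
   \<comment> \<open>Up to jump m only finitely many states have been visited, so one member of the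
     increasing sequence contains them all.\<close>
   define n where "n = Max (N ` {..m})"
   have "N k \<le> n" if "k \<le> m" for k unfolding n_def using that by (intro Max_ge) auto
   then have "D (N k) \<subseteq> D n" if "k \<le> m" for k using D(1) that by (auto dest: incseqD)
   then have "stay m (D n) i w t" using m N unfolding stay_def by blast
   then have "act f w t \<le> (SUP n. if \<exists>m. stay m (D n) i w t then act f w t else 0)"
    by (intro SUP_upper2[of n]) auto
   moreover have "(SUP n. if \<exists>m. stay m (D n) i w t then act f w t else 0) \<le> act f w t"
    by (intro SUP_least) auto
   ultimately show ?thesis using True by (simp add: antisym)
  next
   case False
   then have "(\<exists>m. stay m (D n) i w t) = False" for n unfolding stay_def by blast
   then show ?thesis using False by simp
  qed
 qed
 also have "\<dots> = (SUP n. flow_in (D n) i f t)"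
  unfolding flow_in_def
 proof (rule nn_integral_monotone_convergence_SUP)
  show "incseq (\<lambda>n w. if \<exists>m. stay m (D n) i w t then act f w t else 0)"
  proof (intro incseq_SucI le_funI)
   fix n w
   have "stay m (D n) i w t \<Longrightarrow> stay m (D (Suc n)) i w t" for m
    using incseq_SucD[OF D(1), of n] unfolding stay_def by blast
   then show "(if \<exists>m. stay m (D n) i w t then act f w t else 0) \<le> (if \<exists>m. stay m (D (Suc n)) i w t then act f w t else 0)"
    by auto
  qed
 qed measurable
 finally show ?thesis .
qed

text \<open>The bound for finite sets of states does not depend on the set, so it survives
  exhaustion by the sublevel sets of u.\<close>

lemma moment_bound:
 fixes u :: "'s \<Rightarrow> real"
 assumes u: "\<And>j. 0 \<le> u j" and fin: "\<And>n::nat. finite {i. u i \<le> real n}"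
  and drift: "\<And>i a. a \<in> A i \<Longrightarrow>
   (csum (\<lambda>j. ennreal (u j) * rate j i a)) \<le> ennreal (\<rho> * u i + b) + ennreal (u i) * out_rate i a"
  and \<rho>: "0 < \<rho>" and b: "0 \<le> b" and \<Gamma>: "csum (\<lambda>j. ennreal (u j) * ennreal (pmf \<gamma> j)) \<le> ennreal \<Gamma>" "0 \<le> \<Gamma>"
  and t: "0 < t" "t \<le> T"
 shows "csum (\<lambda>j. ennreal (u j) * flow_in UNIV j (\<lambda>_. 1) t) \<le> ennreal (2 * (\<Gamma> + b * T) * exp (2 * \<rho> * T))"
proof -
 define D where "D n = {i. u i \<le> real n}" for n :: nat
 have D: "incseq D" by (auto simp: incseq_def D_def)
 have U: "(\<Union>n. D n) = UNIV" using real_arch_simple by (auto simp: D_def)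
 have "csum (\<lambda>j. ennreal (u j) * flow_in UNIV j (\<lambda>_. 1) t) =
  csum (\<lambda>j. (SUP n. ennreal (u j) * flow_in (D n) j (\<lambda>_. 1) t))"
  by (intro nn_integral_cong) (simp add: flow_in_SUP[OF D U] SUP_mult_left_ennreal)
 also have "\<dots> = (SUP n. csum (\<lambda>j. ennreal (u j) * flow_in (D n) j (\<lambda>_. 1) t))"
  using D by (intro nn_integral_monotone_convergence_SUP incseq_SucI le_funI mult_left_mono flow_in_mono_set) (auto dest: incseq_SucD)
 also have "\<dots> \<le> ennreal (2 * (\<Gamma> + b * T) * exp (2 * \<rho> * T))"
 proof (rule SUP_least)
  fix n
  show "csum (\<lambda>j. ennreal (u j) * flow_in (D n) j (\<lambda>_. 1) t) \<le> ennreal (2 * (\<Gamma> + b * T) * exp (2 * \<rho> * T))"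
   by (rule finite_moment_bound[of _ _ "real n"]) (use assms in \<open>auto simp: D_def\<close>)
 qed
 finally show ?thesis .
qed

end

section \<open>Expected costs in terms of the flow\<close>

text \<open>Costs are signed Bochner integrals, flows are extended nonnegative. If both double
  integrals are finite, each part is integrable on the product and Fubini applies.\<close>

lemma integral_enn2real_diff:
 fixes F G :: "'b \<Rightarrow> 'c \<Rightarrow> ennreal"
 assumes "sigma_finite_measure M1" "sigma_finite_measure M2"
  and m [measurable]: "case_prod F \<in> borel_measurable (M1 \<Otimes>\<^sub>M M2)" "case_prod G \<in> borel_measurable (M1 \<Otimes>\<^sub>M M2)"
  and fin: "(\<integral>\<^sup>+x. \<integral>\<^sup>+y. F x y \<partial>M2 \<partial>M1) < \<infinity>" "(\<integral>\<^sup>+x. \<integral>\<^sup>+y. G x y \<partial>M2 \<partial>M1) < \<infinity>"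
 shows "(\<integral>x. \<integral>y. enn2real (F x y) - enn2real (G x y) \<partial>M2 \<partial>M1) =
  enn2real (\<integral>\<^sup>+x. \<integral>\<^sup>+y. F x y \<partial>M2 \<partial>M1) - enn2real (\<integral>\<^sup>+x. \<integral>\<^sup>+y. G x y \<partial>M2 \<partial>M1)"
proof -
 interpret M1: sigma_finite_measure M1 by fact
 interpret M2: sigma_finite_measure M2 by fact
 interpret PS: pair_sigma_finite M1 M2 ..
 have *: "integrable (M1 \<Otimes>\<^sub>M M2) (\<lambda>p. enn2real (case_prod H p)) \<and>
   (\<integral>p. enn2real (case_prod H p) \<partial>(M1 \<Otimes>\<^sub>M M2)) = enn2real (\<integral>\<^sup>+x. \<integral>\<^sup>+y. H x y \<partial>M2 \<partial>M1)"
  if [measurable]: "case_prod H \<in> borel_measurable (M1 \<Otimes>\<^sub>M M2)" and fin: "(\<integral>\<^sup>+x. \<integral>\<^sup>+y. H x y \<partial>M2 \<partial>M1) < \<infinity>" for H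
 proof -
  have eq: "(\<integral>\<^sup>+x. \<integral>\<^sup>+y. H x y \<partial>M2 \<partial>M1) = (\<integral>\<^sup>+p. case_prod H p \<partial>(M1 \<Otimes>\<^sub>M M2))"
   using M2.nn_integral_fst[OF that(1)] by simp
  then have "AE p in M1 \<Otimes>\<^sub>M M2. case_prod H p \<noteq> \<infinity>"
   using fin by (intro nn_integral_PInf_AE that(1)) auto
  then have "(\<integral>\<^sup>+p. ennreal (enn2real (case_prod H p)) \<partial>(M1 \<Otimes>\<^sub>M M2)) = (\<integral>\<^sup>+p. case_prod H p \<partial>(M1 \<Otimes>\<^sub>M M2))"
   by (intro nn_integral_cong_AE) (auto simp: ennreal_enn2real_if)
  then show ?thesis
   using fin unfolding eq by (auto intro!: integrableI_bounded simp: integral_eq_nn_integral)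
 qed
 let ?f = "\<lambda>p. enn2real (case_prod F p) - enn2real (case_prod G p)"
 have "integrable (M1 \<Otimes>\<^sub>M M2) ?f" using *[OF m(1) fin(1)] *[OF m(2) fin(2)] by auto
 from PS.integral_fst'[OF this] show ?thesis
  using *[OF m(1) fin(1)] *[OF m(2) fin(2)] by simp
qed

context controlled_process
begin

abbreviation flow :: "'s \<Rightarrow> ('a \<Rightarrow> ennreal) \<Rightarrow> real \<Rightarrow> ennreal" where
 "flow \<equiv> flow_in UNIV"

text \<open>Since \<open>ennreal\<close> clips, only the positive part of \<open>f\<close> counts;
  the expected cost is the difference of the values for \<open>f\<close> and -f.\<close>

definition cost_flow :: "('s \<Rightarrow> 'a \<Rightarrow> real) \<Rightarrow> real \<Rightarrow> ennreal" where
 "cost_flow f T = (\<integral>\<^sup>+t. (if t \<le> T then csum (\<lambda>i. flow i (\<lambda>a. indicator (A i) a * ennreal (f i a)) t) else 0) \<partial>lborel)"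

lemma running_cost_eq:
 assumes w: "w \<in> paths" and t: "0 < t" "state_before t w = Some i"
  and f: "f i \<in> borel_measurable (restrict_space borel (A i))" "\<And>a. a \<in> A i \<Longrightarrow> \<bar>f i a\<bar> \<le> K"
 shows "running_cost A f \<pi> w t =
   enn2real (act (\<lambda>a. indicator (A i) a * ennreal (f i a)) w t) - enn2real (act (\<lambda>a. indicator (A i) a * ennreal (- f i a)) w t)"
proof -
 interpret prob_space "\<pi> w t" using w t by (intro policy_kernel) auto
 define h where "h x = indicator (Some ` A i) x * f i (the x)" for x
 have sets: "sets (\<pi> w t) = sets action_algebra" using w t by (intro policy_kernel) auto
 have m1: "(\<lambda>a. if a \<in> A i then f i a else 0) \<in> borel_measurable borel"
  using f(1) A_borel[of i] by (subst measurable_If_restrict_space_iff) auto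
 have "{x \<in> space action_algebra. x \<in> Some ` A i} \<in> sets action_algebra"
  using Some_image_action[OF A_borel] by simp
 then have "(\<lambda>x. if x \<in> Some ` A i then (if the x \<in> A i then f i (the x) else 0) else 0) \<in> borel_measurable action_algebra"
  by (intro measurable_If measurable_compose[OF measurable_the_action m1]) simp_all
 also have "(\<lambda>x. if x \<in> Some ` A i then (if the x \<in> A i then f i (the x) else 0) else 0) = h"
  by (auto simp: h_def fun_eq_iff)
 finally have h: "h \<in> borel_measurable (\<pi> w t)" by (simp add: measurable_cong_sets[OF sets refl])
 have "integrable (\<pi> w t) h"
  using f(2) h by (intro integrable_const_bound[of _ "max K 0"]) (auto simp: h_def le_max_iff_disj split: split_indicator)
 moreover have "(\<integral>\<^sup>+x. ennreal (s * h x) \<partial>\<pi> w t) = act (\<lambda>a. indicator (A i) a * ennreal (s * f i a)) w t" for s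
  unfolding action_integral_def max_absorb2[OF less_imp_le[OF t(1)]]
  by (rule nn_integral_cong_AE, use policy_admissible[OF w less_imp_le[OF t(1)] t(2)] in eventually_elim) (auto simp: h_def)
 from this[of 1] this[of "-1"] have "(\<integral>\<^sup>+x. ennreal (h x) \<partial>\<pi> w t) = act (\<lambda>a. indicator (A i) a * ennreal (f i a)) w t"
  "(\<integral>\<^sup>+x. ennreal (- h x) \<partial>\<pi> w t) = act (\<lambda>a. indicator (A i) a * ennreal (- f i a)) w t" by simp_all
 ultimately show ?thesis
  using t by (simp add: running_cost_def h_def[symmetric] real_lebesgue_integral_def)
qed

lemma expected_cost_eq:
 fixes f :: "'s \<Rightarrow> 'a \<Rightarrow> real"
 assumes f: "\<And>i. f i \<in> borel_measurable (restrict_space borel (A i))" "\<And>i a. a \<in> A i \<Longrightarrow> \<bar>f i a\<bar> \<le> K i"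
  and fin: "cost_flow f T < \<infinity>" "cost_flow (\<lambda>i a. - f i a) T < \<infinity>"
 shows "expected_cost A q \<gamma> T f \<pi> = enn2real (cost_flow f T) - enn2real (cost_flow (\<lambda>i a. - f i a) T)"
proof -
 interpret prob_space P by (rule prob_space_P)
 interpret PL: pair_sigma_finite P lborel ..
 define E where "E h i = (\<lambda>a. indicator (A i) a * ennreal (h i a))" for h i
 define R where "R h w t = (if t \<le> T then csum (\<lambda>i. (if \<exists>m. stay m UNIV i w t then act (E h i) w t else 0)) else 0)" for h w t
 let ?P = "P \<Otimes>\<^sub>M (lborel :: real measure)"
 have R: "case_prod (R h) \<in> borel_measurable ?P \<and> (\<integral>\<^sup>+w. \<integral>\<^sup>+t. R h w t \<partial>lborel \<partial>P) = cost_flow h T"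
  if "\<And>i. h i \<in> borel_measurable (restrict_space borel (A i))" for h
 proof -
  have [measurable]: "E h i \<in> borel_measurable borel" for i unfolding E_def by (rule borel_measurable_on_actions[OF that])
  have [measurable]: "(\<lambda>p. if \<exists>m. stay m UNIV i (fst p) (snd p) then act (E h i) (fst p) (snd p) else 0) \<in> borel_measurable ?P" for i
   by measurable
  have [measurable]: "(\<lambda>p. csum (\<lambda>i. (if \<exists>m. stay m UNIV i (fst p) (snd p) then act (E h i) (fst p) (snd p) else 0))) \<in> borel_measurable ?P"
   by (intro C.borel_measurable_nn_integral measurable_from_pair_count) simp
  have m: "case_prod (R h) \<in> borel_measurable ?P" unfolding R_def case_prod_beta' by measurable
  have "(\<integral>\<^sup>+w. \<integral>\<^sup>+t. R h w t \<partial>lborel \<partial>P) = (\<integral>\<^sup>+t. \<integral>\<^sup>+w. R h w t \<partial>P \<partial>lborel)"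
   by (rule PL.Fubini'[OF m, symmetric])
  also have "\<dots> = cost_flow h T"
   unfolding cost_flow_def
  proof (rule nn_integral_cong)
   fix t :: real
   have "(\<integral>\<^sup>+w. csum (\<lambda>i. (if \<exists>m. stay m UNIV i w t then act (E h i) w t else 0)) \<partial>P) = csum (\<lambda>i. flow i (E h i) t)"
    unfolding flow_in_def by (rule nn_integral_count_space_nn_integral) measurable
   then show "(\<integral>\<^sup>+w. R h w t \<partial>P) = (if t \<le> T then csum (\<lambda>i. flow i (\<lambda>a. indicator (A i) a * ennreal (h i a)) t) else 0)"
    by (simp add: R_def E_def)
  qed
  finally show ?thesis using m by blast
 qed
 let ?g = "\<lambda>i a. - f i a"
 have g: "?g i \<in> borel_measurable (restrict_space borel (A i))" for i using f(1) by simp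
 have "expected_cost A q \<gamma> T f \<pi> = (\<integral>w. \<integral>t. enn2real (R f w t) - enn2real (R ?g w t) \<partial>lborel \<partial>P)"
  unfolding expected_cost_def set_lebesgue_integral_def
 proof (rule Bochner_Integration.integral_cong[OF refl])
  fix w assume "w \<in> space P"
  then have w: "w \<in> paths" by (simp add: space_P)
  have [measurable]: "(\<lambda>t. enn2real (R f w t) - enn2real (R ?g w t)) \<in> borel_measurable lborel"
   using measurable_Pair2[OF R[of f, THEN conjunct1, OF f(1)] \<open>w \<in> space P\<close>]
    measurable_Pair2[OF R[of ?g, THEN conjunct1, OF g] \<open>w \<in> space P\<close>] by simp
  \<comment> \<open>Time 0 is left out because no sojourn contains it, although
    \<open>state_before\<close> has a value there.\<close>
  have eq: "indicator {0..T} t *\<^sub>R running_cost A f \<pi> w t = enn2real (R f w t) - enn2real (R ?g w t)" if "t \<noteq> 0" for t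
  proof -
   from that consider "t < 0" | "0 < t" "t \<le> T" | "T < t" "0 < t" by linarith
   then show ?thesis
   proof cases
    case 1
    then have "(\<exists>m. stay m UNIV i w t) = False" for i using stay_pos by (metis less_asym)
    then show ?thesis using 1 by (simp add: R_def)
   next
    case 3 then show ?thesis by (simp add: R_def)
   next
    case 2
    have st: "(\<exists>m. stay m UNIV i w t) \<longleftrightarrow> state_before t w = Some i" for i
    proof
     assume "state_before t w = Some i"
     then obtain m where m: "sojourn m w t" "jump_state m w = Some i" using state_before_Some_iff[OF w 2(1)] by blast
     have "jump_state k w \<in> range Some" if "k \<le> m" for k
     proof -
      have "jump_time k w < \<infinity>"
       using le_less_trans[OF jump_time_mono[OF that] sojourn_finite[OF m(1)]] .
      then show ?thesis using jump_state_Some[OF w] by blast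
     qed
     then show "\<exists>m. stay m UNIV i w t" using m by (auto simp: stay_def)
    qed (use stay_state[OF w] in blast)
    show ?thesis
    proof (cases "state_before t w")
     case None
     then show ?thesis using 2 by (simp add: R_def running_cost_def st)
    next
     case (Some i)
     have "csum (\<lambda>j. (if \<exists>m. stay m UNIV j w t then act (E h j) w t else 0)) = act (E h i) w t" for h
      unfolding st Some by (subst nn_integral_count_space'[of "{i}"]) auto
     then show ?thesis
      using running_cost_eq[where f=f and K="K i", OF w 2(1) Some f] 2 by (simp add: R_def E_def)
    qed
   qed
  qed
  show "(\<integral>t. indicator {0..T} t *\<^sub>R running_cost A f \<pi> w t \<partial>lborel) = (\<integral>t. enn2real (R f w t) - enn2real (R ?g w t) \<partial>lborel)"
  proof (rule integral_cong_AE)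
   \<comment> \<open>The integrand differs from a measurable function at most at the point 0, hence
     is measurable itself.\<close>
   have "(\<lambda>t. if t = 0 then indicator {0..T} 0 *\<^sub>R running_cost A f \<pi> w 0 else enn2real (R f w t) - enn2real (R ?g w t)) \<in> borel_measurable lborel"
    by measurable
   also have "(\<lambda>t. if t = 0 then indicator {0..T} 0 *\<^sub>R running_cost A f \<pi> w 0 else enn2real (R f w t) - enn2real (R ?g w t)) =
    (\<lambda>t. indicator {0..T} t *\<^sub>R running_cost A f \<pi> w t)"
    by (rule ext) (simp add: eq[symmetric] del: real_scaleR_def)
   finally show "(\<lambda>t. indicator {0..T} t *\<^sub>R running_cost A f \<pi> w t) \<in> borel_measurable lborel" .
   show "AE t in lborel. indicator {0..T} t *\<^sub>R running_cost A f \<pi> w t = enn2real (R f w t) - enn2real (R ?g w t)"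
    using AE_lborel_singleton[of 0] by eventually_elim (rule eq)
  qed measurable
 qed
 also have "\<dots> = enn2real (cost_flow f T) - enn2real (cost_flow (\<lambda>i a. - f i a) T)"
  using integral_enn2real_diff[of P lborel "R f" "R ?g"] R[OF f(1)] R[OF g] fin
  by (simp add: sigma_finite_measure_axioms lborel.sigma_finite_measure_axioms)
 finally show ?thesis .
qed

end

lemma ennreal_le_epsilonI:
 fixes x y :: ennreal
 assumes "\<And>e. 0 < e \<Longrightarrow> x \<le> y + ennreal e" shows "x \<le> y"
 by (rule ennreal_le_epsilon) (use assms in auto)

lemma nn_integral_split_at:
 fixes f :: "real \<Rightarrow> ennreal"
 assumes [measurable]: "f \<in> borel_measurable borel" and "u \<le> t"
 shows "before t (\<lambda>s. f s) = before u (\<lambda>s. f s) + (\<integral>\<^sup>+s. (if u \<le> s \<and> s < t then f s else 0) \<partial>lborel)"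
 using assms(2) by (subst nn_integral_add[symmetric]) (auto intro!: nn_integral_cong)

section \<open>Uniqueness for the forward equation\<close>

text \<open>If \<open>x\<close> exceeded \<open>y\<close> at time \<open>t\<close>, restart both equations at a time \<open>u\<close> close to the last time at which
 \<open>x \<le> y\<close>: afterwards the loss term of \<open>x\<close> dominates that of \<open>y\<close>.\<close>
lemma linear_comparison:
 fixes x y a h k :: "real \<Rightarrow> ennreal"
 assumes m [measurable]: "x \<in> borel_measurable borel" "y \<in> borel_measurable borel" "a \<in> borel_measurable borel"
   "h \<in> borel_measurable borel" "k \<in> borel_measurable borel"
  and x: "\<And>t. 0 < t \<Longrightarrow> t \<le> T \<Longrightarrow> x t + before t (\<lambda>s. a s * x s) = c + before t (\<lambda>s. h s)"
  and y: "\<And>t. 0 < t \<Longrightarrow> t \<le> T \<Longrightarrow> y t + before t (\<lambda>s. a s * y s) = d + before t (\<lambda>s. k s)"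
  and le: "c \<le> d" "\<And>s. s < T \<Longrightarrow> h s \<le> k s"
  and bnd: "\<And>t. x t \<le> 1" "\<And>t. y t \<le> 1" "\<And>t. a t \<le> ennreal K" "\<And>t. t \<le> 0 \<Longrightarrow> x t = 0 \<and> y t = 0"
  and t: "0 < t" "t \<le> T"
 shows "x t \<le> y t"
proof -
 define K' where "K' = max K 1"
 have K': "0 < K'" and aK: "a s \<le> ennreal K'" for s
  using bnd(3)[of s] order_trans[OF _ ennreal_leI[of K K']] by (auto simp: K'_def)
 have ay: "a s * z s \<le> ennreal K'" if "\<And>t. z t \<le> 1" for s and z :: "real \<Rightarrow> ennreal"
  using mult_mono[OF aK[of s] that[of s]] by simp
 have fin: "before r (\<lambda>s. a s * z s) < \<infinity>"
  if "\<And>t. z t \<le> 1" "\<And>t. t \<le> 0 \<Longrightarrow> z t = 0" for r and z :: "real \<Rightarrow> ennreal"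
 proof -
  have "before r (\<lambda>s. a s * z s) \<le> (\<integral>\<^sup>+s. ennreal K' * indicator {0..max 0 r} s \<partial>lborel)"
   using ay[OF that(1)] that(2) by (intro nn_integral_mono) (auto split: split_indicator simp: not_le)
  also have "\<dots> < \<infinity>" by (subst nn_integral_cmult_indicator) (auto simp: ennreal_mult_less_top)
  finally show ?thesis .
 qed
 have cancel: "p \<le> q" if "p + r \<le> q + r" "r < \<infinity>" for p q r :: ennreal
  using that by (auto simp: ennreal_add_left_cancel_le add.commute[of _ r])
 define I where "I u g = (\<integral>\<^sup>+s. (if u \<le> s \<and> s < t then g s else 0) \<partial>lborel)" for u g
 define J where "J u g = before u (\<lambda>s. g s)" for u :: real and g :: "real \<Rightarrow> ennreal"
 have finx: "J r (\<lambda>s. a s * x s) < \<infinity>" for r unfolding J_def by (rule fin) (simp_all add: bnd)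
 have finy: "J r (\<lambda>s. a s * y s) < \<infinity>" for r unfolding J_def by (rule fin) (simp_all add: bnd)
 have IJ: "J t g = J u g + I u g" if "g \<in> borel_measurable borel" "u \<le> t" for u g
  unfolding I_def J_def by (rule nn_integral_split_at[OF that])
 \<comment> \<open>Both equations restarted at u; the loss integrals up to u are finite and
   cancel.\<close>
 have incr: "x t + I u (\<lambda>s. a s * x s) \<le> y t + I u (\<lambda>s. a s * y s)"
  if u: "0 < u" "u \<le> t" "x u \<le> y u" for u
 proof -
  let ?ax = "\<lambda>s. a s * x s" and ?ay = "\<lambda>s. a s * y s"
  have uT: "u \<le> T" using u t by simp
  have "x t + I u ?ax + J u ?ax = c + (J u h + I u h)"
   using x[OF t] IJ[of ?ax u] IJ[of h u] u by (simp add: J_def[symmetric] ac_simps)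
  also have "\<dots> = x u + I u h + J u ?ax"
   using x[OF u(1) uT] by (simp add: J_def[symmetric] ac_simps)
  finally have "x t + I u ?ax \<le> x u + I u h"
   by (intro cancel[OF eq_refl finx])
  also have "\<dots> \<le> y u + I u k"
   unfolding I_def using u t le by (intro add_mono nn_integral_mono) auto
  also have "y u + I u k \<le> y t + I u ?ay"
  proof (rule cancel[of _ "J u ?ay"])
   have "y t + I u ?ay + J u ?ay = d + (J u k + I u k)"
    using y[OF t] IJ[of ?ay u] IJ[of k u] u by (simp add: J_def[symmetric] ac_simps)
   also have "\<dots> = y u + I u k + J u ?ay"
    using y[OF u(1) uT] by (simp add: J_def[symmetric] ac_simps)
   finally show "y u + I u k + J u ?ay \<le> y t + I u ?ay + J u ?ay" by (simp only: order_refl)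
  qed (rule finy)
  finally show ?thesis .
 qed
 show ?thesis
 proof (rule ccontr)
  assume n: "\<not> x t \<le> y t"
  define S where "S = {u. 0 < u \<and> u < t \<and> x u \<le> y u}"
  show False
  proof (cases "S = {}")
   case True
   \<comment> \<open>Here x exceeds y on all of (0, t), so the loss of x dominates throughout and
     the comparison starts from c <= d.\<close>
   have "J t (\<lambda>s. a s * y s) \<le> J t (\<lambda>s. a s * x s)"
    unfolding J_def using True bnd(4) by (intro nn_integral_mono) (auto simp: S_def not_less intro!: mult_left_mono, metis less_eq_real_def linorder_not_less zero_le nle_le)
   then have "x t + J t (\<lambda>s. a s * x s) \<le> y t + J t (\<lambda>s. a s * x s)"
   proof -
    assume "J t (\<lambda>s. a s * y s) \<le> J t (\<lambda>s. a s * x s)"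
    moreover have "J t h \<le> J t k" unfolding J_def using le(2) t by (intro nn_integral_mono) auto
    then have "c + J t h \<le> d + J t k" using le(1) by (rule add_mono[rotated])
    then have "x t + J t (\<lambda>s. a s * x s) \<le> y t + J t (\<lambda>s. a s * y s)"
     using x[OF t] y[OF t] by (simp add: J_def)
    ultimately show ?thesis by (meson add_left_mono order_trans)
   qed
   then have "x t \<le> y t" by (rule cancel[OF _ finx])
   with n show False ..
  next
   case False
   have bdd: "bdd_above S" by (auto simp: S_def bdd_above_def intro!: exI[of _ t])
   have "x t \<le> y t"
   proof (rule ennreal_le_epsilonI)
    fix e :: real assume e: "0 < e"
    \<comment> \<open>Restart within e / K' of the supremum: up to \<open>Sup S\<close> the loss of
      y is at most K' per unit of time, hence at most e in all, and beyond \<open>Sup S\<close> it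
      is at most that of x.\<close>
    then have "Sup S - e / K' < Sup S" using K' by simp
    then obtain u where u: "u \<in> S" "Sup S - e / K' < u" using less_cSup_iff[OF False bdd] by blast
    have uS: "u \<le> Sup S" using u(1) bdd by (rule cSup_upper)
    have "I u (\<lambda>s. a s * y s) \<le> (\<integral>\<^sup>+s. ennreal K' * indicator {u..Sup S} s + (if u \<le> s \<and> s < t then a s * x s else 0) \<partial>lborel)"
     unfolding I_def
    proof (rule nn_integral_mono)
     fix s :: real
     show "(if u \<le> s \<and> s < t then a s * y s else 0) \<le> ennreal K' * indicator {u..Sup S} s + (if u \<le> s \<and> s < t then a s * x s else 0)"
     proof (cases "u \<le> s \<and> s < t \<and> Sup S < s")
      case True
      then have "s \<notin> S" using cSup_upper[OF _ bdd] by (meson not_less)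
      then have "y s \<le> x s" using True u(1) by (auto simp: S_def)
      then show ?thesis using True by (auto intro!: mult_left_mono)
     next
      case False
      then show ?thesis using ay[of y s] bnd by (auto split: split_indicator intro: add_increasing2)
     qed
    qed
    also have "\<dots> = ennreal K' * ennreal (Sup S - u) + I u (\<lambda>s. a s * x s)"
     unfolding I_def using uS by (subst nn_integral_add) (auto simp: nn_integral_cmult_indicator)
    also have "ennreal K' * ennreal (Sup S - u) \<le> ennreal e"
    proof -
     have "K' * (Sup S - u) \<le> e" using u(2) K' by (simp add: field_simps)
     then show ?thesis using uS K' by (simp add: ennreal_mult[symmetric] ennreal_leI)
    qed
    finally have Iy: "I u (\<lambda>s. a s * y s) \<le> ennreal e + I u (\<lambda>s. a s * x s)" by (simp add: add_right_mono)
    have "x t + I u (\<lambda>s. a s * x s) \<le> y t + (ennreal e + I u (\<lambda>s. a s * x s))"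
    proof -
     have "0 < u" "u \<le> t" "x u \<le> y u" using u(1) by (auto simp: S_def)
     from order_trans[OF incr[OF this] add_left_mono[OF Iy]] show ?thesis .
    qed
    then have Ixy: "x t + I u (\<lambda>s. a s * x s) \<le> (y t + ennreal e) + I u (\<lambda>s. a s * x s)"
     by (simp only: add.assoc)
    have Ix: "I u (\<lambda>s. a s * x s) < \<infinity>"
    proof (rule le_less_trans[OF _ finx[of t]])
     show "I u (\<lambda>s. a s * x s) \<le> J t (\<lambda>s. a s * x s)" unfolding I_def J_def by (rule nn_integral_mono) auto
    qed
    from cancel[OF Ixy Ix] show "x t \<le> y t + ennreal e" .
   qed
   with n show False ..
  qed
 qed
qed

context controlled_process
begin

text \<open>Under a Markov policy the mean of f over the actions depends on state and time only and
  leaves the expectation as a factor.\<close>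

lemma level_flow_cmult_mass:
 assumes "\<And>w. w \<in> paths \<Longrightarrow> state_before t w = Some i \<Longrightarrow> act f w t = c"
 shows "level_flow m D i f t = c * level_flow m D i (\<lambda>_. 1) t"
proof -
 have "c * level_flow m D i (\<lambda>_. 1) t = (\<integral>\<^sup>+w. c * (if stay m D i w t then act (\<lambda>_. 1) w t else 0) \<partial>P)"
  unfolding level_flow_def by (rule nn_integral_cmult[symmetric]) measurable
 also have "\<dots> = level_flow m D i f t"
  unfolding level_flow_def by (rule nn_integral_cong) (use assms stay_state in \<open>auto simp: act_const space_P\<close>)
 finally show ?thesis ..
qed

lemma flow_eq_suminf: "flow i (\<lambda>_. 1) t = (\<Sum>m. level_flow m UNIV i (\<lambda>_. 1) t)"
 by (rule flow_in_eq_suminf) simp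

lemma partial_sum_le_flow: "(\<Sum>m<n. level_flow m UNIV i f t) \<le> flow i f t" if "f \<in> borel_measurable borel"
 unfolding flow_in_eq_suminf[OF that] by (rule sum_le_suminf) auto

text \<open>Summed over all states, gain and loss coincide by conservativity. Being finite they
  cancel, and the mass of \<gamma> remains.\<close>

lemma flow_mass_one:
 assumes t: "0 < t" and fin: "before t (\<lambda>s. csum (\<lambda>i. flow i (out_rate i) s)) < \<infinity>"
 shows "csum (\<lambda>i. flow i (\<lambda>_. 1) t) = 1"
proof -
 let ?X = "before t (\<lambda>s. csum (\<lambda>i. flow i (out_rate i) s))"
 have sw: "csum (\<lambda>j. before t (\<lambda>s. F j s)) = before t (\<lambda>s. csum (\<lambda>j. F j s))"
  if [measurable]: "\<And>j :: 's. F j \<in> borel_measurable borel" for F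
 proof -
  have "csum (\<lambda>j. before t (\<lambda>s. F j s)) = (\<integral>\<^sup>+s. csum (\<lambda>j. (if s < t then F j s else 0)) \<partial>lborel)"
   by (rule nn_integral_count_space_nn_integral[symmetric]) auto
  also have "\<dots> = before t (\<lambda>s. csum (\<lambda>j. F j s))"
   by (rule nn_integral_cong) simp
  finally show ?thesis .
 qed
 have "csum (\<lambda>j. flow j (\<lambda>_. 1) t) + ?X =
  csum (\<lambda>j. flow j (\<lambda>_. 1) t + before t (\<lambda>s. flow j (out_rate j) s))"
  by (subst nn_integral_add) (auto simp: sw measurable_flow_in)
 also have "\<dots> = csum (\<lambda>j. ennreal (pmf \<gamma> j) + before t (\<lambda>s. csum (\<lambda>i. flow i (rate j i) s)))"
  by (intro nn_integral_cong total_forward[OF t]) simp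
 also have "\<dots> = csum (\<lambda>j. ennreal (pmf \<gamma> j)) + before t (\<lambda>s. csum (\<lambda>j. csum (\<lambda>i. flow i (rate j i) s)))"
  by (subst nn_integral_add) (auto simp: sw measurable_flow_in)
 also have "csum (\<lambda>j. ennreal (pmf \<gamma> j)) = 1"
  by (rule nn_integral_pmf_eq_1)
 also have "before t (\<lambda>s. csum (\<lambda>j. csum (\<lambda>i. flow i (rate j i) s))) = ?X"
 proof (rule nn_integral_cong)
  fix s :: real
  have "csum (\<lambda>j. csum (\<lambda>i. flow i (rate j i) s)) = csum (\<lambda>i. csum (\<lambda>j. flow i (rate j i) s))"
   by (rule nn_integral_count_space_nn_integral) auto
  also have "\<dots> = csum (\<lambda>i. flow i (\<lambda>a. csum (\<lambda>j. rate j i a)) s)"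
   by (intro nn_integral_cong flow_in_count[symmetric]) simp
  finally show "(if s < t then csum (\<lambda>j. csum (\<lambda>i. flow i (rate j i) s)) else 0) =
   (if s < t then csum (\<lambda>i. flow i (out_rate i) s) else 0)" by (simp add: nn_integral_rate)
 qed
 finally show ?thesis using fin by (auto simp: ennreal_add_left_cancel add.commute[of _ ?X])
qed

text \<open>The level sums approximate the smallest solution of the forward equation from below; having mass one, it is the
 only solution of mass at most one.\<close>
lemma forward_unique:
 fixes p :: "'s \<Rightarrow> real \<Rightarrow> ennreal" and \<kappa> :: "'s \<Rightarrow> real \<Rightarrow> ('a \<Rightarrow> ennreal) \<Rightarrow> ennreal"
 assumes markov: "\<And>w t i f. w \<in> paths \<Longrightarrow> 0 < t \<Longrightarrow> t \<le> T \<Longrightarrow> f \<in> borel_measurable borel \<Longrightarrow> state_before t w = Some i \<Longrightarrow> act f w t = \<kappa> i t f"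
  and \<kappa>: "\<And>i f. f \<in> borel_measurable borel \<Longrightarrow> (\<lambda>t. \<kappa> i t f) \<in> borel_measurable borel" "\<And>i t. \<kappa> i t (out_rate i) \<le> ennreal (max_rate A q i)"
  and p: "\<And>i. p i \<in> borel_measurable borel" "\<And>t. csum (\<lambda>i. p i t) \<le> 1" "\<And>i t. t \<le> 0 \<Longrightarrow> p i t = 0"
  and fwd: "\<And>j t. 0 < t \<Longrightarrow> t \<le> T \<Longrightarrow> p j t + before t (\<lambda>s. \<kappa> j s (out_rate j) * p j s) =
   ennreal (pmf \<gamma> j) + before t (\<lambda>s. csum (\<lambda>i. \<kappa> i s (rate j i) * p i s))"
  and fin: "before T (\<lambda>s. csum (\<lambda>i. flow i (out_rate i) s)) < \<infinity>"
  and t: "0 < t" "t \<le> T"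
 shows "p j t = flow j (\<lambda>_. 1) t"
proof -
 note [measurable] = p(1) \<kappa>(1)
 have level_flow\<kappa>: "level_flow m UNIV i f s = \<kappa> i s f * level_flow m UNIV i (\<lambda>_. 1) s" if "s \<le> T" "f \<in> borel_measurable borel" for m i f s
 proof (cases "0 < s")
  case False
  then have "\<not> stay m UNIV i w s" for m w using stay_pos by blast
  then show ?thesis by (simp add: level_flow_def)
 qed (use that markov in \<open>intro level_flow_cmult_mass, auto\<close>)
 have p1: "p j s \<le> 1" for j s
  using order_trans[OF nn_integral_ge_point[of j UNIV "\<lambda>i. p i s"] p(2)] by simp
 define S where "S n j s = (\<Sum>m<n. level_flow m UNIV j (\<lambda>_. 1) s)" for n j s
 let ?C = "\<lambda>n j s. csum (\<lambda>i. \<kappa> i s (rate j i) * S n i s)"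
 have S1: "S n j s \<le> 1" for n j s
  unfolding S_def by (rule order_trans[OF partial_sum_le_flow flow_in_mass_single]) simp
 have S0: "S n j s = 0" if "s \<le> 0" for n j s
  using flow_in_outside[of s j UNIV "\<lambda>_. 1"] partial_sum_le_flow[where f="\<lambda>_. 1" and n=n and i=j and t=s] that by (simp add: S_def)
 have mS [measurable]: "S n j \<in> borel_measurable borel" for n j unfolding S_def[abs_def] by measurable
 \<comment> \<open>The first n + 1 levels gain from the first n levels, which the induction
   hypothesis bounds by p; \<open>linear_comparison\<close> absorbs the common loss rate.\<close>
 have Sp: "S n j s \<le> p j s" if "0 < s" "s \<le> T" for n j s
  using that
 proof (induction n arbitrary: j s)
  case 0 then show ?case by (simp add: S_def)
 next
  case (Suc n)
  show ?case
  proof (rule linear_comparison[where x="S (Suc n) j" and y="p j" and t=s and T=T and a="\<lambda>s. \<kappa> j s (out_rate j)" and c="ennreal (pmf \<gamma> j)" and d="ennreal (pmf \<gamma> j)"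
    \<comment> \<open>The gain is cut to positive times, where the induction hypothesis speaks; the
      levels vanish at the others.\<close>
    and h="\<lambda>s. if 0 < s \<and> s < T then ?C n j s else 0"
    and k="\<lambda>s. csum (\<lambda>i. \<kappa> i s (rate j i) * p i s)" and K="max_rate A q j"])
   fix r assume r: "0 < r" "r \<le> T"
   have 1: "before r (\<lambda>s. \<kappa> j s (out_rate j) * S (Suc n) j s)
    = (\<Sum>m<Suc n. before r (\<lambda>s. level_flow m UNIV j (out_rate j) s))"
   proof (subst nn_integral_sum[symmetric])
    show "before r (\<lambda>s. \<kappa> j s (out_rate j) * S (Suc n) j s) =
     (\<integral>\<^sup>+s. (\<Sum>m<Suc n. if s < r then level_flow m UNIV j (out_rate j) s else 0) \<partial>lborel)"
    proof (rule nn_integral_cong)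
     fix s :: real
     have "level_flow m UNIV j (out_rate j) s = \<kappa> j s (out_rate j) * level_flow m UNIV j (\<lambda>_. 1) s" if "s < r" for m
      using r that by (intro level_flow\<kappa>) auto
     then show "(if s < r then \<kappa> j s (out_rate j) * S (Suc n) j s else 0) = (\<Sum>m<Suc n. if s < r then level_flow m UNIV j (out_rate j) s else 0)"
      unfolding S_def by (simp add: sum_distrib_left distrib_left)
    qed
   qed (simp add: measurable_level_flow)
   have 2: "(\<integral>\<^sup>+s. (if s < r then if 0 < s \<and> s < T then ?C n j s else 0 else 0) \<partial>lborel)
    = (\<Sum>m<n. before r (\<lambda>s. csum (\<lambda>i. level_flow m UNIV i (rate j i) s)))"
   proof (subst nn_integral_sum[symmetric])
    show "(\<integral>\<^sup>+s. (if s < r then if 0 < s \<and> s < T then ?C n j s else 0 else 0) \<partial>lborel) =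
     (\<integral>\<^sup>+s. (\<Sum>m<n. if s < r then csum (\<lambda>i. level_flow m UNIV i (rate j i) s) else 0) \<partial>lborel)"
    proof (rule nn_integral_cong)
     fix s :: real
     have "?C n j s = (\<Sum>m<n. csum (\<lambda>i. level_flow m UNIV i (rate j i) s))" if "s < r"
     proof -
      have "?C n j s = csum (\<lambda>i. (\<Sum>m<n. level_flow m UNIV i (rate j i) s))"
       unfolding S_def sum_distrib_left using r that by (intro nn_integral_cong sum.cong level_flow\<kappa>[symmetric]) auto
      then show ?thesis by (simp add: nn_integral_sum)
     qed
     moreover have "level_flow m UNIV i (rate j i) s = 0" if "s \<le> 0" for m i
     proof -
      have "\<not> stay m UNIV i w s" for w using stay_pos[of m UNIV i w s] that by auto
      then show ?thesis by (simp add: level_flow_def)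
     qed
     ultimately show "(if s < r then if 0 < s \<and> s < T then ?C n j s else 0 else 0) =
      (\<Sum>m<n. if s < r then csum (\<lambda>i. level_flow m UNIV i (rate j i) s) else 0)"
      using r by (cases "0 < s") auto
    qed
   qed (simp add: measurable_level_flow)
   show "S (Suc n) j r + before r (\<lambda>s. \<kappa> j s (out_rate j) * S (Suc n) j s) =
    ennreal (pmf \<gamma> j) + (\<integral>\<^sup>+s. (if s < r then if 0 < s \<and> s < T then ?C n j s else 0 else 0) \<partial>lborel)"
    unfolding 1 2 unfolding S_def sum.distrib[symmetric]
    by (subst sum.lessThan_Suc_shift) (simp only: level_0[OF r(1) UNIV_I] level_Suc[OF r(1) UNIV_I])
  next
   fix s assume "s < T"
   then show "(if 0 < s \<and> s < T then ?C n j s else 0) \<le> csum (\<lambda>i. \<kappa> i s (rate j i) * p i s)"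
    using Suc.IH[of s] by (auto intro!: nn_integral_mono mult_left_mono)
  next
   show "S (Suc n) j t \<le> 1" "p j t \<le> 1" "\<kappa> j t (out_rate j) \<le> ennreal (max_rate A q j)" for t by (rule S1 p1 \<kappa>(2))+
   show "S (Suc n) j t = 0 \<and> p j t = 0" if "t \<le> 0" for t using S0 p(3) that by blast
  qed (fact Suc.prems fwd | simp add: measurable_csum)+
 qed
 have le: "flow i (\<lambda>_. 1) t \<le> p i t" for i
  unfolding flow_eq_suminf using Sp[OF t, of _ i] by (intro suminf_le_const) (auto simp: S_def)
 have "csum (\<lambda>i. flow i (\<lambda>_. 1) t) = 1"
 proof (rule flow_mass_one[OF t(1)])
  show "before t (\<lambda>s. csum (\<lambda>i. flow i (out_rate i) s)) < \<infinity>"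
   using t(2) by (intro le_less_trans[OF nn_integral_mono fin]) auto
 qed
 \<comment> \<open>The smaller solution already has mass one, which leaves nothing for the excess of
   p.\<close>
 then have "csum (\<lambda>i. p i t - flow i (\<lambda>_. 1) t) = 0"
  using antisym[OF p(2)[of t]] nn_integral_mono[of "count_space UNIV" "\<lambda>i. flow i (\<lambda>_. 1) t" "\<lambda>i. p i t"] le
  by (subst nn_integral_diff) auto
 then have "p j t - flow j (\<lambda>_. 1) t = 0" by (simp add: nn_integral_0_iff_AE AE_count_space)
 then have "p j t \<le> flow j (\<lambda>_. 1) t"
  using p1[of j t] le[of j] by (auto simp: diff_eq_0_iff_ennreal)
 with le[of j] show ?thesis by simp
qed

end

section \<open>Weak limits of densities and laws of coded actions\<close>

text \<open>Both H and t - H t are increasing, and their interval measures add up to Lebesgue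
  measure. Hence Lebesgue null sets are null for the first measure, and Radon-Nikodym gives the
  density.\<close>

lemma lipschitz_density:
 fixes H :: "real \<Rightarrow> real"
 assumes H: "\<And>u t. u \<le> t \<Longrightarrow> H u \<le> H t" "\<And>u t. u \<le> t \<Longrightarrow> H t - H u \<le> t - u"
 obtains G :: "real \<Rightarrow> ennreal" where "G \<in> borel_measurable borel"
  "\<And>u t. u \<le> t \<Longrightarrow> (\<integral>\<^sup>+s. (if u < s \<and> s < t then G s else 0) \<partial>lborel) = ennreal (H t - H u)"
proof -
 let ?\<mu> = "interval_measure H" and ?\<nu> = "interval_measure (\<lambda>t. t - H t)"
 have H': "u - H u \<le> t - H t" if "u \<le> t" for u t using H(2)[OF that] by simp
 have "1-lipschitz_on UNIV H"
 proof (rule lipschitz_onI)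
  show "dist (H x) (H y) \<le> 1 * dist x y" for x y
   using H[of x y] H[of y x] by (cases "x \<le> y") (auto simp: dist_real_def)
 qed simp
 then have cont: "continuous_on UNIV H" by (rule lipschitz_on_continuous_on)
 have cont': "continuous_on UNIV (\<lambda>t. t - H t)" by (intro continuous_intros cont)
 have at_right: "continuous (at_right a) F" if "continuous_on UNIV F" for a and F :: "real \<Rightarrow> real"
  using that by (auto simp: continuous_on_eq_continuous_within intro: continuous_within_subset)
 have Ioc: "emeasure ?\<mu> {u<..t} = ennreal (H t - H u)" if "u \<le> t" for u t
  by (rule emeasure_interval_measure_Ioc[OF that H(1) at_right[OF cont]])
 have Ioc': "emeasure ?\<nu> {u<..t} = ennreal ((t - H t) - (u - H u))" if "u \<le> t" for u t
  by (rule emeasure_interval_measure_Ioc[OF that H' at_right[OF cont']])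
 \<comment> \<open>The sum of the two interval measures, to be recognised as Lebesgue measure on
   half-open intervals.\<close>
 define M where "M = measure_of UNIV (sets borel) (\<lambda>B. emeasure ?\<mu> B + emeasure ?\<nu> B)"
 have sM: "sets M = sets borel"
  unfolding M_def using sets.sigma_sets_eq[of borel] by (simp add: sets_measure_of)
 have eM: "emeasure M B = emeasure ?\<mu> B + emeasure ?\<nu> B" if "B \<in> sets borel" for B
 proof -
  have "countably_additive (sets borel) (\<lambda>B. emeasure ?\<mu> B + emeasure ?\<nu> B)"
  proof (rule countably_additiveI)
   fix F :: "nat \<Rightarrow> real set" assume F: "range F \<subseteq> sets borel" "disjoint_family F"
   show "(\<Sum>n. emeasure ?\<mu> (F n) + emeasure ?\<nu> (F n)) = emeasure ?\<mu> (\<Union> (range F)) + emeasure ?\<nu> (\<Union> (range F))"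
    using F by (subst suminf_add[OF summableI summableI, symmetric]) (simp add: suminf_emeasure)
  qed
  moreover have "sigma_algebra UNIV (sets (borel :: real measure))"
   using sets.sigma_algebra_axioms[of "borel :: real measure"] by simp
  moreover have "positive (sets borel) (\<lambda>B. emeasure ?\<mu> B + emeasure ?\<nu> B)" by (simp add: positive_def)
  ultimately show ?thesis unfolding M_def by (intro emeasure_measure_of_sigma that)
 qed
 have "interval_measure (\<lambda>t. t) = M"
 proof (rule measure_eqI_generator_eq[where E="range (\<lambda>(a, b). {a<..b})" and A="\<lambda>n. {- real n<..real n}" and \<Omega>=UNIV])
  show "Int_stable (range (\<lambda>(a :: real, b). {a<..b}))"
  proof (rule Int_stableI)
   fix X Y assume "X \<in> range (\<lambda>(a :: real, b). {a<..b})" "Y \<in> range (\<lambda>(a :: real, b). {a<..b})"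
   then obtain a b c d where "X = {a<..b}" "Y = {c<..d}" by auto
   then have "X \<inter> Y = (\<lambda>(a, b). {a<..b}) (max a c, min b d)" by auto
   then show "X \<inter> Y \<in> range (\<lambda>(a, b). {a<..b})" by (rule range_eqI)
  qed
  show "emeasure (interval_measure (\<lambda>t. t)) X = emeasure M X" if "X \<in> range (\<lambda>(a, b). {a<..b})" for X
  proof -
   from that obtain a b where X: "X = {a<..b}" by auto
   show ?thesis
   proof (cases "a \<le> b")
    case True
    have "emeasure (interval_measure (\<lambda>t. t)) {a<..b} = ennreal (b - a)"
     by (rule emeasure_interval_measure_Ioc[OF True]) (auto intro: continuous_ident)
    then show ?thesis
     using H(1)[OF True] H'[OF True] by (simp add: X eM Ioc[OF True] Ioc'[OF True] ennreal_plus[symmetric] del: ennreal_plus)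
   qed (simp add: X)
  qed
  have "sets borel = sigma_sets UNIV (range (\<lambda>(a :: real, b). {a<..b}))"
   unfolding borel_sigma_sets_Ioc by (simp add: sets_measure_of image_def) 
  then show "sets (interval_measure (\<lambda>t. t)) = sigma_sets UNIV (range (\<lambda>(a :: real, b). {a<..b}))"
   "sets M = sigma_sets UNIV (range (\<lambda>(a :: real, b). {a<..b}))" by (simp_all add: sM)
  show "(\<Union>n. {- real n<..real n}) = UNIV"
  proof (intro set_eqI iffI UNIV_I)
   fix x :: real
   obtain n where "\<bar>x\<bar> < real n" using reals_Archimedean2 by blast
   then show "x \<in> (\<Union>n. {- real n<..real n})" by (intro UN_I[of n]) auto
  qed
  show "emeasure (interval_measure (\<lambda>t. t)) {- real n<..real n} \<noteq> \<infinity>" for n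
   by (subst emeasure_interval_measure_Ioc) (auto intro: continuous_ident)
 qed auto
 then have "emeasure lborel B = emeasure ?\<mu> B + emeasure ?\<nu> B" if "B \<in> sets borel" for B
  using eM[OF that] by (simp add: lborel_eq_real)
 then have "absolutely_continuous lborel ?\<mu>"
  unfolding absolutely_continuous_def by (auto simp: null_sets_def)
 then obtain G where G: "G \<in> borel_measurable lborel" "density lborel G = ?\<mu>"
  using sigma_finite_measure.Radon_Nikodym[OF lborel.sigma_finite_measure_axioms] by (metis sets_interval_measure sets_lborel)
 show ?thesis
 proof (rule that[of G])
  fix u t :: real assume ut: "u \<le> t"
  have "(\<integral>\<^sup>+s. (if u < s \<and> s < t then G s else 0) \<partial>lborel) = (\<integral>\<^sup>+s. G s * indicator {u<..t} s \<partial>lborel)"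
  proof (rule nn_integral_cong_AE)
   show "AE s in lborel. (if u < s \<and> s < t then G s else 0) = G s * indicator {u<..t} s"
    using AE_lborel_singleton[of t] by eventually_elim (auto split: split_indicator)
  qed
  also have "\<dots> = emeasure (density lborel G) {u<..t}" using G by (subst emeasure_density) auto
  finally show "(\<integral>\<^sup>+s. (if u < s \<and> s < t then G s else 0) \<partial>lborel) = ennreal (H t - H u)"
   by (simp add: G Ioc[OF ut])
 qed (use G in simp)
qed

text \<open>The primitives of functions with values in [0, 1] are increasing and 1-Lipschitz.
  Compactness of a countable product of intervals gives a subsequence converging at all rational
  times, the common Lipschitz constant extends this to all times, and the limits are primitives
  again.\<close>

lemma weak_star_densities:
 fixes g :: "nat \<Rightarrow> 'k::countable \<Rightarrow> real \<Rightarrow> ennreal"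
 assumes m [measurable]: "\<And>n k. g n k \<in> borel_measurable borel" and le1: "\<And>n k s. g n k s \<le> 1"
 obtains r :: "nat \<Rightarrow> nat" and G where "strict_mono r" "\<And>k. G k \<in> borel_measurable borel"
  "\<And>k t. 0 \<le> t \<Longrightarrow> (\<lambda>n. \<integral>\<^sup>+s. (if 0 < s \<and> s < t then g (r n) k s else 0) \<partial>lborel) \<longlonglongrightarrow> (\<integral>\<^sup>+s. (if 0 < s \<and> s < t then G k s else 0) \<partial>lborel)"
proof -
 define I where "I n k t = (\<integral>\<^sup>+s. (if 0 < s \<and> s < t then g n k s else 0) \<partial>lborel)" for n k t
 define F where "F n k t = enn2real (I n k t)" for n k t
 have incr: "I n k u \<le> I n k t \<and> I n k t \<le> I n k u + ennreal (t - u)" if "u \<le> t" for n k u t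
 proof
  show "I n k u \<le> I n k t" unfolding I_def using that by (intro nn_integral_mono) auto
  have "I n k t \<le> (\<integral>\<^sup>+s. (if 0 < s \<and> s < u then g n k s else 0) + indicator {u..t} s \<partial>lborel)"
   unfolding I_def using le1 by (intro nn_integral_mono) (auto split: split_indicator)
  also have "\<dots> = I n k u + ennreal (t - u)" unfolding I_def using that by (subst nn_integral_add) auto
  finally show "I n k t \<le> I n k u + ennreal (t - u)" .
 qed
 have I0: "I n k t = 0" if "t \<le> 0" for n k t
 proof -
  have "I n k t = (\<integral>\<^sup>+(s :: real). 0 \<partial>lborel)" unfolding I_def by (rule nn_integral_cong) (use that in auto)
  then show ?thesis by simp
 qed
 have fin: "I n k t = ennreal (F n k t)" for n k t
 proof -
  have "I n k t \<le> I n k (min t 0) + ennreal (t - min t 0)" using incr[of "min t 0" t n k] by simp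
  also have "\<dots> < top" by (simp add: I0)
  finally show ?thesis by (simp add: F_def)
 qed
 have F0: "0 \<le> F n k t" for n k t by (simp add: F_def)
 have Fm: "F n k u \<le> F n k t" and Fl: "F n k t - F n k u \<le> t - u" if "u \<le> t" for n k u t
  using incr[OF that, of n k] that F0[of n k] by (auto simp: fin ennreal_plus[symmetric] simp del: ennreal_plus)
 have Fl': "\<bar>F n k t - F n k u\<bar> \<le> \<bar>t - u\<bar>" for n k t u
  using Fm[of u t n k] Fl[of u t n k] Fm[of t u n k] Fl[of t u n k] by (cases "u \<le> t") auto
 have Fb: "F n k t \<le> \<bar>t\<bar>" for n k t
  using Fl'[of n k t 0] by (simp add: F_def I0)
 define x where "x n = (\<lambda>(k, \<rho>). F n k (of_rat \<rho>))" for n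
 define b :: "rat \<Rightarrow> real" where "b \<rho> = \<bar>of_rat \<rho>\<bar>" for \<rho>
 \<comment> \<open>Primitives vanish at 0, so their values at a rational time lie between 0 and its
   absolute value; all indices and rational times together form one compact metrizable
   product.\<close>
 let ?C = "PiE UNIV (\<lambda>(k :: 'k, \<rho>). {0..b \<rho>})"
 have "compact ?C"
  using compactin_PiE[of "\<lambda>_. euclidean" UNIV "\<lambda>(k :: 'k, \<rho>). {0..b \<rho>}"]
  by (auto simp: euclidean_product_topology)
 moreover have "x n \<in> ?C" for n using F0 Fb[of n _ "of_rat _", folded b_def] by (auto simp: x_def)
 ultimately obtain l r where r: "strict_mono r" and l: "(x \<circ> r) \<longlonglongrightarrow> l"
  unfolding compact_eq_seq_compact_metric seq_compact_def by metis
 have rat: "(\<lambda>n. F (r n) k (of_rat \<rho>)) \<longlonglongrightarrow> l (k, \<rho>)" for k \<rho>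
 proof -
  have "(\<lambda>n. (x \<circ> r) n (k, \<rho>)) \<longlonglongrightarrow> l (k, \<rho>)"
   by (rule continuous_on_tendsto_compose[OF continuous_on_product_coordinates l]) auto
  then show ?thesis by (simp add: x_def)
 qed
 have conv: "convergent (\<lambda>n. F (r n) k t)" for k t
 proof (rule real_Cauchy_convergent, rule CauchyI)
  fix e :: real assume e: "0 < e"
  then obtain \<rho> where \<rho>: "t < of_rat \<rho>" "of_rat \<rho> < t + e / 3" using of_rat_dense[of t "t + e / 3"] by auto
  have "Cauchy (\<lambda>n. F (r n) k (of_rat \<rho>))" using rat by (rule LIMSEQ_imp_Cauchy)
  then obtain N where N: "\<And>m n. N \<le> m \<Longrightarrow> N \<le> n \<Longrightarrow> norm (F (r m) k (of_rat \<rho>) - F (r n) k (of_rat \<rho>)) < e / 3"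
   using e unfolding Cauchy_iff by (metis divide_pos_pos zero_less_numeral)
  have "norm (F (r m) k t - F (r n) k t) < e" if "N \<le> m" "N \<le> n" for m n
   using N[OF that] Fl'[of "r m" k t "of_rat \<rho>"] Fl'[of "r n" k t "of_rat \<rho>"] \<rho>
   unfolding real_norm_def by linarith
  then show "\<exists>M. \<forall>m\<ge>M. \<forall>n\<ge>M. norm (F (r m) k t - F (r n) k t) < e" by blast
 qed
 define H where "H k t = lim (\<lambda>n. F (r n) k t)" for k t
 have H: "(\<lambda>n. F (r n) k t) \<longlonglongrightarrow> H k t" for k t
  unfolding H_def using conv by (simp add: convergent_LIMSEQ_iff)
 have "\<exists>G. G \<in> borel_measurable borel \<and> (\<forall>u t. u \<le> t \<longrightarrow> (\<integral>\<^sup>+s. (if u < s \<and> s < t then G s else 0) \<partial>lborel) = ennreal (H k t - H k u))" for k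
 proof -
  have "H k u \<le> H k t" if "u \<le> t" for u t
   using Fm[OF that] by (intro LIMSEQ_le[OF H H]) auto
  moreover have "H k t - H k u \<le> t - u" if "u \<le> t" for u t
   using Fl[OF that] by (intro LIMSEQ_le_const2[OF tendsto_diff[OF H H]]) auto
  ultimately obtain G where "G \<in> borel_measurable borel"
   "\<And>u t. u \<le> t \<Longrightarrow> (\<integral>\<^sup>+s. (if u < s \<and> s < t then G s else 0) \<partial>lborel) = ennreal (H k t - H k u)"
   using lipschitz_density[of "H k"] by blast
  then show ?thesis by blast
 qed
 then obtain G where G: "\<And>k. G k \<in> borel_measurable borel"
  "\<And>k u t. u \<le> t \<Longrightarrow> (\<integral>\<^sup>+s. (if u < s \<and> s < t then G k s else 0) \<partial>lborel) = ennreal (H k t - H k u)"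
  by metis
 have H0: "H k 0 = 0" for k
  using H[of k 0] by (simp add: F_def I0 LIMSEQ_const_iff)
 show ?thesis
 proof (rule that[OF r G(1)])
  fix k and t :: real assume "0 \<le> t"
  have "(\<lambda>n. ennreal (F (r n) k t)) \<longlonglongrightarrow> ennreal (H k t)" using H by (rule tendsto_ennrealI)
  then show "(\<lambda>n. \<integral>\<^sup>+s. (if 0 < s \<and> s < t then g (r n) k s else 0) \<partial>lborel) \<longlonglongrightarrow> (\<integral>\<^sup>+s. (if 0 < s \<and> s < t then G k s else 0) \<partial>lborel)"
   using G(2)[OF \<open>0 \<le> t\<close>, of k] by (simp add: fin[symmetric] I_def H0)
 qed
qed

text \<open>Level \<open>k\<close> of the coding splits the set \<open>K\<close> into the cells of constant code of length \<open>k\<close>; the digit at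
 position \<open>k\<close> is below \<open>N k\<close>.\<close>
locale cell_coding =
 fixes K :: "'a::polish_space set" and code :: "nat \<Rightarrow> 'a \<Rightarrow> nat list" and N :: "nat \<Rightarrow> nat"
 assumes K: "compact K"
  and code_0: "code 0 a = []"
  and code_Suc: "a \<in> K \<Longrightarrow> \<exists>l<N k. code (Suc k) a = code k a @ [l]"
  and code_measurable: "{a. code k a = s} \<in> sets borel"
  and code_dist: "a \<in> K \<Longrightarrow> b \<in> K \<Longrightarrow> code (Suc k) a = code (Suc k) b \<Longrightarrow> dist a b < (1 / 2) ^ k"
begin

fun words :: "nat \<Rightarrow> nat list set" where
 "words 0 = {[]}"
| "words (Suc k) = (\<lambda>(s, l). s @ [l]) ` (words k \<times> {..<N k})"

lemma finite_words [simp]: "finite (words k)" by (induction k) auto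

lemma length_words: "s \<in> words k \<Longrightarrow> length s = k" by (induction k arbitrary: s) auto

lemma snoc_words: "s \<in> words k \<Longrightarrow> l < N k \<Longrightarrow> s @ [l] \<in> words (Suc k)" by force

lemma code_words: "a \<in> K \<Longrightarrow> code k a \<in> words k"
proof (induction k)
 case (Suc k)
 then show ?case using code_Suc[OF Suc.prems, of k] by force
qed (simp add: code_0)

lemma length_code: "a \<in> K \<Longrightarrow> length (code k a) = k" by (rule length_words[OF code_words])

lemma butlast_code: "a \<in> K \<Longrightarrow> butlast (code (Suc k) a) = code k a" using code_Suc[of a k] by auto

lemma sum_words_Suc:
 fixes F :: "nat list \<Rightarrow> 'b::comm_monoid_add"
 shows "(\<Sum>s\<in>words (Suc k). F s) = (\<Sum>s\<in>words k. \<Sum>l<N k. F (s @ [l]))"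
proof -
 have "inj_on (\<lambda>(s, l). s @ [l]) (words k \<times> {..<N k})" by (auto simp: inj_on_def)
 then show ?thesis by (simp add: sum.reindex sum.cartesian_product case_prod_beta' comp_def)
qed

text \<open>A representative of the cell. For an empty cell it is arbitrary, but in the cell sums
  such a cell has weight 0.\<close>

definition point :: "nat list \<Rightarrow> 'a" where
 "point s = (SOME a. a \<in> K \<and> code (length s) a = s)"

text \<open>A consistent family of cell weights is the law of a Markov chain of cells, each refining its predecessor; the
 points of these cells converge, and the law of the limit has approximately the prescribed cell weights.\<close>
lemma limit_law:
 assumes p0: "p [] = 1" and p: "\<And>k s. s \<in> words k \<Longrightarrow> 0 \<le> p s"
  and cons: "\<And>k s. s \<in> words k \<Longrightarrow> p s = (\<Sum>l<N k. p (s @ [l]))"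
  and ne: "\<And>k s. s \<in> words k \<Longrightarrow> p s \<noteq> 0 \<Longrightarrow> \<exists>a\<in>K. code k a = s"
 shows "\<exists>\<Phi>. prob_space \<Phi> \<and> sets \<Phi> = sets borel \<and> emeasure \<Phi> K = 1 \<and>
  (\<forall>f \<epsilon> k. continuous_on K f \<longrightarrow> (\<lambda>a. indicator K a * ennreal (f a)) \<in> borel_measurable borel \<longrightarrow> 0 \<le> \<epsilon> \<longrightarrow>
   (\<forall>a\<in>K. \<forall>b\<in>K. code k a = code k b \<longrightarrow> \<bar>f a - f b\<bar> \<le> \<epsilon>) \<longrightarrow>
   (\<integral>\<^sup>+a. indicator K a * ennreal (f a) \<partial>\<Phi>) \<le> (\<Sum>s\<in>words k. ennreal (p s) * ennreal (f (point s))) + ennreal \<epsilon> \<and>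
   (\<Sum>s\<in>words k. ennreal (p s) * ennreal (f (point s))) \<le> (\<integral>\<^sup>+a. indicator K a * ennreal (f a) \<partial>\<Phi>) + ennreal \<epsilon>)"
proof -
 let ?C = "count_space (UNIV :: nat list set)"
 \<comment> \<open>Conditional law of the next digit; at words of weight 0, which the chain avoids
   almost surely, any law will do.\<close>
 define step :: "nat list \<Rightarrow> nat pmf" where
  "step s = (if s \<in> words (length s) \<and> p s \<noteq> 0 then embed_pmf (\<lambda>l. if l < N (length s) then p (s @ [l]) / p s else 0) else return_pmf 0)" for s
 define T where "T s = map_pmf (\<lambda>l. s @ [l]) (step s)" for s
 have p': "0 \<le> p (s @ [l])" if "s \<in> words k" "l < N k" for s k l using p[of "s @ [l]" "Suc k"] snoc_words that by blast
 have T: "(\<integral>\<^sup>+y. F y \<partial>measure_pmf (T s)) = (\<Sum>l<N k. ennreal (p (s @ [l]) / p s) * F (s @ [l]))"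
  if s: "s \<in> words k" "p s \<noteq> 0" for F s k
 proof -
  have len: "length s = k" by (rule length_words[OF s(1)])
  have ps: "0 < p s" using p[OF s(1)] s(2) by simp
  have nn: "0 \<le> (if l < N k then p (s @ [l]) / p s else 0)" for l using p'[OF s(1)] ps by simp
  have "csum (\<lambda>l. ennreal (if l < N k then p (s @ [l]) / p s else 0)) = (\<Sum>l<N k. ennreal (p (s @ [l]) / p s))"
   by (subst nn_integral_count_space'[of "{..<N k}"]) auto
  also have "\<dots> = ennreal (\<Sum>l<N k. p (s @ [l]) / p s)" using p'[OF s(1)] ps by (subst sum_ennreal) auto
  also have "\<dots> = 1" using cons[OF s(1)] ps by (simp add: sum_divide_distrib[symmetric])
  finally have "pmf (step s) l = (if l < N k then p (s @ [l]) / p s else 0)" for l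
   unfolding step_def len using s nn by (simp add: pmf_embed_pmf)
  then have "(\<integral>\<^sup>+l. F (s @ [l]) \<partial>measure_pmf (step s)) = (\<Sum>l<N k. ennreal (p (s @ [l]) / p s) * F (s @ [l]))"
   unfolding nn_integral_measure_pmf by (subst nn_integral_count_space'[of "{..<N k}"]) auto
  then show ?thesis by (simp add: T_def)
 qed
 have "measure_pmf x \<in> space (prob_algebra ?C)" for x by (simp add: space_prob_algebra measure_pmf.prob_space_axioms)
 then have "(\<lambda>s. measure_pmf (T s)) \<in> ?C \<rightarrow>\<^sub>M prob_algebra ?C" "measure_pmf (return_pmf []) \<in> space (prob_algebra ?C)" by auto
 then obtain Q where Q: "prob_space Q" "sets Q = sets (PiM UNIV (\<lambda>_::nat. ?C))"
   "distr Q ?C (\<lambda>x. x 0) = measure_pmf (return_pmf [])"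
   "\<forall>m. \<forall>F\<in>borel_measurable (?C \<Otimes>\<^sub>M ?C). (\<integral>\<^sup>+x. F (x m, x (Suc m)) \<partial>Q) = (\<integral>\<^sup>+x. \<integral>\<^sup>+y. F (x m, y) \<partial>measure_pmf (T (x m)) \<partial>Q)"
  by (rule markov_chain_exists[of "\<lambda>_ s. measure_pmf (T s)"])
 interpret Q: prob_space Q by fact
 have xm [measurable]: "(\<lambda>x. x k) \<in> Q \<rightarrow>\<^sub>M ?C" for k
  using measurable_component_singleton[of k UNIV "\<lambda>_. ?C"] by (simp add: measurable_cong_sets[OF Q(2) refl])
 have CC: "F \<in> borel_measurable (?C \<Otimes>\<^sub>M ?C)" for F :: "_ \<Rightarrow> ennreal" by (simp add: pair_measure_countable)
 \<comment> \<open>Consistency makes p the marginal law at every level; refinements of a word of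
   weight 0 have weight 0 themselves, being nonnegative with sum 0.\<close>
 have law: "(\<integral>\<^sup>+x. F (x k) \<partial>Q) = (\<Sum>s\<in>words k. ennreal (p s) * F s)" for F k
 proof (induction k arbitrary: F)
  case 0
  have "(\<integral>\<^sup>+x. F (x 0) \<partial>Q) = (\<integral>\<^sup>+s. F s \<partial>distr Q ?C (\<lambda>x. x 0))" by (rule nn_integral_distr[symmetric]) auto
  then show ?case by (simp add: Q(3) p0)
 next
  case (Suc k)
  have "(\<integral>\<^sup>+x. F (x (Suc k)) \<partial>Q) = (\<integral>\<^sup>+x. \<integral>\<^sup>+y. F y \<partial>measure_pmf (T (x k)) \<partial>Q)"
   using bspec[OF spec[OF Q(4), of k] CC, of "\<lambda>z. F (snd z)"] by simp
  also have "\<dots> = (\<Sum>s\<in>words k. ennreal (p s) * (\<integral>\<^sup>+y. F y \<partial>measure_pmf (T s)))"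
   by (rule Suc.IH[of "\<lambda>s. \<integral>\<^sup>+y. F y \<partial>measure_pmf (T s)"])
  also have "\<dots> = (\<Sum>s\<in>words k. \<Sum>l<N k. ennreal (p (s @ [l])) * F (s @ [l]))"
  proof (rule sum.cong[OF refl])
   fix s assume s: "s \<in> words k"
   show "ennreal (p s) * (\<integral>\<^sup>+y. F y \<partial>measure_pmf (T s)) = (\<Sum>l<N k. ennreal (p (s @ [l])) * F (s @ [l]))"
   proof (cases "p s = 0")
    case True
    then have "p (s @ [l]) = 0" if "l < N k" for l
     using cons[OF s] sum_nonneg_eq_0_iff[of "{..<N k}" "\<lambda>l. p (s @ [l])"] p'[OF s] that by auto
    then show ?thesis using True by simp
   next
    case False
    then have ps: "0 < p s" using p[OF s] by simp
    then have "ennreal (p s) * ennreal (p (s @ [l]) / p s) = ennreal (p (s @ [l]))" if "l < N k" for l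
     using p'[OF s that] by (simp add: ennreal_mult[symmetric])
    then show ?thesis
     unfolding T[OF s False] sum_distrib_left mult.assoc[symmetric] by (intro sum.cong) auto
   qed
  qed
  finally show ?case unfolding sum_words_Suc .
 qed
 have ae_law: "AE x in Q. \<forall>k. x k \<in> words k \<and> p (x k) \<noteq> 0"
 proof (subst AE_all_countable, intro allI)
  fix k
  have "(\<integral>\<^sup>+x. indicator {s. \<not> (s \<in> words k \<and> p s \<noteq> 0)} (x k) \<partial>Q) = 0"
   unfolding law by (intro sum.neutral) (auto split: split_indicator)
  then show "AE x in Q. x k \<in> words k \<and> p (x k) \<noteq> 0"
   by (subst (asm) nn_integral_0_iff_AE) (auto split: split_indicator_asm)
 qed
 have ae_step: "AE x in Q. \<forall>k. butlast (x (Suc k)) = x k"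
 proof (subst AE_all_countable, intro allI)
  fix k
  have "(\<integral>\<^sup>+x. indicator {(s, s'). butlast s' \<noteq> s} (x k, x (Suc k)) \<partial>Q) =
    (\<integral>\<^sup>+x. \<integral>\<^sup>+y. indicator {(s, s'). butlast s' \<noteq> s} (x k, y) \<partial>measure_pmf (T (x k)) \<partial>Q)"
   using bspec[OF spec[OF Q(4), of k] CC] .
  also have "\<dots> = 0" by (simp add: T_def)
  finally show "AE x in Q. butlast (x (Suc k)) = x k"
   by (subst (asm) nn_integral_0_iff_AE) (auto split: split_indicator_asm)
 qed
 define good where "good x \<longleftrightarrow> (\<forall>k. x k \<in> words k \<and> p (x k) \<noteq> 0) \<and> (\<forall>k. butlast (x (Suc k)) = x k)" for x :: "nat \<Rightarrow> nat list"
 have ae_good: "AE x in Q. good x" using ae_law ae_step unfolding good_def by eventually_elim blast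
 have pt: "point (x k) \<in> K \<and> code k (point (x k)) = x k" if "good x" for x k
 proof -
  have "\<exists>a. a \<in> K \<and> code (length (x k)) a = x k"
   using that ne[of "x k" k] length_words[of "x k" k] unfolding good_def by auto
  from someI_ex[OF this] show ?thesis using that length_words[of "x k" k] unfolding good_def point_def by auto
 qed
 have nested: "code k (point (x (k + m))) = x k" if "good x" for x k m
 proof (induction m arbitrary: k)
  case 0 then show ?case using pt[OF that, of k] by simp
 next
  case (Suc m)
  have "code k (point (x (Suc k + m))) = butlast (code (Suc k) (point (x (Suc k + m))))"
   using butlast_code pt[OF that] by simp
  also have "\<dots> = butlast (x (Suc k))" using Suc.IH[of "Suc k"] by simp
  also have "\<dots> = x k" using that unfolding good_def by blast
  finally show ?case by simp
 qed
 have nested': "code k (point (x n)) = x k" if "good x" "k \<le> n" for x k n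
  using nested[OF that(1), of k "n - k"] that(2) by simp
 \<comment> \<open>Constant off the good event, so that convergence and measurability of the limit
   hold everywhere.\<close>
 define z where "z k x = (if good x then point (x k) else undefined)" for k x
 have conv: "\<exists>a. (\<lambda>k. z k x) \<longlonglongrightarrow> a \<and> (good x \<longrightarrow> a \<in> K)" for x
 proof (cases "good x")
  case True
  have "Cauchy (\<lambda>k. point (x k))"
  proof (rule metric_CauchyI)
   fix e :: real assume "0 < e"
   then obtain k where k: "(1 / 2) ^ k < e" using real_arch_pow_inv[of e "1 / 2"] by auto
   have "dist (point (x m)) (point (x n)) < e" if "Suc k \<le> m" "Suc k \<le> n" for m n
    using code_dist[of "point (x m)" "point (x n)" k] pt[OF True] nested'[OF True that(1)] nested'[OF True that(2)] k by simp
   then show "\<exists>M. \<forall>m\<ge>M. \<forall>n\<ge>M. dist (point (x m)) (point (x n)) < e" by blast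
  qed
  then obtain a where a: "a \<in> K" "(\<lambda>k. point (x k)) \<longlonglongrightarrow> a"
   using compact_imp_complete[OF K] pt[OF True] unfolding complete_def by metis
  then show ?thesis using True by (auto simp: z_def)
 qed (auto simp: z_def)
 then obtain Z where Z: "\<And>x. (\<lambda>k. z k x) \<longlonglongrightarrow> Z x" "\<And>x. good x \<Longrightarrow> Z x \<in> K" by metis
 have [measurable]: "Measurable.pred Q good" unfolding good_def by measurable
 have "z k \<in> borel_measurable Q" for k
 proof -
  have "(\<lambda>x. point (x k)) \<in> borel_measurable Q" by (rule measurable_compose[OF xm]) simp
  then show ?thesis unfolding z_def[abs_def] by measurable
 qed
 then have mZ: "Z \<in> borel_measurable Q" using Z(1) by (rule borel_measurable_LIMSEQ_metric)
 have Kb: "K \<in> sets borel" using compact_imp_closed[OF K] by simp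
 let ?\<Phi> = "distr Q borel Z"
 have "emeasure ?\<Phi> K = emeasure Q (Z -` K \<inter> space Q)" using Kb by (intro emeasure_distr mZ) simp
 also have "\<dots> = 1"
  using ae_good Z(2) measurable_sets[OF mZ Kb] by (intro Q.emeasure_eq_1_AE) auto
 finally have \<Phi>K: "emeasure ?\<Phi> K = 1" .
 have "(\<integral>\<^sup>+a. indicator K a * ennreal (f a) \<partial>?\<Phi>) \<le> (\<Sum>s\<in>words k. ennreal (p s) * ennreal (f (point s))) + ennreal \<epsilon> \<and>
   (\<Sum>s\<in>words k. ennreal (p s) * ennreal (f (point s))) \<le> (\<integral>\<^sup>+a. indicator K a * ennreal (f a) \<partial>?\<Phi>) + ennreal \<epsilon>"
  if f: "continuous_on K f" "(\<lambda>a. indicator K a * ennreal (f a)) \<in> borel_measurable borel" "0 \<le> \<epsilon>"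
   "\<forall>a\<in>K. \<forall>b\<in>K. code k a = code k b \<longrightarrow> \<bar>f a - f b\<bar> \<le> \<epsilon>" for f \<epsilon> k
 proof -
  have fx [measurable]: "(\<lambda>x. ennreal (f (point (x k)))) \<in> borel_measurable Q" by (rule measurable_compose[OF xm]) simp
  have fZ [measurable]: "(\<lambda>x. indicator K (Z x) * ennreal (f (Z x))) \<in> borel_measurable Q"
   using measurable_compose[OF mZ f(2)] .
  have 1: "(\<integral>\<^sup>+a. indicator K a * ennreal (f a) \<partial>?\<Phi>) = (\<integral>\<^sup>+x. indicator K (Z x) * ennreal (f (Z x)) \<partial>Q)"
   by (rule nn_integral_distr[OF mZ]) (use f(2) in simp)
  have 2: "(\<integral>\<^sup>+x. ennreal (f (point (x k))) \<partial>Q) = (\<Sum>s\<in>words k. ennreal (p s) * ennreal (f (point s)))"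
   by (rule law[of "\<lambda>s. ennreal (f (point s))"])
  \<comment> \<open>The limit may leave the level-k cell, as cells need not be closed. The bound
    holds along the sequence, whose members from k on lie in one cell, and passes to the limit by
    continuity of f.\<close>
  have close: "\<bar>f (Z x) - f (point (x k))\<bar> \<le> \<epsilon>" if x: "good x" for x
  proof -
   have "(\<lambda>n. f (point (x n))) \<longlonglongrightarrow> f (Z x)"
    using Z[of x] x pt[OF x] by (intro continuous_on_tendsto_compose[OF f(1)]) (auto simp: z_def)
   then have "(\<lambda>n. \<bar>f (point (x n)) - f (point (x k))\<bar>) \<longlonglongrightarrow> \<bar>f (Z x) - f (point (x k))\<bar>" by (intro tendsto_intros)
   moreover have "\<bar>f (point (x n)) - f (point (x k))\<bar> \<le> \<epsilon>" if "k \<le> n" for n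
    using f(4) pt[OF x] nested'[OF x that] nested'[OF x order_refl] by auto
   ultimately show ?thesis by (intro LIMSEQ_le_const2) auto
  qed
  have split: "ennreal u \<le> ennreal v + ennreal \<epsilon>" if "u \<le> v + \<epsilon>" for u v
  proof -
   have "ennreal u \<le> ennreal (max v 0 + \<epsilon>)" using that by (intro ennreal_leI) auto
   also have "\<dots> = ennreal v + ennreal \<epsilon>" using f(3) by (simp add: ennreal_plus max_def ennreal_neg)
   finally show ?thesis .
  qed
  have "(\<integral>\<^sup>+x. indicator K (Z x) * ennreal (f (Z x)) \<partial>Q) \<le> (\<integral>\<^sup>+x. ennreal (f (point (x k))) + ennreal \<epsilon> \<partial>Q)"
  proof (rule nn_integral_mono_AE)
   show "AE x in Q. indicator K (Z x) * ennreal (f (Z x)) \<le> ennreal (f (point (x k))) + ennreal \<epsilon>"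
    using ae_good by eventually_elim (use close Z(2) in \<open>auto intro!: split simp: abs_le_iff, smt (verit)\<close>)
  qed
  moreover have "(\<integral>\<^sup>+x. ennreal (f (point (x k))) \<partial>Q) \<le> (\<integral>\<^sup>+x. indicator K (Z x) * ennreal (f (Z x)) + ennreal \<epsilon> \<partial>Q)"
  proof (rule nn_integral_mono_AE)
   show "AE x in Q. ennreal (f (point (x k))) \<le> indicator K (Z x) * ennreal (f (Z x)) + ennreal \<epsilon>"
    using ae_good by eventually_elim (use close Z(2) in \<open>auto intro!: split simp: abs_le_iff, smt (verit)\<close>)
  qed
  ultimately show ?thesis
   unfolding 1 2[symmetric] by (simp add: nn_integral_add Q.emeasure_space_1)
 qed
 moreover have "prob_space ?\<Phi>" by (rule Q.prob_space_distr[OF mZ])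
 ultimately show ?thesis using \<Phi>K by (intro exI[of _ ?\<Phi>]) simp
qed

lemma uniform_level:
 fixes f :: "'a \<Rightarrow> real"
 assumes "continuous_on K f" "0 < e"
 obtains k where "\<And>a b. a \<in> K \<Longrightarrow> b \<in> K \<Longrightarrow> code k a = code k b \<Longrightarrow> \<bar>f a - f b\<bar> \<le> e"
proof -
 have "uniformly_continuous_on K f" using assms(1) K by (rule compact_uniformly_continuous)
 then obtain d where d: "0 < d" "\<And>a b. a \<in> K \<Longrightarrow> b \<in> K \<Longrightarrow> dist b a < d \<Longrightarrow> dist (f b) (f a) < e"
  unfolding uniformly_continuous_on_def using assms(2) by metis
 obtain k where "(1 / 2) ^ k < d" using real_arch_pow_inv[of d "1 / 2"] d(1) by auto
 then show ?thesis
  using d(2) code_dist by (intro that[of "Suc k"]) (fastforce simp: dist_real_def dist_commute)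
qed

end

text \<open>Digit k of a point is the least index of a nearby centre in a finite net of radius
  2^-(k+2). Points sharing it are at distance below 2^-(k+1), and choosing the least index makes the
  digit measurable.\<close>

lemma cell_coding_exists:
 fixes K :: "'a::polish_space set"
 assumes "compact K"
 shows "\<exists>code N. cell_coding K code N"
proof -
 have "\<exists>(N :: nat) x. \<forall>a\<in>K. \<exists>l<N. dist (x l) a < (1 / 2) ^ Suc (Suc k)" for k :: nat
 proof -
  have "\<exists>F. finite F \<and> F \<subseteq> K \<and> K \<subseteq> (\<Union>y\<in>F. ball y ((1 / 2) ^ Suc (Suc k)))"
   using compact_imp_seq_compact[OF assms] seq_compact_imp_totally_bounded[of K] by auto
  then obtain F where F: "finite F" "K \<subseteq> (\<Union>y\<in>F. ball y ((1 / 2) ^ Suc (Suc k)))" by blast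
  obtain x and N :: nat where "F = x ` {i. i < N}"
   using finite_imp_nat_seg_image_inj_on[OF F(1)] by metis
  then have "\<forall>a\<in>K. \<exists>l<N. dist (x l) a < (1 / 2) ^ Suc (Suc k)" using F(2) by (fastforce simp: subset_iff)
  then show ?thesis by blast
 qed
 then obtain N :: "nat \<Rightarrow> nat" and x where cov: "\<And>k a. a \<in> K \<Longrightarrow> \<exists>l<N k. dist (x k l) a < (1 / 2) ^ Suc (Suc k)" by metis
 define digit where "digit k a = (LEAST l. dist (x k l) a < (1 / 2) ^ Suc (Suc k))" for k a
 define code where "code k a = map (\<lambda>j. digit j a) [0..<k]" for k a
 have [measurable]: "digit k \<in> borel \<rightarrow>\<^sub>M count_space UNIV" for k unfolding digit_def by measurable
 have dg: "digit k a < N k \<and> dist (x k (digit k a)) a < (1 / 2) ^ Suc (Suc k)" if "a \<in> K" for k a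
 proof -
  obtain l where l: "l < N k" "dist (x k l) a < (1 / 2) ^ Suc (Suc k)" using cov[OF \<open>a \<in> K\<close>, of k] by auto
  show ?thesis using Least_le[of "\<lambda>l. dist (x k l) a < (1 / 2) ^ Suc (Suc k)", OF l(2)] l(1)
    LeastI[of "\<lambda>l. dist (x k l) a < (1 / 2) ^ Suc (Suc k)", OF l(2)] by (simp add: digit_def)
 qed
 have "cell_coding K code N"
 proof
  fix a b k s
  show "a \<in> K \<Longrightarrow> \<exists>l<N k. code (Suc k) a = code k a @ [l]" using dg by (auto simp: code_def)
  have "{a. code k a = s} = {a. length s = k \<and> (\<forall>j<k. digit j a = s ! j)}"
   by (auto simp: code_def list_eq_iff_nth_eq)
  also have "\<dots> = {a \<in> space borel. length s = k \<and> (\<forall>j\<in>{..<k}. digit j a = s ! j)}" by auto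
  also have "\<dots> \<in> sets borel" by measurable
  finally show "{a. code k a = s} \<in> sets borel" .
  assume ab: "a \<in> K" "b \<in> K" "code (Suc k) a = code (Suc k) b"
  then have "digit k a = digit k b" by (auto simp: code_def)
  then have "dist (x k (digit k a)) a < (1 / 2) ^ k / 4" "dist (x k (digit k a)) b < (1 / 2) ^ k / 4"
   using dg[OF ab(1), of k] dg[OF ab(2), of k] by simp_all
  then show "dist a b < (1 / 2) ^ k"
   using dist_triangle3[of a b "x k (digit k a)"] zero_less_power[of "1 / 2 :: real" k] by linarith
 qed (use assms in \<open>auto simp: code_def\<close>)
 then show ?thesis by blast
qed

section \<open>Limits and equality of time integrals\<close>

abbreviation tint :: "real \<Rightarrow> (real \<Rightarrow> ennreal) \<Rightarrow> ennreal" where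
 "tint t h \<equiv> \<integral>\<^sup>+s. (if 0 < s \<and> s < t then h s else 0) \<partial>lborel"

text \<open>Up to an error uniform in n the sequence follows one whose limit is known. Upper and
  lower limits are compared separately, which avoids differences of extended numbers.\<close>

lemma ennreal_approx_tendsto:
 fixes x :: "nat \<Rightarrow> ennreal"
 assumes "\<And>e. 0 < e \<Longrightarrow> \<exists>y y'. y \<longlonglongrightarrow> y' \<and> (\<forall>n. x n \<le> y n + ennreal e \<and> y n \<le> x n + ennreal e) \<and>
  x' \<le> y' + ennreal e \<and> y' \<le> x' + ennreal e"
 shows "x \<longlonglongrightarrow> x'"
proof -
 have *: "limsup x \<le> x' + ennreal e \<and> x' \<le> liminf x + ennreal e" if "0 < e" for e
 proof -
  obtain y y' where y: "y \<longlonglongrightarrow> y'" "\<And>n. x n \<le> y n + ennreal (e / 2)" "\<And>n. y n \<le> x n + ennreal (e / 2)"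
   "x' \<le> y' + ennreal (e / 2)" "y' \<le> x' + ennreal (e / 2)" using assms[OF half_gt_zero[OF \<open>0 < e\<close>]] by blast
  have e: "ennreal (e / 2) + ennreal (e / 2) = ennreal e" using that by (simp add: ennreal_plus[symmetric] del: ennreal_plus)
  have "limsup x \<le> limsup (\<lambda>n. y n + ennreal (e / 2))" by (intro Limsup_mono always_eventually) (use y in simp)
  also have "\<dots> = y' + ennreal (e / 2)" by (intro lim_imp_Limsup tendsto_add tendsto_const y) simp
  also have "\<dots> \<le> x' + ennreal (e / 2) + ennreal (e / 2)" using y(5) by (rule add_right_mono)
  finally have 1: "limsup x \<le> x' + ennreal e" by (simp only: add.assoc e)
  have "y' = liminf y" using y(1) by (intro lim_imp_Liminf[symmetric]) auto
  also have "\<dots> \<le> liminf (\<lambda>n. x n + ennreal (e / 2))" by (intro Liminf_mono always_eventually) (use y in simp)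
  also have "\<dots> = liminf x + ennreal (e / 2)" by (rule Liminf_add_const) simp
  finally have "x' \<le> liminf x + ennreal (e / 2) + ennreal (e / 2)" using order_trans[OF y(4) add_right_mono] by blast
  then show ?thesis using 1 by (simp only: add.assoc e)
 qed
 have "limsup x \<le> x'" "x' \<le> liminf x" using * by (auto intro: ennreal_le_epsilonI)
 then show ?thesis
  using Liminf_le_Limsup[of sequentially x] by (intro Liminf_eq_Limsup) auto
qed

lemma nn_integral_count_SUP:
 fixes F :: "'b \<Rightarrow> ennreal" and D :: "nat \<Rightarrow> 'b set"
 assumes "incseq D" "\<And>n. finite (D n)" "(\<Union>n. D n) = UNIV"
 shows "csum F = (SUP n. \<Sum>i\<in>D n. F i)"
proof -
 have "csum F = csum (\<lambda>i. SUP n. F i * indicator (D n) i)"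
 proof (rule nn_integral_cong)
  fix i
  obtain n where "i \<in> D n" using assms(3) by blast
  then have "F i \<le> (SUP n. F i * indicator (D n) i)" by (intro SUP_upper2[of n]) auto
  moreover have "(SUP n. F i * indicator (D n) i) \<le> F i" by (intro SUP_least) (simp split: split_indicator)
  ultimately show "F i = (SUP n. F i * indicator (D n) i)" by (rule antisym)
 qed
 also have "\<dots> = (SUP n. csum (\<lambda>i. F i * indicator (D n) i))"
  using assms(1) by (intro nn_integral_monotone_convergence_SUP incseq_SucI le_funI mult_left_mono)
   (auto split: split_indicator dest: incseq_SucD)
 also have "\<dots> = (SUP n. \<Sum>i\<in>D n. F i)"
 proof (rule SUP_cong[OF refl])
  fix n show "csum (\<lambda>i. F i * indicator (D n) i) = (\<Sum>i\<in>D n. F i)"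
   by (subst nn_integral_count_space'[OF assms(2)[of n]]) (auto split: split_indicator_asm)
 qed
 finally show ?thesis .
qed

text \<open>Half-lines generate the Borel sets and are stable under intersection, so equal
  primitives give equal measures, and a density of a measure is unique almost everywhere.\<close>

lemma AE_eq_of_interval_integrals:
 fixes f g :: "real \<Rightarrow> ennreal"
 assumes [measurable]: "f \<in> borel_measurable borel" "g \<in> borel_measurable borel"
  and T: "0 \<le> T" and eq: "\<And>t. 0 \<le> t \<Longrightarrow> t \<le> T \<Longrightarrow> tint t f = tint t g" and fin: "tint T f < \<infinity>"
 shows "AE s in lborel. 0 < s \<and> s < T \<longrightarrow> f s = g s"
proof -
 let ?f = "\<lambda>s. if 0 < s \<and> s < T then f s else 0" and ?g = "\<lambda>s. if 0 < s \<and> s < T then g s else 0"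
 have e: "emeasure (density lborel (\<lambda>s. if 0 < s \<and> s < T then h s else 0)) {..<t} = tint (max 0 (min t T)) h"
  if [measurable]: "h \<in> borel_measurable borel" for h and t :: real
  by (subst emeasure_density) (auto intro!: nn_integral_cong split: split_indicator)
 have "density lborel ?f = density lborel ?g"
 proof (rule measure_eqI_generator_eq[where E="range (\<lambda>t :: real. {..<t})" and A="\<lambda>n. {..<real n}" and \<Omega>=UNIV])
  have "{..<a} \<inter> {..<b} = {..<min a b}" for a b :: real by auto
  then show "Int_stable (range (\<lambda>t :: real. {..<t}))" by (auto simp: Int_stable_def)
  show "emeasure (density lborel ?f) X = emeasure (density lborel ?g) X" if "X \<in> range (\<lambda>t :: real. {..<t})" for X
   using that eq T by (auto simp: e)
  show "sets (density lborel ?f) = sigma_sets UNIV (range (\<lambda>t :: real. {..<t}))"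
   "sets (density lborel ?g) = sigma_sets UNIV (range (\<lambda>t :: real. {..<t}))"
   by (simp_all add: borel_Iio)
  show "emeasure (density lborel ?f) {..<real n} \<noteq> \<infinity>" for n
  proof -
   have "tint (max 0 (min (real n) T)) f \<le> tint T f" using T by (intro nn_integral_mono) auto
   with fin show ?thesis by (auto simp: e top_unique)
  qed
  show "(\<Union>n. {..<real n}) = UNIV" using reals_Archimedean2 by auto
 qed auto
 then have "AE s in lborel. ?f s = ?g s" by (intro sigma_finite_measure.density_unique[OF lborel.sigma_finite_measure_axioms]) auto
 then show ?thesis by eventually_elim auto
qed

section \<open>Limits of flows\<close>

text \<open>\<open>\<Lambda> n i f t\<close> stands for the expectation of \<open>f\<close>, evaluated at the action taken at time \<open>t\<close>, on the event that the
 process under the \<open>n\<close>-th policy is in state \<open>i\<close> just before \<open>t\<close>.\<close>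
locale flow_sequence = control_model A q
 for A :: "'s::countable \<Rightarrow> 'a::polish_space set" and q +
 fixes \<gamma> :: "'s pmf" and \<Lambda> :: "nat \<Rightarrow> 's \<Rightarrow> ('a \<Rightarrow> ennreal) \<Rightarrow> real \<Rightarrow> ennreal"
  and w :: "'s \<Rightarrow> real" and L B T :: real
 assumes compact: "compact (A i)" and nonempty: "A i \<noteq> {}" and q_cont: "continuous_on (A i) (q j i)"
  and w1: "1 \<le> w i" and levels: "finite {i. w i \<le> real m}" and rate_le: "max_rate A q i \<le> L * w i"
  and L0: "0 \<le> L" and B0: "0 \<le> B" and T0: "0 < T"
  and \<Lambda>_measurable [measurable]: "f \<in> borel_measurable borel \<Longrightarrow> \<Lambda> n i f \<in> borel_measurable borel"
  and \<Lambda>_mono: "(\<And>a. a \<in> A i \<Longrightarrow> f a \<le> g a) \<Longrightarrow> \<Lambda> n i f t \<le> \<Lambda> n i g t"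
  and \<Lambda>_add: "f \<in> borel_measurable borel \<Longrightarrow> g \<in> borel_measurable borel \<Longrightarrow> \<Lambda> n i (\<lambda>a. f a + g a) t = \<Lambda> n i f t + \<Lambda> n i g t"
  and \<Lambda>_cmult: "f \<in> borel_measurable borel \<Longrightarrow> \<Lambda> n i (\<lambda>a. c * f a) t = c * \<Lambda> n i f t"
  and \<Lambda>_mass: "csum (\<lambda>i. \<Lambda> n i (\<lambda>_. 1) t) \<le> 1"
  and \<Lambda>_zero: "t \<le> 0 \<Longrightarrow> \<Lambda> n i f t = 0"
  and \<Lambda>_forward: "0 < t \<Longrightarrow> \<Lambda> n j (\<lambda>_. 1) t + before t (\<lambda>s. \<Lambda> n j (out_rate j) s) =
   ennreal (pmf \<gamma> j) + before t (\<lambda>s. csum (\<lambda>i. \<Lambda> n i (rate j i) s))"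
  and \<Lambda>_moment: "0 < t \<Longrightarrow> t \<le> T \<Longrightarrow> csum (\<lambda>i. ennreal (w i ^ 2) * \<Lambda> n i (\<lambda>_. 1) t) \<le> ennreal B"
begin

definition on_actions :: "'s \<Rightarrow> ('a \<Rightarrow> real) \<Rightarrow> 'a \<Rightarrow> ennreal" where
 "on_actions i f a = indicator (A i) a * ennreal (f a)"

lemma measurable_on_actions [measurable (raw)]:
 assumes "continuous_on (A i) f" shows "on_actions i f \<in> borel_measurable borel"
 unfolding on_actions_def[abs_def]
 by (intro borel_measurable_on_actions borel_measurable_continuous_on_restrict assms)

lemma \<Lambda>_sum:
 assumes "finite I" "\<And>x. x \<in> I \<Longrightarrow> F x \<in> borel_measurable borel"
 shows "\<Lambda> n i (\<lambda>a. \<Sum>x\<in>I. c x * F x a) t = (\<Sum>x\<in>I. c x * \<Lambda> n i (F x) t)"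
 using assms
proof (induction I rule: finite_induct)
 case empty then show ?case using \<Lambda>_cmult[of "\<lambda>_. 0" n i 0 t] by simp
next
 case (insert x I)
 have "(\<lambda>a. \<Sum>x\<in>I. c x * F x a) \<in> borel_measurable borel" using insert.prems by (intro borel_measurable_sum) auto
 then show ?case using insert by (simp add: \<Lambda>_add \<Lambda>_cmult)
qed

lemma \<Lambda>_single: "\<Lambda> n i (\<lambda>_. 1) t \<le> 1"
 using order_trans[OF nn_integral_ge_point[of i UNIV "\<lambda>i. \<Lambda> n i (\<lambda>_. 1) t"] \<Lambda>_mass] by simp

end

text \<open>In this locale \<open>'a\<close> is the type of states and \<open>'b\<close> that of
  actions. \<open>G (i, s)\<close> is the weak limit density of the flow through the cell s of state
  i; the empty word gives the whole mass in i.\<close>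

locale flow_limit = flow_sequence +
 fixes code :: "'a \<Rightarrow> nat \<Rightarrow> 'b \<Rightarrow> nat list" and N :: "'a \<Rightarrow> nat \<Rightarrow> nat" and r :: "nat \<Rightarrow> nat" and G :: "'a \<times> nat list \<Rightarrow> real \<Rightarrow> ennreal"
 assumes coding: "cell_coding (A i) (code i) (N i)"
  and G_measurable [measurable]: "G k \<in> borel_measurable borel"
  and G_lim: "0 \<le> t \<Longrightarrow> (\<lambda>n. tint t (\<Lambda> (r n) i (indicator {a. code i (length s) a = s}))) \<longlonglongrightarrow> tint t (G (i, s))"
begin

abbreviation cells where "cells i \<equiv> cell_coding.words (N i)"
abbreviation rep where "rep i \<equiv> cell_coding.point (A i) (code i)"

definition cell :: "'a \<Rightarrow> nat list \<Rightarrow> 'b \<Rightarrow> ennreal" where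
 "cell i s = indicator {a. code i (length s) a = s}"

lemmas G_lim' = G_lim[folded cell_def]

lemma measurable_cell [measurable]: "cell i s \<in> borel_measurable borel"
 unfolding cell_def using cell_coding.code_measurable[OF coding] by simp

lemma \<Lambda>_cell_le: "\<Lambda> n i (cell i s) t \<le> 1"
 by (rule order_trans[OF \<Lambda>_mono \<Lambda>_single]) (simp add: cell_def split: split_indicator)

lemma tint_le: "0 \<le> t \<Longrightarrow> (\<And>s. h s \<le> 1) \<Longrightarrow> tint t h \<le> ennreal t"
proof -
 assume t: "0 \<le> t" and h: "\<And>s. h s \<le> 1"
 have "tint t h \<le> (\<integral>\<^sup>+s. indicator {0..t} s \<partial>lborel)" using h by (intro nn_integral_mono) (auto split: split_indicator)
 then show ?thesis using t by simp
qed

lemma tint_G_le: "0 \<le> t \<Longrightarrow> tint t (G (i, s)) \<le> ennreal t"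
 by (rule LIMSEQ_le_const2[OF G_lim']) (auto intro!: tint_le \<Lambda>_cell_le)

lemma tint_sum:
 assumes "finite I" "\<And>x. x \<in> I \<Longrightarrow> h x \<in> borel_measurable borel"
 shows "tint t (\<lambda>v. \<Sum>x\<in>I. c x * h x v) = (\<Sum>x\<in>I. c x * tint t (h x))"
proof -
 have "tint t (\<lambda>v. \<Sum>x\<in>I. c x * h x v) = (\<integral>\<^sup>+v. (\<Sum>x\<in>I. c x * (if 0 < v \<and> v < t then h x v else 0)) \<partial>lborel)"
 proof (rule nn_integral_cong)
  fix v show "(if 0 < v \<and> v < t then \<Sum>x\<in>I. c x * h x v else 0) = (\<Sum>x\<in>I. c x * (if 0 < v \<and> v < t then h x v else 0))"
   by (cases "0 < v \<and> v < t") auto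
 qed
 also have "\<dots> = (\<Sum>x\<in>I. c x * tint t (h x))"
  using assms by (subst nn_integral_sum) (auto intro!: sum.cong nn_integral_cmult)
 finally show ?thesis .
qed

lemma G_sum_lim:
 assumes "0 \<le> t" "finite I" "\<And>s. s \<in> I \<Longrightarrow> c s < top"
 shows "(\<lambda>n. tint t (\<lambda>v. \<Sum>s\<in>I. c s * \<Lambda> (r n) i (cell i s) v)) \<longlonglongrightarrow> tint t (\<lambda>v. \<Sum>s\<in>I. c s * G (i, s) v)"
 using assms G_lim' by (simp add: tint_sum) (intro tendsto_sum ennreal_tendsto_cmult, auto)

lemma cell_split:
 assumes "a \<in> A i" "s \<in> cells i k" shows "cell i s a = (\<Sum>l<N i k. cell i (s @ [l]) a)"
proof -
 interpret cell_coding "A i" "code i" "N i" by (rule coding)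
 obtain l0 where l0: "l0 < N i k" "code i (Suc k) a = code i k a @ [l0]" using code_Suc[OF assms(1), of k] by blast
 have "(\<Sum>l<N i k. cell i (s @ [l]) a) = (\<Sum>l<N i k. if l = l0 then cell i s a else 0)"
  using l0 length_words[OF assms(2)] by (intro sum.cong) (auto simp: cell_def split: split_indicator)
 then show ?thesis using l0(1) by simp
qed

text \<open>A linear relation between cell flows passes to the limits of their time integrals, hence
  to the densities almost everywhere. The empty index set covers flows that vanish.\<close>

lemma G_AE_eq:
 assumes "finite I" "\<And>n v. \<Lambda> n i (cell i s) v = (\<Sum>u\<in>I. \<Lambda> n i (cell i u) v)"
 shows "AE v in lborel. 0 < v \<and> v < T \<longrightarrow> G (i, s) v = (\<Sum>u\<in>I. G (i, u) v)"
proof (rule AE_eq_of_interval_integrals)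
 fix t :: real assume t: "0 \<le> t"
 have "(\<lambda>n. tint t (\<Lambda> (r n) i (cell i s))) \<longlonglongrightarrow> tint t (\<lambda>v. \<Sum>u\<in>I. G (i, u) v)"
  using G_sum_lim[where c="\<lambda>_. 1" and i=i, OF t assms(1) ennreal_one_less_top] unfolding assms(2) by (simp only: mult_1)
 from LIMSEQ_unique[OF G_lim'[OF t] this] show "tint t (G (i, s)) = tint t (\<lambda>v. \<Sum>u\<in>I. G (i, u) v)" .
next
 show "tint T (G (i, s)) < \<infinity>" using tint_G_le[of T i s] T0 by (simp add: le_less_trans)
qed (use T0 in auto)

text \<open>At good times the limit weights of the cells determine an action law.\<close>
definition good :: "'a \<Rightarrow> real \<Rightarrow> bool" where
 "good i v \<longleftrightarrow> 0 < G (i, []) v \<and> (\<forall>s. G (i, s) v < \<infinity>) \<and>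
   (\<forall>s\<in>\<Union>(range (cells i)). G (i, s) v = (\<Sum>l<N i (length s). G (i, s @ [l]) v)) \<and>
   (\<forall>s. (\<forall>a\<in>A i. code i (length s) a \<noteq> s) \<longrightarrow> G (i, s) v = 0)"

lemma pred_good [measurable]: "Measurable.pred borel (good i)"
proof -
 have "countable (\<Union>(range (cells i)))" by (rule countableI_type)
 then show ?thesis unfolding good_def[abs_def] by measurable
qed

text \<open>There are countably many words, so all relations hold off one null set of times. The
  alternative describes times without mass in i, at which the action law is immaterial.\<close>

lemma AE_good: "AE v in lborel. 0 < v \<and> v < T \<longrightarrow> good i v \<or> (\<forall>k. (\<Sum>s\<in>cells i k. G (i, s) v) = 0) \<and> G (i, []) v = 0"
proof -
 interpret cell_coding "A i" "code i" "N i" by (rule coding)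
 have 1: "AE v in lborel. \<forall>s. 0 < v \<and> v < T \<longrightarrow> G (i, s) v < \<infinity>"
 proof (subst AE_all_countable, intro allI)
  fix s
  have "AE v in lborel. (if 0 < v \<and> v < T then G (i, s) v else 0) \<noteq> \<infinity>"
   using tint_G_le[of T i s] T0 by (intro nn_integral_PInf_AE) (auto simp: top_unique)
  then show "AE v in lborel. 0 < v \<and> v < T \<longrightarrow> G (i, s) v < \<infinity>"
   by eventually_elim (auto simp: less_top)
 qed
 have 2: "AE v in lborel. \<forall>s\<in>\<Union>(range words). 0 < v \<and> v < T \<longrightarrow> G (i, s) v = (\<Sum>l<N i (length s). G (i, s @ [l]) v)"
 proof (subst AE_ball_countable[OF countableI_type], intro ballI)
  fix s assume "s \<in> \<Union>(range words)"
  then obtain k where s: "s \<in> words k" by blast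
  have "\<Lambda> n i (cell i s) v = (\<Sum>u\<in>(\<lambda>l. s @ [l]) ` {..<N i k}. \<Lambda> n i (cell i u) v)" for n v
  proof -
   have "\<Lambda> n i (cell i s) v = \<Lambda> n i (\<lambda>a. \<Sum>l<N i k. 1 * cell i (s @ [l]) a) v"
    by (intro antisym \<Lambda>_mono) (simp_all add: cell_split[OF _ s])
   also have "\<dots> = (\<Sum>l<N i k. 1 * \<Lambda> n i (cell i (s @ [l])) v)" by (rule \<Lambda>_sum) auto
   finally show ?thesis by (simp add: sum.reindex inj_on_def)
  qed
  from G_AE_eq[OF _ this] show "AE v in lborel. 0 < v \<and> v < T \<longrightarrow> G (i, s) v = (\<Sum>l<N i (length s). G (i, s @ [l]) v)"
   by (simp add: sum.reindex inj_on_def length_words[OF s])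
 qed
 have 3: "AE v in lborel. \<forall>s\<in>{s. \<forall>a\<in>A i. code i (length s) a \<noteq> s}. 0 < v \<and> v < T \<longrightarrow> G (i, s) v = 0"
 proof (subst AE_ball_countable[OF countableI_type], intro ballI)
  fix s assume "s \<in> {s. \<forall>a\<in>A i. code i (length s) a \<noteq> s}"
  then have "\<Lambda> n i (cell i s) v \<le> \<Lambda> n i (\<lambda>a. 0) v" for n v by (intro \<Lambda>_mono) (auto simp: cell_def)
  moreover have "\<Lambda> n i (\<lambda>a. 0) v = 0" for n v using \<Lambda>_cmult[of "\<lambda>_. 0" n i 0 v] by simp
  ultimately have "\<Lambda> n i (cell i s) v = 0" for n v by (metis le_zero_eq)
  with G_AE_eq[of "{}" i s] show "AE v in lborel. 0 < v \<and> v < T \<longrightarrow> G (i, s) v = 0" by simp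
 qed
 show ?thesis
  using 1 2 3
 proof eventually_elim
  case (elim v)
  show ?case
  proof (intro impI)
   assume v: "0 < v \<and> v < T"
   have cons: "G (i, s) v = (\<Sum>l<N i k. G (i, s @ [l]) v)" if "s \<in> words k" for s k
    using elim(2) v that length_words[OF that] by blast
   have "(\<Sum>s\<in>words k. G (i, s) v) = G (i, []) v" for k
   proof (induction k)
    case (Suc k)
    have "(\<Sum>s\<in>words (Suc k). G (i, s) v) = (\<Sum>s\<in>words k. G (i, s) v)"
     unfolding sum_words_Suc by (intro sum.cong) (auto simp: cons)
    with Suc show ?case by simp
   qed simp
   then show "good i v \<or> (\<forall>k. (\<Sum>s\<in>words k. G (i, s) v) = 0) \<and> G (i, []) v = 0"
    using elim v unfolding good_def by (auto simp: zero_less_iff_neq_zero)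
  qed
 qed
qed

text \<open>The cell sum of level k matches the integral up to the oscillation of f on cells. Both
  are multiplied by the mass in i, so no normalisation appears and the inequalities can be
  integrated over time.\<close>

definition approximates :: "'a \<Rightarrow> real \<Rightarrow> 'b measure \<Rightarrow> bool" where
 "approximates i v \<Phi> \<longleftrightarrow> (\<forall>f \<epsilon> k. continuous_on (A i) f \<longrightarrow> 0 \<le> \<epsilon> \<longrightarrow>
   (\<forall>a\<in>A i. \<forall>b\<in>A i. code i k a = code i k b \<longrightarrow> \<bar>f a - f b\<bar> \<le> \<epsilon>) \<longrightarrow>
   G (i, []) v * (\<integral>\<^sup>+a. on_actions i f a \<partial>\<Phi>) \<le> (\<Sum>s\<in>cells i k. ennreal (f (rep i s)) * G (i, s) v) + ennreal \<epsilon> * G (i, []) v \<and>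
   (\<Sum>s\<in>cells i k. ennreal (f (rep i s)) * G (i, s) v) \<le> G (i, []) v * (\<integral>\<^sup>+a. on_actions i f a \<partial>\<Phi>) + ennreal \<epsilon> * G (i, []) v)"

lemma approximatesD:
 assumes "approximates i v \<Phi>" "continuous_on (A i) f" "0 \<le> \<epsilon>"
  "\<forall>a\<in>A i. \<forall>b\<in>A i. code i k a = code i k b \<longrightarrow> \<bar>f a - f b\<bar> \<le> \<epsilon>"
 shows "G (i, []) v * (\<integral>\<^sup>+a. on_actions i f a \<partial>\<Phi>) \<le> (\<Sum>s\<in>cells i k. ennreal (f (rep i s)) * G (i, s) v) + ennreal \<epsilon> * G (i, []) v"
  "(\<Sum>s\<in>cells i k. ennreal (f (rep i s)) * G (i, s) v) \<le> G (i, []) v * (\<integral>\<^sup>+a. on_actions i f a \<partial>\<Phi>) + ennreal \<epsilon> * G (i, []) v"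
 using assms unfolding approximates_def by blast+

text \<open>The cell weights divided by the mass in i form a consistent family, to which
  \<open>limit_law\<close> applies.\<close>

lemma action_law_exists:
 assumes "good i v"
 shows "\<exists>\<Phi>. prob_space \<Phi> \<and> sets \<Phi> = sets borel \<and> emeasure \<Phi> (A i) = 1 \<and> approximates i v \<Phi>"
proof -
 interpret cell_coding "A i" "code i" "N i" by (rule coding)
 define g where "g s = enn2real (G (i, s) v)" for s
 have G: "G (i, s) v = ennreal (g s)" for s using assms unfolding good_def g_def by (simp add: less_top[symmetric])
 have g0: "0 < g []" using assms G[of "[]"] unfolding good_def by simp
 have gnn: "0 \<le> g s" for s by (simp add: g_def)
 have "\<exists>\<Phi>. prob_space \<Phi> \<and> sets \<Phi> = sets borel \<and> emeasure \<Phi> (A i) = 1 \<and>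
  (\<forall>f \<epsilon> k. continuous_on (A i) f \<longrightarrow> (\<lambda>a. indicator (A i) a * ennreal (f a)) \<in> borel_measurable borel \<longrightarrow> 0 \<le> \<epsilon> \<longrightarrow>
   (\<forall>a\<in>A i. \<forall>b\<in>A i. code i k a = code i k b \<longrightarrow> \<bar>f a - f b\<bar> \<le> \<epsilon>) \<longrightarrow>
   (\<integral>\<^sup>+a. indicator (A i) a * ennreal (f a) \<partial>\<Phi>) \<le> (\<Sum>s\<in>words k. ennreal (g s / g []) * ennreal (f (point s))) + ennreal \<epsilon> \<and>
   (\<Sum>s\<in>words k. ennreal (g s / g []) * ennreal (f (point s))) \<le> (\<integral>\<^sup>+a. indicator (A i) a * ennreal (f a) \<partial>\<Phi>) + ennreal \<epsilon>)"
 proof (rule limit_law[of "\<lambda>s. g s / g []"])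
  fix k s assume s: "s \<in> words k"
  have "ennreal (g s) = ennreal (\<Sum>l<N i k. g (s @ [l]))"
   using assms s length_words[OF s] unfolding good_def by (auto simp: G gnn sum_ennreal)
  then have "g s = (\<Sum>l<N i k. g (s @ [l]))" using gnn by (simp add: sum_nonneg)
  then show "g s / g [] = (\<Sum>l<N i k. g (s @ [l]) / g [])" by (simp add: sum_divide_distrib)
  assume "g s / g [] \<noteq> 0"
  then have "G (i, s) v \<noteq> 0" using gnn[of s] by (auto simp: G)
  then show "\<exists>a\<in>A i. code i k a = s" using assms length_words[OF s] unfolding good_def by blast
 qed (use g0 gnn in auto)
 then obtain \<Phi> where \<Phi>: "prob_space \<Phi>" "sets \<Phi> = sets borel" "emeasure \<Phi> (A i) = 1"
  "\<And>f \<epsilon> k. continuous_on (A i) f \<Longrightarrow> 0 \<le> \<epsilon> \<Longrightarrow> (\<forall>a\<in>A i. \<forall>b\<in>A i. code i k a = code i k b \<longrightarrow> \<bar>f a - f b\<bar> \<le> \<epsilon>) \<Longrightarrow>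
   (\<integral>\<^sup>+a. on_actions i f a \<partial>\<Phi>) \<le> (\<Sum>s\<in>words k. ennreal (g s / g []) * ennreal (f (point s))) + ennreal \<epsilon> \<and>
   (\<Sum>s\<in>words k. ennreal (g s / g []) * ennreal (f (point s))) \<le> (\<integral>\<^sup>+a. on_actions i f a \<partial>\<Phi>) + ennreal \<epsilon>"
  using measurable_on_actions unfolding on_actions_def by blast
 have S: "ennreal (g []) * (\<Sum>s\<in>words k. ennreal (g s / g []) * ennreal (f (point s))) = (\<Sum>s\<in>words k. ennreal (f (point s)) * G (i, s) v)" for f :: "'b \<Rightarrow> real" and k
 proof -
  have "ennreal (g []) * ennreal (g s / g []) = ennreal (g s)" for s
   using g0 gnn[of s] by (simp add: ennreal_mult[symmetric])
  then show ?thesis unfolding sum_distrib_left mult.assoc[symmetric] G by (simp add: mult.commute)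
 qed
 have "approximates i v \<Phi>" unfolding approximates_def
 proof (intro allI impI)
  fix f :: "'b \<Rightarrow> real" and \<epsilon> k
  assume f: "continuous_on (A i) f" "0 \<le> \<epsilon>" "\<forall>a\<in>A i. \<forall>b\<in>A i. code i k a = code i k b \<longrightarrow> \<bar>f a - f b\<bar> \<le> \<epsilon>"
  show "G (i, []) v * (\<integral>\<^sup>+a. on_actions i f a \<partial>\<Phi>) \<le> (\<Sum>s\<in>words k. ennreal (f (point s)) * G (i, s) v) + ennreal \<epsilon> * G (i, []) v \<and>
   (\<Sum>s\<in>words k. ennreal (f (point s)) * G (i, s) v) \<le> G (i, []) v * (\<integral>\<^sup>+a. on_actions i f a \<partial>\<Phi>) + ennreal \<epsilon> * G (i, []) v"
   using \<Phi>(4)[OF f, THEN conjunct1, THEN mult_left_mono[of _ _ "ennreal (g [])"]]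
    \<Phi>(4)[OF f, THEN conjunct2, THEN mult_left_mono[of _ _ "ennreal (g [])"]]
   unfolding S[symmetric] G[of "[]"] by (simp add: distrib_left mult.commute)
 qed
 with \<Phi> show ?thesis by blast
qed

text \<open>Off the good times one fixed admissible action is taken at all times, so measurability
  in time is an issue at good times only.\<close>

definition law :: "'a \<Rightarrow> real \<Rightarrow> 'b measure" where
 "law i v = (if good i v then SOME \<Phi>. prob_space \<Phi> \<and> sets \<Phi> = sets borel \<and> emeasure \<Phi> (A i) = 1 \<and> approximates i v \<Phi>
   else return borel (SOME a. a \<in> A i))"

lemma law: "prob_space (law i v)" "sets (law i v) = sets borel" "emeasure (law i v) (A i) = 1" "good i v \<Longrightarrow> approximates i v (law i v)"
proof -
 have "prob_space (law i v) \<and> sets (law i v) = sets borel \<and> emeasure (law i v) (A i) = 1 \<and> (good i v \<longrightarrow> approximates i v (law i v))"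
 proof (cases "good i v")
  case True
  from someI_ex[OF action_law_exists[OF True]] show ?thesis using True by (simp add: law_def)
 next
  case False
  have "(SOME a. a \<in> A i) \<in> A i" using nonempty by (simp add: some_in_eq)
  then show ?thesis using False A_borel[of i] by (simp add: law_def prob_space_return)
 qed
 then show "prob_space (law i v)" "sets (law i v) = sets borel" "emeasure (law i v) (A i) = 1" "good i v \<Longrightarrow> approximates i v (law i v)" by auto
qed

text \<open>The laws are chosen separately for each time, so measurability cannot come from the
  choice. But \<open>approximates\<close> pins down the integral of a continuous function, up to the
  factor \<open>G (i, [])\<close>, as a limit of finite cell sums, and these are measurable in
  time.\<close>

lemma measurable_law_continuous:
 assumes f: "continuous_on (A i) f"
 shows "(\<lambda>v. \<integral>\<^sup>+a. on_actions i f a \<partial>law i v) \<in> borel_measurable borel"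
proof -
 interpret cell_coding "A i" "code i" "N i" by (rule coding)
 have "\<exists>k. \<forall>a\<in>A i. \<forall>b\<in>A i. code i k a = code i k b \<longrightarrow> \<bar>f a - f b\<bar> \<le> 1 / real (Suc m)" for m
  using uniform_level[OF f, of "1 / real (Suc m)"] by (metis of_nat_0_less_iff zero_less_Suc zero_less_divide_1_iff)
 then obtain k where k: "\<And>m. \<forall>a\<in>A i. \<forall>b\<in>A i. code i (k m) a = code i (k m) b \<longrightarrow> \<bar>f a - f b\<bar> \<le> 1 / real (Suc m)" by metis
 define h where "h m v = (if good i v then (\<Sum>s\<in>words (k m). ennreal (f (point s)) * G (i, s) v) else 0)" for m v
 have [measurable]: "h m \<in> borel_measurable borel" for m unfolding h_def[abs_def] by measurable
 have "(\<lambda>m. h m v) \<longlonglongrightarrow> (if good i v then G (i, []) v * (\<integral>\<^sup>+a. on_actions i f a \<partial>law i v) else 0)" for v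
 proof (cases "good i v")
  case True
  then have fin: "G (i, []) v < \<infinity>" by (simp add: good_def)
  define g where "g = enn2real (G (i, []) v)"
  have g: "G (i, []) v = ennreal g" "0 \<le> g" using fin by (auto simp: g_def less_top[symmetric])
  let ?x = "G (i, []) v * (\<integral>\<^sup>+a. on_actions i f a \<partial>law i v)"
  have app: "?x \<le> h m v + ennreal (g / real (Suc m)) \<and> h m v \<le> ?x + ennreal (g / real (Suc m))" for m
   using approximatesD[OF law(4)[OF True] f _ k, of m] True g(2)
   by (simp add: h_def g(1) ennreal_mult[symmetric])
  have up: "limsup (\<lambda>m. h m v) \<le> ?x" and lo: "?x \<le> liminf (\<lambda>m. h m v)"
  proof -
   have e: "(\<lambda>m. ennreal (g / real (Suc m))) \<longlonglongrightarrow> 0"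
    using tendsto_ennrealI[OF LIMSEQ_Suc[OF lim_const_over_n[of g]]] by simp
   have "limsup (\<lambda>m. h m v) \<le> limsup (\<lambda>m. ?x + ennreal (g / real (Suc m)))" by (intro Limsup_mono always_eventually) (use app in simp)
   also have "\<dots> = ?x" using tendsto_add[OF tendsto_const e, of ?x] by (intro lim_imp_Limsup) auto
   finally show "limsup (\<lambda>m. h m v) \<le> ?x" .
   show "?x \<le> liminf (\<lambda>m. h m v)"
   proof (rule ennreal_le_epsilonI)
    fix \<epsilon> :: real assume "0 < \<epsilon>"
    then have "eventually (\<lambda>m. ennreal (g / real (Suc m)) < ennreal \<epsilon>) sequentially" by (intro order_tendstoD(2)[OF e]) simp
    then have "eventually (\<lambda>m. ?x \<le> h m v + ennreal \<epsilon>) sequentially"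
     by eventually_elim (use app in \<open>meson add_left_mono less_imp_le order_trans\<close>)
    then have "?x \<le> liminf (\<lambda>m. h m v + ennreal \<epsilon>)" by (rule Liminf_bounded)
    then show "?x \<le> liminf (\<lambda>m. h m v) + ennreal \<epsilon>" by (simp add: Liminf_add_const)
   qed
  qed
  then show ?thesis
   using True Liminf_le_Limsup[of sequentially "\<lambda>m. h m v"] by (intro Liminf_eq_Limsup) auto
 qed (simp add: h_def)
 then have "(\<lambda>v. limsup (\<lambda>m. h m v)) = (\<lambda>v. if good i v then G (i, []) v * (\<integral>\<^sup>+a. on_actions i f a \<partial>law i v) else 0)"
  by (intro ext lim_imp_Limsup) auto
 moreover have "(\<lambda>v. limsup (\<lambda>m. h m v)) \<in> borel_measurable borel" by measurable
 ultimately have m: "(\<lambda>v. if good i v then G (i, []) v * (\<integral>\<^sup>+a. on_actions i f a \<partial>law i v) else 0) \<in> borel_measurable borel"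
  by (simp only:)
 have "(\<lambda>v. if good i v then (if good i v then G (i, []) v * (\<integral>\<^sup>+a. on_actions i f a \<partial>law i v) else 0) / G (i, []) v
   else (\<integral>\<^sup>+a. on_actions i f a \<partial>return borel (SOME a. a \<in> A i))) \<in> borel_measurable borel"
  using m by measurable
 also have "(\<lambda>v. if good i v then (if good i v then G (i, []) v * (\<integral>\<^sup>+a. on_actions i f a \<partial>law i v) else 0) / G (i, []) v
   else (\<integral>\<^sup>+a. on_actions i f a \<partial>return borel (SOME a. a \<in> A i))) = (\<lambda>v. \<integral>\<^sup>+a. on_actions i f a \<partial>law i v)"
 proof (rule ext)
  fix v
  show "(if good i v then (if good i v then G (i, []) v * (\<integral>\<^sup>+a. on_actions i f a \<partial>law i v) else 0) / G (i, []) v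
   else (\<integral>\<^sup>+a. on_actions i f a \<partial>return borel (SOME a. a \<in> A i))) = (\<integral>\<^sup>+a. on_actions i f a \<partial>law i v)"
  proof (cases "good i v")
   case True
   then have "G (i, []) v \<noteq> 0" "G (i, []) v \<noteq> \<infinity>" unfolding good_def by (metis less_irrefl)+
   then show ?thesis using True by (simp add: mult_divide_eq_ennreal mult.commute[of "G (i, []) v"])
  qed (simp add: law_def)
 qed
 finally show ?thesis .
qed

lemma measurable_law [measurable]: "law i \<in> borel \<rightarrow>\<^sub>M prob_algebra borel"
proof (rule measurable_prob_algebra_generated)
 show "sets borel = sigma_sets UNIV (Collect closed)" by (subst borel_eq_closed) simp
 show "Int_stable (Collect closed)" by (auto simp: Int_stable_def)
 fix C :: "'b set" assume "C \<in> Collect closed"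
 then have C: "closed C" by simp
 show "(\<lambda>v. emeasure (law i v) C) \<in> borel_measurable borel"
 proof (cases "C = {}")
  case False
  define f where "f n a = max 0 (1 - real n * infdist a C)" for n a
  have f: "continuous_on (A i) (f n)" for n unfolding f_def by (intro continuous_intros)
  have "emeasure (law i v) C = (INF n. \<integral>\<^sup>+a. on_actions i (f n) a \<partial>law i v)" for v
  proof -
   interpret prob_space "law i v" by (rule law)
   have mf: "on_actions i (f n) \<in> borel_measurable (law i v)" for n
    using measurable_on_actions[OF f] by (simp cong: measurable_cong_sets add: law(2))
   have AE: "AE a in law i v. a \<in> A i"
    using law(3)[of i v] A_borel[of i] law(2)[of i v] by (intro AE_prob_1) (simp_all add: emeasure_eq_measure)
   have "emeasure (law i v) C = (\<integral>\<^sup>+a. indicator C a \<partial>law i v)" using C by (simp add: law(2))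
   also have "\<dots> = (\<integral>\<^sup>+a. (INF n. on_actions i (f n) a) \<partial>law i v)"
   proof (rule nn_integral_cong_AE)
    show "AE a in law i v. indicator C a = (INF n. on_actions i (f n) a)"
     using AE
    proof eventually_elim
     fix a assume a: "a \<in> A i"
     show "indicator C a = (INF n. on_actions i (f n) a)"
     proof (cases "a \<in> C")
      case True
      then have "on_actions i (f n) a = 1" for n using a by (simp add: on_actions_def f_def)
      then show ?thesis using True by simp
     next
      case False
      then have "0 < infdist a C" using in_closed_iff_infdist_zero[OF C \<open>C \<noteq> {}\<close>, of a] infdist_nonneg[of a C] by linarith
      then obtain n where "1 < real n * infdist a C" using reals_Archimedean3 by blast
      then have "on_actions i (f n) a = 0" by (simp add: on_actions_def f_def)
      then have "(INF n. on_actions i (f n) a) \<le> 0" by (intro INF_lower2[of n]) auto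
      then show ?thesis using False by simp
     qed
    qed
   qed
   also have "\<dots> = (INF n. \<integral>\<^sup>+a. on_actions i (f n) a \<partial>law i v)"
   proof (rule nn_integral_monotone_convergence_INF_decseq[OF _ mf])
    show "decseq (\<lambda>n. on_actions i (f n))"
    proof (intro decseq_SucI le_funI)
     fix n a
     have "real n * infdist a C \<le> real (Suc n) * infdist a C" by (intro mult_right_mono) (auto simp: infdist_nonneg)
     then show "on_actions i (f (Suc n)) a \<le> on_actions i (f n) a"
      unfolding on_actions_def f_def by (intro mult_left_mono ennreal_leI) auto
    qed
    show "(\<integral>\<^sup>+a. on_actions i (f 0) a \<partial>law i v) < \<infinity>"
     by (rule le_less_trans[OF nn_integral_mono[of _ _ "\<lambda>_. 1"]]) (auto simp: on_actions_def f_def emeasure_space_1 split: split_indicator)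
   qed
   finally show ?thesis .
  qed
  then show ?thesis using measurable_law_continuous[OF f] by simp
 qed simp
qed (use law in auto)

end

section \<open>Passage to the limit in the forward equation and in the costs\<close>

lemma tint_le_add:
 assumes m [measurable]: "g \<in> borel_measurable borel" "h \<in> borel_measurable borel"
  and le: "AE v in lborel. 0 < v \<and> v < t \<longrightarrow> f v \<le> g v + ennreal c * h v" and h: "tint t h \<le> ennreal b"
 shows "tint t f \<le> tint t g + ennreal c * ennreal b"
proof -
 have "tint t f \<le> (\<integral>\<^sup>+v. (if 0 < v \<and> v < t then g v else 0) + ennreal c * (if 0 < v \<and> v < t then h v else 0) \<partial>lborel)"
  by (rule nn_integral_mono_AE, use le in eventually_elim) auto
 also have "\<dots> = tint t g + ennreal c * tint t h" by (simp add: nn_integral_add nn_integral_cmult)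
 also have "\<dots> \<le> tint t g + ennreal c * ennreal b" by (intro add_left_mono mult_left_mono h) simp
 finally show ?thesis .
qed

lemma tint_const: "0 \<le> t \<Longrightarrow> tint t (\<lambda>_. c) = c * ennreal t"
proof -
 assume "0 \<le> t"
 have "tint t (\<lambda>_. c) = (\<integral>\<^sup>+s. c * indicator {0<..<t} s \<partial>lborel)" by (intro nn_integral_cong) (auto split: split_indicator)
 then show ?thesis using \<open>0 \<le> t\<close> by (simp add: nn_integral_cmult_indicator)
qed

context flow_limit
begin

abbreviation mean :: "'a \<Rightarrow> ('b \<Rightarrow> ennreal) \<Rightarrow> real \<Rightarrow> ennreal" where
 "mean i f v \<equiv> \<integral>\<^sup>+a. f a \<partial>law i v"

lemma measurable_mean [measurable]: "f \<in> borel_measurable borel \<Longrightarrow> mean i f \<in> borel_measurable borel"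
 by (rule measurable_compose[OF measurable_prob_algebraD[OF measurable_law] nn_integral_measurable_subprob_algebra])

lemma mean_le:
 assumes "\<And>a. a \<in> A i \<Longrightarrow> f a \<le> c" shows "mean i f v \<le> c"
proof -
 interpret prob_space "law i v" by (rule law)
 have "AE a in law i v. a \<in> A i"
  using law(3)[of i v] A_borel[of i] law(2)[of i v] by (intro AE_prob_1) (simp_all add: emeasure_eq_measure)
 then have "AE a in law i v. f a \<le> c" by eventually_elim (rule assms)
 then have "mean i f v \<le> (\<integral>\<^sup>+a. c \<partial>law i v)" by (rule nn_integral_mono_AE)
 then show ?thesis by (simp add: emeasure_space_1)
qed

lemma sum_cell: "a \<in> A i \<Longrightarrow> (\<Sum>s\<in>cells i k. c s * cell i s a) = c (code i k a)"
proof -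
 interpret cell_coding "A i" "code i" "N i" by (rule coding)
 assume a: "a \<in> A i"
 have "(\<Sum>s\<in>words k. c s * cell i s a) = (\<Sum>s\<in>words k. if s = code i k a then c (code i k a) else 0)"
  by (intro sum.cong) (auto simp: cell_def length_words split: split_indicator)
 then show ?thesis using code_words[OF a, of k] by simp
qed

lemma rep_code: "a \<in> A i \<Longrightarrow> rep i (code i k a) \<in> A i \<and> code i k (rep i (code i k a)) = code i k a"
proof -
 interpret cell_coding "A i" "code i" "N i" by (rule coding)
 assume a: "a \<in> A i"
 then have "\<exists>b. b \<in> A i \<and> code i (length (code i k a)) b = code i k a" using length_code by auto
 from someI_ex[OF this] show ?thesis using length_code[OF a] by (simp add: point_def)
qed

text \<open>Uniform continuity replaces f by a function that is constant on the cells of some level,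
  up to \<epsilon>. For such functions convergence is that of finitely many cell flows, and the
  error is \<epsilon> times a mass of at most one.\<close>

lemma G_lim_single:
 assumes f: "continuous_on (A i) f" and t: "0 \<le> t" "t \<le> T"
 shows "(\<lambda>n. tint t (\<Lambda> (r n) i (on_actions i f))) \<longlonglongrightarrow> tint t (\<lambda>v. G (i, []) v * mean i (on_actions i f) v)"
proof (rule ennreal_approx_tendsto)
 interpret cell_coding "A i" "code i" "N i" by (rule coding)
 fix e :: real assume e: "0 < e"
 \<comment> \<open>Chosen so that the error, integrated up to t <= T, stays below e.\<close>
 define \<epsilon> where "\<epsilon> = e / (T + 1)"
 have \<epsilon>: "0 < \<epsilon>" using e T0 by (simp add: \<epsilon>_def)
 have "\<epsilon> * t \<le> \<epsilon> * (T + 1)" using t \<epsilon> by (intro mult_left_mono) auto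
 then have \<epsilon>t: "ennreal \<epsilon> * ennreal t \<le> ennreal e" using t \<epsilon> T0 by (simp add: ennreal_mult[symmetric] ennreal_leI \<epsilon>_def)
 obtain k where k: "\<And>a b. a \<in> A i \<Longrightarrow> b \<in> A i \<Longrightarrow> code i k a = code i k b \<Longrightarrow> \<bar>f a - f b\<bar> \<le> \<epsilon>"
  using uniform_level[OF f \<epsilon>] by blast
 define S where "S n v = (\<Sum>s\<in>words k. ennreal (f (point s)) * \<Lambda> n i (cell i s) v)" for n v
 define S' where "S' v = (\<Sum>s\<in>words k. ennreal (f (point s)) * G (i, s) v)" for v
 have [measurable]: "S n \<in> borel_measurable borel" "S' \<in> borel_measurable borel" for n
  unfolding S_def[abs_def] S'_def[abs_def] by measurable
 have split: "ennreal x \<le> ennreal y + ennreal \<epsilon> * 1" if "\<bar>x - y\<bar> \<le> \<epsilon>" for x y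
 proof -
  have "ennreal x \<le> ennreal (max y 0 + \<epsilon>)" using that by (intro ennreal_leI) auto
  also have "\<dots> = ennreal y + ennreal \<epsilon> * 1" using \<epsilon> by (simp add: ennreal_plus max_def ennreal_neg)
  finally show ?thesis .
 qed
 let ?F = "\<lambda>a. \<Sum>s\<in>words k. ennreal (f (point s)) * cell i s a"
 have mE [measurable]: "on_actions i f \<in> borel_measurable borel" by (rule measurable_on_actions[OF f])
 have close: "\<bar>f a - f (point (code i k a))\<bar> \<le> \<epsilon> \<and> \<bar>f (point (code i k a)) - f a\<bar> \<le> \<epsilon>" if "a \<in> A i" for a
  using k[OF that, of "point (code i k a)"] k[of "point (code i k a)" a] rep_code[OF that, of k] that by auto
 have \<Lambda>S: "S n v = \<Lambda> n i ?F v" for n v unfolding S_def by (rule \<Lambda>_sum[symmetric]) auto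
 have le1: "\<Lambda> n i (on_actions i f) v \<le> S n v + ennreal \<epsilon> * \<Lambda> n i (\<lambda>_. 1) v" for n v
 proof -
  have "\<Lambda> n i (on_actions i f) v \<le> \<Lambda> n i (\<lambda>a. ?F a + ennreal \<epsilon> * 1) v"
  proof (rule \<Lambda>_mono)
   fix a assume a: "a \<in> A i"
   show "on_actions i f a \<le> ?F a + ennreal \<epsilon> * 1"
    using split[of "f a" "f (point (code i k a))"] close[OF a] a by (simp add: sum_cell on_actions_def)
  qed
  also have "\<dots> = S n v + ennreal \<epsilon> * \<Lambda> n i (\<lambda>_. 1) v"
   unfolding \<Lambda>S by (subst \<Lambda>_add) (auto intro!: \<Lambda>_cmult[of "\<lambda>_. 1", simplified])
  finally show ?thesis .
 qed
 have le2: "S n v \<le> \<Lambda> n i (on_actions i f) v + ennreal \<epsilon> * \<Lambda> n i (\<lambda>_. 1) v" for n v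
 proof -
  have "S n v \<le> \<Lambda> n i (\<lambda>a. on_actions i f a + ennreal \<epsilon> * 1) v" unfolding \<Lambda>S
  proof (rule \<Lambda>_mono)
   fix a assume a: "a \<in> A i"
   show "?F a \<le> on_actions i f a + ennreal \<epsilon> * 1"
    using split[of "f (point (code i k a))" "f a"] close[OF a] a by (simp add: sum_cell on_actions_def)
  qed
  also have "\<dots> = \<Lambda> n i (on_actions i f) v + ennreal \<epsilon> * \<Lambda> n i (\<lambda>_. 1) v"
   by (subst \<Lambda>_add) (auto intro!: \<Lambda>_cmult[of "\<lambda>_. 1", simplified])
  finally show ?thesis .
 qed
 let ?x = "\<lambda>v. G (i, []) v * mean i (on_actions i f) v"
 have le3: "AE v in lborel. 0 < v \<and> v < t \<longrightarrow> ?x v \<le> S' v + ennreal \<epsilon> * G (i, []) v"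
  and le4: "AE v in lborel. 0 < v \<and> v < t \<longrightarrow> S' v \<le> ?x v + ennreal \<epsilon> * G (i, []) v"
 proof -
  have k': "\<forall>a\<in>A i. \<forall>b\<in>A i. code i k a = code i k b \<longrightarrow> \<bar>f a - f b\<bar> \<le> \<epsilon>" using k by blast
  show "AE v in lborel. 0 < v \<and> v < t \<longrightarrow> ?x v \<le> S' v + ennreal \<epsilon> * G (i, []) v"
   using AE_good[of i] by eventually_elim (use t approximatesD(1)[OF law(4) f less_imp_le[OF \<epsilon>] k'] in \<open>auto simp: S'_def\<close>)
  show "AE v in lborel. 0 < v \<and> v < t \<longrightarrow> S' v \<le> ?x v + ennreal \<epsilon> * G (i, []) v"
   using AE_good[of i]
  proof eventually_elim
   case (elim v)
   show ?case
   proof (cases "good i v")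
    case True
    then show ?thesis using approximatesD(2)[OF law(4) f less_imp_le[OF \<epsilon>] k'] by (simp add: S'_def)
   next
    case False
    have "S' v = 0" if "0 < v" "v < t"
    proof -
     have "(\<Sum>s\<in>words k. G (i, s) v) = 0" using elim False that t by auto
     then show ?thesis by (simp add: S'_def sum_eq_0_iff)
    qed
    then show ?thesis by simp
   qed
  qed
 qed
 have m1: "tint t (\<Lambda> n i (\<lambda>_. 1)) \<le> ennreal t" for n by (rule tint_le[OF t(1) \<Lambda>_single])
 have "(\<lambda>n. tint t (S (r n))) \<longlonglongrightarrow> tint t S'"
  unfolding S_def S'_def by (rule G_sum_lim[OF t(1)]) auto
 moreover have "tint t (\<Lambda> (r n) i (on_actions i f)) \<le> tint t (S (r n)) + ennreal e \<and> tint t (S (r n)) \<le> tint t (\<Lambda> (r n) i (on_actions i f)) + ennreal e" for n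
  using order_trans[OF tint_le_add[OF _ _ always_eventually m1[of "r n"]] add_left_mono[OF \<epsilon>t]] le1 le2 by auto
 moreover have "tint t ?x \<le> tint t S' + ennreal e" "tint t S' \<le> tint t ?x + ennreal e"
  using order_trans[OF tint_le_add[OF _ _ le3 tint_G_le[OF t(1)]] add_left_mono[OF \<epsilon>t]]
   order_trans[OF tint_le_add[OF _ _ le4 tint_G_le[OF t(1)]] add_left_mono[OF \<epsilon>t]] by auto
 ultimately show "\<exists>y y'. y \<longlonglongrightarrow> y' \<and> (\<forall>n. tint t (\<Lambda> (r n) i (on_actions i f)) \<le> y n + ennreal e \<and> y n \<le> tint t (\<Lambda> (r n) i (on_actions i f)) + ennreal e) \<and>
  tint t ?x \<le> y' + ennreal e \<and> y' \<le> tint t ?x + ennreal e" by blast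
qed

lemma levels_cover: "incseq (\<lambda>m. {i. w i \<le> real m})" "(\<Union>m. {i. w i \<le> real m}) = UNIV"
 using real_arch_simple by (auto simp: incseq_def)

text \<open>Sums over finitely many states pass to the limit under the uniform bound B T; monotone
  convergence then gives all states.\<close>

lemma G_moment:
 assumes t: "0 \<le> t" "t \<le> T"
 shows "tint t (\<lambda>v. csum (\<lambda>i. ennreal (w i ^ 2) * G (i, []) v)) \<le> ennreal (B * T)"
proof -
 define D where "D m = {i. w i \<le> real m}" for m :: nat
 have D: "incseq D" "\<And>m. finite (D m)" "(\<Union>m. D m) = UNIV" unfolding D_def using levels_cover levels by auto
 define h where "h m v = (\<Sum>i\<in>D m. ennreal (w i ^ 2) * G (i, []) v)" for m v
 have [measurable]: "h m \<in> borel_measurable borel" for m unfolding h_def[abs_def] by measurable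
 have "tint t (\<lambda>v. csum (\<lambda>i. ennreal (w i ^ 2) * G (i, []) v)) = (\<integral>\<^sup>+v. (SUP m. if 0 < v \<and> v < t then h m v else 0) \<partial>lborel)"
  unfolding nn_integral_count_SUP[OF D] h_def by (intro nn_integral_cong) auto
 also have "\<dots> = (SUP m. tint t (h m))"
 proof (rule nn_integral_monotone_convergence_SUP)
  show "incseq (\<lambda>m v. if 0 < v \<and> v < t then h m v else 0)"
   using D(1,2) unfolding h_def by (intro incseq_SucI le_funI) (auto intro!: sum_mono2 dest: incseq_SucD)
 qed measurable
 also have "\<dots> \<le> ennreal (B * T)"
 proof (rule SUP_least)
  fix m
  have "(\<lambda>n. tint t (\<lambda>v. \<Sum>i\<in>D m. ennreal (w i ^ 2) * \<Lambda> (r n) i (cell i []) v)) \<longlonglongrightarrow> tint t (h m)"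
   unfolding h_def using D(2) G_lim'[OF t(1)] by (simp add: tint_sum) (intro tendsto_sum ennreal_tendsto_cmult, auto)
  moreover have "tint t (\<lambda>v. \<Sum>i\<in>D m. ennreal (w i ^ 2) * \<Lambda> (r n) i (cell i []) v) \<le> ennreal (B * T)" for n
  proof -
   have "(\<Sum>i\<in>D m. ennreal (w i ^ 2) * \<Lambda> (r n) i (cell i []) v) \<le> ennreal B" if "0 < v" "v < t" for v
   proof -
    have "(\<Sum>i\<in>D m. ennreal (w i ^ 2) * \<Lambda> (r n) i (cell i []) v) \<le> (\<Sum>i\<in>D m. ennreal (w i ^ 2) * \<Lambda> (r n) i (\<lambda>_. 1) v)"
     by (intro sum_mono mult_left_mono \<Lambda>_mono) (auto simp: cell_def split: split_indicator)
    also have "\<dots> \<le> csum (\<lambda>i. ennreal (w i ^ 2) * \<Lambda> (r n) i (\<lambda>_. 1) v)"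
     unfolding nn_integral_count_SUP[OF D] by (rule SUP_upper) simp
    also have "\<dots> \<le> ennreal B" using that t by (intro \<Lambda>_moment) auto
    finally show ?thesis .
   qed
   then have "tint t (\<lambda>v. \<Sum>i\<in>D m. ennreal (w i ^ 2) * \<Lambda> (r n) i (cell i []) v) \<le> tint T (\<lambda>_. ennreal B)"
    using t by (intro nn_integral_mono) auto
   then show ?thesis using T0 B0 by (simp add: tint_const ennreal_mult)
  qed
  ultimately show "tint t (h m) \<le> ennreal (B * T)" by (intro LIMSEQ_le_const2) auto
 qed
 finally show ?thesis .
qed

text \<open>Where w exceeds R one has C w <= (C / R) w^2. This is the uniform integrability that
  reduces limits over all states to finitely many.\<close>

lemma csum_tail:
 assumes C: "0 \<le> C" and F: "\<And>i. F i \<le> ennreal (C * w i) * m i" and R: "0 < R"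
 shows "csum F \<le> (\<Sum>i\<in>{i. w i \<le> real R}. F i) + ennreal (C / real R) * csum (\<lambda>i. ennreal (w i ^ 2) * m i)"
proof -
 let ?D = "{i. w i \<le> real R}"
 have "csum F \<le> csum (\<lambda>i. F i * indicator ?D i + ennreal (C / real R) * (ennreal (w i ^ 2) * m i))"
 proof (rule nn_integral_mono)
  fix i
  show "F i \<le> F i * indicator ?D i + ennreal (C / real R) * (ennreal (w i ^ 2) * m i)"
  proof (cases "w i \<le> real R")
   case False
   have "C * w i \<le> C * w i * (w i / real R)"
    using False C R w1[of i] by (intro mult_left_mono[of 1 _ "C * w i", simplified]) (auto simp: field_simps)
   also have "\<dots> = C / real R * w i ^ 2" by (simp add: power2_eq_square)
   finally have "ennreal (C * w i) \<le> ennreal (C / real R) * ennreal (w i ^ 2)"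
    using C by (simp add: ennreal_mult[symmetric] ennreal_leI)
   from order_trans[OF F mult_right_mono[OF this]] show ?thesis using False by (simp add: mult.assoc)
  qed simp
 qed
 also have "\<dots> = csum (\<lambda>i. F i * indicator ?D i) + ennreal (C / real R) * csum (\<lambda>i. ennreal (w i ^ 2) * m i)"
  by (simp add: nn_integral_add nn_integral_cmult)
 also have "csum (\<lambda>i. F i * indicator ?D i) = (\<Sum>i\<in>?D. F i)"
  by (subst nn_integral_count_space'[OF levels]) (auto split: split_indicator_asm)
 finally show ?thesis .
qed

text \<open>Cutting at w <= R leaves a finite sum, handled by \<open>G_lim_single\<close>. The tails
  of the sequence and of the limit are small uniformly, by the moment bound and by
  \<open>G_moment\<close>. An upper bound on f suffices because \<open>on_actions\<close> clips
  negative values.\<close>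

lemma G_lim_csum:
 assumes f: "\<And>i. continuous_on (A i) (f i)" and C: "0 \<le> C" "\<And>i a. a \<in> A i \<Longrightarrow> f i a \<le> C * w i" and t: "0 \<le> t" "t \<le> T"
 shows "(\<lambda>n. tint t (\<lambda>v. csum (\<lambda>i. \<Lambda> (r n) i (on_actions i (f i)) v))) \<longlonglongrightarrow>
  tint t (\<lambda>v. csum (\<lambda>i. G (i, []) v * mean i (on_actions i (f i)) v))"
proof (rule ennreal_approx_tendsto)
 fix e :: real assume e: "0 < e"
 \<comment> \<open>The tail is at most (C / R) B T, so this R makes it at most e.\<close>
 obtain R :: nat where R: "C * (B * T) / e < real R" "0 < R"
  using reals_Archimedean2[of "max (C * (B * T) / e) 1"] by (metis less_trans max_less_iff_conj of_nat_0_less_iff zero_less_one)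
 then have "C / real R * (B * T) \<le> e" using e by (simp add: field_simps)
 then have small: "ennreal (C / real R) * ennreal (B * T) \<le> ennreal e"
  using C(1) B0 T0 by (simp add: ennreal_mult[symmetric] ennreal_leI)
 let ?D = "{i. w i \<le> real R}"
 let ?E = "\<lambda>i. on_actions i (f i)"
 have [measurable]: "?E i \<in> borel_measurable borel" for i by (rule measurable_on_actions[OF f])
 have bE: "?E i a \<le> ennreal (C * w i)" if "a \<in> A i" for i a using C(2)[OF that] that by (simp add: on_actions_def ennreal_leI)
 have b\<Lambda>: "\<Lambda> n i (?E i) v \<le> ennreal (C * w i) * \<Lambda> n i (\<lambda>_. 1) v" for n i v
  using \<Lambda>_mono[of i "?E i" "\<lambda>_. ennreal (C * w i)" n v] \<Lambda>_cmult[of "\<lambda>_. 1" n i "ennreal (C * w i)" v] bE by simp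
 have bG: "G (i, []) v * mean i (?E i) v \<le> ennreal (C * w i) * G (i, []) v" for i v
 proof -
  have "mean i (?E i) v \<le> ennreal (C * w i)" by (rule mean_le[OF bE])
  then show ?thesis using mult_left_mono[of "mean i (?E i) v" _ "G (i, []) v"] by (simp add: mult.commute)
 qed
 have mom: "tint t (\<lambda>v. csum (\<lambda>i. ennreal (w i ^ 2) * \<Lambda> n i (\<lambda>_. 1) v)) \<le> ennreal (B * T)" for n
 proof -
  have "tint t (\<lambda>v. csum (\<lambda>i. ennreal (w i ^ 2) * \<Lambda> n i (\<lambda>_. 1) v)) \<le> tint T (\<lambda>_. ennreal B)"
   using t \<Lambda>_moment by (intro nn_integral_mono) auto
  then show ?thesis using T0 B0 by (simp add: tint_const ennreal_mult)
 qed
 let ?X = "\<lambda>n v. csum (\<lambda>i. \<Lambda> (r n) i (?E i) v)" and ?Y = "\<lambda>n v. \<Sum>i\<in>?D. 1 * \<Lambda> (r n) i (?E i) v"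
 let ?X' = "\<lambda>v. csum (\<lambda>i. G (i, []) v * mean i (?E i) v)" and ?Y' = "\<lambda>v. \<Sum>i\<in>?D. 1 * (G (i, []) v * mean i (?E i) v)"
 have part: "(\<Sum>i\<in>?D. 1 * F i) \<le> csum F" for F
  unfolding nn_integral_count_SUP[OF levels_cover(1) levels levels_cover(2)] by (rule SUP_upper2[of R]) simp_all
 have "(\<lambda>n. tint t (?Y n)) \<longlonglongrightarrow> tint t ?Y'"
  using G_lim_single[OF f t] by (subst (1 2) tint_sum[OF levels]) (auto intro!: tendsto_sum)
 moreover have "tint t (?X n) \<le> tint t (?Y n) + ennreal e \<and> tint t (?Y n) \<le> tint t (?X n) + ennreal e" for n
 proof
  have "tint t (?X n) \<le> tint t (?Y n) + ennreal (C / real R) * ennreal (B * T)"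
  proof (rule tint_le_add[OF _ _ always_eventually mom[of "r n"]])
   show "\<forall>v. 0 < v \<and> v < t \<longrightarrow> ?X n v \<le> ?Y n v + ennreal (C / real R) * csum (\<lambda>i. ennreal (w i ^ 2) * \<Lambda> (r n) i (\<lambda>_. 1) v)"
    using csum_tail[OF C(1) b\<Lambda> R(2)] by simp
  qed auto
  then show "tint t (?X n) \<le> tint t (?Y n) + ennreal e" using add_left_mono[OF small] order_trans by blast
  have "tint t (?Y n) \<le> tint t (?X n)" using part by (intro nn_integral_mono) auto
  then show "tint t (?Y n) \<le> tint t (?X n) + ennreal e" by (simp add: add_increasing2)
 qed
 moreover have "tint t ?X' \<le> tint t ?Y' + ennreal e"
 proof -
  have "tint t ?X' \<le> tint t ?Y' + ennreal (C / real R) * ennreal (B * T)"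
  proof (rule tint_le_add[OF _ _ always_eventually G_moment[OF t]])
   show "\<forall>v. 0 < v \<and> v < t \<longrightarrow> ?X' v \<le> ?Y' v + ennreal (C / real R) * csum (\<lambda>i. ennreal (w i ^ 2) * G (i, []) v)"
    using csum_tail[OF C(1) bG R(2)] by simp
  qed auto
  then show ?thesis using add_left_mono[OF small] order_trans by blast
 qed
 moreover have "tint t ?Y' \<le> tint t ?X' + ennreal e"
 proof -
  have "tint t ?Y' \<le> tint t ?X'" using part by (intro nn_integral_mono) auto
  then show ?thesis by (simp add: add_increasing2)
 qed
 ultimately show "\<exists>y y'. y \<longlonglongrightarrow> y' \<and> (\<forall>n. tint t (?X n) \<le> y n + ennreal e \<and> y n \<le> tint t (?X n) + ennreal e) \<and>
  tint t ?X' \<le> y' + ennreal e \<and> y' \<le> tint t ?X' + ennreal e" by blast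
qed

lemma rate_eq: "rate j i = on_actions i (q j i)" and out_rate_eq: "out_rate i = on_actions i (\<lambda>a. - q i i a)"
 by (auto simp: rate_def out_rate_def on_actions_def fun_eq_iff)

lemma q_le: "a \<in> A i \<Longrightarrow> q j i a \<le> L * w i"
proof -
 assume a: "a \<in> A i"
 have "ennreal (q j i a) = rate j i a" using a by (simp add: rate_def)
 also have "\<dots> \<le> out_rate i a" unfolding nn_integral_rate[symmetric] by (rule nn_integral_ge_point) simp
 also have "\<dots> \<le> ennreal (L * w i)" using out_rate_le[of i a] rate_le[of i] by (meson ennreal_leI order_trans)
 finally show ?thesis using mult_nonneg_nonneg[OF L0, of "w i"] w1[of i] by (auto simp: ennreal_le_iff2)
qed

text \<open>With \<open>liminf\<close>, measurability and, by Fatou, mass at most one are available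
  before convergence is known; \<open>p_lim\<close> shows that it is a limit on (0, T].\<close>

definition p :: "'a \<Rightarrow> real \<Rightarrow> ennreal" where
 "p j t = (if 0 < t \<and> t \<le> T then liminf (\<lambda>n. \<Lambda> (r n) j (\<lambda>_. 1) t) else 0)"

lemma measurable_p [measurable]: "p j \<in> borel_measurable borel"
 unfolding p_def[abs_def] by measurable

lemma p_0: "t \<le> 0 \<Longrightarrow> p j t = 0" by (simp add: p_def)

lemma p_mass: "csum (\<lambda>i. p i t) \<le> 1"
proof -
 have "csum (\<lambda>i. p i t) \<le> csum (\<lambda>i. liminf (\<lambda>n. \<Lambda> (r n) i (\<lambda>_. 1) t))" by (intro nn_integral_mono) (simp add: p_def)
 also have "\<dots> \<le> liminf (\<lambda>n. csum (\<lambda>i. \<Lambda> (r n) i (\<lambda>_. 1) t))" by (intro nn_integral_liminf) simp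
 also have "\<dots> \<le> liminf (\<lambda>n. 1)" by (intro Liminf_mono always_eventually allI \<Lambda>_mass)
 finally show ?thesis by (simp add: Liminf_const)
qed

text \<open>The forward equation expresses the mass at a single time by time integrals, and these
  converge. So the masses converge at every time, which weak convergence of densities would not
  give. The loss term is bounded by the maximal rate times t, hence can be subtracted.\<close>

lemma p_lim:
 assumes t: "0 < t" "t \<le> T"
 shows "(\<lambda>n. \<Lambda> (r n) j (\<lambda>_. 1) t) \<longlonglongrightarrow> p j t"
  "p j t + tint t (\<lambda>v. G (j, []) v * mean j (out_rate j) v) = ennreal (pmf \<gamma> j) + tint t (\<lambda>v. csum (\<lambda>i. G (i, []) v * mean i (rate j i) v))"
proof -
 let ?a = "\<lambda>n. tint t (\<Lambda> (r n) j (out_rate j))" and ?b = "\<lambda>n. tint t (\<lambda>v. csum (\<lambda>i. \<Lambda> (r n) i (rate j i) v))"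
 let ?a' = "tint t (\<lambda>v. G (j, []) v * mean j (out_rate j) v)" and ?b' = "tint t (\<lambda>v. csum (\<lambda>i. G (i, []) v * mean i (rate j i) v))"
 have t0: "0 \<le> t" using t by simp
 have a: "?a \<longlonglongrightarrow> ?a'"
  unfolding out_rate_eq using q_cont by (intro G_lim_single t0 t) (intro continuous_intros)
 have b: "?b \<longlonglongrightarrow> ?b'"
  unfolding rate_eq using q_le q_cont L0 by (intro G_lim_csum t0 t) auto
 have fwd: "\<Lambda> n j (\<lambda>_. 1) t + tint t (\<Lambda> n j (out_rate j)) = ennreal (pmf \<gamma> j) + tint t (\<lambda>v. csum (\<lambda>i. \<Lambda> n i (rate j i) v))" for n
 proof -
  have "before t (\<lambda>s. \<Lambda> n j (out_rate j) s) = tint t (\<Lambda> n j (out_rate j))"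
   "before t (\<lambda>s. csum (\<lambda>i. \<Lambda> n i (rate j i) s)) = tint t (\<lambda>v. csum (\<lambda>i. \<Lambda> n i (rate j i) v))"
   by (auto intro!: nn_integral_cong simp: \<Lambda>_zero not_less)
  then show ?thesis using \<Lambda>_forward[OF t(1), of n j] by simp
 qed
 have fin: "tint t h \<le> ennreal (max_rate A q j) * ennreal t" if "\<And>v. h v \<le> ennreal (max_rate A q j)" for h
 proof -
  have "tint t h \<le> tint t (\<lambda>_. ennreal (max_rate A q j))" using that by (intro nn_integral_mono) auto
  then show ?thesis by (simp add: tint_const[OF t0])
 qed
 have a_le: "?a n \<le> ennreal (max_rate A q j) * ennreal t" for n
 proof (rule fin)
  fix v
  have "\<Lambda> (r n) j (out_rate j) v \<le> \<Lambda> (r n) j (\<lambda>a. ennreal (max_rate A q j) * 1) v" using out_rate_le by (intro \<Lambda>_mono) simp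
  also have "\<dots> = ennreal (max_rate A q j) * \<Lambda> (r n) j (\<lambda>_. 1) v" by (rule \<Lambda>_cmult) simp
  also have "\<dots> \<le> ennreal (max_rate A q j) * 1" by (intro mult_left_mono \<Lambda>_single) simp
  finally show "\<Lambda> (r n) j (out_rate j) v \<le> ennreal (max_rate A q j)" by simp
 qed
 have a_fin: "?a n \<noteq> top" for n using a_le[of n] by (auto simp: top_unique ennreal_mult_eq_top_iff)
 have "?a' \<le> ennreal (max_rate A q j) * ennreal t" using a a_le by (intro LIMSEQ_le_const2) auto
 then have a'_fin: "?a' \<noteq> top" by (auto simp: top_unique ennreal_mult_eq_top_iff)
 have eq: "\<Lambda> (r n) j (\<lambda>_. 1) t = (ennreal (pmf \<gamma> j) + ?b n) - ?a n" for n
  unfolding fwd[symmetric] by (simp add: a_fin)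
 have b_le: "ennreal (pmf \<gamma> j) + ?b n \<le> 1 + ennreal (max_rate A q j) * ennreal t" for n
  unfolding fwd[symmetric] by (intro add_mono \<Lambda>_single a_le)
 have bb: "(\<lambda>n. ennreal (pmf \<gamma> j) + ?b n) \<longlonglongrightarrow> ennreal (pmf \<gamma> j) + ?b'" by (intro tendsto_add tendsto_const b)
 have "ennreal (pmf \<gamma> j) + ?b' \<le> 1 + ennreal (max_rate A q j) * ennreal t" using bb b_le by (intro LIMSEQ_le_const2) auto
 then have b'_fin: "ennreal (pmf \<gamma> j) + ?b' \<noteq> top" by (auto simp: top_unique ennreal_mult_eq_top_iff)
 have lim: "(\<lambda>n. \<Lambda> (r n) j (\<lambda>_. 1) t) \<longlonglongrightarrow> (ennreal (pmf \<gamma> j) + ?b') - ?a'"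
  unfolding eq by (rule tendsto_diff_ennreal[OF bb a b'_fin a'_fin])
 then have p: "p j t = (ennreal (pmf \<gamma> j) + ?b') - ?a'" using t lim_imp_Liminf[OF _ lim] by (simp add: p_def)
 with lim show *: "(\<lambda>n. \<Lambda> (r n) j (\<lambda>_. 1) t) \<longlonglongrightarrow> p j t" by simp
 show "p j t + ?a' = ennreal (pmf \<gamma> j) + ?b'"
  using LIMSEQ_unique[OF tendsto_add[OF * a] bb[folded fwd]] .
qed

text \<open>\<open>G (j, [])\<close> is a weak and \<open>p j\<close> a pointwise limit of the same
  masses. Dominated convergence identifies their time integrals, and countability of the states
  yields one null set for all.\<close>

lemma G_eq_p: "AE v in lborel. 0 < v \<and> v < T \<longrightarrow> (\<forall>j. G (j, []) v = p j v)"
proof -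
 have "AE v in lborel. 0 < v \<and> v < T \<longrightarrow> G (j, []) v = p j v" for j
 proof (rule AE_eq_of_interval_integrals)
  fix t assume t: "0 \<le> t" "t \<le> T"
  have "\<Lambda> n j (cell j []) v = \<Lambda> n j (\<lambda>_. 1) v" for n v
   by (intro antisym \<Lambda>_mono) (simp_all add: cell_def cell_coding.code_0[OF coding])
  then have E: "\<Lambda> n j (cell j []) = \<Lambda> n j (\<lambda>_. 1)" for n by (rule ext)
  have 1: "(\<lambda>n. tint t (\<Lambda> (r n) j (\<lambda>_. 1))) \<longlonglongrightarrow> tint t (G (j, []))" using G_lim'[OF t(1), of j "[]"] unfolding E .
  have "(\<lambda>n. tint t (\<Lambda> (r n) j (\<lambda>_. 1))) \<longlonglongrightarrow> tint t (p j)"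
  proof (rule nn_integral_dominated_convergence[where w="indicator {0..t}"])
   show "AE v in lborel. (\<lambda>n. if 0 < v \<and> v < t then \<Lambda> (r n) j (\<lambda>_. 1) v else 0) \<longlonglongrightarrow> (if 0 < v \<and> v < t then p j v else 0)"
    using t p_lim(1) by (intro AE_I2) auto
  qed (use t \<Lambda>_single in \<open>auto split: split_indicator\<close>)
  with 1 show "tint t (G (j, [])) = tint t (p j)" by (rule LIMSEQ_unique)
 next
  show "tint T (G (j, [])) < \<infinity>" using tint_G_le[of T j "[]"] T0 by (simp add: le_less_trans)
 qed (use T0 in auto)
 then have "AE v in lborel. \<forall>j. 0 < v \<and> v < T \<longrightarrow> G (j, []) v = p j v" by (subst AE_all_countable) blast
 then show ?thesis by eventually_elim blast
qed

lemma p_forward: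
 assumes t: "0 < t" "t \<le> T"
 shows "p j t + before t (\<lambda>s. mean j (out_rate j) s * p j s) =
  ennreal (pmf \<gamma> j) + before t (\<lambda>s. csum (\<lambda>i. mean i (rate j i) s * p i s))"
proof -
 have "tint t (\<lambda>v. G (j, []) v * mean j (out_rate j) v) = before t (\<lambda>s. mean j (out_rate j) s * p j s)"
  by (rule nn_integral_cong_AE, use G_eq_p in eventually_elim) (use t p_0 in \<open>auto simp: mult.commute\<close>)
 moreover have "tint t (\<lambda>v. csum (\<lambda>i. G (i, []) v * mean i (rate j i) v)) = before t (\<lambda>s. csum (\<lambda>i. mean i (rate j i) s * p i s))"
  by (rule nn_integral_cong_AE, use G_eq_p in eventually_elim) (use t p_0 in \<open>auto simp: mult.commute\<close>)
 ultimately show ?thesis using p_lim(2)[OF t, of j] by simp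
qed

lemma p_lim_csum:
 assumes "\<And>i. continuous_on (A i) (f i)" "0 \<le> C" "\<And>i a. a \<in> A i \<Longrightarrow> f i a \<le> C * w i"
 shows "(\<lambda>n. tint T (\<lambda>v. csum (\<lambda>i. \<Lambda> (r n) i (on_actions i (f i)) v))) \<longlonglongrightarrow>
  tint T (\<lambda>v. csum (\<lambda>i. mean i (on_actions i (f i)) v * p i v))"
proof -
 have eq: "tint T (\<lambda>v. csum (\<lambda>i. G (i, []) v * mean i (on_actions i (f i)) v)) = tint T (\<lambda>v. csum (\<lambda>i. mean i (on_actions i (f i)) v * p i v))"
  by (rule nn_integral_cong_AE, use G_eq_p in eventually_elim) (auto simp: mult.commute)
 show ?thesis using G_lim_csum[OF assms, of T] T0 unfolding eq by simp
qed

end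

context controlled_process
begin

lemma flow_in_cmult_mass:
 assumes "\<And>w. w \<in> paths \<Longrightarrow> state_before t w = Some i \<Longrightarrow> act f w t = c" and [measurable]: "f \<in> borel_measurable borel"
 shows "flow_in D i f t = c * flow_in D i (\<lambda>_. 1) t"
proof -
 have "flow_in D i f t = (\<Sum>m. c * level_flow m D i (\<lambda>_. 1) t)"
  unfolding flow_in_eq_suminf[OF assms(2)] using level_flow_cmult_mass[OF assms(1)] by simp
 then show ?thesis by (simp add: flow_in_eq_suminf)
qed

lemma cost_flow_eq_tint:
 "cost_flow f T = tint T (\<lambda>t. csum (\<lambda>i. flow i (\<lambda>a. indicator (A i) a * ennreal (f i a)) t))"
 unfolding cost_flow_def
proof (rule nn_integral_cong_AE)
 show "AE t in lborel. (if t \<le> T then csum (\<lambda>i. flow i (\<lambda>a. indicator (A i) a * ennreal (f i a)) t) else 0) =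
  (if 0 < t \<and> t < T then csum (\<lambda>i. flow i (\<lambda>a. indicator (A i) a * ennreal (f i a)) t) else 0)"
  using AE_lborel_singleton[of T] by eventually_elim (auto simp: flow_in_outside)
qed

end

section \<open>The optimal Markov policy\<close>

locale Markov_kernel = control_model A q for A :: "'s::countable \<Rightarrow> 'a::polish_space set" and q +
 fixes \<kappa> :: "'s \<Rightarrow> real \<Rightarrow> 'a measure"
 assumes \<kappa>: "\<kappa> i \<in> borel \<rightarrow>\<^sub>M prob_algebra borel" and \<kappa>_A: "emeasure (\<kappa> i t) (A i) = 1"
begin

definition kernel :: "'s option \<Rightarrow> real \<Rightarrow> 'a option measure" where
 "kernel x t = (case x of None \<Rightarrow> return action_algebra None | Some i \<Rightarrow> distr (\<kappa> i t) action_algebra Some)"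

definition Markov_policy :: "('s, 'a) policy" where
 "Markov_policy w t = kernel (state_before t w) t"

lemma kernel_measurable: "(\<lambda>(x, t). kernel x t) \<in> count_space UNIV \<Otimes>\<^sub>M restrict_space borel {0..} \<rightarrow>\<^sub>M prob_algebra action_algebra"
proof -
 have K: "kernel x \<in> borel \<rightarrow>\<^sub>M prob_algebra action_algebra" for x
 proof (cases x)
  case None
  have "return action_algebra None \<in> space (prob_algebra action_algebra)"
   by (simp add: space_prob_algebra prob_space_return)
  then show ?thesis unfolding kernel_def[abs_def] None by simp
 next
  case (Some i)
  have "kernel x = (\<lambda>t. distr (\<kappa> i t) action_algebra Some)" by (simp add: kernel_def Some fun_eq_iff)
  then show ?thesis using measurable_compose[OF \<kappa> measurable_distr_prob_space[OF measurable_Some_action]] by simp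
 qed
 have "(\<lambda>p. kernel (fst p) (snd p)) \<in> count_space UNIV \<Otimes>\<^sub>M restrict_space borel {0..} \<rightarrow>\<^sub>M prob_algebra action_algebra"
  by (rule measurable_compose_countable[of "\<lambda>x p. kernel x (snd p)"])
   (auto intro!: measurable_compose[OF measurable_compose[OF measurable_snd measurable_restrict_space1[OF measurable_ident_sets[OF refl]]] K, simplified])
 then show ?thesis by (simp add: case_prod_beta')
qed

lemma Markov_policy: "Markov_policy \<in> markov_policies A"
proof -
 let ?P = "(predictable :: ('s path \<times> real) measure)"
 have "(\<lambda>p. (case p of (w, t) \<Rightarrow> state_before t w, snd p)) \<in> ?P \<rightarrow>\<^sub>M count_space UNIV \<Otimes>\<^sub>M restrict_space borel {0..}"
 proof (rule measurable_Pair[OF measurable_state_before])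
  show "snd \<in> ?P \<rightarrow>\<^sub>M restrict_space borel {0 :: real..}"
   using measurable_predictable_time by (intro measurable_restrict_space2) auto
 qed
 from measurable_compose[OF this kernel_measurable]
 have "(\<lambda>(w, t). Markov_policy w t) \<in> ?P \<rightarrow>\<^sub>M prob_algebra action_algebra"
  by (simp add: Markov_policy_def case_prod_beta')
 moreover have "emeasure (Markov_policy w t) (admissible A (state_before t w)) = 1" for w t
 proof (cases "state_before t w")
  case None
  then show ?thesis using Some_image_action[of "{} :: 'a set"] by (simp add: Markov_policy_def kernel_def sets_action_algebra vimage_def)
 next
  case (Some i)
  have "\<kappa> i t \<in> space (prob_algebra borel)" by (rule measurable_space[OF \<kappa>]) simp
  then have "sets (\<kappa> i t) = sets borel" by (simp add: space_prob_algebra)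
  then have "Some \<in> \<kappa> i t \<rightarrow>\<^sub>M action_algebra" using measurable_Some_action by (simp cong: measurable_cong_sets)
  then have "emeasure (distr (\<kappa> i t) action_algebra Some) (Some ` A i) = emeasure (\<kappa> i t) (Some -` (Some ` A i) \<inter> space (\<kappa> i t))"
   by (rule emeasure_distr) (rule Some_image_action[OF A_borel])
  also have "\<dots> = 1" using \<kappa>_A[of i t] sets_eq_imp_space_eq[OF \<open>sets (\<kappa> i t) = sets borel\<close>] by (simp add: inj_vimage_image_eq)
  finally show ?thesis by (simp add: Markov_policy_def kernel_def Some)
 qed
 ultimately have "Markov_policy \<in> policies A" by (simp add: policies_def)
 then show ?thesis unfolding markov_policies_def using kernel_measurable by (auto simp: Markov_policy_def)
qed

lemma action_integral_Markov:
 assumes "0 < t" "state_before t w = Some i" and f: "f \<in> borel_measurable borel"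
 shows "action_integral Markov_policy f w t = (\<integral>\<^sup>+a. f a \<partial>\<kappa> i t)"
proof -
 have "\<kappa> i t \<in> space (prob_algebra borel)" by (rule measurable_space[OF \<kappa>]) simp
 then have "sets (\<kappa> i t) = sets borel" by (simp add: space_prob_algebra)
 then have "Some \<in> \<kappa> i t \<rightarrow>\<^sub>M action_algebra" using measurable_Some_action by (simp cong: measurable_cong_sets)
 then have "(\<integral>\<^sup>+x. f (the x) \<partial>distr (\<kappa> i t) action_algebra Some) = (\<integral>\<^sup>+a. f (the (Some a)) \<partial>\<kappa> i t)"
  by (rule nn_integral_distr) (use measurable_compose[OF measurable_the_action f] in simp)
 then show ?thesis using assms by (simp add: action_integral_def Markov_policy_def kernel_def)
qed

end

text \<open>On a path starting in i a policy must charge \<open>A i\<close> at time 0. Nonemptiness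
  supplies the default action of \<open>law\<close>.\<close>

lemma policies_actions_nonempty: "\<pi> \<in> policies A \<Longrightarrow> A i \<noteq> {}"
proof
 assume \<pi>: "\<pi> \<in> policies A" and "A i = {}"
 define w :: "'a path" where "w = (\<lambda>_. (Some i, 1))"
 have w: "w \<in> paths" by (simp add: w_def paths_def)
 have "state_before 0 w = Some i" unfolding state_before_0[OF w] by (simp add: w_def jump_state_def)
 moreover have "emeasure (\<pi> w 0) (admissible A (state_before 0 w)) = 1" using \<pi> w unfolding policies_def by blast
 ultimately show False using \<open>A i = {}\<close> by simp
qed

theorem theorem5p2:
  fixes A :: "'s::countable \<Rightarrow> 'a::polish_space set"
    and q :: "'s \<Rightarrow> 's \<Rightarrow> 'a \<Rightarrow> real"
    and N :: nat
    and c :: "nat \<Rightarrow> 's \<Rightarrow> 'a \<Rightarrow> real"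
    and d :: "nat \<Rightarrow> real"
    and T :: real
    and \<gamma> :: "'s pmf"
    and w :: "'s \<Rightarrow> real"
    and \<rho>1 \<rho>2 \<rho>3 b1 b2 b3 L M :: real
  assumes A_borel: "\<And>i. A i \<in> sets borel"
    and q_measurable: "\<And>i j. (\<lambda>a. q j i a) \<in> borel_measurable (restrict_space borel (A i))"
    and q_nonneg: "\<And>i j a. a \<in> A i \<Longrightarrow> j \<noteq> i \<Longrightarrow> 0 \<le> q j i a"
    and q_conservative: "\<And>i a. a \<in> A i \<Longrightarrow> ((\<lambda>j. q j i a) has_sum 0) UNIV"
    and q_stable: "\<And>i. bdd_above ((\<lambda>a. \<bar>q i i a\<bar>) ` A i)"
    and c_measurable: "\<And>n i. n \<le> N \<Longrightarrow> c n i \<in> borel_measurable (restrict_space borel (A i))"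
    and T_pos: "0 < T"
    and feasible: "feasible_policies A q \<gamma> T N c d \<noteq> {}"
    and w_ge_1: "\<And>i. 1 \<le> w i"
    and constants: "0 < \<rho>1" "0 < \<rho>2" "0 < \<rho>3" "0 \<le> b1" "0 \<le> b2" "0 \<le> b3" "0 < L" "0 < M"
    and drift1: "\<And>i a. a \<in> A i \<Longrightarrow>
      (\<lambda>j. w j * q j i a) summable_on UNIV \<and> (\<Sum>\<^sub>\<infinity>j. w j * q j i a) \<le> \<rho>1 * w i + b1"
    and rate_bound: "\<And>i. max_rate A q i \<le> L * w i"
    and initial1: "(\<lambda>i. w i * pmf \<gamma> i) summable_on UNIV"
    and cost_bound: "\<And>n i a. n \<le> N \<Longrightarrow> a \<in> A i \<Longrightarrow> \<bar>c n i a\<bar> \<le> M * w i"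
    and drift2: "\<And>i a. a \<in> A i \<Longrightarrow>
      (\<lambda>j. w j ^ 2 * q j i a) summable_on UNIV \<and> (\<Sum>\<^sub>\<infinity>j. w j ^ 2 * q j i a) \<le> \<rho>2 * w i ^ 2 + b2"
    and drift3: "\<And>i a. a \<in> A i \<Longrightarrow>
      (\<lambda>j. w j ^ 3 * q j i a) summable_on UNIV \<and> (\<Sum>\<^sub>\<infinity>j. w j ^ 3 * q j i a) \<le> \<rho>3 * w i ^ 3 + b3"
    and A_compact: "\<And>i. compact (A i)"
    and c_continuous: "\<And>n i. n \<le> N \<Longrightarrow> continuous_on (A i) (c n i)"
    and q_continuous: "\<And>i j. continuous_on (A i) (\<lambda>a. q j i a)"
    and drift_continuous: "\<And>i. continuous_on (A i) (\<lambda>a. \<Sum>\<^sub>\<infinity>k. w k * q k i a)"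
    and level_sets: "\<And>m::nat. 1 \<le> m \<Longrightarrow> {i. w i \<le> real m} \<noteq> {} \<and> finite {i. w i \<le> real m}"
    and initial2: "(\<lambda>i. w i ^ 2 * pmf \<gamma> i) summable_on UNIV"
    and initial3: "(\<lambda>i. w i ^ 3 * pmf \<gamma> i) summable_on UNIV"
  shows "\<exists>\<pi> \<in> markov_policies A. constrained_optimal A q \<gamma> T N c d \<pi>"
proof -
 interpret control_model A q by unfold_locales (fact A_borel q_measurable q_nonneg q_conservative q_stable)+
 have cp: "controlled_process A q \<pi>" if "\<pi> \<in> policies A" for \<pi>
  using that by (simp add: controlled_process_def controlled_policy_def controlled_policy_axioms_def control_model_axioms)
 define \<Lambda> where "\<Lambda> \<pi> i = controlled_process.flow_in A q \<pi> \<gamma> UNIV i" for \<pi> i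
 have nonempty: "A i \<noteq> {}" for i
  using feasible policies_actions_nonempty[of _ A i] unfolding feasible_policies_def by blast
 \<comment> \<open>From w >= 1: sublevel sets of w^2 lie in those of w, and first moments are
   bounded by second moments.\<close>
 have ww: "w i \<le> w i ^ 2" for i using w_ge_1[of i] by (simp add: self_le_power)
 define \<Gamma> where "\<Gamma> = (\<Sum>\<^sub>\<infinity>i. w i ^ 2 * pmf \<gamma> i)"
 \<comment> \<open>The constant of \<open>moment_bound\<close> for u = w^2 and the second drift
   condition.\<close>
 define B where "B = 2 * (\<Gamma> + b2 * T) * exp (2 * \<rho>2 * T)"
 have \<Gamma>: "csum (\<lambda>i. ennreal (w i ^ 2) * ennreal (pmf \<gamma> i)) = ennreal \<Gamma>" "0 \<le> \<Gamma>"
 proof -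
  have "csum (\<lambda>i. ennreal (w i ^ 2 * pmf \<gamma> i)) = ennreal \<Gamma>"
   unfolding \<Gamma>_def by (rule nn_integral_count_has_sum[OF has_sum_infsum[OF initial2]]) simp
  then show "csum (\<lambda>i. ennreal (w i ^ 2) * ennreal (pmf \<gamma> i)) = ennreal \<Gamma>" by (simp add: ennreal_mult)
  show "0 \<le> \<Gamma>" unfolding \<Gamma>_def by (rule infsum_nonneg) simp
 qed
 have B: "0 \<le> B" unfolding B_def using \<Gamma>(2) constants T_pos by simp
 \<comment> \<open>The hypothesis speaks of m >= 1 only; for m = 0 the level set is contained in
   that of 1.\<close>
 have levels: "finite {i. w i \<le> real m}" for m
  using level_sets[of "max m 1"] by (rule_tac finite_subset[of _ "{i. w i \<le> real (max m 1)}"]) auto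
 have moment: "csum (\<lambda>i. ennreal (w i ^ 2) * \<Lambda> \<pi> i (\<lambda>_. 1) t) \<le> ennreal B" if \<pi>: "\<pi> \<in> policies A" and t: "0 < t" "t \<le> T" for \<pi> t
  unfolding \<Lambda>_def B_def
 proof (rule controlled_process.moment_bound[OF cp[OF \<pi>]])
  show "finite {i. w i ^ 2 \<le> real n}" for n
   by (rule finite_subset[OF _ levels[of n]]) (use ww order_trans in auto)
  fix i a assume a: "a \<in> A i"
  show "csum (\<lambda>j. ennreal (w j ^ 2) * rate j i a) \<le> ennreal (\<rho>2 * w i ^ 2 + b2) + ennreal (w i ^ 2) * out_rate i a"
   by (rule drift_nn_integral[OF a]) (use drift2[OF a] constants in auto)
 qed (use \<Gamma> constants t in auto)
 \<comment> \<open>Functions growing at most like w are controlled by the second moment. This gives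
   finite costs for all policies and a finite total loss for the limit policy.\<close>
 have weighted: "csum (\<lambda>i. F i) \<le> ennreal (K * B)"
  if \<pi>: "\<pi> \<in> policies A" and t: "0 < t" "t \<le> T" and K: "0 \<le> K" and F: "\<And>i. F i = \<Lambda> \<pi> i (f i) t"
   and f: "\<And>i a. a \<in> A i \<Longrightarrow> f i a \<le> ennreal (K * w i)" for \<pi> t K F f
 proof -
  have "F i \<le> ennreal K * (ennreal (w i ^ 2) * \<Lambda> \<pi> i (\<lambda>_. 1) t)" for i
  proof -
   have "F i \<le> \<Lambda> \<pi> i (\<lambda>_. ennreal (K * w i)) t"
    unfolding F \<Lambda>_def by (rule controlled_process.flow_in_mono[OF cp[OF \<pi>] f])
   also have "\<dots> = ennreal (K * w i) * \<Lambda> \<pi> i (\<lambda>_. 1) t" unfolding \<Lambda>_def by (rule controlled_process.flow_in_const[OF cp[OF \<pi>]])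
   also have "\<dots> \<le> ennreal (K * w i ^ 2) * \<Lambda> \<pi> i (\<lambda>_. 1) t"
    using ww K by (intro mult_right_mono ennreal_leI mult_left_mono) auto
   finally show ?thesis using K by (simp add: ennreal_mult mult.assoc)
  qed
  then have "csum F \<le> csum (\<lambda>i. ennreal K * (ennreal (w i ^ 2) * \<Lambda> \<pi> i (\<lambda>_. 1) t))" by (rule nn_integral_mono)
  also have "\<dots> \<le> ennreal K * ennreal B"
   using moment[OF \<pi> t] by (subst nn_integral_cmult) (auto intro!: mult_left_mono)
  finally show ?thesis using K B by (simp add: ennreal_mult)
 qed
 have E_le: "indicator (A i) a * ennreal (f i a) \<le> ennreal (M * w i)" if "\<And>i a. a \<in> A i \<Longrightarrow> \<bar>f i a\<bar> \<le> M * w i" "a \<in> A i" for f :: "'s \<Rightarrow> 'a \<Rightarrow> real" and i a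
  using that by (auto intro!: ennreal_leI dest: abs_le_D1)
 define CF where "CF \<pi> f = tint T (\<lambda>t. csum (\<lambda>i. \<Lambda> \<pi> i (\<lambda>a. indicator (A i) a * ennreal (f i a)) t))" for \<pi> and f :: "'s \<Rightarrow> 'a \<Rightarrow> real"
 have CF: "CF \<pi> f = controlled_process.cost_flow A q \<pi> \<gamma> f T" "CF \<pi> f < \<infinity>"
  if "\<pi> \<in> policies A" "\<And>i a. a \<in> A i \<Longrightarrow> \<bar>f i a\<bar> \<le> M * w i" for \<pi> f
 proof -
  show "CF \<pi> f = controlled_process.cost_flow A q \<pi> \<gamma> f T"
   unfolding controlled_process.cost_flow_eq_tint[OF cp[OF that(1)]] CF_def \<Lambda>_def ..
  have "csum (\<lambda>i. \<Lambda> \<pi> i (\<lambda>a. indicator (A i) a * ennreal (f i a)) t) \<le> ennreal (M * B)" if "0 < t" "t \<le> T" for t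
   by (rule weighted[OF \<open>\<pi> \<in> policies A\<close> that]) (use constants E_le[where f=f] \<open>\<And>i a. a \<in> A i \<Longrightarrow> \<bar>f i a\<bar> \<le> M * w i\<close> in auto)
  then have "CF \<pi> f \<le> tint T (\<lambda>_. ennreal (M * B))" unfolding CF_def by (intro nn_integral_mono) auto
  then show "CF \<pi> f < \<infinity>" using T_pos by (simp add: tint_const ennreal_mult_less_top le_less_trans)
 qed
 have cost: "expected_cost A q \<gamma> T (c n) \<pi> = enn2real (CF \<pi> (c n)) - enn2real (CF \<pi> (\<lambda>i a. - c n i a))"
  if "\<pi> \<in> policies A" "n \<le> N" for \<pi> n
  using controlled_process.expected_cost_eq[OF cp[OF that(1)], of "c n" "\<lambda>i. M * w i" \<gamma> T] CF[OF that(1), of "c n"]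
   CF[OF that(1), of "\<lambda>i a. - c n i a"] c_measurable[OF that(2)] cost_bound[OF that(2)] by simp
 let ?U = "feasible_policies A q \<gamma> T N c d" and ?V = "\<lambda>\<pi>. ereal (expected_cost A q \<gamma> T (c 0) \<pi>)"
 obtain u where u: "\<And>n. u n \<in> ?V ` ?U" "u \<longlonglongrightarrow> (INF \<pi>\<in>?U. ?V \<pi>)"
  using Inf_as_limit[of "?V ` ?U"] feasible by auto
 have "\<exists>\<pi>. \<pi> \<in> ?U \<and> u n = ?V \<pi>" for n using u(1)[of n] by auto
 then obtain \<psi> where \<psi>: "\<And>n. \<psi> n \<in> ?U" "\<And>n. u n = ?V (\<psi> n)" by metis
 have \<psi>p: "\<psi> n \<in> policies A" for n using \<psi>(1)[of n] by (simp add: feasible_policies_def)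
 interpret FS: flow_sequence A q \<gamma> "\<lambda>n. \<Lambda> (\<psi> n)" w L B T
 proof
  fix n i j t and f g :: "'a \<Rightarrow> ennreal" and k and m :: nat
  interpret controlled_process A q "\<psi> n" \<gamma> by (rule cp[OF \<psi>p])
  show "f \<in> borel_measurable borel \<Longrightarrow> \<Lambda> (\<psi> n) i f \<in> borel_measurable borel" unfolding \<Lambda>_def by (rule measurable_flow_in)
  show "(\<And>a. a \<in> A i \<Longrightarrow> f a \<le> g a) \<Longrightarrow> \<Lambda> (\<psi> n) i f t \<le> \<Lambda> (\<psi> n) i g t" unfolding \<Lambda>_def by (rule flow_in_mono)
  show "f \<in> borel_measurable borel \<Longrightarrow> g \<in> borel_measurable borel \<Longrightarrow> \<Lambda> (\<psi> n) i (\<lambda>a. f a + g a) t = \<Lambda> (\<psi> n) i f t + \<Lambda> (\<psi> n) i g t"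
   unfolding \<Lambda>_def by (rule flow_in_add)
  show "f \<in> borel_measurable borel \<Longrightarrow> \<Lambda> (\<psi> n) i (\<lambda>a. k * f a) t = k * \<Lambda> (\<psi> n) i f t" unfolding \<Lambda>_def by (rule flow_in_cmult)
  show "csum (\<lambda>i. \<Lambda> (\<psi> n) i (\<lambda>_. 1) t) \<le> 1" unfolding \<Lambda>_def by (rule flow_in_mass)
  show "t \<le> 0 \<Longrightarrow> \<Lambda> (\<psi> n) i f t = 0" unfolding \<Lambda>_def by (rule flow_in_outside) simp
  show "0 < t \<Longrightarrow> \<Lambda> (\<psi> n) j (\<lambda>_. 1) t + before t (\<lambda>s. \<Lambda> (\<psi> n) j (out_rate j) s) =
   ennreal (pmf \<gamma> j) + before t (\<lambda>s. csum (\<lambda>i. \<Lambda> (\<psi> n) i (rate j i) s))"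
   unfolding \<Lambda>_def by (rule total_forward) simp_all
  show "0 < t \<Longrightarrow> t \<le> T \<Longrightarrow> csum (\<lambda>i. ennreal (w i ^ 2) * \<Lambda> (\<psi> n) i (\<lambda>_. 1) t) \<le> ennreal B" by (rule moment[OF \<psi>p])
 qed (use A_compact nonempty q_continuous w_ge_1 levels rate_bound constants B T_pos in auto)
 have "\<forall>i. \<exists>code N. cell_coding (A i) code N" using cell_coding_exists[OF A_compact] by blast
 then obtain code digits where coding: "\<And>i. cell_coding (A i) (code i) (digits i)" by metis
 let ?g = "\<lambda>n (i, s). \<Lambda> (\<psi> n) i (indicator {a. code i (length s) a = s})"
 have mg: "?g n k \<in> borel_measurable borel" for n k
  using cell_coding.code_measurable[OF coding] by (cases k) (auto intro!: FS.\<Lambda>_measurable)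
 have g1: "?g n k v \<le> 1" for n k v
 proof (cases k)
  case (Pair i s)
  then show ?thesis by (auto intro!: order_trans[OF FS.\<Lambda>_mono FS.\<Lambda>_single] split: split_indicator)
 qed
 obtain r G where r: "strict_mono r" and G: "\<And>k. G k \<in> borel_measurable borel"
  "\<And>k t. 0 \<le> t \<Longrightarrow> (\<lambda>n. tint t (?g (r n) k)) \<longlonglongrightarrow> tint t (G k)"
  using weak_star_densities[of ?g, OF mg g1] by blast
 interpret FL: flow_limit A q \<gamma> "\<lambda>n. \<Lambda> (\<psi> n)" w L B T code digits r G
 proof (rule flow_limit.intro[OF FS.flow_sequence_axioms flow_limit_axioms.intro])
  show "(\<lambda>n. tint t (\<Lambda> (\<psi> (r n)) i (indicator {a. code i (length s) a = s}))) \<longlonglongrightarrow> tint t (G (i, s))" if "0 \<le> t" for t i s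
   using G(2)[OF that, of "(i, s)"] unfolding prod.case .
 qed (fact coding G(1))+
 interpret MK: Markov_kernel A q FL.law
  by unfold_locales (rule FL.measurable_law FL.law(3))+
 define \<pi> where "\<pi> = MK.Markov_policy"
 have \<pi>: "\<pi> \<in> markov_policies A" unfolding \<pi>_def by (rule MK.Markov_policy)
 then have \<pi>p: "\<pi> \<in> policies A" by (simp add: markov_policies_def)
 interpret CP: controlled_process A q \<pi> \<gamma> by (rule cp[OF \<pi>p])
 have act: "action_integral \<pi> f \<omega> t = FL.mean i f t" if "0 < t" "state_before t \<omega> = Some i" "f \<in> borel_measurable borel" for f \<omega> t i
  unfolding \<pi>_def by (rule MK.action_integral_Markov[OF that])
 have out_fin: "before T (\<lambda>s. csum (\<lambda>i. CP.flow i (out_rate i) s)) < \<infinity>"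
 proof -
  have "csum (\<lambda>i. CP.flow i (out_rate i) s) \<le> ennreal (L * B)" if "0 < s" "s \<le> T" for s
   by (rule weighted[OF \<pi>p that, where f=out_rate]) (use constants order_trans[OF out_rate_le ennreal_leI[OF rate_bound]] in \<open>auto simp: \<Lambda>_def\<close>)
  then have "before T (\<lambda>s. csum (\<lambda>i. CP.flow i (out_rate i) s)) \<le> tint T (\<lambda>_. ennreal (L * B))"
   by (intro nn_integral_mono) (auto simp: CP.flow_in_outside)
  then show ?thesis using T_pos by (simp add: tint_const ennreal_mult_less_top le_less_trans)
 qed
 \<comment> \<open>The weak limit solves the forward equation of the Markov policy with kernel
   \<open>FL.law\<close>, so uniqueness identifies it with the flow of that policy at every time up
   to T.\<close>
 have flow: "FL.p j t = CP.flow j (\<lambda>_. 1) t" if "0 < t" "t \<le> T" for j t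
 proof (rule CP.forward_unique[where \<kappa>="\<lambda>i t f. FL.mean i f t" and T=T and p=FL.p])
  show "FL.mean i (out_rate i) t \<le> ennreal (max_rate A q i)" for i t by (rule FL.mean_le[OF out_rate_le])
 qed (rule act FL.measurable_mean FL.measurable_p FL.p_mass FL.p_0 FL.p_forward out_fin that; assumption)+
 \<comment> \<open>Under the Markov policy the flow of f is its mean times the mass, and with
   \<open>flow\<close> this is the limit provided by \<open>p_lim_csum\<close>.\<close>
 have CF_lim: "(\<lambda>n. enn2real (CF (\<psi> (r n)) f)) \<longlonglongrightarrow> enn2real (CF \<pi> f)"
  if f: "\<And>i. continuous_on (A i) (f i)" "\<And>i a. a \<in> A i \<Longrightarrow> \<bar>f i a\<bar> \<le> M * w i" for f
 proof (rule tendsto_enn2real)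
  have fin: "ennreal (enn2real (CF \<pi> f)) = CF \<pi> f" using CF(2)[OF \<pi>p f(2)] by simp
  have E: "(\<lambda>a. indicator (A i) a * ennreal (f i a)) = FS.on_actions i (f i)" for i by (simp add: fun_eq_iff FS.on_actions_def)
  have "CF \<pi> f = tint T (\<lambda>t. csum (\<lambda>i. FL.mean i (FS.on_actions i (f i)) t * FL.p i t))"
   unfolding CF_def E
  proof (rule nn_integral_cong)
   fix t :: real
   have "\<Lambda> \<pi> i (FS.on_actions i (f i)) t = FL.mean i (FS.on_actions i (f i)) t * FL.p i t" if "0 < t" "t < T" for i
    unfolding \<Lambda>_def flow[OF that(1) less_imp_le[OF that(2)]]
    by (rule CP.flow_in_cmult_mass) (use act that(1) FS.measurable_on_actions[OF f(1)] in auto)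
   then show "(if 0 < t \<and> t < T then csum (\<lambda>i. \<Lambda> \<pi> i (FS.on_actions i (f i)) t) else 0) =
    (if 0 < t \<and> t < T then csum (\<lambda>i. FL.mean i (FS.on_actions i (f i)) t * FL.p i t) else 0)" by simp
  qed
  then show "(\<lambda>n. CF (\<psi> (r n)) f) \<longlonglongrightarrow> ennreal (enn2real (CF \<pi> f))"
   unfolding fin using FL.p_lim_csum[of f M] f constants unfolding CF_def E by (auto dest: abs_le_D1)
 qed simp
 \<comment> \<open>Positive and negative parts of the cost converge separately, both being dominated
   by M w.\<close>
 have lim: "(\<lambda>k. expected_cost A q \<gamma> T (c n) (\<psi> (r k))) \<longlonglongrightarrow> expected_cost A q \<gamma> T (c n) \<pi>" if n: "n \<le> N" for n
  unfolding cost[OF \<psi>p n] cost[OF \<pi>p n]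
  using cost_bound[OF n] c_continuous[OF n] by (intro tendsto_diff CF_lim) (auto intro: continuous_intros)
 have "expected_cost A q \<gamma> T (c n) \<pi> \<le> d n" if "n \<in> {1..N}" for n
  using that \<psi>(1) by (intro LIMSEQ_le_const2[OF lim]) (auto simp: feasible_policies_def)
 then have "\<pi> \<in> ?U" using \<pi>p by (simp add: feasible_policies_def)
 moreover have "(\<lambda>k. ?V (\<psi> (r k))) \<longlonglongrightarrow> ?V \<pi>" using lim[of 0] by (intro tendsto_ereal) simp
 then have "?V \<pi> = (INF \<pi>\<in>?U. ?V \<pi>)"
  using LIMSEQ_subseq_LIMSEQ[OF u(2) r] by (intro LIMSEQ_unique) (auto simp: comp_def \<psi>(2))
 ultimately show ?thesis using \<pi> unfolding constrained_optimal_def by blast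
qed

end
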